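(* Let $n\ge1$ and let $\Gamma$, $\Gamma'$ be marked planar graphs (of the kind described in the context) such that $\Gamma'$ is obtained from $\Gamma$ by placing a different collection of internal marks on the oriented edges and loops of $\Gamma$. Then there is a canonical isomorphism $C(\Gamma')\cong C(\Gamma)$ in $\mathrm{hmf}_{w(\Gamma)}$.
   Context: **Graded factorizations.** Let $R$ be a polynomial ring over $\mathbb Q$ in finitely many variables of degree $2$, $w\in R$ homogeneous of degree $2(n+1)$. $\{m\}$ shifts the grading up by $m$. A graded $(R,w)$-factorization is a pair of free graded $R$-modules $M^0,M^1$ (possibly of infinite rank) with maps $M^0\xrightarrow{d}M^1\xrightarrow{d}M^0$ of degree $n+1$, $d^2=w$. Morphisms are degree $0$ maps commuting with $d$; homotopies $h^i:M^i\to N^{i-1}$ have degree $-n-1$, $f-g=hd+dh$. $H(M)$ is the cohomology of $M/\mathfrak mM$, $\mathfrak m$ the ideal generated by the variables. $\mathrm{hmf}_w$ is the category of graded factorizations with $\dim_{\mathbb Q}H(M)<\infty$, morphisms up to homotopy. $\langle1\rangle$: $M\langle1\rangle^i=M^{i+1}$, differential $-d$. Tensor products: $d(m\otimes m')=dm\otimes m'+(-1)^im\otimes dm'$, $m\in M^i$. If $R\subset S$ and $w\in R$, an $(S,w)$-factorization is regarded as an $(R,w)$-factorization. $\{a,b\}$ is $R\xrightarrow{a}R\{n+1-\deg a\}\xrightarrow{b}R$ for $\deg a+\deg b=2n+2$; $\{(a_i),(b_i)\}=\bigotimes_i\{a_i,b_i\}$. **Graphs.** $\Gamma$ is a graph embedded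 in a disc, with oriented edges, unoriented "wide" edges and possibly oriented loops. Inside the disc only trivalent vertices are allowed, each an endpoint of one wide and two oriented edges; each wide edge has two oriented edges entering it at one vertex and two leaving it at the other. Oriented edges may end on the boundary of the disc. Boundary points count as marks; every internal oriented edge (no endpoint on the boundary of the disc) has at least one mark; additional marks on any oriented edge are allowed; loops may or may not be marked. Each mark $i$ has a variable $x_i$ of degree $2$. $\partial\Gamma$ is the set of boundary points, $s(i)=1$ (resp. $-1$) if the edge at $i\in\partial\Gamma$ is oriented outward (resp. inward), $R'=\mathbb Q[x_i]_{i\in\partial\Gamma}$, $w(\Gamma)=\sum_{i\in\partial\Gamma}s(i)x_i^{n+1}$. **$C(\Gamma)$.** Arc from mark $j$ to mark $i$: $L^i_j=\{\pi_{ij},x_i-x_j\}$, $\pi_{ij}=(x_i^{n+1}-x_j^{n+1})/(x_i-x_j)$. Markless loop: $A\langle1\rangle$, $A=\mathbb Q[X]/(X^n)$, $\deg X^i=2i+1-n$, in $\mathbb Z_2$-degree 0. Wide edge $t$ with nearest outgoing marks $1,2$ and nearest incoming marks $3,4$: $C_t=\{(u_1,u_2),(x_1+x_2-x_3-x_4,x_1x_2-x_3x_4)\}\{-1\}$, where $g(x+y,xy)=x^{n+1}+y^{n+1}$, $u_1=\frac{g(x_1+x_2,x_1x_2)-g(x_3+x_4,x_1x_2)}{x_1+x_2-x_3-x_4}$, $u_2=\frac{g(x_3+x_4,x_1x_2)-g(x_3+x_4,x_3x_4)}{x_1x_2-x_3x_4}$. $C(\Gamma)$ is the tensor product of all $C_t$,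 all $L^i_j$ (arcs between consecutive marks), and $A\langle1\rangle$ for each markless loop, over the polynomial rings in shared variables (coinciding marks identified), regarded as a graded $(R',w(\Gamma))$-factorization. **Canonical.** The isomorphism is the one composed of elementary mark-removal isomorphisms and their inverses, and does not depend on the order in which marks are removed or added: removing an internal mark $y$ from an arc $L^x_y$ (or $L^y_z$) adjacent to the rest $M$ of the graph is the map $L^x_y\otimes_{\mathbb Q[y]}M\to M|_{y=x}$ (resp. $M\otimes_{\mathbb Q[y]}L^y_z\to M|_{y=z}$) that kills the odd part of the arc factorization and sets $y=x$ (resp. $y=z$); and adding a mark $x$ to a markless circle is $A\langle1\rangle\to L^x_x=L^x_y/(x-y)$, $X^i\mapsto x^i$ ($0\le i\le n-1$) in the odd part. *)

theory Defs
  imports "HOL-Analysis.Analysis" "HOL-Library.Poly_Mapping"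
begin

section \<open>Polynomials over the rationals\<close>

text \<open>A value of type \<open>'v mpoly\<close> may use any variables from \<open>'v\<close>; the ring \<open>\<rat>[x\<^sub>v | v \<in> V]\<close> is the
  subset \<open>polys V\<close>.\<close>

type_synonym 'v mpoly = "('v \<Rightarrow>\<^sub>0 nat) \<Rightarrow>\<^sub>0 rat"

definition Const :: "rat \<Rightarrow> 'v mpoly" where
  "Const c = Poly_Mapping.single 0 c"

definition X :: "'v \<Rightarrow> 'v mpoly" where
  "X v = Poly_Mapping.single (Poly_Mapping.single v 1) 1"

definition polys :: "'v set \<Rightarrow> 'v mpoly set" where
  "polys V = {p. \<forall>m\<in>Poly_Mapping.keys p. Poly_Mapping.keys m \<subseteq> V}"

definition psubst :: "('u \<Rightarrow> 'v mpoly) \<Rightarrow> 'u mpoly \<Rightarrow> 'v mpoly" where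
  "psubst f p = (\<Sum>m\<in>Poly_Mapping.keys p.
     Const (Poly_Mapping.lookup p m) * (\<Prod>v\<in>Poly_Mapping.keys m. f v ^ Poly_Mapping.lookup m v))"

text \<open>Every variable has degree 2.\<close>

definition mon_deg :: "('v \<Rightarrow>\<^sub>0 nat) \<Rightarrow> int" where
  "mon_deg m = 2 * int (\<Sum>v\<in>Poly_Mapping.keys m. Poly_Mapping.lookup m v)"

definition homog :: "int \<Rightarrow> 'v mpoly \<Rightarrow> bool" where
  "homog k p \<longleftrightarrow> (\<forall>m\<in>Poly_Mapping.keys p. mon_deg m = k)"

definition pdeg :: "'v mpoly \<Rightarrow> int" where
  "pdeg p = Max (mon_deg ` Poly_Mapping.keys p)"

text \<open>Exact quotients; they are only formed over the variable type \<^typ>\<open>nat\<close>, where polynomials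
  form an integral domain and the divisor is nonzero and divides.\<close>

definition pquot :: "nat mpoly \<Rightarrow> nat mpoly \<Rightarrow> nat mpoly" where
  "pquot a b = (THE q. q * b = a)"


section \<open>Graded factorizations and their homotopy category\<close>

text \<open>The index \<open>False\<close> stands for \<open>\<int>\<^sub>2\<close>-degree 0 and \<open>True\<close> for \<open>\<int>\<^sub>2\<close>-degree 1. The set
  \<open>gcar M i\<close> is the module \<open>M\<^sup>i\<close> and \<open>ghom M i k\<close> its homogeneous part of degree \<open>k\<close>. The action
  \<open>gsmul\<close> is only constrained for scalars in the ring over which \<open>M\<close> is considered, so restriction
  of scalars from \<open>S\<close> to \<open>R \<subseteq> S\<close> leaves the record unchanged.\<close>

record ('v, 'm) gfact =
  gcar :: "bool \<Rightarrow> 'm set"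
  ghom :: "bool \<Rightarrow> int \<Rightarrow> 'm set"
  gsmul :: "'v mpoly \<Rightarrow> 'm \<Rightarrow> 'm"
  gdif :: "bool \<Rightarrow> 'm \<Rightarrow> 'm"

definition submodule_laws :: "'v set \<Rightarrow> ('v mpoly \<Rightarrow> 'm \<Rightarrow> 'm) \<Rightarrow> 'm::ab_group_add set \<Rightarrow> bool" where
  "submodule_laws V s A \<longleftrightarrow>
     0 \<in> A \<and> (\<forall>a\<in>A. \<forall>b\<in>A. a + b \<in> A) \<and> (\<forall>a\<in>A. - a \<in> A) \<and>
     (\<forall>p\<in>polys V. \<forall>a\<in>A. s p a \<in> A) \<and>
     (\<forall>p\<in>polys V. \<forall>a\<in>A. \<forall>b\<in>A. s p (a + b) = s p a + s p b) \<and>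
     (\<forall>p\<in>polys V. \<forall>q\<in>polys V. \<forall>a\<in>A. s (p + q) a = s p a + s q a) \<and>
     (\<forall>p\<in>polys V. \<forall>q\<in>polys V. \<forall>a\<in>A. s (p * q) a = s p (s q a)) \<and>
     (\<forall>a\<in>A. s 1 a = a)"

definition comb :: "('v mpoly \<Rightarrow> 'm \<Rightarrow> 'm) \<Rightarrow> ('m::ab_group_add \<Rightarrow>\<^sub>0 'v mpoly) \<Rightarrow> 'm" where
  "comb s c = (\<Sum>b\<in>Poly_Mapping.keys c. s (Poly_Mapping.lookup c b) b)"

definition coeffs_in :: "'v set \<Rightarrow> 'm set \<Rightarrow> ('m \<Rightarrow>\<^sub>0 'v mpoly) \<Rightarrow> bool" where
  "coeffs_in V B c \<longleftrightarrow> Poly_Mapping.keys c \<subseteq> B \<and> (\<forall>b. Poly_Mapping.lookup c b \<in> polys V)"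

text \<open>A free graded module has a homogeneous basis \<open>B\<close> (of any cardinality), with degrees \<open>e\<close>.\<close>

definition free_graded ::
  "'v set \<Rightarrow> ('v mpoly \<Rightarrow> 'm \<Rightarrow> 'm) \<Rightarrow> 'm::ab_group_add set \<Rightarrow> (int \<Rightarrow> 'm set) \<Rightarrow> bool" where
  "free_graded V s A H \<longleftrightarrow> submodule_laws V s A \<and>
     (\<exists>B \<subseteq> A. \<exists>e :: 'm \<Rightarrow> int.
        (\<forall>a\<in>A. \<exists>!c. coeffs_in V B c \<and> a = comb s c) \<and>
        (\<forall>k. H k = comb s ` {c. coeffs_in V B c \<and>
                                (\<forall>b\<in>B. homog (k - e b) (Poly_Mapping.lookup c b))}))"

definition rlinear ::
  "'v set \<Rightarrow> ('v mpoly \<Rightarrow> 'm \<Rightarrow> 'm) \<Rightarrow> ('v mpoly \<Rightarrow> 'k \<Rightarrow> 'k) \<Rightarrow>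
   'm::ab_group_add set \<Rightarrow> 'k::ab_group_add set \<Rightarrow> ('m \<Rightarrow> 'k) \<Rightarrow> bool" where
  "rlinear V s t A B f \<longleftrightarrow> f ` A \<subseteq> B \<and>
     (\<forall>a\<in>A. \<forall>b\<in>A. f (a + b) = f a + f b) \<and>
     (\<forall>p\<in>polys V. \<forall>a\<in>A. f (s p a) = t p (f a))"

definition graded_factorization ::
  "nat \<Rightarrow> 'v set \<Rightarrow> 'v mpoly \<Rightarrow> ('v, 'm::ab_group_add) gfact \<Rightarrow> bool" where
  "graded_factorization n V w M \<longleftrightarrow>
     finite V \<and> w \<in> polys V \<and> homog (2 * (int n + 1)) w \<and>
     (\<forall>i. free_graded V (gsmul M) (gcar M i) (ghom M i)) \<and>
     (\<forall>i. rlinear V (gsmul M) (gsmul M) (gcar M i) (gcar M (\<not> i)) (gdif M i)) \<and>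
     (\<forall>i k. gdif M i ` ghom M i k \<subseteq> ghom M (\<not> i) (k + int n + 1)) \<and>
     (\<forall>i. \<forall>m\<in>gcar M i. gdif M (\<not> i) (gdif M i m) = gsmul M w m)"

text \<open>\<open>\<mm>M\<^sup>i\<close>, the lifts to \<open>M\<^sup>i\<close> of the cocycles and of the coboundaries of \<open>M/\<mm>M\<close>, and
  finite-dimensionality of a quotient \<open>Z/B\<close> of rational vector spaces.\<close>

definition max_ideal_part :: "'v set \<Rightarrow> ('v, 'm::ab_group_add) gfact \<Rightarrow> bool \<Rightarrow> 'm set" where
  "max_ideal_part V M i = {\<Sum>v\<in>V. gsmul M (X v) (m v) | m. \<forall>v\<in>V. m v \<in> gcar M i}"

definition cocycles_mod :: "'v set \<Rightarrow> ('v, 'm::ab_group_add) gfact \<Rightarrow> bool \<Rightarrow> 'm set" where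
  "cocycles_mod V M i = {m \<in> gcar M i. gdif M i m \<in> max_ideal_part V M (\<not> i)}"

definition coboundaries_mod :: "'v set \<Rightarrow> ('v, 'm::ab_group_add) gfact \<Rightarrow> bool \<Rightarrow> 'm set" where
  "coboundaries_mod V M i =
     {gdif M (\<not> i) a + b | a b. a \<in> gcar M (\<not> i) \<and> b \<in> max_ideal_part V M i}"

definition fin_dim_quotient :: "(rat \<Rightarrow> 'm \<Rightarrow> 'm) \<Rightarrow> 'm::ab_group_add set \<Rightarrow> 'm set \<Rightarrow> bool" where
  "fin_dim_quotient s Z B \<longleftrightarrow>
     (\<exists>F. finite F \<and> F \<subseteq> Z \<and> (\<forall>z\<in>Z. \<exists>c. z - (\<Sum>f\<in>F. s (c f) f) \<in> B))"

definition hmf_object ::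
  "nat \<Rightarrow> 'v set \<Rightarrow> 'v mpoly \<Rightarrow> ('v, 'm::ab_group_add) gfact \<Rightarrow> bool" where
  "hmf_object n V w M \<longleftrightarrow> graded_factorization n V w M \<and>
     (\<forall>i. fin_dim_quotient (\<lambda>c. gsmul M (Const c)) (cocycles_mod V M i) (coboundaries_mod V M i))"

definition gmor ::
  "'v set \<Rightarrow> ('v, 'm::ab_group_add) gfact \<Rightarrow> ('v, 'k::ab_group_add) gfact \<Rightarrow>
   (bool \<Rightarrow> 'm \<Rightarrow> 'k) \<Rightarrow> bool" where
  "gmor V M N f \<longleftrightarrow>
     (\<forall>i. rlinear V (gsmul M) (gsmul N) (gcar M i) (gcar N i) (f i)) \<and>
     (\<forall>i k. f i ` ghom M i k \<subseteq> ghom N i k) \<and>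
     (\<forall>i. \<forall>m\<in>gcar M i. f (\<not> i) (gdif M i m) = gdif N i (f i m))"

definition homotopic ::
  "nat \<Rightarrow> 'v set \<Rightarrow> ('v, 'm::ab_group_add) gfact \<Rightarrow> ('v, 'k::ab_group_add) gfact \<Rightarrow>
   (bool \<Rightarrow> 'm \<Rightarrow> 'k) \<Rightarrow> (bool \<Rightarrow> 'm \<Rightarrow> 'k) \<Rightarrow> bool" where
  "homotopic n V M N f g \<longleftrightarrow>
     (\<exists>h. (\<forall>i. rlinear V (gsmul M) (gsmul N) (gcar M i) (gcar N (\<not> i)) (h i)) \<and>
          (\<forall>i k. h i ` ghom M i k \<subseteq> ghom N (\<not> i) (k - int n - 1)) \<and>
          (\<forall>i. \<forall>m\<in>gcar M i. f i m - g i m = h (\<not> i) (gdif M i m) + gdif N (\<not> i) (h i m)))"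

definition hmf_inverse ::
  "nat \<Rightarrow> 'v set \<Rightarrow> ('v, 'm::ab_group_add) gfact \<Rightarrow> ('v, 'k::ab_group_add) gfact \<Rightarrow>
   (bool \<Rightarrow> 'm \<Rightarrow> 'k) \<Rightarrow> (bool \<Rightarrow> 'k \<Rightarrow> 'm) \<Rightarrow> bool" where
  "hmf_inverse n V M N f g \<longleftrightarrow> gmor V M N f \<and> gmor V N M g \<and>
     homotopic n V M M (\<lambda>i. g i \<circ> f i) (\<lambda>i m. m) \<and>
     homotopic n V N N (\<lambda>i. f i \<circ> g i) (\<lambda>i m. m)"

definition hmf_iso ::
  "nat \<Rightarrow> 'v set \<Rightarrow> ('v, 'm::ab_group_add) gfact \<Rightarrow> ('v, 'k::ab_group_add) gfact \<Rightarrow>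
   (bool \<Rightarrow> 'm \<Rightarrow> 'k) \<Rightarrow> bool" where
  "hmf_iso n V M N f \<longleftrightarrow> (\<exists>g. hmf_inverse n V M N f g)"


section \<open>Factorizations with a chosen basis and their tensor products\<close>

text \<open>A free graded factorization over \<open>\<rat>[bvars]\<close>, given by a homogeneous basis \<open>bas\<close> with its
  parities and degrees and by the differentials of the basis elements.\<close>

record ('v, 'b) bfact =
  bvars :: "'v set"
  bas :: "'b set"
  bpar :: "'b \<Rightarrow> bool"
  bdeg :: "'b \<Rightarrow> int"
  bdif :: "'b \<Rightarrow> 'b \<Rightarrow>\<^sub>0 'v mpoly"

definition psmul :: "'v mpoly \<Rightarrow> ('b \<Rightarrow>\<^sub>0 'v mpoly) \<Rightarrow> ('b \<Rightarrow>\<^sub>0 'v mpoly)" where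
  "psmul p f = Poly_Mapping.map ((*) p) f"

text \<open>The map sending \<open>\<Sum> p\<^sub>b b\<close> to \<open>\<Sum> \<sigma>(p\<^sub>b) \<phi>(b)\<close>.\<close>

definition lin_ext ::
  "('v mpoly \<Rightarrow> 'v mpoly) \<Rightarrow> ('b \<Rightarrow> 'c \<Rightarrow>\<^sub>0 'v mpoly) \<Rightarrow> ('b \<Rightarrow>\<^sub>0 'v mpoly) \<Rightarrow> ('c \<Rightarrow>\<^sub>0 'v mpoly)" where
  "lin_ext \<sigma> \<phi> f = (\<Sum>b\<in>Poly_Mapping.keys f. psmul (\<sigma> (Poly_Mapping.lookup f b)) (\<phi> b))"

definition gfact_of :: "('v, 'b) bfact \<Rightarrow> ('v, 'b \<Rightarrow>\<^sub>0 'v mpoly) gfact" where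
  "gfact_of M =
     \<lparr> gcar = (\<lambda>i. {f. \<forall>b\<in>Poly_Mapping.keys f. b \<in> bas M \<and> bpar M b = i \<and>
                        Poly_Mapping.lookup f b \<in> polys (bvars M)}),
       ghom = (\<lambda>i k. {f. \<forall>b\<in>Poly_Mapping.keys f. b \<in> bas M \<and> bpar M b = i \<and>
                        Poly_Mapping.lookup f b \<in> polys (bvars M) \<and>
                        homog (k - bdeg M b) (Poly_Mapping.lookup f b)}),
       gsmul = psmul,
       gdif = (\<lambda>i. lin_ext id (bdif M)) \<rparr>"

text \<open>The iterated tensor product over the polynomial rings in shared variables, i.e.
  \<open>(M \<otimes> N) = M \<otimes>\<^bsub>\<rat>[V \<inter> W]\<^esub> N\<close> for \<open>M\<close> over \<open>\<rat>[V]\<close> and \<open>N\<close> over \<open>\<rat>[W]\<close>. As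
  \<open>\<rat>[V] \<otimes>\<^bsub>\<rat>[V \<inter> W]\<^esub> \<rat>[W] = \<rat>[V \<union> W]\<close>, it is free over \<open>\<rat>[V \<union> W]\<close> on the products of basis
  elements, and the differential is given by the signed Leibniz rule.\<close>

definition btensor :: "('v, 'b) bfact list \<Rightarrow> ('v, 'b list) bfact" where
  "btensor Ms =
     \<lparr> bvars = (\<Union>M\<in>set Ms. bvars M),
       bas = {bs. list_all2 (\<lambda>M b. b \<in> bas M) Ms bs},
       bpar = (\<lambda>bs. odd (card {k. k < length Ms \<and> bpar (Ms ! k) (bs ! k)})),
       bdeg = (\<lambda>bs. \<Sum>k<length Ms. bdeg (Ms ! k) (bs ! k)),
       bdif = (\<lambda>bs. \<Sum>k<length Ms. \<Sum>c\<in>Poly_Mapping.keys (bdif (Ms ! k) (bs ! k)).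
          Poly_Mapping.single (bs[k := c])
            ((- 1) ^ card {j. j < k \<and> bpar (Ms ! j) (bs ! j)} *
             Poly_Mapping.lookup (bdif (Ms ! k) (bs ! k)) c)) \<rparr>"

text \<open>\<open>bshift m\<close> is \<open>{m}\<close>, \<open>bflip\<close> is \<open>\<langle>1\<rangle>\<close>, and \<open>brename \<rho>\<close> substitutes the variable
  \<open>\<rho> v\<close> for \<open>v\<close> (possibly identifying variables).\<close>

definition bshift :: "int \<Rightarrow> ('v, 'b) bfact \<Rightarrow> ('v, 'b) bfact" where
  "bshift m M = M \<lparr> bdeg := (\<lambda>b. bdeg M b + m) \<rparr>"

definition bflip :: "('v, 'b) bfact \<Rightarrow> ('v, 'b) bfact" where
  "bflip M = M \<lparr> bpar := (\<lambda>b. \<not> bpar M b), bdif := (\<lambda>b. - bdif M b) \<rparr>"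

definition brename :: "('u \<Rightarrow> 'v) \<Rightarrow> ('u, 'b) bfact \<Rightarrow> ('v, 'b) bfact" where
  "brename \<rho> M =
     \<lparr> bvars = \<rho> ` bvars M, bas = bas M, bpar = bpar M, bdeg = bdeg M,
       bdif = (\<lambda>b. Poly_Mapping.map (psubst (\<lambda>v. X (\<rho> v))) (bdif M b)) \<rparr>"

text \<open>\<open>{a, b}\<close>, with basis element 0 in even and 1 in odd \<open>\<int>\<^sub>2\<close>-degree, and
  \<open>{(a\<^sub>i), (b\<^sub>i)}\<close>, over \<open>\<rat>[V]\<close>.\<close>

definition koszul1 :: "nat \<Rightarrow> 'v set \<Rightarrow> 'v mpoly \<Rightarrow> 'v mpoly \<Rightarrow> ('v, nat) bfact" where
  "koszul1 n V a b =
     \<lparr> bvars = V, bas = {0, 1}, bpar = odd,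
       bdeg = (\<lambda>e. if e = 0 then 0 else int n + 1 - pdeg a),
       bdif = (\<lambda>e. if e = 0 then Poly_Mapping.single 1 a else Poly_Mapping.single 0 b) \<rparr>"

definition koszul :: "nat \<Rightarrow> 'v set \<Rightarrow> ('v mpoly \<times> 'v mpoly) list \<Rightarrow> ('v, nat list) bfact" where
  "koszul n V ps = btensor (map (\<lambda>(a, b). koszul1 n V a b) ps)"


section \<open>The elementary factorizations\<close>

text \<open>The factorizations of an arc and of a wide edge are built in distinct variables and are then
  renamed to the marks at hand: when marks coincide (e.g. on a loop with one mark), the defining
  quotients only make sense before the variables are identified.\<close>

definition arc_generic :: "nat \<Rightarrow> (nat, nat list) bfact" where
  "arc_generic n =
     koszul n {1, 2} [(pquot (X 1 ^ (n + 1) - X 2 ^ (n + 1)) (X 1 - X 2), X 1 - X 2)]"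

definition g_poly :: "nat \<Rightarrow> nat mpoly" where
  "g_poly n = (THE g. g \<in> polys {0, 1} \<and>
     psubst (\<lambda>v. if v = 0 then X 0 + X 1 else X 0 * X 1) g =
       (X 0 ^ (n + 1) + X 1 ^ (n + 1) :: nat mpoly))"

definition g_at :: "nat \<Rightarrow> nat mpoly \<Rightarrow> nat mpoly \<Rightarrow> nat mpoly" where
  "g_at n a b = psubst (\<lambda>v. if v = 0 then a else b) (g_poly n)"

definition u1 :: "nat \<Rightarrow> nat mpoly" where
  "u1 n = pquot (g_at n (X 1 + X 2) (X 1 * X 2) - g_at n (X 3 + X 4) (X 1 * X 2))
                (X 1 + X 2 - X 3 - X 4)"

definition u2 :: "nat \<Rightarrow> nat mpoly" where
  "u2 n = pquot (g_at n (X 3 + X 4) (X 1 * X 2) - g_at n (X 3 + X 4) (X 3 * X 4))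
                (X 1 * X 2 - X 3 * X 4)"

definition wide_generic :: "nat \<Rightarrow> (nat, nat list) bfact" where
  "wide_generic n = bshift (- 1)
     (koszul n {1, 2, 3, 4} [(u1 n, X 1 + X 2 - X 3 - X 4), (u2 n, X 1 * X 2 - X 3 * X 4)])"

text \<open>\<open>A = \<rat>[X]/(X\<^sup>n)\<close> as a factorization of 0 over \<open>\<rat>\<close>; the basis element \<open>[i]\<close> is \<open>X\<^sup>i\<close>.\<close>

definition circle_algebra :: "nat \<Rightarrow> ('v, nat list) bfact" where
  "circle_algebra n =
     \<lparr> bvars = {}, bas = {[i] | i. i < n}, bpar = (\<lambda>b. False),
       bdeg = (\<lambda>b. 2 * int (hd b) + 1 - int n), bdif = (\<lambda>b. 0) \<rparr>"


section \<open>Marked planar graphs\<close>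

text \<open>The disc is the closed unit disc of \<open>\<complex>\<close>; edges and loops are paths parametrized by
  \<open>[0, 1]\<close>. Oriented edges and loops are parametrized along their orientation. A wide edge carries
  no orientation; it is parametrized from its vertex with two entering edges to its vertex with two
  leaving edges.\<close>

record wide_graph =
  oedges :: "(real \<Rightarrow> complex) list"
  wedges :: "(real \<Rightarrow> complex) list"
  oloops :: "(real \<Rightarrow> complex) list"

definition in_edges :: "wide_graph \<Rightarrow> (real \<Rightarrow> complex) \<Rightarrow> (real \<Rightarrow> complex) list" where
  "in_edges G w = filter (\<lambda>\<gamma>. pathfinish \<gamma> = pathstart w) (oedges G)"

definition out_edges :: "wide_graph \<Rightarrow> (real \<Rightarrow> complex) \<Rightarrow> (real \<Rightarrow> complex) list" where
  "out_edges G w = filter (\<lambda>\<gamma>. pathstart \<gamma> = pathfinish w) (oedges G)"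

definition ends :: "(real \<Rightarrow> complex) \<Rightarrow> complex set" where
  "ends \<gamma> = {pathstart \<gamma>, pathfinish \<gamma>}"

definition planar_graph :: "wide_graph \<Rightarrow> bool" where
  "planar_graph G \<longleftrightarrow>
     distinct (oedges G) \<and> distinct (wedges G) \<and> distinct (oloops G) \<and>
     (\<forall>\<gamma>\<in>set (oedges G). arc \<gamma> \<and> \<gamma> ` {0<..<1} \<subseteq> ball 0 1 \<and>
        (pathstart \<gamma> \<in> sphere 0 1 \<or> (\<exists>w\<in>set (wedges G). pathstart \<gamma> = pathfinish w)) \<and>
        (pathfinish \<gamma> \<in> sphere 0 1 \<or> (\<exists>w\<in>set (wedges G). pathfinish \<gamma> = pathstart w))) \<and>
     (\<forall>w\<in>set (wedges G). arc w \<and> path_image w \<subseteq> ball 0 1 \<and>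
        length (in_edges G w) = 2 \<and> length (out_edges G w) = 2) \<and>
     (\<forall>c\<in>set (oloops G). simple_path c \<and> pathfinish c = pathstart c \<and> path_image c \<subseteq> ball 0 1) \<and>
     pairwise (\<lambda>\<gamma> \<delta>. path_image \<gamma> \<inter> path_image \<delta> \<subseteq> ends \<gamma> \<inter> ends \<delta> - sphere 0 1)
       (set (oedges G)) \<and>
     (\<forall>\<gamma>\<in>set (oedges G). \<forall>w\<in>set (wedges G). path_image \<gamma> \<inter> path_image w \<subseteq> ends \<gamma> \<inter> ends w) \<and>
     pairwise (\<lambda>v w. path_image v \<inter> path_image w = {}) (set (wedges G)) \<and>
     pairwise (\<lambda>c c'. path_image c \<inter> path_image c' = {}) (set (oloops G)) \<and>
     (\<forall>c\<in>set (oloops G). \<forall>\<gamma>\<in>set (oedges G) \<union> set (wedges G). path_image c \<inter> path_image \<gamma> = {})"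

definition boundary_points :: "wide_graph \<Rightarrow> complex set" where
  "boundary_points G = (\<Union>\<gamma>\<in>set (oedges G). ends \<gamma>) \<inter> sphere 0 1"

text \<open>A mark is a point of the graph, and it names its own variable.\<close>

definition marking :: "wide_graph \<Rightarrow> complex set \<Rightarrow> bool" where
  "marking G P \<longleftrightarrow> finite P \<and>
     P \<subseteq> (\<Union>\<gamma>\<in>set (oedges G) \<union> set (oloops G). path_image \<gamma>) - (\<Union>w\<in>set (wedges G). path_image w) \<and>
     boundary_points G \<subseteq> P \<and>
     (\<forall>\<gamma>\<in>set (oedges G). ends \<gamma> \<inter> sphere 0 1 = {} \<longrightarrow> path_image \<gamma> \<inter> P \<noteq> {})"

definition potential :: "nat \<Rightarrow> wide_graph \<Rightarrow> complex mpoly" where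
  "potential n G = (\<Sum>i\<in>boundary_points G.
     (if \<exists>\<gamma>\<in>set (oedges G). pathfinish \<gamma> = i then 1 else - 1) * X i ^ (n + 1))"

definition edge_marks :: "complex set \<Rightarrow> (real \<Rightarrow> complex) \<Rightarrow> complex list" where
  "edge_marks P \<gamma> = map \<gamma> (sorted_list_of_set {t \<in> {0..1}. \<gamma> t \<in> P})"

definition loop_marks :: "complex set \<Rightarrow> (real \<Rightarrow> complex) \<Rightarrow> complex list" where
  "loop_marks P c = map c (sorted_list_of_set {t \<in> {0..<1}. c t \<in> P})"


section \<open>The factorization of a marked graph\<close>

text \<open>Names for the tensor factors. \<open>Arc_factor y x\<close> is the arc from the mark \<open>y\<close> to the next
  mark \<open>x\<close>.\<close>

datatype factor_name =
    Wide_factor "real \<Rightarrow> complex"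
  | Arc_factor complex complex
  | Circle_factor "real \<Rightarrow> complex"

definition edge_arcs :: "complex list \<Rightarrow> factor_name list" where
  "edge_arcs ms = map (\<lambda>(y, x). Arc_factor y x) (zip ms (tl ms))"

definition loop_arcs :: "complex list \<Rightarrow> factor_name list" where
  "loop_arcs ms = map (\<lambda>(y, x). Arc_factor y x) (zip ms (rotate1 ms))"

definition factor_names :: "wide_graph \<Rightarrow> complex set \<Rightarrow> factor_name list" where
  "factor_names G P =
     map Wide_factor (wedges G) @
     concat (map (\<lambda>\<gamma>. edge_arcs (edge_marks P \<gamma>)) (oedges G)) @
     concat (map (\<lambda>c. if loop_marks P c = [] then [Circle_factor c] else loop_arcs (loop_marks P c))
       (oloops G))"

definition arc_fact :: "nat \<Rightarrow> complex \<Rightarrow> complex \<Rightarrow> (complex, nat list) bfact" where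
  "arc_fact n i j = brename (\<lambda>v. if v = 1 then i else j) (arc_generic n)"

definition wide_fact ::
  "nat \<Rightarrow> wide_graph \<Rightarrow> complex set \<Rightarrow> (real \<Rightarrow> complex) \<Rightarrow> (complex, nat list) bfact" where
  "wide_fact n G P w = brename
     (\<lambda>v. if v = 1 then hd (edge_marks P (out_edges G w ! 0))
          else if v = 2 then hd (edge_marks P (out_edges G w ! 1))
          else if v = 3 then last (edge_marks P (in_edges G w ! 0))
          else last (edge_marks P (in_edges G w ! 1)))
     (wide_generic n)"

fun factor :: "nat \<Rightarrow> wide_graph \<Rightarrow> complex set \<Rightarrow> factor_name \<Rightarrow> (complex, nat list) bfact" where
  "factor n G P (Wide_factor w) = wide_fact n G P w"
| "factor n G P (Arc_factor y x) = arc_fact n x y"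
| "factor n G P (Circle_factor c) = bflip (circle_algebra n)"

type_synonym graph_module = "nat list list \<Rightarrow>\<^sub>0 complex mpoly"

definition C_graph :: "nat \<Rightarrow> wide_graph \<Rightarrow> complex set \<Rightarrow> (complex, graph_module) gfact" where
  "C_graph n G P = gfact_of (btensor (map (factor n G P) (factor_names G P)))"


section \<open>Mark removal and the canonical morphisms\<close>

text \<open>The symmetry of the tensor product: reordering the factors \<open>Is\<close> as \<open>Js\<close> costs a sign for each
  pair of odd entries whose order is reversed.\<close>

definition precedes :: "'i list \<Rightarrow> 'i \<Rightarrow> 'i \<Rightarrow> bool" where
  "precedes Js i j \<longleftrightarrow> (\<exists>k l. k < l \<and> l < length Js \<and> Js ! k = i \<and> Js ! l = j)"

definition reorder ::
  "('i \<Rightarrow> 'b \<Rightarrow> bool) \<Rightarrow> 'i list \<Rightarrow> 'i list \<Rightarrow> 'b list \<Rightarrow> ('b list \<Rightarrow>\<^sub>0 'v mpoly)" where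
  "reorder par Is Js bs = Poly_Mapping.single
     (map (\<lambda>j. the (map_of (zip Is bs) j)) Js)
     ((- 1) ^ card {(k, l). k < l \<and> l < length Is \<and> par (Is ! k) (bs ! k) \<and> par (Is ! l) (bs ! l) \<and>
                            precedes Js (Is ! l) (Is ! k)})"

fun rename_factor :: "(complex \<Rightarrow> complex) \<Rightarrow> factor_name \<Rightarrow> factor_name" where
  "rename_factor \<rho> (Arc_factor y x) = Arc_factor (\<rho> y) (\<rho> x)"
| "rename_factor \<rho> (Wide_factor w) = Wide_factor w"
| "rename_factor \<rho> (Circle_factor c) = Circle_factor c"

text \<open>Removal of the mark \<open>p\<close> using the arc \<open>\<alpha>\<close> between \<open>p\<close> and \<open>q\<close>: kill the odd part of
  the factor \<open>\<alpha>\<close> and set \<open>p = q\<close> in the remaining factors, which turns their list into a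
  rearrangement of the factors for \<open>P - {p}\<close>. Dropping the even element of \<open>\<alpha>\<close> causes no sign.\<close>

definition remove_mark ::
  "nat \<Rightarrow> wide_graph \<Rightarrow> complex set \<Rightarrow> factor_name \<Rightarrow> complex \<Rightarrow> complex \<Rightarrow>
   graph_module \<Rightarrow> graph_module" where
  "remove_mark n G P \<alpha> p q =
     (let \<rho> = id(p := q); Is = factor_names G P; Js = factor_names G (P - {p}) in
      lin_ext (psubst (\<lambda>v. X (\<rho> v)))
        (\<lambda>bs. if bpar (factor n G P \<alpha>) (the (map_of (zip Is bs) \<alpha>)) then 0
              else let rest = filter (\<lambda>(i, b). i \<noteq> \<alpha>) (zip Is bs) in
                reorder (\<lambda>i. bpar (factor n G (P - {p}) i))
                  (map (rename_factor \<rho> \<circ> fst) rest) Js (map snd rest)))"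

text \<open>Adding the mark \<open>x\<close> to the markless loop \<open>c\<close>, which replaces the factor \<open>A\<langle>1\<rangle>\<close> of \<open>c\<close>
  by the arc from \<open>x\<close> to \<open>x\<close> in the same place; \<open>[1]\<close> generates the odd part of the latter.\<close>

definition add_first_mark ::
  "wide_graph \<Rightarrow> complex set \<Rightarrow> (real \<Rightarrow> complex) \<Rightarrow> complex \<Rightarrow> graph_module \<Rightarrow> graph_module" where
  "add_first_mark G P c x =
     (let Is = factor_names G P in
      lin_ext id (\<lambda>bs. Poly_Mapping.single
        (map (\<lambda>(i, b). if i = Circle_factor c then [1] else b) (zip Is bs))
        (X x ^ hd (the (map_of (zip Is bs) (Circle_factor c))))))"

inductive elementary_map ::
  "nat \<Rightarrow> wide_graph \<Rightarrow> complex set \<Rightarrow> complex set \<Rightarrow> (bool \<Rightarrow> graph_module \<Rightarrow> graph_module) \<Rightarrow> bool"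
  for n G where
  remove_start:
    "marking G P \<Longrightarrow> marking G (P - {y}) \<Longrightarrow> Arc_factor y x \<in> set (factor_names G P) \<Longrightarrow> x \<noteq> y \<Longrightarrow>
     elementary_map n G P (P - {y}) (\<lambda>i. remove_mark n G P (Arc_factor y x) y x)"
| remove_end:
    "marking G P \<Longrightarrow> marking G (P - {y}) \<Longrightarrow> Arc_factor z y \<in> set (factor_names G P) \<Longrightarrow> z \<noteq> y \<Longrightarrow>
     elementary_map n G P (P - {y}) (\<lambda>i. remove_mark n G P (Arc_factor z y) y z)"
| add_first:
    "marking G P \<Longrightarrow> c \<in> set (oloops G) \<Longrightarrow> path_image c \<inter> P = {} \<Longrightarrow> x \<in> path_image c \<Longrightarrow>
     elementary_map n G P (insert x P) (\<lambda>i. add_first_mark G P c x)"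

inductive mark_change ::
  "nat \<Rightarrow> wide_graph \<Rightarrow> complex set \<Rightarrow> complex set \<Rightarrow> (bool \<Rightarrow> graph_module \<Rightarrow> graph_module) \<Rightarrow> bool"
  for n G where
  none:
    "marking G P \<Longrightarrow> mark_change n G P P (\<lambda>i m. m)"
| forward:
    "mark_change n G P Q f \<Longrightarrow> elementary_map n G Q Q' e \<Longrightarrow>
     mark_change n G P Q' (\<lambda>i. e i \<circ> f i)"
| backward:
    "mark_change n G P Q f \<Longrightarrow> elementary_map n G Q' Q e \<Longrightarrow>
     hmf_inverse n (boundary_points G) (C_graph n G Q') (C_graph n G Q) e g \<Longrightarrow>
     mark_change n G P Q' (\<lambda>i. g i \<circ> f i)"

definition canonical ::
  "nat \<Rightarrow> wide_graph \<Rightarrow> complex set \<Rightarrow> complex set \<Rightarrow> (bool \<Rightarrow> graph_module \<Rightarrow> graph_module) \<Rightarrow> bool"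
  where
  "canonical n G P P' f \<longleftrightarrow> mark_change n G P P' f \<and>
     (\<forall>f'. mark_change n G P P' f' \<longrightarrow>
        homotopic n (boundary_points G) (C_graph n G P) (C_graph n G P') f' f)"

end

(* Removing an internal mark p next to q kills an odd factor of C(Gamma), and a section of this map
   together with a contracting homotopy is read off from the divided difference (f - f|p=q)/(q - p):
   so the removal is a strong deformation retraction. Adding the first mark x to a circle is inverted
   in the same way by division with remainder by x^n. Differentiating d^2 = w with respect to a mark x
   shows that x^n acts null-homotopically on C(Gamma) for every internal x, which makes the cohomology
   finite-dimensional.

   Canonicity is a coherence argument. Up to homotopy the map P -> P - {y} does not depend on the
   neighbour with which y is merged, and the removals of two marks commute; so between nested markings
   there is one reduction Q -> P up to homotopy. Every composite f : P -> P' of elementary maps and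
   their inverses is compatible with the reductions from a large enough marking Q, which are
   isomorphisms, and this determines f. *)
theory Submission
  imports Defs
begin

text \<open>The retraction exists because contracting an arc through its odd generator is a
  null-homotopy of q - p itself. Dividing this homotopy by q - p, with a divided difference in place
  of a quotient, leaves exactly the part of the identity that is visible after setting p = q. A
  circle is treated alike with x^n in place of q - p: closing an arc turns its first entry into
  (n+1) x^n, and n+1 is invertible over the rationals. Derivatives of potentials are taken before
  marks are identified, because the potential of an arc from x to x is already zero.

  Two removals commute strictly unless each of the two marks would be merged into the other. A third
  mark on the curve allows other neighbours to be chosen, and an edge never loses its last mark, so
  the one genuine obstruction is a loop carrying only these two marks. There both orders of removal
  pass through inverses of the map that marks a circle, and comparing them amounts to moving a mark
  along the loop.\<close>

abbreviation mor where "mor V K L \<equiv> gmor V (gfact_of K) (gfact_of L)"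
abbreviation htpy where "htpy n V K L \<equiv> homotopic n V (gfact_of K) (gfact_of L)"
abbreviation hinverse where "hinverse n V K L \<equiv> hmf_inverse n V (gfact_of K) (gfact_of L)"

abbreviation keys where "keys \<equiv> Poly_Mapping.keys"
abbreviation lookup where "lookup \<equiv> Poly_Mapping.lookup"
abbreviation single where "single \<equiv> Poly_Mapping.single"

section \<open>Polynomials\<close>

text \<open>Additive identities follow from singletons and sums. Zero is covered by
  \<open>single k 0\<close>, and updating a key outside the support is the addition of a
  singleton.\<close>

lemma pm_induct [case_names single add]:
  assumes "\<And>k v. P (single k v)" and "\<And>f g. P f ==> P g ==> P (f + g)"
  shows "P (f :: 'a \<Rightarrow>\<^sub>0 'b::comm_monoid_add)"
proof (induction f rule: update_induct)
  case const
  show ?case using assms(1)[of _ 0] by simp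
next
  case (update f a b)
  have "Poly_Mapping.update a b f = f + single a b"
    using update(1) by (intro poly_mapping_eqI) (auto simp: lookup_update lookup_add lookup_single when_def in_keys_iff)
  thus ?case using update assms by simp
qed

text \<open>The hypothesis on zero takes care of \<open>b = 0\<close>, where
  \<open>single a b\<close> has empty support and the sum is empty.\<close>

lemma sum_keys_single:
  assumes "\<And>k. f k 0 = 0"
  shows "(\<Sum>k\<in>keys (single a b). f k (lookup (single a b) k)) = f a b" using assms by (auto simp: keys_single)

lemma poly_mapping_sum_singles: "p = (\<Sum>k\<in>keys p. single k (lookup p k))"
proof (induction p rule: pm_induct)
  case (single k v)
  thus ?case by (subst sum_keys_single) auto
next
  case (add f g)
  thus ?case by (subst setsum_keys_plus_distrib) (auto simp: single_add)
qed

section \<open>Evaluation of monomials and substitution\<close>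

definition mev :: "('u => 'c::comm_monoid_mult) => ('u \<Rightarrow>\<^sub>0 nat) => 'c" where
  "mev f m = (\<Prod>v\<in>keys m. f v ^ lookup m v)"

lemma mev_superset: "finite A ==> keys m \<subseteq> A ==> mev f m = (\<Prod>v\<in>A. f v ^ lookup m v)"
  unfolding mev_def by (intro prod.mono_neutral_left) (auto simp: in_keys_iff)

lemma mev_add: "mev f (m + m') = mev f m * mev f m'"
proof -
  let ?A = "keys m \<union> keys m'"
  have "keys (m + m') \<subseteq> ?A" by (rule Poly_Mapping.keys_add)
  thus ?thesis by (simp add: mev_superset[of ?A] lookup_add power_add prod.distrib)
qed

lemma mev_0 [simp]: "mev f 0 = 1" by (simp add: mev_def)

lemma mev_single [simp]: "mev f (single v k) = f v ^ k" by (cases "k = 0") (auto simp: mev_def)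

text \<open>Isolates the value of a monomial, which turns sums of exponents into products;
  multiplicativity of \<open>psubst\<close> then only has to be checked on singletons.\<close>

lemma psubst_mev: "psubst f p = (\<Sum>m\<in>keys p. Const (lookup p m) * mev f m)" by (simp add: psubst_def mev_def)

lemma Const_0 [simp]: "Const 0 = 0" and Const_1 [simp]: "Const 1 = 1" by (simp_all add: Const_def)

lemma Const_add: "Const (a + b) = Const a + Const b" by (simp add: Const_def single_add)

lemma Const_mult: "Const (a * b) = Const a * Const b" by (simp add: Const_def mult_single)

lemma Const_power: "Const (a ^ k) = Const a ^ k" by (induction k) (auto simp: Const_mult)

lemma Const_prod: "Const (\<Prod>a\<in>A. f a) = (\<Prod>a\<in>A. Const (f a))" by (induction A rule: infinite_finite_induct) (auto simp: Const_mult)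

lemma psubst_single: "psubst f (single m c) = Const c * mev f m" unfolding psubst_mev by (subst sum_keys_single) auto

lemma psubst_0 [simp]: "psubst f 0 = 0" by (simp add: psubst_def)

lemma psubst_add: "psubst f (p + q) = psubst f p + psubst f q" unfolding psubst_mev
  by (subst setsum_keys_plus_distrib) (auto simp: Const_add algebra_simps)

lemma psubst_mult: "psubst f (p * q) = psubst f p * psubst f q"
proof (induction p rule: pm_induct)
  case (single m c)
  show ?case by (induction q rule: pm_induct)
       (auto simp: mult_single psubst_single mev_add Const_mult psubst_add algebra_simps)
qed (auto simp: psubst_add algebra_simps)

lemma psubst_Const [simp]: "psubst f (Const c) = Const c" by (simp add: Const_def[of c] psubst_single)

lemma psubst_1 [simp]: "psubst f 1 = 1" using psubst_Const[of f 1] by (simp del: psubst_Const)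

lemma psubst_X [simp]: "psubst f (X v) = f v" by (simp add: X_def psubst_single)

lemma psubst_uminus: "psubst f (- p) = - psubst f p" by (metis add.right_inverse add_eq_0_iff psubst_0 psubst_add)

lemma psubst_diff: "psubst f (p - q) = psubst f p - psubst f q" using psubst_add[of f p "- q"] by (simp add: psubst_uminus)

lemma psubst_power: "psubst f (p ^ k) = psubst f p ^ k" by (induction k) (auto simp: psubst_mult)

lemma psubst_sum: "psubst f (sum g A) = (\<Sum>a\<in>A. psubst f (g a))" by (induction A rule: infinite_finite_induct) (auto simp: psubst_add)

lemma X_power: "X v ^ k = single (single v k) 1" by (induction k) (auto simp: X_def mult_single single_add[symmetric])

lemma mev_X: "mev X m = single m 1"
proof -
  have "mev X m = (\<Prod>v\<in>keys m. single (single v (lookup m v)) (1::rat))" by (simp add: mev_def X_power)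
  also have "\<dots> = single (\<Sum>v\<in>keys m. single v (lookup m v)) 1"
  proof -
    have "(\<Prod>v\<in>A. single (h v) (1::rat)) = single (\<Sum>v\<in>A. h v) 1" if "finite A" for A :: "'a set" and h :: "'a => 'a \<Rightarrow>\<^sub>0 nat"
      using that by (induction A) (auto simp: mult_single)
    thus ?thesis by simp
  qed
  finally show ?thesis by (simp add: poly_mapping_sum_singles[symmetric])
qed

lemma single_conv_mev: "single m c = Const c * mev X m" by (simp add: mev_X Const_def mult_single)

lemma psubst_id [simp]: "psubst X p = p" by (induction p rule: pm_induct) (auto simp: psubst_single psubst_add single_conv_mev[symmetric])

lemma psubst_mev_comp: "psubst f (mev g m) = mev (\<lambda>v. psubst f (g v)) m"
proof -
  have "psubst f (\<Prod>v\<in>A. h v) = (\<Prod>v\<in>A. psubst f (h v))" for A :: "'c set" and h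
    by (induction A rule: infinite_finite_induct) (auto simp: psubst_mult)
  thus ?thesis by (simp add: mev_def psubst_power)
qed

lemma psubst_psubst: "psubst f (psubst g p) = psubst (\<lambda>v. psubst f (g v)) p" by (induction p rule: pm_induct)
     (auto simp: psubst_single psubst_add psubst_mult psubst_mev_comp)

lemma mpoly_induct [case_names Const X add mult]:
  assumes "\<And>c. P (Const c)" "\<And>v. P (X v)" "\<And>p q. P p ==> P q ==> P (p + q)"
    "\<And>p q. P p ==> P q ==> P (p * q)"
  shows "P (p :: 'v mpoly)"
proof (induction p rule: pm_induct)
  case (single m c)
  have 1: "P 1" using assms(1)[of 1] by simp
  have "P (X v ^ k)" for v k by (induction k) (auto intro: 1 assms)
  hence "P (\<Prod>v\<in>A. X v ^ lookup m v)" for A by (induction A rule: infinite_finite_induct) (auto intro: 1 assms)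
  thus ?case unfolding single_conv_mev mev_def using assms by auto
qed (use assms in auto)

section \<open>Subrings of polynomials in a given set of variables\<close>

lemma polys_Const [simp, intro]: "Const c \<in> polys V" by (auto simp: polys_def Const_def)

lemma polys_0 [simp, intro]: "0 \<in> polys V" and polys_1 [simp, intro]: "1 \<in> polys V" using polys_Const[of 0 V] polys_Const[of 1 V] by simp_all

lemma polys_X [simp, intro]: "v \<in> V ==> X v \<in> polys V" by (auto simp: polys_def X_def)

lemma polys_add [intro]: "p \<in> polys V ==> q \<in> polys V ==> p + q \<in> polys V" using Poly_Mapping.keys_add[of p q] by (force simp: polys_def)

lemma polys_uminus [intro]: "p \<in> polys V ==> - p \<in> polys V" by (auto simp: polys_def in_keys_iff)

lemma polys_diff [intro]: "p \<in> polys V ==> q \<in> polys V ==> p - q \<in> polys V" using polys_add[of p V "- q"] polys_uminus[of q V] by simp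

lemma polys_mult [intro]: "p \<in> polys V ==> q \<in> polys V ==> p * q \<in> polys V"
proof -
  assume a: "p \<in> polys V" "q \<in> polys V"
  show ?thesis unfolding polys_def
  proof (intro CollectI ballI)
    fix m assume "m \<in> keys (p * q)"
    then obtain a b where "m = a + b" "a \<in> keys p" "b \<in> keys q" using Poly_Mapping.keys_mult[of p q] by blast
    thus "keys m \<subseteq> V" using a Poly_Mapping.keys_add[of a b] by (force simp: polys_def)
  qed
qed

lemma polys_power [intro]: "p \<in> polys V ==> p ^ k \<in> polys V" by (induction k) auto

lemma polys_sum [intro]: "(\<And>a. a \<in> A ==> f a \<in> polys V) ==> sum f A \<in> polys V" by (induction A rule: infinite_finite_induct) auto

lemma polys_prod [intro]: "(\<And>a. a \<in> A ==> f a \<in> polys V) ==> prod f A \<in> polys V" by (induction A rule: infinite_finite_induct) auto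

lemma polys_mono: "p \<in> polys V ==> V \<subseteq> W ==> p \<in> polys W" by (auto simp: polys_def)

lemma psubst_polys:
  assumes "p \<in> polys V" "\<And>v. v \<in> V ==> f v \<in> polys W"
  shows "psubst f p \<in> polys W" using assms unfolding psubst_def polys_def[of V]
  by (intro polys_sum polys_mult polys_Const polys_prod polys_power) auto

lemma psubst_cong:
  assumes "p \<in> polys V" "\<And>v. v \<in> V ==> f v = g v"
  shows "psubst f p = psubst g p" using assms unfolding psubst_def polys_def
  by (intro sum.cong prod.cong arg_cong2[where f="(*)"] arg_cong2[where f="(^)"] refl) auto

lemma psubst_eq_self:
  assumes "p \<in> polys V" "\<And>v. v \<in> V ==> f v = X v"
  shows "psubst f p = p" using psubst_cong[OF assms] by simp

text \<open>The source of the divisibilities behind divided differences and behind \<open>u1\<close>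
  and \<open>u2\<close>: by induction on p, a congruence modulo d passes through sums and
  products.\<close>

lemma psubst_vanish_diff:
  "\<exists>q. psubst f p - psubst g p = q * d" if "\<And>v. \<exists>q. f v - g v = q * d"
proof (induction p rule: mpoly_induct)
  case (Const c)
  show ?case by (auto intro: exI[of _ 0])
next
  case (add p q)
  then obtain a b where "psubst f p - psubst g p = a * d" "psubst f q - psubst g q = b * d" by blast
  hence "psubst f (p + q) - psubst g (p + q) = (a + b) * d" by (simp add: psubst_add algebra_simps)
  thus ?case by blast
next
  case (mult p q)
  then obtain a b where "psubst f p - psubst g p = a * d" "psubst f q - psubst g q = b * d" by blast
  hence "psubst f (p * q) - psubst g (p * q) = (a * psubst f q + psubst g p * b) * d" by (simp add: psubst_mult) (simp add: algebra_simps)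
  thus ?case by blast
qed (use that in auto)

text \<open>Only finitely many variables occur in p and q, so an injective renaming moves the
  product into \<open>nat mpoly\<close>, which is an integral domain, and renaming back recovers p
  and q.\<close>

lemma mpoly_no_zero_divisors:
  fixes p q :: "'v mpoly"
  assumes "p * q = 0"
  shows "p = 0 \<or> q = 0"
proof -
  define V where "V = (\<Union>m\<in>keys p \<union> keys q. keys m)"
  have fin: "finite V" by (simp add: V_def)
  have pq: "p \<in> polys V" "q \<in> polys V" by (auto simp: polys_def V_def)
  obtain f :: "'v => nat" where f: "inj_on f V" using finite_imp_inj_to_nat_seg[OF fin] by blast
  let ?r = "psubst (\<lambda>v. X (f v) :: nat mpoly)"
  let ?s = "psubst (\<lambda>k. X (inv_into V f k))"
  have inv: "?s (?r p) = p" if "p \<in> polys V" for p unfolding psubst_psubst using that f by (simp add: psubst_eq_self[where V=V])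
  have "?r p * ?r q = 0" using assms by (simp add: psubst_mult[symmetric])
  hence "?r p = 0 \<or> ?r q = 0" by simp
  thus ?thesis using inv[OF pq(1)] inv[OF pq(2)] by auto
qed

lemma mpoly_cancel: "c \<noteq> 0 ==> c * p = c * q ==> p = (q :: 'v mpoly)" using mpoly_no_zero_divisors[of c "p - q"] by (auto simp: algebra_simps)

lemma X_eq_iff [simp]: "X u = X v \<longleftrightarrow> u = v"
proof
  assume "X u = X v"
  hence "single (single u (1::nat)) (1::rat) = single (single v 1) 1" by (simp add: X_def)
  hence "single u (1::nat) = single v 1" by (metis keys_single singleton_inject zero_neq_one)
  thus "u = v" by (metis keys_single singleton_inject zero_neq_one)
qed auto

lemma Const_eq_iff [simp]: "Const a = Const b \<longleftrightarrow> a = b" by (metis Const_def lookup_single_eq)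

subsection \<open>Homogeneity\<close>

lemma mon_deg_mev: "mon_deg m = 2 * int (\<Sum>v\<in>A. lookup m v)" if "finite A" "keys m \<subseteq> A"
  unfolding mon_deg_def using that by (auto intro!: sum.mono_neutral_left simp: in_keys_iff)

lemma mon_deg_add: "mon_deg (a + b) = mon_deg a + mon_deg b" using Poly_Mapping.keys_add[of a b]
  by (simp add: mon_deg_mev[of "keys a \<union> keys b"] lookup_add sum.distrib)

lemma mon_deg_0 [simp]: "mon_deg 0 = 0" by (simp add: mon_deg_def)

lemma mon_deg_single [simp]: "mon_deg (single v k) = 2 * int k" by (cases "k = 0") (auto simp: mon_deg_def)

lemma homog_0 [simp, intro]: "homog k 0" by (simp add: homog_def)

lemma homog_single: "homog (mon_deg m) (single m c)" by (auto simp: homog_def)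

lemma homog_Const [simp, intro]: "homog 0 (Const c)" using homog_single[of 0 c] by (simp add: Const_def)

lemma homog_1 [simp, intro]: "homog 0 1" using homog_Const[of 1] by (simp del: homog_Const)

lemma homog_X [simp, intro]: "homog 2 (X v)" using homog_single[of "single v 1" 1] by (simp add: X_def)

lemma homog_add [intro]: "homog k p ==> homog k q ==> homog k (p + q)" using Poly_Mapping.keys_add[of p q] by (auto simp: homog_def)

lemma homog_uminus [intro]: "homog k p ==> homog k (- p)" by (auto simp: homog_def in_keys_iff)

lemma homog_diff [intro]: "homog k p ==> homog k q ==> homog k (p - q)" using homog_add[of k p "- q"] homog_uminus[of k q] by simp

lemma homog_sum [intro]: "(\<And>a. a \<in> A ==> homog k (f a)) ==> homog k (sum f A)" by (induction A rule: infinite_finite_induct) auto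

lemma homog_mult: "homog k p ==> homog l q ==> homog (k + l) (p * q)" using Poly_Mapping.keys_mult[of p q] by (fastforce simp: homog_def mon_deg_add)

lemma homog_power: "homog k p ==> homog (int j * k) (p ^ j)"
proof (induction j)
  case (Suc j)
  thus ?case using homog_mult[of k p "int j * k" "p ^ j"] by (simp add: algebra_simps)
qed auto

lemma homog_mev:
  assumes "\<And>v. homog 2 (f v)"
  shows "homog (mon_deg m) (mev f m)"
proof -
  have "homog (2 * int (\<Sum>v\<in>A. lookup m v)) (\<Prod>v\<in>A. f v ^ lookup m v)" if "finite A" for A using that
  proof (induction A)
    case (insert a A)
    thus ?case using homog_mult[OF homog_power[OF assms, of "lookup m a" a] insert.IH] by (simp add: algebra_simps)
  qed auto
  thus ?thesis by (simp add: mon_deg_def mev_def)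
qed

lemma homog_psubst:
  assumes "\<And>v. homog 2 (f v)" "homog k p"
  shows "homog k (psubst f p)" unfolding psubst_mev
proof (rule homog_sum)
  fix m assume "m \<in> keys p"
  thus "homog k (Const (lookup p m) * mev f m)" using homog_mult[OF homog_Const homog_mev[of f m]] assms by (auto simp: homog_def)
qed

text \<open>Homogeneity is detected by the substitution \<open>v \<mapsto> 2 v\<close>, which makes it compatible with
  exact quotients.\<close>

abbreviation scale2 :: "'v mpoly => 'v mpoly" where
  "scale2 \<equiv> psubst (\<lambda>v. Const 2 * X v)"

lemma lookup_Const_mult [simp]: "lookup (Const c * p) m = c * lookup p m"
  unfolding Const_def mult_map_scale_conv_mult[symmetric] by (simp add: Poly_Mapping.map.rep_eq when_def)

lemma lookup_scale2: "lookup (scale2 p) m = 2 ^ (\<Sum>v\<in>keys m. lookup m v) * lookup p m"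
proof (induction p rule: pm_induct)
  case (single k c)
  have "mev (\<lambda>v. Const 2 * X v) k = Const (2 ^ (\<Sum>v\<in>keys k. lookup k v)) * mev X k"
    unfolding mev_def by (simp add: power_mult_distrib prod.distrib Const_power[symmetric] power_sum Const_prod)
  thus ?case by (simp add: psubst_single mev_X lookup_single when_def)
qed (auto simp: psubst_add lookup_add algebra_simps)

text \<open>\<open>scale2\<close> multiplies the coefficient of m by 2 to the total exponent of m,
  and powers of 2 determine their exponents. Writing the degree as a difference covers the degrees
  of quotients, which may be negative a priori, without dividing by powers of 2.\<close>

lemma homog_iff_scale2: "homog (2 * int j - 2 * int i) p \<longleftrightarrow> Const (2 ^ i) * scale2 p = Const (2 ^ j) * p"
proof -
  have pow: "(2::rat) ^ a = 2 ^ b \<longleftrightarrow> a = b" for a b by simp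
  have "Const (2 ^ i) * scale2 p = Const (2 ^ j) * p \<longleftrightarrow>
     (\<forall>m. (2::rat) ^ i * (2 ^ (\<Sum>v\<in>keys m. lookup m v) * lookup p m) = 2 ^ j * lookup p m)"
    by (subst poly_mapping_eq_iff) (simp add: fun_eq_iff lookup_scale2)
  also have "\<dots> \<longleftrightarrow> (\<forall>m\<in>keys p. (2::rat) ^ (i + (\<Sum>v\<in>keys m. lookup m v)) = 2 ^ j)"
  proof (intro iffI ballI allI)
    fix m assume "\<forall>m. (2::rat) ^ i * (2 ^ (\<Sum>v\<in>keys m. lookup m v) * lookup p m) = 2 ^ j * lookup p m" "m \<in> keys p"
    hence "((2::rat) ^ i * 2 ^ (\<Sum>v\<in>keys m. lookup m v)) * lookup p m = 2 ^ j * lookup p m" "lookup p m \<noteq> 0"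
      by (simp_all only: mult.assoc in_keys_iff) simp
    thus "(2::rat) ^ (i + (\<Sum>v\<in>keys m. lookup m v)) = 2 ^ j" unfolding power_add by (metis mult_right_cancel)
  next
    fix m assume *: "\<forall>m\<in>keys p. (2::rat) ^ (i + (\<Sum>v\<in>keys m. lookup m v)) = 2 ^ j"
    show "(2::rat) ^ i * (2 ^ (\<Sum>v\<in>keys m. lookup m v) * lookup p m) = 2 ^ j * lookup p m"
      by (cases "m \<in> keys p") (use * in \<open>auto simp: power_add mult.assoc[symmetric] in_keys_iff\<close>)
  qed
  also have "\<dots> \<longleftrightarrow> (\<forall>m\<in>keys p. i + (\<Sum>v\<in>keys m. lookup m v) = j)" unfolding pow ..
  also have "\<dots> \<longleftrightarrow> homog (2 * int j - 2 * int i) p" unfolding homog_def mon_deg_def by (intro ball_cong refl) linarith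
  finally show ?thesis by simp
qed

text \<open>\<open>scale2\<close> is a ring homomorphism, so the scaling identities of b and of q *
  b give that of q after cancelling b.\<close>

lemma homog_quotient:
  assumes "b \<noteq> 0" "homog (2 * int d) b" "homog k (q * b)"
  shows "homog (k - 2 * int d) q"
proof (cases "q = 0")
  case False
  hence "q * b \<noteq> 0" using mpoly_no_zero_divisors assms by blast
  then obtain m where "m \<in> keys (q * b)" by (metis all_not_in_conv keys_eq_empty)
  \<comment> \<open>A monomial of the nonzero product shows that k is an even natural
    number.\<close>
  then obtain j where j: "k = 2 * int j" using assms unfolding homog_def mon_deg_def by metis
  have *: "scale2 b = Const (2 ^ d) * b" "scale2 (q * b) = Const (2 ^ j) * (q * b)"
    using homog_iff_scale2[of d 0 b] homog_iff_scale2[of j 0 "q * b"] assms j by auto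
  have "b * (Const (2 ^ d) * scale2 q) = scale2 (q * b)" by (simp only: psubst_mult *) (simp only: ac_simps)
  also have "\<dots> = b * (Const (2 ^ j) * q)" unfolding * by (simp only: ac_simps)
  finally have "Const (2 ^ d) * scale2 q = Const (2 ^ j) * q" using assms mpoly_cancel by blast
  thus ?thesis using homog_iff_scale2[of j d q] j by simp
qed simp

text \<open>Setting the variables outside V to zero fixes b and q * b; cancelling b shows that it
  fixes q as well.\<close>

lemma polys_quotient:
  assumes "b \<noteq> 0" "b \<in> polys V" "q * b \<in> polys V"
  shows "q \<in> polys V"
proof -
  let ?z = "psubst (\<lambda>v. if v \<in> V then X v else 0)"
  have id: "?z p = p" if "p \<in> polys V" for p using that by (intro psubst_eq_self[where V=V]) auto
  have "b * ?z q = b * q" using id[OF assms(2)] id[OF assms(3)] by (simp add: psubst_mult ac_simps)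
  hence "?z q = q" using mpoly_cancel assms(1) by blast
  moreover have "?z q \<in> polys V" by (rule psubst_polys[where V=UNIV]) (auto simp: polys_def[of UNIV])
  ultimately show ?thesis by simp
qed

lemma pdeg_homog: "p \<noteq> 0 ==> homog k p ==> pdeg p = k"
proof -
  assume "p \<noteq> 0" "homog k p"
  hence "mon_deg ` keys p = {k}" by (auto simp: homog_def simp flip: keys_eq_empty)
  thus ?thesis by (simp add: pdeg_def)
qed

subsection \<open>Divided differences, quotients by powers of a variable, derivatives\<close>

definition identify :: "'v => 'v => 'v mpoly => 'v mpoly" where
  "identify p q = psubst (\<lambda>v. X ((id(p := q)) v))"

lemma identify_hom [simp]:
  "identify p q 0 = 0" "identify p q 1 = 1" "identify p q (Const c) = Const c"
  "identify p q (f + g) = identify p q f + identify p q g"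
  "identify p q (f - g) = identify p q f - identify p q g"
  "identify p q (f * g) = identify p q f * identify p q g"
  "identify p q (- f) = - identify p q f"
  "identify p q (f ^ k) = identify p q f ^ k"
  "identify p q (X v) = X (if v = p then q else v)"
  by (simp_all add: identify_def psubst_add psubst_diff psubst_mult psubst_uminus psubst_power del: fun_upd_apply) simp

lemma identify_polys: "f \<in> polys V ==> q \<in> W ==> V - {p} \<subseteq> W ==> identify p q f \<in> polys W"
  unfolding identify_def by (erule psubst_polys) auto

lemma identify_homog: "homog k f ==> homog k (identify p q f)" unfolding identify_def by (intro homog_psubst) auto

text \<open>The sign is normalised so that the divided difference of \<open>X p\<close> is
  1.\<close>

definition divdiff :: "'v => 'v => 'v mpoly => 'v mpoly" where
  "divdiff p q f = (THE g. g * (X q - X p) = identify p q f - f)"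

context
  fixes p q :: 'v
  assumes pq: "p \<noteq> q"
begin

lemma divdiff_unique: "g * (X q - X p) = identify p q f - f ==> divdiff p q f = g"
proof -
  assume g: "g * (X q - X p) = identify p q f - f"
  have nz: "X q - X p \<noteq> 0" using pq by simp
  show ?thesis unfolding divdiff_def
  proof (rule the_equality, rule g)
    fix h assume "h * (X q - X p) = identify p q f - f"
    hence "(X q - X p) * h = (X q - X p) * g" using g by (simp only: mult.commute)
    thus "h = g" using nz mpoly_cancel by blast
  qed
qed

lemma divdiff: "divdiff p q f * (X q - X p) = identify p q f - f"
proof -
  have "\<exists>r. identify p q f - psubst X f = r * (X q - X p)" unfolding identify_def
  proof (rule psubst_vanish_diff)
    fix v show "\<exists>r. X ((id(p := q)) v) - X v = r * (X q - X p)" by (cases "v = p") (auto intro: exI[of _ 1] exI[of _ 0])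
  qed
  thus ?thesis using divdiff_unique by fastforce
qed

lemma divdiff_0 [simp]: "divdiff p q 0 = 0" by (rule divdiff_unique) simp

lemma divdiff_add: "divdiff p q (f + g) = divdiff p q f + divdiff p q g"
  by (rule divdiff_unique) (simp only: divdiff distrib_right identify_hom, simp)

lemma identify_self: "f \<in> polys V ==> p \<notin> V ==> identify p q f = f" unfolding identify_def by (erule psubst_eq_self) auto

lemma divdiff_mult_const: "f \<in> polys V ==> p \<notin> V ==> divdiff p q (f * g) = f * divdiff p q g"
  by (rule divdiff_unique) (simp only: mult.assoc divdiff identify_hom, simp add: right_diff_distrib identify_self[of f V])

lemma divdiff_const: "f \<in> polys V ==> p \<notin> V ==> divdiff p q f = 0" by (rule divdiff_unique) (simp add: identify_self[of f V])

lemma divdiff_mult_diff: "divdiff p q ((X q - X p) * g) = - g" using pq by (intro divdiff_unique) (simp add: algebra_simps)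

lemma divdiff_polys: "f \<in> polys V ==> p \<in> V ==> q \<in> V ==> divdiff p q f \<in> polys V"
  by (rule polys_quotient[of "X q - X p"]) (auto simp: divdiff pq[symmetric] intro!: identify_polys)

lemma divdiff_homog: "homog k f ==> homog (k - 2) (divdiff p q f)" using homog_quotient[of "X q - X p" 1 k "divdiff p q f"] pq
  by (auto simp: divdiff intro!: homog_diff identify_homog)

end

section \<open>Division with remainder by a power of one variable\<close>

definition vrem :: "'v => nat => 'v mpoly => 'v mpoly" where
  "vrem v n p = (\<Sum>m\<in>keys p. if lookup m v < n then single m (lookup p m) else 0)"

definition vquo :: "'v => nat => 'v mpoly => 'v mpoly" where
  "vquo v n p = (\<Sum>m\<in>keys p. if lookup m v < n then 0 else single (m - single v n) (lookup p m))"

lemma vrem_single: "vrem v n (single m c) = (if lookup m v < n then single m c else 0)" unfolding vrem_def by (subst sum_keys_single) auto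

lemma vquo_single: "vquo v n (single m c) = (if lookup m v < n then 0 else single (m - single v n) c)"
  unfolding vquo_def by (subst sum_keys_single) auto

lemma vrem_add: "vrem v n (p + q) = vrem v n p + vrem v n q" unfolding vrem_def by (subst setsum_keys_plus_distrib) (auto simp: single_add)

lemma vquo_add: "vquo v n (p + q) = vquo v n p + vquo v n q" unfolding vquo_def by (subst setsum_keys_plus_distrib) (auto simp: single_add)

lemma vrem_0 [simp]: "vrem v n 0 = 0" and vquo_0 [simp]: "vquo v n 0 = 0" by (simp_all add: vrem_def vquo_def)

lemma minus_single_add: "\<not> lookup m v < n ==> single v n + (m - single v n) = (m :: 'v \<Rightarrow>\<^sub>0 nat)"
  by (intro poly_mapping_eqI) (auto simp: lookup_add lookup_minus lookup_single when_def)

lemma lookup_vrem: "lookup (vrem v n p) m = (lookup p m when lookup m v < n)" by (induction p rule: pm_induct)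
     (auto simp: vrem_single vrem_add lookup_add lookup_single when_def)

text \<open>Adding n to the exponent of v avoids the truncated subtraction in the
  definition.\<close>

lemma lookup_vquo: "lookup (vquo v n p) m = lookup p (m + single v n)"
proof (induction p rule: pm_induct)
  case (single k c)
  have "k - single v n = m \<longleftrightarrow> k = m + single v n" if "\<not> lookup k v < n"
    using minus_single_add[OF that] by (auto simp: add.commute)
  moreover have "k \<noteq> m + single v n" if "lookup k v < n" using that by (auto simp: lookup_add)
  ultimately show ?case by (auto simp: vquo_single lookup_single when_def)
qed (auto simp: vquo_add lookup_add)

lemma vrem_vquo: "vrem v n p + X v ^ n * vquo v n p = p"
proof (induction p rule: pm_induct)
  case (single m c)
  show ?case by (auto simp: vrem_single vquo_single X_power mult_single minus_single_add)
next
  case (add f g)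
  have "vrem v n (f + g) + X v ^ n * vquo v n (f + g)
      = (vrem v n f + X v ^ n * vquo v n f) + (vrem v n g + X v ^ n * vquo v n g)" by (simp add: vrem_add vquo_add ring_distribs)
  thus ?case by (simp only: add)
qed

lemma lookup_X_power_mult: "lookup (X v ^ n * p) (m + single v n) = lookup p m"
proof (induction p rule: pm_induct)
  case (single k c)
  show ?case by (auto simp: X_power mult_single lookup_single when_def add.commute)
qed (auto simp: algebra_simps lookup_add)

lemma vquo_X_power: "vquo v n (X v ^ n * p) = p" by (intro poly_mapping_eqI) (simp add: lookup_vquo lookup_X_power_mult)

lemma vrem_vquo_mult_single:
  assumes "lookup k v = 0"
  shows "vrem v n (single k d * p) = single k d * vrem v n p"
    and "vquo v n (single k d * p) = single k d * vquo v n p"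
proof -
  have 1: "vrem v n (single k d * p) = single k d * vrem v n p \<and> vquo v n (single k d * p) = single k d * vquo v n p" for p
  proof (induction p rule: pm_induct)
    case (single m c)
    have "k + m - single v n = k + (m - single v n)" if "\<not> lookup m v < n"
      using that assms by (intro poly_mapping_eqI) (auto simp: lookup_add lookup_minus lookup_single when_def)
    thus ?case using assms by (auto simp: mult_single vrem_single vquo_single lookup_add)
  qed (auto simp: algebra_simps vrem_add vquo_add)
  thus "vrem v n (single k d * p) = single k d * vrem v n p"
    "vquo v n (single k d * p) = single k d * vquo v n p" by auto
qed

text \<open>Multiplying by a monomial without v does not change the exponent of v, so division is
  linear over polynomials free of v. The homotopy for a circle is linear over the boundary ring for
  this reason.\<close>

lemma vrem_vquo_mult_const:
  assumes "f \<in> polys V" "v \<notin> V"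
  shows "vrem v n (f * p) = f * vrem v n p" and "vquo v n (f * p) = f * vquo v n p"
proof -
  have vsum: "vrem v n (\<Sum>a\<in>A. g a) = (\<Sum>a\<in>A. vrem v n (g a))" "vquo v n (\<Sum>a\<in>A. g a) = (\<Sum>a\<in>A. vquo v n (g a))"
    for A and g :: "('a \<Rightarrow>\<^sub>0 nat) => 'a mpoly" by (induction A rule: infinite_finite_induct) (auto simp: vrem_add vquo_add)
  have k: "lookup k v = 0" if "k \<in> keys f" for k
  proof -
    have "keys k \<subseteq> V" using that assms(1) by (auto simp: polys_def)
    thus ?thesis using assms(2) by (auto simp: in_keys_iff)
  qed
  \<comment> \<open>Naming the support keeps the expansion of f into monomials from rewriting the
    index set too.\<close>
  define S where "S = keys f"
  have f: "f = (\<Sum>k\<in>S. single k (lookup f k))" unfolding S_def by (rule poly_mapping_sum_singles)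
  have "vrem v n ((\<Sum>k\<in>S. single k (g k)) * p) = (\<Sum>k\<in>S. single k (g k)) * vrem v n p"
    "vquo v n ((\<Sum>k\<in>S. single k (g k)) * p) = (\<Sum>k\<in>S. single k (g k)) * vquo v n p" for g
    unfolding sum_distrib_right vsum using k by (auto intro!: sum.cong vrem_vquo_mult_single simp: S_def)
  from this[of "lookup f"] show "vrem v n (f * p) = f * vrem v n p" "vquo v n (f * p) = f * vquo v n p" unfolding f[symmetric] by auto
qed

lemma vrem_polys: "p \<in> polys V ==> vrem v n p \<in> polys V" unfolding polys_def by (auto simp: in_keys_iff lookup_vrem when_def split: if_splits)

lemma vquo_polys: "p \<in> polys V ==> vquo v n p \<in> polys V"
proof -
  assume "p \<in> polys V"
  moreover have "keys m \<subseteq> keys (m + single v n)" for m :: "'a \<Rightarrow>\<^sub>0 nat" by (auto simp: in_keys_iff lookup_add)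
  moreover have "m + single v n \<in> keys p" if "m \<in> keys (vquo v n p)" for m using that by (simp add: in_keys_iff lookup_vquo)
  ultimately show ?thesis unfolding polys_def by blast
qed

lemma vrem_homog: "homog k p ==> homog k (vrem v n p)" by (auto simp: homog_def in_keys_iff lookup_vrem when_def split: if_splits)

lemma vquo_homog: "homog k p ==> homog (k - 2 * int n) (vquo v n p)" unfolding homog_def
proof
  fix m assume a: "\<forall>m\<in>keys p. mon_deg m = k" "m \<in> keys (vquo v n p)"
  hence "mon_deg (m + single v n) = k" by (simp add: in_keys_iff lookup_vquo)
  thus "mon_deg m = k - 2 * int n" by (simp add: mon_deg_add)
qed

text \<open>Where v does not occur in m the truncated exponent is meaningless, but then the
  coefficient is zero.\<close>

definition vderiv :: "'v => 'v mpoly => 'v mpoly" where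
  "vderiv v p = (\<Sum>m\<in>keys p. single (m - single v 1) (of_nat (lookup m v) * lookup p m))"

lemma vderiv_single: "vderiv v (single m c) = single (m - single v 1) (of_nat (lookup m v) * c)" unfolding vderiv_def by (subst sum_keys_single) auto

lemma vderiv_add: "vderiv v (p + q) = vderiv v p + vderiv v q"
  unfolding vderiv_def by (subst setsum_keys_plus_distrib) (auto simp: algebra_simps single_add)

lemma vderiv_0 [simp]: "vderiv v 0 = 0" by (simp add: vderiv_def)

lemma vderiv_mult: "vderiv v (p * q) = vderiv v p * q + p * vderiv v q"
proof (induction p rule: pm_induct)
  case (single a c)
  show ?case
  proof (induction q rule: pm_induct)
    case (single b d)
    have 1: "a + b - single v 1 = (a - single v 1) + b" if "lookup a v \<noteq> 0"
      using that by (intro poly_mapping_eqI) (auto simp: lookup_add lookup_minus lookup_single when_def)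
    have 2: "a + b - single v 1 = a + (b - single v 1)" if "lookup b v \<noteq> 0"
      using that by (intro poly_mapping_eqI) (auto simp: lookup_add lookup_minus lookup_single when_def)
    have "vderiv v (single a c * single b d) = single (a + b - single v 1) (of_nat (lookup a v) * c * d)
        + single (a + b - single v 1) (of_nat (lookup b v) * c * d)"
      by (simp add: mult_single vderiv_single lookup_add single_add[symmetric] algebra_simps)
    also have "single (a + b - single v 1) (of_nat (lookup a v) * c * d) = vderiv v (single a c) * single b d"
      by (cases "lookup a v = 0") (simp_all add: 1 vderiv_single mult_single del: One_nat_def)
    also have "single (a + b - single v 1) (of_nat (lookup b v) * c * d) = single a c * vderiv v (single b d)"
      by (cases "lookup b v = 0") (simp_all add: 2 vderiv_single mult_single ac_simps del: One_nat_def)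
    finally show ?case .
  qed (auto simp: algebra_simps vderiv_add)
qed (auto simp: algebra_simps vderiv_add)

lemma vderiv_X: "vderiv v (X u) = (if u = v then 1 else 0)" by (auto simp: X_def vderiv_single lookup_single when_def)

lemma vderiv_uminus: "vderiv v (- p) = - vderiv v p" by (metis add.right_inverse add_eq_0_iff vderiv_0 vderiv_add)

lemma vderiv_diff: "vderiv v (p - q) = vderiv v p - vderiv v q" using vderiv_add[of v p "- q"] by (simp add: vderiv_uminus)

lemma vderiv_power: "vderiv v (p ^ Suc k) = of_nat (Suc k) * p ^ k * vderiv v p" by (induction k) (simp_all add: vderiv_mult algebra_simps)

lemma vderiv_polys: "p \<in> polys V ==> vderiv v p \<in> polys V"
proof -
  assume p: "p \<in> polys V"
  have "keys (m - single v 1) \<subseteq> keys m" for m :: "'a \<Rightarrow>\<^sub>0 nat" by (auto simp: in_keys_iff lookup_minus)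
  hence "single (m - single v 1) c \<in> polys V" if "m \<in> keys p" for m c using p that by (fastforce simp: polys_def)
  thus ?thesis unfolding vderiv_def by (intro polys_sum)
qed

section \<open>Free modules with a basis\<close>

text \<open>\<open>lin_ext\<close> accepts any map on coefficients; its additivity, semilinearity
  and composition laws are proved for ring homomorphisms, of which identities and substitutions
  occur.\<close>

definition ringhom :: "('v mpoly => 'w mpoly) => bool" where
  "ringhom \<sigma> \<longleftrightarrow> \<sigma> 0 = 0 \<and> \<sigma> 1 = 1 \<and> (\<forall>p q. \<sigma> (p + q) = \<sigma> p + \<sigma> q) \<and> (\<forall>p q. \<sigma> (p * q) = \<sigma> p * \<sigma> q)"

lemma ringhom_id [simp, intro]: "ringhom id" and ringhom_psubst [simp, intro]: "ringhom (psubst f)"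
  and ringhom_identify [simp, intro]: "ringhom (identify p q)" by (simp_all add: ringhom_def psubst_add psubst_mult)

lemma ringhomD:
  assumes "ringhom \<sigma>"
  shows "\<sigma> 0 = 0" "\<sigma> 1 = 1" "\<sigma> (p + q) = \<sigma> p + \<sigma> q" "\<sigma> (p * q) = \<sigma> p * \<sigma> q"
    "\<sigma> (- p) = - \<sigma> p"
proof -
  show *: "\<sigma> 0 = 0" "\<sigma> 1 = 1" "\<sigma> (p + q) = \<sigma> p + \<sigma> q" "\<sigma> (p * q) = \<sigma> p * \<sigma> q" for p q
    using assms by (auto simp: ringhom_def)
  show "\<sigma> (- p) = - \<sigma> p" using *(1) *(3)[of p "- p"] by (simp add: eq_neg_iff_add_eq_0 add.commute)
qed

lemma lookup_psmul [simp]: "lookup (psmul p f) b = p * lookup f b" by (simp add: psmul_def Poly_Mapping.map.rep_eq when_def)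

lemma psmul_add_right: "psmul p (f + g) = psmul p f + psmul p g"
  and psmul_add_left: "psmul (p + q) f = psmul p f + psmul q f"
  and psmul_psmul [simp]: "psmul p (psmul q f) = psmul (p * q) f"
  and psmul_1 [simp]: "psmul 1 f = f"
  and psmul_0_left [simp]: "psmul 0 f = 0"
  and psmul_0_right [simp]: "psmul p 0 = 0"
  and psmul_minus_left: "psmul (- p) f = - psmul p f"
  and psmul_minus_right: "psmul p (- f) = - psmul p f"
  and psmul_diff_right: "psmul p (f - g) = psmul p f - psmul p g"
  and psmul_diff_left: "psmul (p - q) f = psmul p f - psmul q f"
  and psmul_single [simp]: "psmul p (single b q) = single b (p * q)"
  by (auto intro!: poly_mapping_eqI simp: lookup_add lookup_minus algebra_simps lookup_single when_def)

lemma psmul_sum_right: "psmul p (\<Sum>a\<in>A. g a) = (\<Sum>a\<in>A. psmul p (g a))"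
  by (induction A rule: infinite_finite_induct) (auto simp: psmul_add_right)

lemma lin_ext_lambda_id [simp]: "lin_ext (\<lambda>p. p) = lin_ext id" by (simp add: id_def)

lemma lin_ext_0 [simp]: "lin_ext \<sigma> \<phi> 0 = 0" by (simp add: lin_ext_def)

lemma lin_ext_cong:
  assumes "\<And>b. b \<in> keys f ==> \<sigma> (lookup f b) = \<tau> (lookup f b)" "\<And>b. b \<in> keys f ==> \<phi> b = \<psi> b"
  shows "lin_ext \<sigma> \<phi> f = lin_ext \<tau> \<psi> f" unfolding lin_ext_def using assms by (intro sum.cong) auto

context
  fixes \<sigma> :: "'v mpoly => 'v mpoly"
  assumes \<sigma>: "ringhom \<sigma>"
begin

lemma lin_ext_add: "lin_ext \<sigma> \<phi> (f + g) = lin_ext \<sigma> \<phi> f + lin_ext \<sigma> \<phi> g"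
  unfolding lin_ext_def by (subst setsum_keys_plus_distrib) (auto simp: psmul_add_left ringhomD[OF \<sigma>])

lemma lin_ext_single [simp]: "lin_ext \<sigma> \<phi> (single b p) = psmul (\<sigma> p) (\<phi> b)"
  unfolding lin_ext_def by (subst sum_keys_single) (auto simp: ringhomD[OF \<sigma>])

lemma lin_ext_uminus: "lin_ext \<sigma> \<phi> (- f) = - lin_ext \<sigma> \<phi> f"
  using lin_ext_add[of \<phi> f "- f"] by (simp add: eq_neg_iff_add_eq_0 add.commute)

lemma lin_ext_diff: "lin_ext \<sigma> \<phi> (f - g) = lin_ext \<sigma> \<phi> f - lin_ext \<sigma> \<phi> g"
  using lin_ext_add[of \<phi> f "- g"] by (simp add: lin_ext_uminus)

lemma lin_ext_sum: "lin_ext \<sigma> \<phi> (\<Sum>a\<in>A. g a) = (\<Sum>a\<in>A. lin_ext \<sigma> \<phi> (g a))"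
  by (induction A rule: infinite_finite_induct) (auto simp: lin_ext_add)

lemma lin_ext_psmul: "lin_ext \<sigma> \<phi> (psmul p f) = psmul (\<sigma> p) (lin_ext \<sigma> \<phi> f)"
proof (induction f rule: pm_induct)
  case (single k v)
  thus ?case by (simp add: ringhomD[OF \<sigma>])
qed (auto simp: psmul_add_right lin_ext_add)

end

lemma lin_ext_fun_sum: "lin_ext \<sigma> (\<lambda>b. \<Sum>a\<in>A. \<phi> a b) f = (\<Sum>a\<in>A. lin_ext \<sigma> (\<phi> a) f)"
  unfolding lin_ext_def psmul_sum_right by (rule sum.swap)

lemma lin_ext_fun_psmul: "lin_ext id (\<lambda>b. psmul p (\<phi> b)) f = psmul p (lin_ext id \<phi> f)"
  unfolding lin_ext_def psmul_sum_right by (simp add: mult.commute)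

lemma lin_ext_id_self [simp]: "lin_ext id (\<lambda>b. single b 1) f = f" by (simp add: lin_ext_def poly_mapping_sum_singles[symmetric])

lemma lin_ext_lin_ext:
  assumes "ringhom \<sigma>" "ringhom \<tau>"
  shows "lin_ext \<sigma> \<phi> (lin_ext \<tau> \<psi> f) = lin_ext (\<sigma> \<circ> \<tau>) (\<lambda>b. lin_ext \<sigma> \<phi> (\<psi> b)) f"
  unfolding lin_ext_def[of \<tau>] lin_ext_def[of "\<sigma> \<circ> \<tau>"] by (simp add: lin_ext_sum lin_ext_psmul assms)

lemma module_basis_induct [consumes 1, case_names zero single add]:
  assumes "keys f \<subseteq> B" "P 0" "\<And>b p. b \<in> B ==> P (single b p)" "\<And>f g. P f ==> P g ==> P (f + g)"
  shows "P (f :: 'b \<Rightarrow>\<^sub>0 'c::comm_monoid_add)"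
proof -
  have "P (\<Sum>k\<in>A. single k (lookup f k))" if "finite A" "A \<subseteq> B" for A
    using that by (induction A rule: finite_induct) (auto intro: assms)
  from this[of "keys f"] show ?thesis using assms(1) by (simp add: poly_mapping_sum_singles[symmetric])
qed

text \<open>Coefficientwise action of operations that are additive but in general not
  multiplicative: divided differences, quotients by powers, derivatives, truncations.\<close>

definition cmap :: "('v mpoly => 'w mpoly) => ('b \<Rightarrow>\<^sub>0 'v mpoly) => ('b \<Rightarrow>\<^sub>0 'w mpoly)" where
  "cmap D f = Poly_Mapping.map D f"

lemma lookup_cmap: "D 0 = 0 ==> lookup (cmap D f) b = D (lookup f b)" by (simp add: cmap_def Poly_Mapping.map.rep_eq when_def)

lemma cmap_add: "D 0 = 0 ==> (\<And>p q. D (p + q) = D p + D q) ==> cmap D (f + g) = cmap D f + cmap D g"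
  by (intro poly_mapping_eqI) (simp add: lookup_cmap lookup_add)

lemma cmap_single: "D 0 = 0 ==> cmap D (single b p) = single b (D p)" by (intro poly_mapping_eqI) (simp add: lookup_cmap lookup_single when_def)

lemma cmap_0 [simp]: "D 0 = 0 ==> cmap D 0 = 0" by (intro poly_mapping_eqI) (simp add: lookup_cmap)

lemma keys_cmap: "D 0 = 0 ==> keys (cmap D f) \<subseteq> keys f" by (auto simp: in_keys_iff lookup_cmap)

text \<open>An additive operation on coefficients passes through a matrix whose entries it treats as
  scalars.\<close>

lemma cmap_lin_ext_commute:
  assumes D: "D 0 = 0" "\<And>p q. D (p + q) = D p + D q"
    and f: "keys f \<subseteq> B" and lin: "\<And>b c p. b \<in> B ==> D (lookup (\<phi> b) c * p) = lookup (\<phi> b) c * D p"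
  shows "cmap D (lin_ext id \<phi> f) = lin_ext id \<phi> (cmap D f)" using f
proof (induction f rule: module_basis_induct)
  case (single b p)
  thus ?case by (intro poly_mapping_eqI) (simp add: cmap_single lookup_cmap D lin mult.commute[of p] mult.commute[of "D p"])
qed (auto simp: cmap_add D lin_ext_add)

text \<open>The elements and the maps of the modules spanned by \<open>bas M\<close>; \<open>fl\<close> tells whether a map
  reverses the parity, \<open>s\<close> is its degree.\<close>

abbreviation car :: "('v, 'b) bfact => bool => ('b \<Rightarrow>\<^sub>0 'v mpoly) set" where
  "car M i \<equiv> gcar (gfact_of M) i"

abbreviation hom :: "('v, 'b) bfact => bool => int => ('b \<Rightarrow>\<^sub>0 'v mpoly) set" where
  "hom M i k \<equiv> ghom (gfact_of M) i k"

abbreviation bd :: "('v, 'b) bfact => ('b \<Rightarrow>\<^sub>0 'v mpoly) => ('b \<Rightarrow>\<^sub>0 'v mpoly)" where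
  "bd M \<equiv> lin_ext id (bdif M)"

lemma gdif_gfact_of [simp]: "gdif (gfact_of M) i = bd M" and gsmul_gfact_of [simp]: "gsmul (gfact_of M) = psmul" by (simp_all add: gfact_of_def)

lemma car_iff: "f \<in> car M i \<longleftrightarrow> keys f \<subseteq> bas M \<and> (\<forall>b\<in>keys f. bpar M b = i) \<and> (\<forall>b. lookup f b \<in> polys (bvars M))"
  using polys_0 by (fastforce simp: gfact_of_def in_keys_iff)

lemma hom_iff: "f \<in> hom M i k \<longleftrightarrow> f \<in> car M i \<and> (\<forall>b. homog (k - bdeg M b) (lookup f b))"
  by (auto simp: gfact_of_def) (metis in_keys_iff homog_0)

lemma car_keys: "f \<in> car M i ==> keys f \<subseteq> bas M" by (simp add: car_iff)

section \<open>Parity components and homogeneous parts of a based module\<close>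

lemma keys_plus: "keys f \<subseteq> A ==> keys g \<subseteq> A ==> keys (f + g) \<subseteq> A" using Poly_Mapping.keys_add[of f g] by blast

lemma keys_psmul: "keys (psmul p f) \<subseteq> keys f" by (auto simp: in_keys_iff)

lemma car_0 [simp, intro]: "0 \<in> car M i" by (simp add: car_iff)

lemma car_add [intro]: "f \<in> car M i ==> g \<in> car M i ==> f + g \<in> car M i"
proof -
  assume fg: "f \<in> car M i" "g \<in> car M i"
  have k: "b \<in> keys f \<or> b \<in> keys g" if "b \<in> keys (f + g)" for b using Poly_Mapping.keys_add[of f g] that by blast
  show ?thesis unfolding car_iff
  proof (intro conjI subsetI ballI allI)
    fix b assume "b \<in> keys (f + g)"
    thus "b \<in> bas M" "bpar M b = i" using k[of b] fg by (auto simp: car_iff)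
  qed (use fg in \<open>auto simp: car_iff lookup_add\<close>)
qed

lemma car_uminus [intro]: "f \<in> car M i ==> - f \<in> car M i" by (auto simp: car_iff)

lemma car_diff [intro]: "f \<in> car M i ==> g \<in> car M i ==> f - g \<in> car M i" using car_add[of f M i "- g"] by auto

lemma car_psmul [intro]: "p \<in> polys (bvars M) ==> f \<in> car M i ==> psmul p f \<in> car M i" using keys_psmul[of p f] by (auto simp: car_iff)

lemma car_sum [intro]: "(\<And>a. a \<in> A ==> f a \<in> car M i) ==> sum f A \<in> car M i" by (induction A rule: infinite_finite_induct) auto

lemma car_single: "b \<in> bas M ==> bpar M b = i ==> p \<in> polys (bvars M) ==> single b p \<in> car M i"
  by (auto simp: car_iff lookup_single when_def)

lemma hom_car: "f \<in> hom M i k ==> f \<in> car M i" by (simp add: hom_iff)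

lemma hom_0 [simp, intro]: "0 \<in> hom M i k" by (simp add: hom_iff)

lemma hom_add [intro]: "f \<in> hom M i k ==> g \<in> hom M i k ==> f + g \<in> hom M i k" by (auto simp: hom_iff lookup_add)

lemma hom_uminus [intro]: "f \<in> hom M i k ==> - f \<in> hom M i k" by (auto simp: hom_iff)

lemma hom_diff [intro]: "f \<in> hom M i k ==> g \<in> hom M i k ==> f - g \<in> hom M i k" using hom_add[of f M i k "- g"] by auto

lemma hom_sum [intro]: "(\<And>a. a \<in> A ==> f a \<in> hom M i k) ==> sum f A \<in> hom M i k" by (induction A rule: infinite_finite_induct) auto

lemma car_cmap:
  assumes "f \<in> car M i" "D 0 = 0" "\<And>p. p \<in> polys (bvars M) ==> D p \<in> polys (bvars M)"
  shows "cmap D f \<in> car M i" using assms keys_cmap[of D f] by (auto simp: car_iff lookup_cmap)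

lemma hom_cmap:
  assumes "f \<in> hom M i k" "D 0 = 0" "\<And>p. p \<in> polys (bvars M) ==> D p \<in> polys (bvars M)"
    "\<And>l p. homog l p ==> homog (l + s) (D p)"
  shows "cmap D f \<in> hom M i (k + s)"
proof -
  have "homog (k + s - bdeg M b) (D (lookup f b))" for b using assms(4)[of "k - bdeg M b" "lookup f b"] assms(1) by (simp add: hom_iff algebra_simps)
  thus ?thesis using assms car_cmap[of f M i D] by (auto simp: hom_iff lookup_cmap)
qed

definition car_map :: "('v, 'b) bfact => ('v, 'c) bfact => bool => ('b => 'c \<Rightarrow>\<^sub>0 'v mpoly) => bool" where
  "car_map M N fl \<phi> \<longleftrightarrow> (\<forall>b\<in>bas M. \<phi> b \<in> car N (bpar M b \<noteq> fl))"

definition hom_map :: "('v, 'b) bfact => ('v, 'c) bfact => bool => int => ('b => 'c \<Rightarrow>\<^sub>0 'v mpoly) => bool" where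
  "hom_map M N fl s \<phi> \<longleftrightarrow> (\<forall>b\<in>bas M. \<phi> b \<in> hom N (bpar M b \<noteq> fl) (bdeg M b + s))"

lemma hom_map_car_map: "hom_map M N fl s \<phi> ==> car_map M N fl \<phi>" by (auto simp: hom_map_def car_map_def hom_iff)

lemma car_map_apply:
  assumes "car_map M N fl \<phi>" "f \<in> car M i" "\<And>p. p \<in> polys (bvars M) ==> \<sigma> p \<in> polys (bvars N)"
  shows "lin_ext \<sigma> \<phi> f \<in> car N (i \<noteq> fl)"
  unfolding lin_ext_def using assms by (intro car_sum car_psmul) (auto simp: car_map_def car_iff)

lemma hom_psmul: "homog l p ==> p \<in> polys (bvars M) ==> f \<in> hom M i k ==> psmul p f \<in> hom M i (k + l)"
proof -
  assume a: "homog l p" "p \<in> polys (bvars M)" "f \<in> hom M i k"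
  have "homog (k + l - bdeg M b) (p * lookup f b)" for b
    using homog_mult[OF a(1), of "k - bdeg M b" "lookup f b"] a by (simp add: hom_iff algebra_simps)
  thus ?thesis using a by (auto simp: hom_iff)
qed

lemma hom_map_apply:
  assumes "hom_map M N fl s \<phi>" "f \<in> hom M i k" "\<And>p. p \<in> polys (bvars M) ==> \<sigma> p \<in> polys (bvars N)"
    "\<And>l p. homog l p ==> homog l (\<sigma> p)"
  shows "lin_ext \<sigma> \<phi> f \<in> hom N (i \<noteq> fl) (k + s)" unfolding lin_ext_def
proof (rule hom_sum)
  fix b assume b: "b \<in> keys f"
  hence "b \<in> bas M" "bpar M b = i" using assms(2) by (auto simp: hom_iff car_iff)
  hence \<phi>: "\<phi> b \<in> hom N (i \<noteq> fl) (bdeg M b + s)" using assms(1) by (auto simp: hom_map_def)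
  have h: "homog (k - bdeg M b) (\<sigma> (lookup f b))" "\<sigma> (lookup f b) \<in> polys (bvars N)"
    using assms(2,3,4) by (auto simp: hom_iff car_iff)
  show "psmul (\<sigma> (lookup f b)) (\<phi> b) \<in> hom N (i \<noteq> fl) (k + s)" using hom_psmul[OF h \<phi>] by (simp add: algebra_simps)
qed

section \<open>Tensor products\<close>

lemma bas_btensor: "bs \<in> bas (btensor Ms) \<longleftrightarrow> length bs = length Ms \<and> (\<forall>k<length Ms. bs ! k \<in> bas (Ms ! k))"
  by (auto simp: btensor_def list_all2_conv_all_nth)

lemma bvars_btensor [simp]: "bvars (btensor Ms) = (\<Union>M\<in>set Ms. bvars M)" by (simp add: btensor_def)

lemma bvars_nth: "k < length Ms ==> bvars (Ms ! k) \<subseteq> bvars (btensor Ms)" by (auto intro!: bexI[of _ "Ms ! k"])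

text \<open>Koszul sign for moving an odd operator past the entries in front of position k.\<close>

definition osgn :: "('v, 'b) bfact list => nat => 'b list => 'v mpoly" where
  "osgn Ms k bs = (- 1) ^ card {j. j < k \<and> bpar (Ms ! j) (bs ! j)}"

lemma osgn_sq: "osgn Ms k bs * osgn Ms k bs = 1" by (simp add: osgn_def flip: power_add)

text \<open>As a constant, the sign lies in every subring, has degree 0 and is fixed by every
  substitution.\<close>

lemma osgn_Const:
  fixes Ms :: "('v, 'b) bfact list"
  shows "osgn Ms k bs = Const ((-1) ^ card {j. j < k \<and> bpar (Ms ! j) (bs ! j)})"
proof -
  have "Const (- 1) = (- 1 :: 'v mpoly)" using Const_add[of "-1" 1] by (simp add: eq_neg_iff_add_eq_0)
  thus ?thesis unfolding osgn_def Const_power by simp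
qed

lemma osgn_ge: "k \<le> l ==> osgn Ms k (bs[l := c]) = osgn Ms k bs"
proof -
  assume "k \<le> l"
  hence "{j. j < k \<and> bpar (Ms ! j) (bs[l := c] ! j)} = {j. j < k \<and> bpar (Ms ! j) (bs ! j)}" by auto
  thus ?thesis by (simp add: osgn_def)
qed

lemma card_toggle: "finite S ==> (x \<in> S \<longleftrightarrow> x \<notin> T) ==> S - {x} = T - {x} ==> even (card S) \<longleftrightarrow> odd (card T)"
proof -
  assume a: "finite S" "(x \<in> S \<longleftrightarrow> x \<notin> T)" "S - {x} = T - {x}"
  show ?thesis
  proof (cases "x \<in> S")
    case True
    hence "S = insert x T" "x \<notin> T" "finite T" using a by auto
    thus ?thesis by simp
  next
    case False
    hence "T = insert x S" using a by auto
    thus ?thesis using card_insert_disjoint[OF a(1) False] by simp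
  qed
qed

lemma minus_one_power_eq: "(even a \<longleftrightarrow> even b) ==> (- 1 :: 'a::ring_1) ^ a = (- 1) ^ b"
  by (cases "even a") (auto simp: minus_one_power_iff)

lemma osgn_less:
  assumes "l < k" "k \<le> length bs" "bpar (Ms ! l) c \<noteq> bpar (Ms ! l) (bs ! l)"
  shows "osgn Ms k (bs[l := c]) = - osgn Ms k bs"
proof -
  have "even (card {j. j < k \<and> bpar (Ms ! j) (bs[l := c] ! j)}) \<longleftrightarrow> odd (card {j. j < k \<and> bpar (Ms ! j) (bs ! j)})"
  proof (rule card_toggle[where x=l])
    show "(l \<in> {j. j < k \<and> bpar (Ms ! j) (bs[l := c] ! j)}) = (l \<notin> {j. j < k \<and> bpar (Ms ! j) (bs ! j)})" using assms by simp
    show "{j. j < k \<and> bpar (Ms ! j) (bs[l := c] ! j)} - {l} = {j. j < k \<and> bpar (Ms ! j) (bs ! j)} - {l}" by auto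
  qed simp
  thus ?thesis by (auto simp: osgn_def minus_one_power_iff)
qed

lemma bpar_update:
  assumes "l < length Ms" "length bs = length Ms" "bpar (Ms ! l) c \<noteq> bpar (Ms ! l) (bs ! l)"
  shows "bpar (btensor Ms) (bs[l := c]) \<longleftrightarrow> \<not> bpar (btensor Ms) bs"
proof -
  have "even (card {j. j < length Ms \<and> bpar (Ms ! j) (bs[l := c] ! j)}) \<longleftrightarrow> odd (card {j. j < length Ms \<and> bpar (Ms ! j) (bs ! j)})"
  proof (rule card_toggle[where x=l])
    show "(l \<in> {j. j < length Ms \<and> bpar (Ms ! j) (bs[l := c] ! j)}) = (l \<notin> {j. j < length Ms \<and> bpar (Ms ! j) (bs ! j)})"
      using assms by simp
    show "{j. j < length Ms \<and> bpar (Ms ! j) (bs[l := c] ! j)} - {l} = {j. j < length Ms \<and> bpar (Ms ! j) (bs ! j)} - {l}" by auto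
  qed simp
  thus ?thesis by (auto simp: btensor_def)
qed

lemma bdeg_update:
  assumes "l < length Ms" "length bs = length Ms"
  shows "bdeg (btensor Ms) (bs[l := c]) = bdeg (btensor Ms) bs - bdeg (Ms ! l) (bs ! l) + bdeg (Ms ! l) c"
proof -
  have "(\<Sum>k<length Ms. bdeg (Ms ! k) (bs[l := c] ! k)) = (\<Sum>k<length Ms. bdeg (Ms ! k) (bs ! k) + (if k = l then bdeg (Ms ! l) c - bdeg (Ms ! l) (bs ! l) else 0))"
    using assms by (intro sum.cong) (auto simp: nth_list_update)
  thus ?thesis using assms by (simp add: btensor_def sum.distrib)
qed

definition put :: "nat => 'b list => ('b \<Rightarrow>\<^sub>0 'v mpoly) => ('b list \<Rightarrow>\<^sub>0 'v mpoly)" where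
  "put k bs = lin_ext id (\<lambda>c. single (bs[k := c]) 1)"

lemma put_single [simp]: "put k bs (single c p) = single (bs[k := c]) p"
  and put_add: "put k bs (f + g) = put k bs f + put k bs g"
  and put_0 [simp]: "put k bs 0 = 0" by (simp_all add: put_def lin_ext_add)

lemma put_update [simp]: "put k (bs[k := c]) = put k bs" by (simp add: put_def)

lemma lin_ext_put: "ringhom \<sigma> ==> lin_ext \<sigma> \<phi> (put k bs g) = lin_ext \<sigma> (\<lambda>c. \<phi> (bs[k := c])) g"
  by (simp add: put_def lin_ext_lin_ext ringhomD)

lemma put_lin_ext: "put k bs (lin_ext id \<phi> f) = lin_ext id (\<lambda>b. put k bs (\<phi> b)) f" unfolding put_def by (subst lin_ext_lin_ext) auto

lemma lookup_put:
  assumes "k < length bs"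
  shows "lookup (put k bs g) cs = (lookup g (cs ! k) when cs = bs[k := cs ! k])"
proof (induction g rule: pm_induct)
  case (single b p)
  thus ?case using assms by (auto simp: lookup_single when_def)
qed (auto simp: put_add lookup_add when_def)

definition lop :: "('v, 'b) bfact list => nat => ('b => 'b \<Rightarrow>\<^sub>0 'v mpoly) => 'b list => ('b list \<Rightarrow>\<^sub>0 'v mpoly)" where
  "lop Ms k T bs = psmul (osgn Ms k bs) (put k bs (T (bs ! k)))"

text \<open>The odd operator \<open>T\<close> acting on the \<open>k\<close>-th tensor factor, with the Koszul sign.\<close>

definition LO :: "('v, 'b) bfact list => nat => ('b => 'b \<Rightarrow>\<^sub>0 'v mpoly) => ('b list \<Rightarrow>\<^sub>0 'v mpoly) => ('b list \<Rightarrow>\<^sub>0 'v mpoly)" where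
  "LO Ms k T = lin_ext id (lop Ms k T)"

lemma LO_single [simp]: "LO Ms k T (single bs p) = psmul p (lop Ms k T bs)"
  and LO_add: "LO Ms k T (f + g) = LO Ms k T f + LO Ms k T g"
  and LO_uminus: "LO Ms k T (- f) = - LO Ms k T f"
  and LO_diff: "LO Ms k T (f - g) = LO Ms k T f - LO Ms k T g"
  and LO_psmul: "LO Ms k T (psmul p f) = psmul p (LO Ms k T f)"
  and LO_sum: "LO Ms k T (\<Sum>a\<in>A. h a) = (\<Sum>a\<in>A. LO Ms k T (h a))"
  and LO_0 [simp]: "LO Ms k T 0 = 0" by (simp_all add: LO_def lin_ext_add lin_ext_psmul lin_ext_sum lin_ext_uminus lin_ext_diff)

lemma bdif_btensor: "bdif (btensor Ms) bs = (\<Sum>k<length Ms. lop Ms k (bdif (Ms ! k)) bs)"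
  by (simp add: btensor_def lop_def put_def osgn_def lin_ext_def psmul_sum_right)

lemma bd_btensor: "bd (btensor Ms) f = (\<Sum>k<length Ms. LO Ms k (bdif (Ms ! k)) f)"
  unfolding LO_def lin_ext_fun_sum[symmetric] by (simp add: lin_ext_def bdif_btensor)

lemma LO_put: "LO Ms k S (put l bs g) = lin_ext id (\<lambda>c. lop Ms k S (bs[l := c])) g" by (simp add: LO_def lin_ext_put)

text \<open>Both sides are the bilinear filling of slot l by f and of slot k by g.\<close>

lemma put_put_swap:
  assumes "k \<noteq> l"
  shows "lin_ext id (\<lambda>c. put k (bs[l := c]) g) f = lin_ext id (\<lambda>d. put l (bs[k := d]) f) (g :: 'b \<Rightarrow>\<^sub>0 'v mpoly)"
proof (induction f rule: pm_induct)
  case (single c p)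
  show ?case using assms by (induction g rule: pm_induct)
      (auto simp: lin_ext_add psmul_add_right put_add list_update_swap mult.commute)
next
  case (add f f')
  have "lin_ext id (\<lambda>d. put l (bs[k := d]) (f + f')) g
     = lin_ext id (\<lambda>d. put l (bs[k := d]) f) g + lin_ext id (\<lambda>d. put l (bs[k := d]) f') g" for g
    by (induction g rule: pm_induct) (auto simp: put_add lin_ext_add psmul_add_right)
  with add show ?case by (simp add: lin_ext_add)
qed

text \<open>Say l < k. Acting at l first changes the parity of an entry in front of k and so
  reverses the sign of the operator at k, while the operator at l does not see slot k. The two
  orders therefore differ by exactly one sign.\<close>

lemma LO_lop_anticommute:
  assumes "k \<noteq> l" "k < length bs" "l < length bs"
    "\<And>c. c \<in> keys (S (bs ! k)) ==> bpar (Ms ! k) c \<noteq> bpar (Ms ! k) (bs ! k)"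
    "\<And>c. c \<in> keys (T (bs ! l)) ==> bpar (Ms ! l) c \<noteq> bpar (Ms ! l) (bs ! l)"
  shows "LO Ms k S (lop Ms l T bs) + LO Ms l T (lop Ms k S bs) = 0"
proof -
  have *: "LO Ms k S (lop Ms l T bs) + LO Ms l T (lop Ms k S bs) = 0"
    if "l < k" "k < length bs"
      "\<And>c. c \<in> keys (T (bs ! l)) ==> bpar (Ms ! l) c \<noteq> bpar (Ms ! l) (bs ! l)" for k l S T
  proof -
    have "LO Ms k S (lop Ms l T bs) = psmul (osgn Ms l bs) (lin_ext id (\<lambda>c. lop Ms k S (bs[l := c])) (T (bs ! l)))"
      by (simp add: lop_def[of Ms l] LO_psmul LO_put)
    also have "lin_ext id (\<lambda>c. lop Ms k S (bs[l := c])) (T (bs ! l))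
       = lin_ext id (\<lambda>c. psmul (- osgn Ms k bs) (put k (bs[l := c]) (S (bs ! k)))) (T (bs ! l))"
      using that by (intro lin_ext_cong) (auto simp: lop_def osgn_less)
    also have "\<dots> = psmul (- osgn Ms k bs) (lin_ext id (\<lambda>c. put k (bs[l := c]) (S (bs ! k))) (T (bs ! l)))" by (rule lin_ext_fun_psmul)
    also have "lin_ext id (\<lambda>c. put k (bs[l := c]) (S (bs ! k))) (T (bs ! l))
       = lin_ext id (\<lambda>d. put l (bs[k := d]) (T (bs ! l))) (S (bs ! k))" using that by (intro put_put_swap) auto
    finally have 1: "LO Ms k S (lop Ms l T bs) =
      psmul (osgn Ms l bs * - osgn Ms k bs) (lin_ext id (\<lambda>d. put l (bs[k := d]) (T (bs ! l))) (S (bs ! k)))" by simp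
    have "LO Ms l T (lop Ms k S bs) = psmul (osgn Ms k bs) (lin_ext id (\<lambda>d. lop Ms l T (bs[k := d])) (S (bs ! k)))"
      by (simp add: lop_def[of Ms k] LO_psmul LO_put)
    also have "lin_ext id (\<lambda>d. lop Ms l T (bs[k := d])) (S (bs ! k)) =
       lin_ext id (\<lambda>d. psmul (osgn Ms l bs) (put l (bs[k := d]) (T (bs ! l)))) (S (bs ! k))"
      using that by (intro lin_ext_cong) (auto simp: lop_def osgn_ge)
    also have "\<dots> = psmul (osgn Ms l bs) (lin_ext id (\<lambda>d. put l (bs[k := d]) (T (bs ! l))) (S (bs ! k)))" by (rule lin_ext_fun_psmul)
    finally show ?thesis unfolding 1 by (simp add: psmul_minus_left mult.commute)
  qed
  show ?thesis
  proof (cases "l < k")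
    case True
    thus ?thesis using * assms by blast
  next
    case False
    hence "k < l" using assms(1) by simp
    from *[OF this assms(3), where S=T and T=S] assms(4) show ?thesis by (simp add: add.commute)
  qed
qed

text \<open>Both Koszul signs count only entries in front of k, which the first operator leaves
  alone, so their product is 1.\<close>

lemma LO_lop_same: "LO Ms k S (lop Ms k T bs) = put k bs (lin_ext id S (T (bs ! k)))" if "k < length bs"
proof -
  have "LO Ms k S (lop Ms k T bs) = psmul (osgn Ms k bs) (lin_ext id (\<lambda>c. lop Ms k S (bs[k := c])) (T (bs ! k)))"
    by (simp add: lop_def[of Ms k T] LO_psmul LO_put)
  also have "lin_ext id (\<lambda>c. lop Ms k S (bs[k := c])) (T (bs ! k)) =
     lin_ext id (\<lambda>c. psmul (osgn Ms k bs) (put k bs (S c))) (T (bs ! k))" using that by (intro lin_ext_cong) (auto simp: lop_def osgn_ge)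
  also have "\<dots> = psmul (osgn Ms k bs) (put k bs (lin_ext id S (T (bs ! k))))" by (simp add: lin_ext_fun_psmul put_lin_ext)
  finally show ?thesis by (simp add: osgn_sq)
qed

definition odd_map :: "('v, 'b) bfact => ('b => 'b \<Rightarrow>\<^sub>0 'v mpoly) => bool" where
  "odd_map M T \<longleftrightarrow> (\<forall>b\<in>bas M. \<forall>c\<in>keys (T b). c \<in> bas M \<and> bpar M c \<noteq> bpar M b)"

lemma car_map_odd_map: "car_map M M True T ==> odd_map M T" by (auto simp: car_map_def odd_map_def car_iff)

lemma LO_anticommute:
  assumes "k \<noteq> l" "k < length Ms" "l < length Ms" "odd_map (Ms ! k) S" "odd_map (Ms ! l) T" "keys f \<subseteq> bas (btensor Ms)"
  shows "LO Ms k S (LO Ms l T f) = - LO Ms l T (LO Ms k S f)" using assms(6)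
proof (induction f rule: module_basis_induct)
  case (single bs p)
  have "LO Ms k S (lop Ms l T bs) + LO Ms l T (lop Ms k S bs) = 0"
    using assms single by (intro LO_lop_anticommute) (auto simp: odd_map_def bas_btensor)
  hence "psmul p (LO Ms k S (lop Ms l T bs) + LO Ms l T (lop Ms k S bs)) = 0" by simp
  thus ?case by (simp add: LO_psmul psmul_add_right eq_neg_iff_add_eq_0)
qed (auto simp: LO_add)

lemma LO_LO_same:
  assumes "k < length Ms" "keys f \<subseteq> bas (btensor Ms)"
  shows "LO Ms k S (LO Ms k T f) = lin_ext id (\<lambda>bs. put k bs (lin_ext id S (T (bs ! k)))) f" using assms(2)
proof (induction f rule: module_basis_induct)
  case (single bs p)
  thus ?case using assms(1) by (simp add: LO_psmul LO_lop_same bas_btensor)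
qed (auto simp: LO_add lin_ext_add)

text \<open>The operator at k anticommutes with the differentials of the other factors, so the
  anticommutator with the whole differential is the one computed inside factor k. This transports
  contractions and null-homotopies from one factor to the tensor product.\<close>

lemma btensor_anticommutator:
  assumes k: "k < length Ms" and odd: "\<And>l. l < length Ms ==> odd_map (Ms ! l) (bdif (Ms ! l))"
    and T: "odd_map (Ms ! k) T"
    and loc: "\<And>b. b \<in> bas (Ms ! k) ==> lin_ext id T (bdif (Ms ! k) b) + lin_ext id (bdif (Ms ! k)) (T b) = single b q"
    and f: "keys f \<subseteq> bas (btensor Ms)"
  shows "LO Ms k T (bd (btensor Ms) f) + bd (btensor Ms) (LO Ms k T f) = psmul q f"
proof -
  have "LO Ms k T (bd (btensor Ms) f) + bd (btensor Ms) (LO Ms k T f)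
    = (\<Sum>l<length Ms. LO Ms k T (LO Ms l (bdif (Ms ! l)) f) + LO Ms l (bdif (Ms ! l)) (LO Ms k T f))" by (simp add: bd_btensor LO_sum sum.distrib)
  also have "\<dots> = (\<Sum>l<length Ms. if l = k then psmul q f else 0)"
  proof (intro sum.cong refl)
    fix l assume l: "l \<in> {..<length Ms}"
    show "LO Ms k T (LO Ms l (bdif (Ms ! l)) f) + LO Ms l (bdif (Ms ! l)) (LO Ms k T f) = (if l = k then psmul q f else 0)"
    proof (cases "l = k")
      case True
      show ?thesis unfolding True LO_LO_same[OF k f] using f
      proof (induction f rule: module_basis_induct)
        case (single bs p)
        hence "put k bs (lin_ext id T (bdif (Ms ! k) (bs ! k)) + lin_ext id (bdif (Ms ! k)) (T (bs ! k))) = single bs q"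
          using loc[of "bs ! k"] k by (simp add: bas_btensor)
        thus ?case by (simp add: put_add psmul_add_right[symmetric] mult.commute)
      qed (auto simp: lin_ext_add psmul_add_right add_ac)
    next
      case False
      thus ?thesis using LO_anticommute[OF False[symmetric] k _ T odd f] odd l by simp
    qed
  qed
  also have "\<dots> = psmul q f" using k by simp
  finally show ?thesis .
qed

text \<open>The terms off the diagonal cancel in pairs, so no division by 2 occurs.\<close>

lemma sum_antisymmetric:
  fixes A :: "nat => nat => 'a::ab_group_add"
  assumes "\<And>k l. k < N ==> l < N ==> k \<noteq> l ==> A k l = - A l k"
  shows "(\<Sum>k<N. \<Sum>l<N. A k l) = (\<Sum>k<N. A k k)" using assms
proof (induction N)
  case (Suc N)
  have "(\<Sum>k<N. A k N) = - (\<Sum>k<N. A N k)" unfolding sum_negf[symmetric]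
  proof (intro sum.cong refl)
    fix k assume "k \<in> {..<N}"
    thus "A k N = - A N k" using Suc.prems[of k N] by simp
  qed
  moreover have "(\<Sum>k<Suc N. \<Sum>l<Suc N. A k l) = (\<Sum>k<N. \<Sum>l<N. A k l) + (\<Sum>k<N. A k N) + (\<Sum>l<N. A N l) + A N N"
    by (simp add: sum.distrib)
  moreover have "(\<Sum>k<N. \<Sum>l<N. A k l) = (\<Sum>k<N. A k k)" by (rule Suc.IH, rule Suc.prems) auto
  ultimately show ?case by simp
qed simp

text \<open>The mixed terms of the square cancel by anticommutation, and the diagonal terms add up
  the potentials.\<close>

lemma btensor_square:
  assumes odd: "\<And>l. l < length Ms ==> odd_map (Ms ! l) (bdif (Ms ! l))"
    and sq: "\<And>k b. k < length Ms ==> b \<in> bas (Ms ! k) ==> bd (Ms ! k) (bdif (Ms ! k) b) = single b (w k)"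
    and f: "keys f \<subseteq> bas (btensor Ms)"
  shows "bd (btensor Ms) (bd (btensor Ms) f) = psmul (\<Sum>k<length Ms. w k) f"
proof -
  have "bd (btensor Ms) (bd (btensor Ms) f)
    = (\<Sum>k<length Ms. \<Sum>l<length Ms. LO Ms k (bdif (Ms ! k)) (LO Ms l (bdif (Ms ! l)) f))" by (simp add: bd_btensor LO_sum)
  also have "\<dots> = (\<Sum>k<length Ms. LO Ms k (bdif (Ms ! k)) (LO Ms k (bdif (Ms ! k)) f))"
    using LO_anticommute odd f by (intro sum_antisymmetric) blast
  also have "\<dots> = (\<Sum>k<length Ms. psmul (w k) f)"
  proof (intro sum.cong refl)
    fix k assume k: "k \<in> {..<length Ms}"
    hence k': "k < length Ms" by simp
    show "LO Ms k (bdif (Ms ! k)) (LO Ms k (bdif (Ms ! k)) f) = psmul (w k) f" unfolding LO_LO_same[OF k' f] using f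
    proof (induction f rule: module_basis_induct)
      case (single bs p)
      thus ?case using sq[OF k', of "bs ! k"] k by (simp add: bas_btensor mult.commute)
    qed (auto simp: lin_ext_add psmul_add_right)
  qed
  also have "\<dots> = psmul (\<Sum>k<length Ms. w k) f" by (intro poly_mapping_eqI) (simp add: lookup_sum sum_distrib_right)
  finally show ?thesis .
qed

section \<open>Parity and degree of operators on one tensor factor\<close>

lemma lop_car_map:
  assumes "k < length Ms" "car_map (Ms ! k) (Ms ! k) True T"
  shows "car_map (btensor Ms) (btensor Ms) True (lop Ms k T)" unfolding car_map_def
proof
  fix bs assume bs: "bs \<in> bas (btensor Ms)"
  hence Tb: "T (bs ! k) \<in> car (Ms ! k) (\<not> bpar (Ms ! k) (bs ! k))" using assms by (auto simp: car_map_def bas_btensor)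
  have len: "length bs = length Ms" using bs by (simp add: bas_btensor)
  show "lop Ms k T bs \<in> car (btensor Ms) (bpar (btensor Ms) bs \<noteq> True)" unfolding car_iff
  proof (intro conjI ballI allI subsetI)
    fix cs assume cs: "cs \<in> keys (lop Ms k T bs)"
    hence c: "cs = bs[k := cs ! k]" "cs ! k \<in> keys (T (bs ! k))"
      using assms len by (auto simp: lop_def in_keys_iff lookup_put when_def split: if_splits)
    have m: "cs ! k \<in> bas (Ms ! k)" "bpar (Ms ! k) (cs ! k) = (\<not> bpar (Ms ! k) (bs ! k))" using Tb c(2) by (auto simp: car_iff)
    have "bs[k := cs ! k] \<in> bas (btensor Ms)" using bs m(1) unfolding bas_btensor by (metis length_list_update nth_list_update_eq nth_list_update_neq)
    thus "cs \<in> bas (btensor Ms)" using c by metis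
    have "bpar (btensor Ms) (bs[k := cs ! k]) = (\<not> bpar (btensor Ms) bs)" using m assms len by (intro bpar_update) auto
    thus "bpar (btensor Ms) cs = (bpar (btensor Ms) bs \<noteq> True)" using c by simp
  next
    fix cs
    have "lookup (T (bs ! k)) (cs ! k) \<in> polys (bvars (btensor Ms))"
      using Tb by (intro polys_mono[OF _ bvars_nth[OF assms(1)]]) (auto simp: car_iff)
    thus "lookup (lop Ms k T bs) cs \<in> polys (bvars (btensor Ms))" using assms(1) len by (auto simp: lop_def lookup_put when_def osgn_Const)
  qed
qed

lemma lop_hom_map:
  assumes "k < length Ms" "hom_map (Ms ! k) (Ms ! k) True s T"
  shows "hom_map (btensor Ms) (btensor Ms) True s (lop Ms k T)" unfolding hom_map_def hom_iff
proof (intro ballI conjI allI)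
  fix bs cs assume bs: "bs \<in> bas (btensor Ms)"
  show "lop Ms k T bs \<in> car (btensor Ms) (bpar (btensor Ms) bs \<noteq> True)"
    using lop_car_map[OF assms(1) hom_map_car_map[OF assms(2)]] bs by (auto simp: car_map_def)
  have len: "length bs = length Ms" and bk: "bs ! k \<in> bas (Ms ! k)" using bs assms(1) by (auto simp: bas_btensor)
  have h: "homog (bdeg (Ms ! k) (bs ! k) + s - bdeg (Ms ! k) c) (lookup (T (bs ! k)) c)" for c using assms(2) bk by (auto simp: hom_map_def hom_iff)
  show "homog (bdeg (btensor Ms) bs + s - bdeg (btensor Ms) cs) (lookup (lop Ms k T bs) cs)"
  proof (cases "cs = bs[k := cs ! k]")
    case True
    have "bdeg (btensor Ms) cs = bdeg (btensor Ms) bs - bdeg (Ms ! k) (bs ! k) + bdeg (Ms ! k) (cs ! k)"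
      using bdeg_update[OF assms(1) len, of "cs ! k"] True by simp
    hence deg: "bdeg (btensor Ms) bs + s - bdeg (btensor Ms) cs = 0 + (bdeg (Ms ! k) (bs ! k) + s - bdeg (Ms ! k) (cs ! k))" by simp
    have "homog (bdeg (btensor Ms) bs + s - bdeg (btensor Ms) cs) (Const x * lookup (T (bs ! k)) (cs ! k))" for x :: rat
      unfolding deg by (rule homog_mult[OF homog_Const h])
    thus ?thesis using assms(1) len True by (simp add: lop_def lookup_put when_def osgn_Const)
  qed (use assms(1) len in \<open>simp add: lop_def lookup_put\<close>)
qed

lemma LO_car: "k < length Ms ==> car_map (Ms ! k) (Ms ! k) True T ==> f \<in> car (btensor Ms) i ==> LO Ms k T f \<in> car (btensor Ms) (\<not> i)"
  unfolding LO_def using car_map_apply[OF lop_car_map, of k Ms T f i id] by auto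

lemma LO_hom: "k < length Ms ==> hom_map (Ms ! k) (Ms ! k) True s T ==> f \<in> hom (btensor Ms) i l ==> LO Ms k T f \<in> hom (btensor Ms) (\<not> i) (l + s)"
  unfolding LO_def using hom_map_apply[OF lop_hom_map, of k Ms s T f i l id] by auto

text \<open>Here the module is taken over its full ring, where the basis is finite; the rank may
  become infinite when scalars are restricted to the boundary variables.\<close>

definition factorization :: "nat => 'v mpoly => ('v, 'b) bfact => bool" where
  "factorization n w M \<longleftrightarrow> finite (bvars M) \<and> finite (bas M) \<and> w \<in> polys (bvars M) \<and>
     hom_map M M True (int n + 1) (bdif M) \<and>
     (\<forall>b\<in>bas M. bd M (bdif M b) = single b w)"

lemma factorization_car_map: "factorization n w M ==> car_map M M True (bdif M)"
  and factorization_odd_map: "factorization n w M ==> odd_map M (bdif M)" by (auto simp: factorization_def intro: hom_map_car_map car_map_odd_map)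

lemma bd_car: "factorization n w M ==> f \<in> car M i ==> bd M f \<in> car M (\<not> i)"
  using car_map_apply[OF factorization_car_map, of n w M f i id] by auto

lemma bd_hom: "factorization n w M ==> f \<in> hom M i k ==> bd M f \<in> hom M (\<not> i) (k + int n + 1)"
  using hom_map_apply[of M M True "int n + 1" "bdif M" f i k id] by (auto simp: factorization_def add.assoc)

lemma bd_bd: "factorization n w M ==> keys f \<subseteq> bas M ==> bd M (bd M f) = psmul w f"
proof -
  assume M: "factorization n w M" and "keys f \<subseteq> bas M"
  from this(2) show ?thesis by (induction f rule: module_basis_induct)
      (use M in \<open>auto simp: lin_ext_add lin_ext_psmul psmul_add_right factorization_def mult.commute\<close>)
qed

lemma hom_map_sum:
  assumes "\<And>a. a \<in> A ==> hom_map M N fl s (\<phi> a)"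
  shows "hom_map M N fl s (\<lambda>b. \<Sum>a\<in>A. \<phi> a b)" using assms unfolding hom_map_def by (intro ballI hom_sum) blast

lemma finite_bas_btensor: "(\<And>k. k < length Ms ==> finite (bas (Ms ! k))) ==> finite (bas (btensor Ms))"
proof -
  assume "\<And>k. k < length Ms ==> finite (bas (Ms ! k))"
  hence "finite {bs. set bs \<subseteq> (\<Union>k<length Ms. bas (Ms ! k)) \<and> length bs = length Ms}" by (intro finite_lists_length_eq) auto
  moreover have "bas (btensor Ms) \<subseteq> {bs. set bs \<subseteq> (\<Union>k<length Ms. bas (Ms ! k)) \<and> length bs = length Ms}"
    by (fastforce simp: bas_btensor in_set_conv_nth)
  ultimately show ?thesis by (rule finite_subset[rotated])
qed

lemma factorization_btensor:
  assumes "\<And>k. k < length Ms ==> factorization n (w k) (Ms ! k)"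
  shows "factorization n (\<Sum>k<length Ms. w k) (btensor Ms)" unfolding factorization_def
proof (intro conjI ballI)
  show "finite (bvars (btensor Ms))" using assms by (auto simp: factorization_def in_set_conv_nth)
  show "finite (bas (btensor Ms))" using assms by (intro finite_bas_btensor) (auto simp: factorization_def)
  show "(\<Sum>k<length Ms. w k) \<in> polys (bvars (btensor Ms))"
  proof (intro polys_sum)
    fix k assume "k \<in> {..<length Ms}"
    thus "w k \<in> polys (bvars (btensor Ms))" using assms[of k] by (intro polys_mono[OF _ bvars_nth[of k]]) (auto simp: factorization_def)
  qed
  have "hom_map (btensor Ms) (btensor Ms) True (int n + 1) (\<lambda>bs. \<Sum>k<length Ms. lop Ms k (bdif (Ms ! k)) bs)"
    using assms by (intro hom_map_sum lop_hom_map) (auto simp: factorization_def)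
  thus "hom_map (btensor Ms) (btensor Ms) True (int n + 1) (bdif (btensor Ms))" by (simp add: bdif_btensor[abs_def])
next
  fix bs assume "bs \<in> bas (btensor Ms)"
  hence "bd (btensor Ms) (bd (btensor Ms) (single bs 1)) = psmul (\<Sum>k<length Ms. w k) (single bs 1)"
    using assms by (intro btensor_square) (auto simp: factorization_odd_map[OF assms], auto simp: factorization_def)
  thus "bd (btensor Ms) (bdif (btensor Ms) bs) = single bs (\<Sum>k<length Ms. w k)" by simp
qed

subsection \<open>Renaming of variables, derivatives\<close>

lemma cmap_psubst_lin_ext:
  "cmap (psubst g) (lin_ext id \<phi> f) = lin_ext id (\<lambda>b. cmap (psubst g) (\<phi> b)) (cmap (psubst g) f)"
proof (induction f rule: pm_induct)
  case (single b p)
  show ?case by (intro poly_mapping_eqI) (simp add: cmap_single lookup_cmap psubst_mult)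
qed (auto simp: lin_ext_add cmap_add psubst_add)

lemma brename_simps [simp]:
  "bas (brename \<rho> M) = bas M" "bpar (brename \<rho> M) = bpar M" "bdeg (brename \<rho> M) = bdeg M"
  "bvars (brename \<rho> M) = \<rho> ` bvars M" "bdif (brename \<rho> M) = (\<lambda>b. cmap (psubst (\<lambda>v. X (\<rho> v))) (bdif M b))"
  by (simp_all add: brename_def cmap_def)

lemma brename_brename:
  fixes M :: "('y, 'x) bfact"
  shows "brename \<rho> (brename \<tau> M) = brename (\<rho> \<circ> \<tau>) M"
proof -
  have "cmap (psubst (\<lambda>v. X (\<rho> v))) (cmap (psubst (\<lambda>v. X (\<tau> v))) f) = cmap (psubst (\<lambda>v. X ((\<rho> \<circ> \<tau>) v))) f" for f :: "'x \<Rightarrow>\<^sub>0 'y mpoly"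
    by (intro poly_mapping_eqI) (simp add: lookup_cmap psubst_psubst)
  thus ?thesis by (simp add: brename_def cmap_def image_comp comp_def)
qed

text \<open>A degree-preserving ring homomorphism of the coefficients carries the matrix identity
  behind d^2 = w to the image of w, even when it identifies variables.\<close>

lemma factorization_brename:
  assumes "factorization n w M"
  shows "factorization n (psubst (\<lambda>v. X (\<rho> v)) w) (brename \<rho> M)" unfolding factorization_def
proof (intro conjI ballI)
  let ?\<rho> = "psubst (\<lambda>v. X (\<rho> v))"
  show "finite (bvars (brename \<rho> M))" "finite (bas (brename \<rho> M))" using assms by (auto simp: factorization_def)
  show "?\<rho> w \<in> polys (bvars (brename \<rho> M))" using assms by (auto simp: factorization_def intro!: psubst_polys[of w "bvars M"])
  show "hom_map (brename \<rho> M) (brename \<rho> M) True (int n + 1) (bdif (brename \<rho> M))" unfolding hom_map_def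
  proof
    fix b assume "b \<in> bas (brename \<rho> M)"
    hence *: "bdif M b \<in> hom M (\<not> bpar M b) (bdeg M b + (int n + 1))" using assms by (auto simp: factorization_def hom_map_def)
    show "bdif (brename \<rho> M) b \<in> hom (brename \<rho> M) (bpar (brename \<rho> M) b \<noteq> True) (bdeg (brename \<rho> M) b + (int n + 1))"
      using * keys_cmap[of ?\<rho> "bdif M b"] by (auto simp: hom_iff car_iff lookup_cmap intro!: homog_psubst psubst_polys[of _ "bvars M"])
  qed
next
  fix b assume "b \<in> bas (brename \<rho> M)"
  thus "bd (brename \<rho> M) (bdif (brename \<rho> M) b) = single b (psubst (\<lambda>v. X (\<rho> v)) w)"
    using assms by (simp add: cmap_psubst_lin_ext[symmetric] factorization_def cmap_single)
qed

lemma cmap_vderiv_lin_ext: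
  "cmap (vderiv v) (lin_ext id \<phi> f) = lin_ext id \<phi> (cmap (vderiv v) f) + lin_ext id (\<lambda>b. cmap (vderiv v) (\<phi> b)) f"
proof (induction f rule: pm_induct)
  case (single b p)
  show ?case by (intro poly_mapping_eqI) (simp add: cmap_single lookup_cmap vderiv_mult lookup_add)
qed (auto simp: lin_ext_add cmap_add vderiv_add)

text \<open>Differentiating \<open>d\<^sup>2 = w\<close> shows that \<open>\<partial>w/\<partial>v\<close> is null-homotopic, with homotopy \<open>\<partial>d/\<partial>v\<close>.\<close>

lemma factorization_vderiv_null:
  fixes M :: "('u, 'b) bfact" and \<rho> :: "'u => 'v"
  fixes u :: 'u
  assumes M: "factorization n w M"
  defines "T \<equiv> \<lambda>b. cmap (psubst (\<lambda>v. X (\<rho> v))) (cmap (vderiv u) (bdif M b))"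
  shows "car_map (brename \<rho> M) (brename \<rho> M) True T"
    and "b \<in> bas (brename \<rho> M) ==>
      lin_ext id T (bdif (brename \<rho> M) b) + bd (brename \<rho> M) (T b) = single b (psubst (\<lambda>v. X (\<rho> v)) (vderiv u w))"
proof -
  let ?\<rho> = "psubst (\<lambda>v. X (\<rho> v)) :: 'u mpoly => 'v mpoly"
  show "car_map (brename \<rho> M) (brename \<rho> M) True T" unfolding car_map_def
  proof
    fix b assume "b \<in> bas (brename \<rho> M)"
    hence *: "bdif M b \<in> car M (\<not> bpar M b)" using factorization_car_map[OF M] by (auto simp: car_map_def)
    have "cmap (vderiv u) (bdif M b) \<in> car M (\<not> bpar M b)" using * by (rule car_cmap) (auto intro: vderiv_polys)
    thus "T b \<in> car (brename \<rho> M) (bpar (brename \<rho> M) b \<noteq> True)"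
      using keys_cmap[of ?\<rho> "cmap (vderiv u) (bdif M b)"] unfolding T_def
      by (auto simp: car_iff lookup_cmap intro!: psubst_polys[of _ "bvars M"])
  qed
  assume b: "b \<in> bas (brename \<rho> M)"
  have "cmap (vderiv u) (bd M (bdif M b)) = single b (vderiv u w)" using M b by (simp add: factorization_def cmap_single)
  hence "cmap ?\<rho> (lin_ext id (bdif M) (cmap (vderiv u) (bdif M b)) + lin_ext id (\<lambda>b. cmap (vderiv u) (bdif M b)) (bdif M b))
    = single b (?\<rho> (vderiv u w))" by (simp add: cmap_vderiv_lin_ext cmap_single)
  thus "lin_ext id T (bdif (brename \<rho> M) b) + bd (brename \<rho> M) (T b) = single b (?\<rho> (vderiv u w))"
    by (simp add: cmap_add psubst_add cmap_psubst_lin_ext T_def add.commute)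
qed

section \<open>The factorizations of arcs, wide edges and circles\<close>

text \<open>The generic variables are the numerals 1 to 4, and the simplifier would otherwise turn
  the variable 1 into \<open>Suc 0\<close>.\<close>

declare One_nat_def [simp del]

lemma pquot_eq: "b \<noteq> 0 ==> q * b = a ==> pquot a b = q" unfolding pquot_def by (intro the_equality) auto

subsection \<open>The polynomials \<open>\<pi>\<close>, \<open>g\<close>, \<open>u\<^sub>1\<close> and \<open>u\<^sub>2\<close>\<close>

text \<open>The geometric sum, an explicit value for the exact quotient in the definition of an
  arc.\<close>

definition arc_pi :: "nat => nat mpoly" where
  "arc_pi n = (\<Sum>i<n + 1. X 2 ^ (n + 1 - Suc i) * X 1 ^ i)"

lemma arc_pi: "arc_pi n * (X 1 - X 2) = X 1 ^ (n + 1) - X 2 ^ (n + 1)" by (subst power_diff_sumr2) (simp only: arc_pi_def mult.commute)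

lemma pquot_arc_pi: "pquot (X 1 ^ (n + 1) - X 2 ^ (n + 1)) (X 1 - X 2) = arc_pi n" using arc_pi by (intro pquot_eq) auto

lemma X_power_nz: "X v ^ k \<noteq> 0" by (simp add: X_power) (metis keys_zero keys_single empty_not_insert zero_neq_one)

lemma X_nz [simp]: "X v \<noteq> 0" using X_power_nz[of v 1] by simp

lemma Const_of_nat: "Const (of_nat k) = of_nat k" by (induction k) (auto simp: Const_add)

text \<open>Nonvanishing matters because \<open>koszul1\<close> reads its degree shift off
  \<open>pdeg a\<close>, which is only meaningful for nonzero a.\<close>

lemma arc_pi_props: "arc_pi n \<in> polys {1, 2}" "homog (2 * int n) (arc_pi n)" "arc_pi n \<noteq> 0"
proof -
  show "arc_pi n \<in> polys {1, 2}" unfolding arc_pi_def by (intro polys_sum polys_mult polys_power) auto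
  have h: "homog (2 * (int n + 1)) (X v ^ (n + 1))" for v :: nat using homog_power[OF homog_X, of "n + 1" v] by (simp add: algebra_simps)
  have "homog (2 * int (n + 1) - 2 * int 1) (arc_pi n)" using homog_quotient[of "X 1 - X 2" 1 "2 * (int n + 1)" "arc_pi n"] h homog_X
    by (simp add: arc_pi[simplified] homog_diff)
  thus "homog (2 * int n) (arc_pi n)" by simp
  \<comment> \<open>At \<open>X 2 = 0\<close> the product becomes a power of \<open>X 1\<close>, so
    neither factor can be zero.\<close>
  have "psubst (\<lambda>v. if v = 1 then X 1 else 0 :: nat mpoly) (arc_pi n * (X 1 - X 2)) = X 1 ^ (n + 1)"
    unfolding arc_pi by (simp add: psubst_diff psubst_power psubst_mult)
  thus "arc_pi n \<noteq> 0" using X_power_nz[of "1::nat" "n+1"] by auto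
qed

abbreviation sym_subst :: "nat => nat mpoly" where
  "sym_subst v \<equiv> (if v = 0 then X 0 + X 1 else X 0 * X 1)"

text \<open>Power sums satisfy p_(k+2) = e_1 p_(k+1) - e_2 p_k, so the induction carries two
  consecutive ones.\<close>

lemma g_poly_exists:
  "\<exists>g \<in> polys {0, 1}. psubst sym_subst g = X 0 ^ k + X 1 ^ k \<and>
     (\<exists>g' \<in> polys {0, 1}. psubst sym_subst g' = X 0 ^ Suc k + X 1 ^ Suc k)"
proof (induction k)
  case 0
  have "psubst sym_subst (Const 2) = X 0 ^ 0 + X 1 ^ 0" using Const_add[of 1 1] by simp
  moreover have "psubst sym_subst (X 0) = X 0 ^ Suc 0 + X 1 ^ Suc 0" by simp
  ultimately show ?case by (meson insertI1 polys_Const polys_X)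
next
  case (Suc k)
  then obtain g g' where g: "g \<in> polys {0, 1}" "psubst sym_subst g = X 0 ^ k + X 1 ^ k"
    "g' \<in> polys {0, 1}" "psubst sym_subst g' = X 0 ^ Suc k + X 1 ^ Suc k" by blast
  let ?h = "X 0 * g' - X 1 * g"
  have "psubst sym_subst ?h = X 0 ^ Suc (Suc k) + X 1 ^ Suc (Suc k)" by (simp add: psubst_diff psubst_mult g) (simp add: algebra_simps)
  moreover have "?h \<in> polys {0, 1}" using g by (intro polys_diff polys_mult polys_X) auto
  ultimately show ?case using g by blast
qed

text \<open>Algebraic independence of the elementary symmetric polynomials in two variables.
  Dividing g by the largest power of the variable standing for the product gives q, which is still
  mapped to zero. Setting the second root to zero then shows that q has no term free of that
  variable, against the choice of the power.\<close>

lemma sym_subst_inj: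
  assumes "g \<in> polys {0, 1}" "psubst sym_subst g = 0"
  shows "g = 0"
proof (rule ccontr)
  assume nz: "g \<noteq> 0"
  define k where "k = Min ((\<lambda>m. lookup m 1) ` keys g)"
  have fin: "finite ((\<lambda>m. lookup m 1) ` keys g)" and ne: "(\<lambda>m. lookup m 1) ` keys g \<noteq> {}" using nz by auto
  obtain m where m: "m \<in> keys g" "lookup m 1 = k" using Min_in[OF fin ne] unfolding k_def by fastforce
  have min: "k \<le> lookup m 1" if "m \<in> keys g" for m using Min_le[OF fin] that unfolding k_def by auto
  have "vrem 1 k g = 0" using min by (intro poly_mapping_eqI) (auto simp: lookup_vrem when_def in_keys_iff not_less[symmetric])
  hence g: "g = X 1 ^ k * vquo 1 k g" using vrem_vquo[of 1 k g] by simp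
  define q where "q = vquo 1 k g"
  have q: "q \<in> polys {0, 1}" unfolding q_def using assms(1) by (rule vquo_polys)
  have "X 0 * X 1 \<noteq> (0 :: nat mpoly)" by simp
  moreover have "(X 0 * X 1) ^ k * psubst sym_subst q = 0" using assms(2) by (subst (asm) g) (simp add: psubst_mult psubst_power q_def)
  ultimately have "psubst sym_subst q = 0" by simp
  hence "psubst (\<lambda>v. if v = 0 then X 0 else 0 :: nat mpoly) (psubst sym_subst q) = 0" by simp
  also have "psubst (\<lambda>v. if v = 0 then X 0 else 0) (psubst sym_subst q) = psubst (\<lambda>v. if v = 0 then X 0 else 0) q"
    unfolding psubst_psubst by (rule arg_cong2[where f=psubst, OF ext refl]) (auto simp: psubst_add psubst_mult)
  also have "\<dots> = psubst (\<lambda>v. if v = 0 then X 0 else 0) (vrem 1 1 q + X 1 ^ 1 * vquo 1 1 q)" by (simp only: vrem_vquo)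
  also have "\<dots> = psubst (\<lambda>v. if v = 0 then X 0 else 0) (vrem 1 1 q)" by (simp add: psubst_add psubst_mult)
  also have "\<dots> = vrem 1 1 q"
  proof (rule psubst_eq_self[where V="{0}"])
    show "vrem 1 1 q \<in> polys {0}" unfolding polys_def
    proof (intro CollectI ballI subsetI)
      fix m v assume mv: "m \<in> keys (vrem 1 1 q)" "v \<in> keys m"
      hence "m \<in> keys q" "lookup m 1 = 0" by (auto simp: in_keys_iff lookup_vrem when_def split: if_splits)
      moreover from this have "v \<in> {0, 1}" using q mv(2) by (auto simp: polys_def)
      ultimately show "v \<in> {0}" using mv(2) by (auto simp: in_keys_iff)
    qed
  qed auto
  finally have "vrem 1 1 q = 0" by simp
  moreover have "lookup (vrem 1 1 q) (m - single 1 k) = lookup g m"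
  proof -
    have "m - single 1 k + single 1 k = m" using minus_single_add[of m 1 k] m by (simp add: add.commute)
    thus ?thesis using m by (simp add: lookup_vrem q_def lookup_vquo lookup_minus when_def)
  qed
  ultimately show False using m by (simp add: in_keys_iff)
qed

lemma g_poly: "g_poly n \<in> polys {0, 1}" "psubst sym_subst (g_poly n) = X 0 ^ (n + 1) + X 1 ^ (n + 1)"
proof -
  obtain g where g: "g \<in> polys {0, 1}" "psubst sym_subst g = X 0 ^ (n + 1) + X 1 ^ (n + 1)" using g_poly_exists[of "n + 1"] by blast
  have "g_poly n = g" unfolding g_poly_def
  proof (rule the_equality)
    fix h assume h: "h \<in> polys {0, 1} \<and> psubst sym_subst h = X 0 ^ (n + 1) + X 1 ^ (n + 1)"
    hence "psubst sym_subst (h - g) = 0" using g by (simp add: psubst_diff)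
    thus "h = g" using sym_subst_inj[of "h - g"] h g by (auto intro: polys_diff)
  qed (use g in auto)
  thus "g_poly n \<in> polys {0, 1}" "psubst sym_subst (g_poly n) = X 0 ^ (n + 1) + X 1 ^ (n + 1)" using g by auto
qed

lemma g_at_sym: "g_at n (a + b) (a * b) = a ^ (n + 1) + b ^ (n + 1)"
proof -
  have "psubst (\<lambda>v. if v = 0 then a else b) (psubst sym_subst (g_poly n)) = a ^ (n + 1) + b ^ (n + 1)"
    unfolding g_poly by (simp add: psubst_add psubst_mult psubst_power)
  moreover have "(\<lambda>v. psubst (\<lambda>v. if v = 0 then a else b) (sym_subst v)) = (\<lambda>v. if v = 0 then a + b else a * b)"
    by (auto simp: psubst_add psubst_mult)
  ultimately show ?thesis unfolding psubst_psubst g_at_def by simp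
qed

lemma psubst_g_at: "psubst f (g_at n a b) = g_at n (psubst f a) (psubst f b)"
  unfolding g_at_def psubst_psubst by (intro arg_cong2[where f=psubst]) auto

text \<open>By uniqueness of \<open>g\<close>, it is homogeneous when its variables get the weights 1 and 2.\<close>

lemma g_at_scale: "g_at n (c * a) (c ^ 2 * b) = c ^ (n + 1) * g_at n a b" if c: "c = Const r"
proof -
  let ?s = "psubst (\<lambda>v. if v = 0 then Const r * X 0 else Const (r ^ 2) * X 1 :: nat mpoly)"
  have "psubst sym_subst (?s (g_poly n)) = psubst (\<lambda>v. Const r * X v) (psubst sym_subst (g_poly n))" unfolding psubst_psubst
    by (rule arg_cong2[where f=psubst, OF ext refl]) (auto simp: psubst_add psubst_mult Const_mult algebra_simps power2_eq_square)
  also have "\<dots> = Const (r ^ (n + 1)) * (X 0 ^ (n + 1) + X 1 ^ (n + 1))"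
    by (simp only: g_poly psubst_add psubst_power psubst_X Const_power power_mult_distrib distrib_left)
  also have "\<dots> = psubst sym_subst (Const (r ^ (n + 1)) * g_poly n)" by (simp only: g_poly psubst_mult psubst_Const)
  finally have "psubst sym_subst (?s (g_poly n) - Const (r ^ (n + 1)) * g_poly n) = 0" by (simp add: psubst_diff)
  moreover have "?s (g_poly n) \<in> polys {0, 1}" using g_poly(1) by (rule psubst_polys) auto
  ultimately have eq: "?s (g_poly n) = Const (r ^ (n + 1)) * g_poly n"
    using sym_subst_inj[of "?s (g_poly n) - Const (r ^ (n + 1)) * g_poly n"] g_poly(1) by auto
  have "g_at n (c * a) (c ^ 2 * b) = psubst (\<lambda>v. if v = 0 then a else b) (?s (g_poly n))" unfolding psubst_psubst g_at_def c
    by (rule arg_cong2[where f=psubst, OF ext refl]) (auto simp: psubst_mult psubst_power Const_power)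
  also have "\<dots> = psubst (\<lambda>v. if v = 0 then a else b) (Const (r ^ (n + 1)) * g_poly n)" by (simp only: eq)
  also have "\<dots> = c ^ (n + 1) * g_at n a b" by (simp only: psubst_mult psubst_Const g_at_def c Const_power psubst_power)
  finally show ?thesis .
qed

lemma g_at_homog: "homog 2 a ==> homog 4 b ==> homog (2 * (int n + 1)) (g_at n a b)"
proof -
  assume "homog 2 a" "homog 4 b"
  hence sc: "scale2 a = Const 2 * a" "scale2 b = Const (2 ^ 2) * b" using homog_iff_scale2[of 1 0 a] homog_iff_scale2[of 2 0 b] by simp_all
  have "scale2 (g_at n a b) = Const (2 ^ (n + 1)) * g_at n a b" by (simp only: psubst_g_at sc Const_power g_at_scale[OF refl])
  thus ?thesis using homog_iff_scale2[of "n + 1" 0 "g_at n a b"] by (simp add: algebra_simps)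
qed

lemma g_at_polys: "a \<in> polys V ==> b \<in> polys V ==> g_at n a b \<in> polys V" unfolding g_at_def using g_poly(1) by (rule psubst_polys) auto

lemma g_at_diff: "\<exists>q. q * (a - a') = g_at n a b - g_at n a' b" "\<exists>q. q * (b - b') = g_at n a b - g_at n a b'"
proof -
  have "\<exists>q. g_at n a b - g_at n a' b = q * (a - a')" unfolding g_at_def
  proof (rule psubst_vanish_diff)
    fix v :: nat
    show "\<exists>q. (if v = 0 then a else b) - (if v = 0 then a' else b) = q * (a - a')" by (cases "v = 0") (auto intro: exI[of _ 1] exI[of _ 0])
  qed
  thus "\<exists>q. q * (a - a') = g_at n a b - g_at n a' b" by metis
  have "\<exists>q. g_at n a b - g_at n a b' = q * (b - b')" unfolding g_at_def
  proof (rule psubst_vanish_diff)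
    fix v :: nat
    show "\<exists>q. (if v = 0 then a else b) - (if v = 0 then a else b') = q * (b - b')" by (cases "v = 0") (auto intro: exI[of _ 1] exI[of _ 0])
  qed
  thus "\<exists>q. q * (b - b') = g_at n a b - g_at n a b'" by metis
qed

abbreviation wide_s :: "nat mpoly" where "wide_s \<equiv> X 1 + X 2 - X 3 - X 4"
abbreviation wide_p :: "nat mpoly" where "wide_p \<equiv> X 1 * X 2 - X 3 * X 4"

lemma wide_sp_nz: "wide_s \<noteq> 0" "wide_p \<noteq> 0"
proof -
  have "psubst (\<lambda>v. if v = 1 then X 1 else 0 :: nat mpoly) wide_s = X 1 ^ 1" by (simp add: psubst_add psubst_diff)
  thus "wide_s \<noteq> 0" using X_power_nz[of 1 1] by (metis psubst_0)
  have "psubst (\<lambda>v. if v = 3 then 0 else X 1 :: nat mpoly) wide_p = X 1 ^ 2"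
    by (simp add: psubst_add psubst_diff psubst_mult power2_eq_square)
  thus "wide_p \<noteq> 0" using X_power_nz[of 1 2] by (metis psubst_0)
qed

lemma u1: "u1 n * wide_s = g_at n (X 1 + X 2) (X 1 * X 2) - g_at n (X 3 + X 4) (X 1 * X 2)"
proof -
  obtain q where "q * (X 1 + X 2 - (X 3 + X 4)) = g_at n (X 1 + X 2) (X 1 * X 2) - g_at n (X 3 + X 4) (X 1 * X 2)" using g_at_diff(1) by blast
  hence q: "q * wide_s = g_at n (X 1 + X 2) (X 1 * X 2) - g_at n (X 3 + X 4) (X 1 * X 2)" by (simp add: algebra_simps)
  thus ?thesis using pquot_eq[OF wide_sp_nz(1) q] by (simp add: u1_def)
qed

lemma u2: "u2 n * wide_p = g_at n (X 3 + X 4) (X 1 * X 2) - g_at n (X 3 + X 4) (X 3 * X 4)"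
proof -
  obtain q where q: "q * wide_p = g_at n (X 3 + X 4) (X 1 * X 2) - g_at n (X 3 + X 4) (X 3 * X 4)" using g_at_diff(2) by blast
  thus ?thesis using pquot_eq[OF wide_sp_nz(2) q] by (simp add: u2_def)
qed

text \<open>The intermediate value g(x_3 + x_4, x_1 x_2) cancels between the two products.\<close>

lemma wide_potential: "u1 n * wide_s + u2 n * wide_p = X 1 ^ (n + 1) + X 2 ^ (n + 1) - X 3 ^ (n + 1) - X 4 ^ (n + 1)" unfolding u1 u2 g_at_sym by simp

lemma homog_2_sums: "homog 2 (X a + X b)" "homog 4 (X a * X b)" using homog_mult[OF homog_X homog_X, of a b] by auto

lemma homog_wide: "homog 2 wide_s" "homog 4 wide_p" using homog_2_sums by (auto intro!: homog_diff)

lemma u1_props: "u1 n \<in> polys {1, 2, 3, 4}" "homog (2 * int n) (u1 n)" "u1 n \<noteq> 0"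
proof -
  show "u1 n \<in> polys {1, 2, 3, 4}" by (rule polys_quotient[OF wide_sp_nz(1)], unfold u1)
       (auto intro!: g_at_polys polys_add polys_diff polys_mult)
  have "homog (2 * (int n + 1) - 2 * int 1) (u1 n)" by (rule homog_quotient[OF wide_sp_nz(1)], simp add: homog_wide, unfold u1)
       (intro g_at_homog homog_2_sums homog_diff)
  thus "homog (2 * int n) (u1 n)" by (simp add: algebra_simps)
  \<comment> \<open>When only \<open>X 1\<close> survives, \<open>wide_p\<close> vanishes and the
    term of \<open>u1\<close> has to account for the whole potential.\<close>
  have "psubst (\<lambda>v. if v = 1 then X 1 else 0 :: nat mpoly) (u1 n * wide_s + u2 n * wide_p) = X 1 ^ (n + 1)"
    unfolding wide_potential by (simp add: psubst_diff psubst_add psubst_power psubst_mult)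
  hence "psubst (\<lambda>v. if v = 1 then X 1 else 0 :: nat mpoly) (u1 n) * X 1 = X 1 ^ (n + 1)"
    by (simp add: psubst_diff psubst_add psubst_power psubst_mult)
  thus "u1 n \<noteq> 0" using X_power_nz[of "1::nat" "n+1"] by auto
qed

lemma u2_props: assumes "n \<ge> 1" shows "u2 n \<in> polys {1, 2, 3, 4}" "homog (2 * int n - 2) (u2 n)" "u2 n \<noteq> 0"
proof -
  show "u2 n \<in> polys {1, 2, 3, 4}" by (rule polys_quotient[OF wide_sp_nz(2)], unfold u2)
       (auto intro!: g_at_polys polys_add polys_diff polys_mult)
  have "homog (2 * (int n + 1) - 2 * int 2) (u2 n)" by (rule homog_quotient[OF wide_sp_nz(2)], simp add: homog_wide, unfold u2)
       (intro g_at_homog homog_2_sums homog_diff)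
  thus "homog (2 * int n - 2) (u2 n)" by (simp add: algebra_simps)
  \<comment> \<open>Evaluate at a point with \<open>x\<^sub>1 + x\<^sub>2 = x\<^sub>3 + x\<^sub>4\<close>, where the term of \<open>u\<^sub>1\<close> vanishes.\<close>
  let ?e = "psubst (\<lambda>v. if v = 1 then Const 2 else if v = 2 then 0 else 1 :: nat mpoly)"
  have c2: "Const 2 = (2 :: nat mpoly)" "Const (2 ^ (n + 1)) = 2 + (Const (2 ^ (n + 1) - 2) :: nat mpoly)"
  proof -
    show "Const 2 = (2 :: nat mpoly)" using Const_of_nat[of 2] by simp
    thus "Const (2 ^ (n + 1)) = 2 + (Const (2 ^ (n + 1) - 2) :: nat mpoly)"
      using Const_add[of 2 "2 ^ (n + 1) - 2"] by (metis add_diff_cancel_left' add_diff_eq)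
  qed
  have "?e (u1 n * wide_s + u2 n * wide_p) = Const (2 ^ (n + 1) - 2)" unfolding wide_potential using c2
    by (simp add: psubst_diff psubst_add psubst_power psubst_mult Const_power algebra_simps Const_mult zero_power)
  moreover have "?e wide_s = 0" using Const_add[of 1 1] by (simp add: psubst_diff psubst_add)
  ultimately have *: "?e (u2 n) * ?e wide_p = Const (2 ^ (n + 1) - 2)" by (simp add: psubst_add psubst_mult)
  \<comment> \<open>The bound on n enters here: for n = 0 the value 2^(n+1) - 2 would be
    zero.\<close>
  have "(2::rat) ^ (n + 1) \<noteq> 2" using assms power_increasing[of 2 "n + 1" "2::rat"] by fastforce
  hence "Const (2 ^ (n + 1) - 2) \<noteq> Const (0::rat)" unfolding Const_eq_iff by simp
  thus "u2 n \<noteq> 0" using * by auto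
qed

subsection \<open>Koszul factorizations\<close>

lemma factorization_koszul1:
  assumes "finite V" "a \<in> polys V" "b \<in> polys V" "a \<noteq> 0" "homog d a" "homog (2 * int n + 2 - d) b"
  shows "factorization n (a * b) (koszul1 n V a b)" unfolding factorization_def hom_map_def hom_iff car_iff using assms pdeg_homog[OF assms(4,5)]
  by (auto simp: koszul1_def lookup_single when_def algebra_simps split: if_splits)

lemma factorization_koszul:
  assumes V: "finite V"
    and ps: "\<And>a b. (a, b) \<in> set ps ==> a \<in> polys V \<and> b \<in> polys V \<and> a \<noteq> 0 \<and> (\<exists>d. homog d a \<and> homog (2 * int n + 2 - d) b)"
  shows "factorization n (\<Sum>k<length ps. fst (ps ! k) * snd (ps ! k)) (koszul n V ps)"
proof -
  let ?Ms = "map (\<lambda>(a, b). koszul1 n V a b) ps"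
  have "factorization n (\<Sum>k<length ?Ms. fst (ps ! k) * snd (ps ! k)) (btensor ?Ms)"
  proof (rule factorization_btensor)
    fix k assume "k < length ?Ms"
    hence k: "k < length ps" by simp
    obtain a b where ab: "ps ! k = (a, b)" by force
    hence "(a, b) \<in> set ps" using k nth_mem by metis
    thus "factorization n (fst (ps ! k) * snd (ps ! k)) (?Ms ! k)" using ps[of a b] V k ab by (auto intro: factorization_koszul1)
  qed
  thus ?thesis by (simp add: koszul_def)
qed

lemma factorization_bshift: "factorization n w M ==> factorization n w (bshift m M)"
proof -
  assume M: "factorization n w M"
  have "f \<in> hom (bshift m M) i (k + m + l) \<longleftrightarrow> f \<in> hom M i (k + l)" for f i k l
    by (simp add: hom_iff car_iff bshift_def algebra_simps)
  thus ?thesis using M by (simp add: factorization_def hom_map_def bshift_def)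
qed

subsection \<open>Arcs\<close>

lemma factorization_arc_generic: "factorization n (X 1 ^ (n + 1) - X 2 ^ (n + 1)) (arc_generic n)"
proof -
  let ?ps = "[(arc_pi n, X 1 - X 2 :: nat mpoly)]"
  have "factorization n (\<Sum>k<length ?ps. fst (?ps ! k) * snd (?ps ! k)) (koszul n {1, 2} ?ps)"
    using arc_pi_props by (intro factorization_koszul) (auto intro!: exI[of _ "2 * int n"] homog_diff polys_diff)
  thus ?thesis unfolding arc_generic_def pquot_arc_pi using arc_pi by simp
qed

definition arc_pi_at :: "nat => complex => complex => complex mpoly" where
  "arc_pi_at n x y = psubst (\<lambda>v. X (if v = 1 then x else y)) (arc_pi n)"

text \<open>With its ends identified the arc becomes {(n+1) x^n, 0}, whose cohomology is Q[x]/(x^n)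
  in odd degree. This is what makes it comparable with the markless circle.\<close>

lemma arc_pi_at_same: "arc_pi_at n x x = Const (of_nat (n + 1)) * X x ^ n"
proof -
  have "arc_pi_at n x x = (\<Sum>i<n + 1. X x ^ n)" unfolding arc_pi_at_def arc_pi_def psubst_sum
    by (intro sum.cong) (auto simp: psubst_mult psubst_power simp flip: power_add)
  thus ?thesis by (simp add: Const_of_nat Const_add add.commute)
qed

lemma arc_fact_simps:
  shows "bas (arc_fact n x y) = {[0], [1]}" "\<not> bpar (arc_fact n x y) [0]" "bpar (arc_fact n x y) [1]"
    "bdeg (arc_fact n x y) [0] = 0" "bdeg (arc_fact n x y) [1] = 1 - int n" "bvars (arc_fact n x y) = {x, y}"
    "bdif (arc_fact n x y) [0] = single [1] (arc_pi_at n x y)" "bdif (arc_fact n x y) [1] = single [0] (X x - X y)"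
proof -
  have pdeg: "pdeg (arc_pi n) = 2 * int n" using arc_pi_props by (intro pdeg_homog) auto
  have g: "arc_generic n = btensor [koszul1 n {1, 2} (arc_pi n) (X 1 - X 2)]" by (simp add: arc_generic_def koszul_def pquot_arc_pi[simplified])
  show "bas (arc_fact n x y) = {[0], [1]}" by (auto simp: arc_fact_def g bas_btensor length_Suc_conv koszul1_def)
  show "\<not> bpar (arc_fact n x y) [0]" "bpar (arc_fact n x y) [1]" by (simp_all add: arc_fact_def g btensor_def koszul1_def cong: conj_cong)
  show "bdeg (arc_fact n x y) [0] = 0" "bdeg (arc_fact n x y) [1] = 1 - int n" by (simp_all add: arc_fact_def g btensor_def koszul1_def pdeg)
  show "bvars (arc_fact n x y) = {x, y}" by (auto simp: arc_fact_def g koszul1_def)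
  show "bdif (arc_fact n x y) [0] = single [1] (arc_pi_at n x y)"
    by (simp add: arc_fact_def g bdif_btensor lop_def koszul1_def osgn_def cmap_single arc_pi_at_def)
  show "bdif (arc_fact n x y) [1] = single [0] (X x - X y)"
    by (simp add: arc_fact_def g bdif_btensor lop_def koszul1_def osgn_def cmap_single psubst_diff)
qed

lemma factorization_arc_fact: "factorization n (X x ^ (n + 1) - X y ^ (n + 1)) (arc_fact n x y)"
  using factorization_brename[OF factorization_arc_generic, of n "\<lambda>v. if v = 1 then x else y"]
  by (simp add: arc_fact_def psubst_diff psubst_power psubst_mult)

subsection \<open>Wide edges and circles\<close>

lemma factorization_wide_generic:
  assumes "n \<ge> 1"
  shows "factorization n (X 1 ^ (n + 1) + X 2 ^ (n + 1) - X 3 ^ (n + 1) - X 4 ^ (n + 1)) (wide_generic n)"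
proof -
  let ?ps = "[(u1 n, wide_s), (u2 n, wide_p)]"
  have "factorization n (\<Sum>k<length ?ps. fst (?ps ! k) * snd (?ps ! k)) (koszul n {1, 2, 3, 4} ?ps)"
  proof (rule factorization_koszul)
    fix a b assume ab: "(a, b) \<in> set ?ps"
    have "homog (2 * int n + 2 - 2 * int n) wide_s" by (auto intro!: homog_diff)
    moreover have "homog (2 * int n + 2 - (2 * int n - 2)) wide_p" using homog_2_sums by (auto intro!: homog_diff)
    ultimately have "\<exists>d. homog d a \<and> homog (2 * int n + 2 - d) b" using ab u1_props[of n] u2_props[OF assms] by auto
    thus "a \<in> polys {1, 2, 3, 4} \<and> b \<in> polys {1, 2, 3, 4} \<and> a \<noteq> 0 \<and> (\<exists>d. homog d a \<and> homog (2 * int n + 2 - d) b)"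
      using ab u1_props[of n] u2_props[OF assms] by (auto intro!: polys_diff polys_add polys_mult)
  qed simp
  thus ?thesis unfolding wide_generic_def using wide_potential[of n] by (intro factorization_bshift) simp
qed

lemma bvars_wide_generic [simp]: "bvars (wide_generic n) = {1, 2, 3, 4}"
  and bvars_arc_generic [simp]: "bvars (arc_generic n) = {1, 2}"
  by (auto simp: wide_generic_def bshift_def koszul_def btensor_def koszul1_def arc_generic_def)

lemma circle_simps:
  "bas (bflip (circle_algebra n)) = {[i] | i. i < n}" "bpar (bflip (circle_algebra n)) b"
  "bdif (bflip (circle_algebra n)) b = 0" "bdeg (bflip (circle_algebra n)) [i] = 2 * int i + 1 - int n"
  "bvars (bflip (circle_algebra n)) = {}" by (simp_all add: bflip_def circle_algebra_def)

lemma factorization_circle: "factorization n 0 (bflip (circle_algebra n))"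
  unfolding factorization_def hom_map_def circle_simps by (auto simp: setcompr_eq_image)

text \<open>A nonzero multiple of x^n is null-homotopic on M. Only the parity of the homotopy is
  recorded, since finite-dimensionality does not refer to the grading.\<close>

definition nilpotent_var :: "nat => ('v, 'b) bfact => 'v => bool" where
  "nilpotent_var n M x \<longleftrightarrow> (\<exists>T c. c \<noteq> 0 \<and> car_map M M True T \<and>
     (\<forall>b\<in>bas M. lin_ext id T (bdif M b) + bd M (T b) = single b (Const c * X x ^ n)))"

text \<open>The derivative is taken in the generic variables. For an arc from x to x the renamed
  potential is zero and has no derivative left, whereas the generic one still yields (n+1) x^n after
  renaming.\<close>

lemma nilpotent_var_brename:
  assumes M: "factorization n w M" and w: "vderiv u w = Const c * X u ^ n" "c \<noteq> 0"
  shows "nilpotent_var n (brename \<rho> M) (\<rho> u)"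
proof -
  note * = factorization_vderiv_null[OF M, where \<rho>=\<rho> and u=u]
  have "psubst (\<lambda>v. X (\<rho> v)) (vderiv u w) = Const c * X (\<rho> u) ^ n" by (simp add: w psubst_mult psubst_power)
  thus ?thesis unfolding nilpotent_var_def using * w(2) by metis
qed

lemma vderiv_X_power: "vderiv u (X v ^ (n + 1)) = (if u = v then Const (of_nat (n + 1)) * X v ^ n else 0)"
proof -
  show ?thesis using vderiv_power[of u "X v" n] by (simp add: vderiv_X Const_of_nat Suc_eq_plus1[symmetric] del: power_Suc of_nat_Suc)
qed

lemma Const_uminus: "Const (- c) = - Const c" using Const_add[of c "- c"] by (simp add: eq_neg_iff_add_eq_0 add.commute)

lemma nilpotent_arc:
  assumes "u \<in> bvars (arc_generic n)"
  shows "nilpotent_var n (brename \<rho> (arc_generic n)) (\<rho> u)"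
proof (rule nilpotent_var_brename[OF factorization_arc_generic])
  show "vderiv u (X 1 ^ (n + 1) - X 2 ^ (n + 1)) = Const (if u = 1 then of_nat (n + 1) else - of_nat (n + 1)) * X u ^ n"
    using assms unfolding vderiv_diff vderiv_X_power by (auto simp del: of_nat_add of_nat_Suc simp: Const_uminus)
  show "(if u = 1 then of_nat (n + 1) else - of_nat (n + 1)) \<noteq> (0::rat)" by (simp add: add_eq_0_iff)
qed

lemma nilpotent_wide:
  assumes "n \<ge> 1" "u \<in> bvars (wide_generic n)"
  shows "nilpotent_var n (brename \<rho> (wide_generic n)) (\<rho> u)"
proof (rule nilpotent_var_brename[OF factorization_wide_generic[OF assms(1)]])
  show "vderiv u (X 1 ^ (n + 1) + X 2 ^ (n + 1) - X 3 ^ (n + 1) - X 4 ^ (n + 1))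
     = Const (if u \<in> {1, 2} then of_nat (n + 1) else - of_nat (n + 1)) * X u ^ n"
    using assms unfolding vderiv_diff vderiv_add vderiv_X_power by (auto simp del: of_nat_add of_nat_Suc simp: Const_uminus)
  show "(if u \<in> {1, 2} then of_nat (n + 1) else - of_nat (n + 1)) \<noteq> (0::rat)" by (simp add: add_eq_0_iff)
qed

declare One_nat_def [simp]

section \<open>The homotopy category\<close>

lemma rlinear_0: "rlinear V s t (car K i) B f ==> f 0 = 0" unfolding rlinear_def by (metis add_cancel_right_right car_0)

lemma rlinear_uminus: "rlinear V s t (car K i) B f ==> a \<in> car K i ==> f (- a) = - f a" using rlinear_0[of V s t K i B f] unfolding rlinear_def
  by (metis add.right_inverse add_eq_0_iff car_uminus)

lemma rlinear_diff: "rlinear V s t (car K i) B f ==> a \<in> car K i ==> b \<in> car K i ==> f (a - b) = f a - f b"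
  using rlinear_uminus[of V s t K i B f b] unfolding rlinear_def by (metis car_uminus diff_conv_add_uminus)

lemma gmorI:
  assumes "\<And>i m. m \<in> car K i ==> f i m \<in> car L i" "\<And>i k m. m \<in> hom K i k ==> f i m \<in> hom L i k"
    "\<And>i a b. a \<in> car K i ==> b \<in> car K i ==> f i (a + b) = f i a + f i b"
    "\<And>i p a. p \<in> polys V ==> a \<in> car K i ==> f i (psmul p a) = psmul p (f i a)"
    "\<And>i m. m \<in> car K i ==> f (\<not> i) (bd K m) = bd L (f i m)"
  shows "mor V K L f" unfolding gmor_def rlinear_def using assms by (auto simp: image_subset_iff)

lemma gmor_car: "mor V K L f ==> m \<in> car K i ==> f i m \<in> car L i"
  and gmor_hom: "mor V K L f ==> m \<in> hom K i k ==> f i m \<in> hom L i k"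
  and gmor_bd: "mor V K L f ==> m \<in> car K i ==> f (\<not> i) (bd K m) = bd L (f i m)"
  and gmor_add: "mor V K L f ==> m \<in> car K i ==> m' \<in> car K i ==> f i (m + m') = f i m + f i m'"
  and gmor_psmul: "mor V K L f ==> m \<in> car K i ==> p \<in> polys V ==> f i (psmul p m) = psmul p (f i m)"
  and gmor_rlinear: "mor V K L f ==> rlinear V psmul psmul (car K i) (car L i) (f i)" by (auto simp: gmor_def rlinear_def image_subset_iff)

lemma gmor_diff: "mor V K L f ==> m \<in> car K i ==> m' \<in> car K i ==> f i (m - m') = f i m - f i m'" using gmor_rlinear rlinear_diff by blast

lemma gmor_id: "mor V K K (\<lambda>i m. m)" by (rule gmorI) auto

lemma gmor_comp:
  "mor V K L f ==> mor V L N g ==> mor V K N (\<lambda>i. g i \<circ> f i)" by (rule gmorI) (auto simp: gmor_add gmor_psmul gmor_bd gmor_car gmor_hom)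

definition homotopy ::
  "nat => 'v set => ('v, 'b) bfact => ('v, 'c) bfact => (bool => ('b \<Rightarrow>\<^sub>0 'v mpoly) => ('c \<Rightarrow>\<^sub>0 'v mpoly)) =>
    (bool => ('b \<Rightarrow>\<^sub>0 'v mpoly) => ('c \<Rightarrow>\<^sub>0 'v mpoly)) => (bool => ('b \<Rightarrow>\<^sub>0 'v mpoly) => ('c \<Rightarrow>\<^sub>0 'v mpoly)) => bool" where
  "homotopy n V K L h f g \<longleftrightarrow>
     (\<forall>i. rlinear V psmul psmul (car K i) (car L (\<not> i)) (h i)) \<and>
     (\<forall>i k. h i ` hom K i k \<subseteq> hom L (\<not> i) (k - int n - 1)) \<and>
     (\<forall>i. \<forall>m\<in>car K i. f i m - g i m = h (\<not> i) (bd K m) + bd L (h i m))"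

lemma homotopic_iff: "htpy n V K L f g \<longleftrightarrow> (\<exists>h. homotopy n V K L h f g)" by (simp add: homotopic_def homotopy_def)

lemma homotopyD:
  assumes "homotopy n V K L h f g"
  shows "m \<in> car K i ==> h i m \<in> car L (\<not> i)" "m \<in> hom K i k ==> h i m \<in> hom L (\<not> i) (k - int n - 1)"
    "a \<in> car K i ==> b \<in> car K i ==> h i (a + b) = h i a + h i b"
    "p \<in> polys V ==> a \<in> car K i ==> h i (psmul p a) = psmul p (h i a)"
    "m \<in> car K i ==> f i m - g i m = h (\<not> i) (bd K m) + bd L (h i m)" using assms by (auto simp: homotopy_def rlinear_def image_subset_iff)

lemma homotopicI:
  assumes "\<And>i m. m \<in> car K i ==> h i m \<in> car L (\<not> i)" "\<And>i k m. m \<in> hom K i k ==> h i m \<in> hom L (\<not> i) (k - int n - 1)"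
    "\<And>i a b. a \<in> car K i ==> b \<in> car K i ==> h i (a + b) = h i a + h i b"
    "\<And>i p a. p \<in> polys V ==> a \<in> car K i ==> h i (psmul p a) = psmul p (h i a)"
    "\<And>i m. m \<in> car K i ==> f i m - g i m = h (\<not> i) (bd K m) + bd L (h i m)"
  shows "htpy n V K L f g" unfolding homotopic_iff homotopy_def rlinear_def using assms by (intro exI[of _ h]) (auto simp: image_subset_iff)

lemma homotopic_eqI: "(\<And>i m. m \<in> car K i ==> f i m = g i m) ==> htpy n V K L f g" by (rule homotopicI[where h="\<lambda>_ _. 0"]) auto

lemma homotopic_refl: "htpy n V K L f f" by (rule homotopic_eqI) simp

lemma homotopic_sym:
  assumes "htpy n V K L f g"
  shows "htpy n V K L g f"
proof -
  from assms obtain h where "homotopy n V K L h f g" unfolding homotopic_iff by blast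
  note h = homotopyD[OF this]
  show ?thesis
  proof (rule homotopicI[where h="\<lambda>i m. - h i m"])
    fix i m assume "m \<in> car K i"
    thus "g i m - f i m = - h (\<not> i) (bd K m) + bd L (- h i m)" using h(5)[of m i] by (simp add: lin_ext_uminus algebra_simps)
  qed (use h in \<open>auto simp: psmul_minus_right\<close>)
qed

lemma homotopic_trans:
  assumes "htpy n V K L f g" "htpy n V K L g g'"
  shows "htpy n V K L f g'"
proof -
  from assms(1) obtain h where "homotopy n V K L h f g" unfolding homotopic_iff by blast
  note h = homotopyD[OF this]
  from assms(2) obtain h' where "homotopy n V K L h' g g'" unfolding homotopic_iff by blast
  note h' = homotopyD[OF this]
  show ?thesis
  proof (rule homotopicI[where h="\<lambda>i m. h i m + h' i m"])
    fix i m assume "m \<in> car K i"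
    thus "f i m - g' i m = h (\<not> i) (bd K m) + h' (\<not> i) (bd K m) + bd L (h i m + h' i m)"
      using h(5)[of m i] h'(5)[of m i] by (simp add: lin_ext_add algebra_simps)
  qed (use h h' in \<open>auto simp: psmul_add_right\<close>)
qed

lemma homotopic_comp_left:
  assumes "htpy n V K L f f'" and g: "mor V L N g"
    and f: "\<And>i m. m \<in> car K i ==> f i m \<in> car L i" "\<And>i m. m \<in> car K i ==> f' i m \<in> car L i"
    and K: "\<And>i m. m \<in> car K i ==> bd K m \<in> car K (\<not> i)" and L: "\<And>i m. m \<in> car L i ==> bd L m \<in> car L (\<not> i)"
  shows "htpy n V K N (\<lambda>i. g i \<circ> f i) (\<lambda>i. g i \<circ> f' i)"
proof -
  from assms(1) obtain h where "homotopy n V K L h f f'" unfolding homotopic_iff by blast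
  note h = homotopyD[OF this]
  show ?thesis
  proof (rule homotopicI[where h="\<lambda>i m. g (\<not> i) (h i m)"])
    fix i m assume m: "m \<in> car K i"
    have 1: "h (\<not> i) (bd K m) \<in> car L i" using h(1)[OF K[OF m]] by simp
    have 2: "bd L (h i m) \<in> car L i" using L[OF h(1)[OF m]] by simp
    have "g i (f i m) - g i (f' i m) = g i (f i m - f' i m)" using gmor_diff[OF g f(1)[OF m] f(2)[OF m]] by simp
    also have "\<dots> = g i (h (\<not> i) (bd K m)) + g i (bd L (h i m))" unfolding h(5)[OF m] by (rule gmor_add[OF g 1 2])
    also have "g i (bd L (h i m)) = bd N (g (\<not> i) (h i m))" using gmor_bd[OF g h(1)[OF m]] by simp
    finally show "(g i \<circ> f i) m - (g i \<circ> f' i) m = g (\<not> \<not> i) (h (\<not> i) (bd K m)) + bd N (g (\<not> i) (h i m))" by simp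
  qed (use h g in \<open>auto simp: gmor_car gmor_hom gmor_add[OF g] gmor_psmul[OF g]\<close>)
qed

lemma homotopic_comp_right:
  assumes "htpy n V L N g g'" and f: "mor V K L f"
  shows "htpy n V K N (\<lambda>i. g i \<circ> f i) (\<lambda>i. g' i \<circ> f i)"
proof -
  from assms(1) obtain h where "homotopy n V L N h g g'" unfolding homotopic_iff by blast
  note h = homotopyD[OF this]
  show ?thesis by (rule homotopicI[where h="\<lambda>i m. h i (f i m)"])
       (use h f in \<open>auto simp: gmor_car gmor_hom gmor_add[OF f] gmor_psmul[OF f] gmor_bd[OF f]\<close>)
qed

text \<open>The part of being a factorization that composing homotopies uses. It stands alone
  because for the target of a mark removal it is obtained by transport along the removal
  map.\<close>

definition bd_closed :: "('v, 'b) bfact => bool" where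
  "bd_closed K \<longleftrightarrow> (\<forall>i. \<forall>m\<in>car K i. bd K m \<in> car K (\<not> i))"

lemma factorization_bd_closed: "factorization n w K ==> bd_closed K" by (auto simp: bd_closed_def intro: bd_car)

lemma homotopic_comp:
  assumes "htpy n V K L f f'" "htpy n V L N g g'"
    "mor V K L f" "mor V K L f'" "mor V L N g'"
    "bd_closed K" "bd_closed L"
  shows "htpy n V K N (\<lambda>i. g i \<circ> f i) (\<lambda>i. g' i \<circ> f' i)"
  by (rule homotopic_trans[OF homotopic_comp_right[OF assms(2,3)] homotopic_comp_left[OF assms(1,5)]])
     (use assms(3,4,6,7) in \<open>auto simp: gmor_car bd_closed_def\<close>)

section \<open>Isomorphisms up to homotopy: composition, cancellation, uniqueness of
  inverses\<close>

lemma hmf_inverse_sym: "hmf_inverse n V M N f g ==> hmf_inverse n V N M g f" by (auto simp: hmf_inverse_def)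

lemma hmf_inverse_id: "hinverse n V K K (\<lambda>i m. m) (\<lambda>i m. m)" unfolding hmf_inverse_def by (auto simp: gmor_id intro!: homotopic_eqI)

lemma hmf_inverse_comp:
  fixes V :: "'x set"
  assumes f: "hinverse n V K L f f'" and g: "hinverse n V L N g g'"
    and c: "bd_closed K" "bd_closed L" "bd_closed N"
  shows "hinverse n V K N (\<lambda>i. g i \<circ> f i) (\<lambda>i. f' i \<circ> g' i)"
proof -
  \<comment> \<open>Stated for arbitrary basis types, so that the second composite is the same fact
    applied to the inverses.\<close>
  have *: "htpy n V K K (\<lambda>i. (f' i \<circ> g' i) \<circ> (g i \<circ> f i)) (\<lambda>i m. m)"
    if f: "hinverse n V K L f f'" and g: "hinverse n V L N g g'"
    and c: "bd_closed K" "bd_closed L" "bd_closed N"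
    for K :: "('x, 'y) bfact" and L :: "('x, 'y1) bfact" and N :: "('x, 'y2) bfact" and f f' g g'
  proof -
    have "htpy n V K L (\<lambda>i. (g' i \<circ> g i) \<circ> f i) (\<lambda>i. (\<lambda>m. m) \<circ> f i)"
      using f g by (intro homotopic_comp_right) (auto simp: hmf_inverse_def)
    hence "htpy n V K K (\<lambda>i. f' i \<circ> ((g' i \<circ> g i) \<circ> f i)) (\<lambda>i. f' i \<circ> ((\<lambda>m. m) \<circ> f i))"
      using f g c by (intro homotopic_comp_left) (auto simp: hmf_inverse_def gmor_car bd_closed_def)
    moreover have "htpy n V K K (\<lambda>i. f' i \<circ> f i) (\<lambda>i m. m)" using f by (simp add: hmf_inverse_def)
    ultimately show ?thesis using homotopic_trans by (fastforce simp: comp_def)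
  qed
  show ?thesis using *[OF f g c] *[OF hmf_inverse_sym[OF g] hmf_inverse_sym[OF f] c(3,2,1)] f g by (auto simp: hmf_inverse_def intro: gmor_comp)
qed

text \<open>Solves g f ~ f' for f, which moves an elementary map to the other side of a
  homotopy.\<close>

lemma hmf_inverse_cancel_left:
  assumes "hinverse n V L N g g'"
    "htpy n V K N (\<lambda>i. g i \<circ> f i) f'"
    "mor V K L f" "mor V K N f'"
    "bd_closed K" "bd_closed L" "bd_closed N"
  shows "htpy n V K L f (\<lambda>i. g' i \<circ> f' i)"
proof -
  have g: "mor V L N g" "mor V N L g'"
    and gg: "htpy n V L L (\<lambda>i. g' i \<circ> g i) (\<lambda>i m. m)" using assms(1) by (auto simp: hmf_inverse_def)
  have "htpy n V K L (\<lambda>i. g' i \<circ> (g i \<circ> f i)) (\<lambda>i. g' i \<circ> f' i)"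
    using assms g by (intro homotopic_comp_left[OF assms(2)]) (auto simp: gmor_car bd_closed_def)
  moreover have "htpy n V K L (\<lambda>i. (g' i \<circ> g i) \<circ> f i) (\<lambda>i. (\<lambda>m. m) \<circ> f i)"
    using assms by (intro homotopic_comp_right[OF gg])
  ultimately show ?thesis using homotopic_trans homotopic_sym by (fastforce simp: comp_def)
qed

lemma hmf_inverse_cancel_right:
  assumes "hinverse n V K L f f'"
    "htpy n V K N (\<lambda>i. g i \<circ> f i) (\<lambda>i. g' i \<circ> f i)"
    "mor V L N g" "mor V L N g'"
    "bd_closed K" "bd_closed L" "bd_closed N"
  shows "htpy n V L N g g'"
proof -
  have f: "mor V K L f" "mor V L K f'"
    and ff: "htpy n V L L (\<lambda>i. f i \<circ> f' i) (\<lambda>i m. m)" using assms(1) by (auto simp: hmf_inverse_def)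
  have *: "htpy n V L N (\<lambda>i. g i \<circ> (f i \<circ> f' i)) (\<lambda>i. g i \<circ> (\<lambda>m. m))"
    if "mor V L N g" for g using that f assms by (intro homotopic_comp_left[OF ff]) (auto simp: gmor_car bd_closed_def)
  have "htpy n V L N (\<lambda>i. (g i \<circ> f i) \<circ> f' i) (\<lambda>i. (g' i \<circ> f i) \<circ> f' i)"
    by (rule homotopic_comp_right[OF assms(2) f(2)])
  thus ?thesis using *[OF assms(3)] *[OF assms(4)] homotopic_trans homotopic_sym by (simp add: comp_def) blast
qed

lemma hmf_inverse_unique:
  assumes "hinverse n V K L f g" "hinverse n V K L f' g'"
    "htpy n V K L f f'" "bd_closed K" "bd_closed L"
  shows "htpy n V L K g g'"
proof -
  have m: "mor V K L f" "mor V L K g"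
    "mor V K L f'" "mor V L K g'" using assms by (auto simp: hmf_inverse_def)
  have "htpy n V L L (\<lambda>i. f' i \<circ> g i) (\<lambda>i. f i \<circ> g i)" by (rule homotopic_comp_right[OF homotopic_sym[OF assms(3)] m(2)])
  hence "htpy n V L L (\<lambda>i. f' i \<circ> g i) (\<lambda>i m. m)" using assms(1) homotopic_trans by (fastforce simp: hmf_inverse_def)
  hence "htpy n V L K g (\<lambda>i. g' i \<circ> (\<lambda>m. m))" using assms m by (intro hmf_inverse_cancel_left[OF assms(2)]) (auto simp: gmor_id)
  thus ?thesis by (simp add: comp_def)
qed

text \<open>Only e is assumed to commute with d. The right-hand side of \<open>se\<close> commutes
  with d because h is linear over w = d^2, and e s = 1 transfers this to s, which thus becomes a
  morphism.\<close>

lemma hmf_inverse_retract: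
  assumes e: "mor V K N (\<lambda>i. e)"
    and s: "\<And>i m. m \<in> car N i ==> s m \<in> car K i" "\<And>i k m. m \<in> hom N i k ==> s m \<in> hom K i k"
      "\<And>i a b. a \<in> car N i ==> b \<in> car N i ==> s (a + b) = s a + s b"
      "\<And>i p a. p \<in> polys V ==> a \<in> car N i ==> s (psmul p a) = psmul p (s a)"
    and es: "\<And>i m. m \<in> car N i ==> e (s m) = m"
    and h: "\<And>i m. m \<in> car K i ==> h m \<in> car K (\<not> i)" "\<And>i k m. m \<in> hom K i k ==> h m \<in> hom K (\<not> i) (k - int n - 1)"
      "\<And>i a b. a \<in> car K i ==> b \<in> car K i ==> h (a + b) = h a + h b"
      "\<And>i p a. p \<in> polys V ==> a \<in> car K i ==> h (psmul p a) = psmul p (h a)"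
    and se: "\<And>i m. m \<in> car K i ==> s (e m) = m - bd K (h m) - h (bd K m)"
    and K: "factorization n w K" and N: "bd_closed N" and w: "w \<in> polys V"
  shows "hinverse n V K N (\<lambda>i. e) (\<lambda>i. s)"
proof -
  have bdK: "bd K m \<in> car K (\<not> i)" if "m \<in> car K i" for i m using K that by (rule bd_car)
  have bdN: "bd N m \<in> car N (\<not> i)" if "m \<in> car N i" for i m using N that by (auto simp: bd_closed_def)
  have ecar: "e m \<in> car N i" if "m \<in> car K i" for i m using gmor_car[OF e that] .
  have ebd: "e (bd K m) = bd N (e m)" if "m \<in> car K i" for i m using gmor_bd[OF e that] .
  have se_bd: "s (e (bd K m)) = bd K (s (e m))" if m: "m \<in> car K i" for i m
  proof -
    have "s (e (bd K m)) = bd K m - bd K (h (bd K m)) - h (bd K (bd K m))" using bdK[OF m] by (rule se)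
    also have "h (bd K (bd K m)) = psmul w (h m)" using bd_bd[OF K car_keys[OF m]] h(4)[OF w m] by simp
    also have "psmul w (h m) = bd K (bd K (h m))" using bd_bd[OF K car_keys[OF h(1)[OF m]]] by simp
    finally show ?thesis unfolding se[OF m] by (simp add: lin_ext_diff)
  qed
  have s_mor: "mor V N K (\<lambda>i. s)"
  proof (rule gmorI)
    fix i m assume m: "m \<in> car N i"
    have "s (bd N m) = s (bd N (e (s m)))" using es[OF m] by simp
    also have "\<dots> = s (e (bd K (s m)))" using ebd[OF s(1)[OF m]] by simp
    also have "\<dots> = bd K (s (e (s m)))" using se_bd[OF s(1)[OF m]] .
    finally show "s (bd N m) = bd K (s m)" using es[OF m] by simp
  qed (use s in auto)
  have "htpy n V K K (\<lambda>i. s \<circ> e) (\<lambda>i m. m)" by (rule homotopicI[where h="\<lambda>i m. - h m"])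
       (use h se in \<open>auto simp: psmul_minus_right lin_ext_uminus\<close>)
  moreover have "htpy n V N N (\<lambda>i. e \<circ> s) (\<lambda>i m. m)" using es by (intro homotopic_eqI) auto
  ultimately show ?thesis using e s_mor by (auto simp: hmf_inverse_def)
qed

text \<open>The dual situation: a is the morphism and has the left inverse r. As before a r commutes
  with d, and the injectivity of a shows that r does.\<close>

lemma hmf_inverse_section:
  assumes a: "mor V N K (\<lambda>i. a)"
    and r: "\<And>i m. m \<in> car K i ==> r m \<in> car N i" "\<And>i k m. m \<in> hom K i k ==> r m \<in> hom N i k"
      "\<And>i m m'. m \<in> car K i ==> m' \<in> car K i ==> r (m + m') = r m + r m'"
      "\<And>i p m. p \<in> polys V ==> m \<in> car K i ==> r (psmul p m) = psmul p (r m)"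
    and ra: "\<And>i m. m \<in> car N i ==> r (a m) = m"
    and h: "\<And>i m. m \<in> car K i ==> h m \<in> car K (\<not> i)" "\<And>i k m. m \<in> hom K i k ==> h m \<in> hom K (\<not> i) (k - int n - 1)"
      "\<And>i a b. a \<in> car K i ==> b \<in> car K i ==> h (a + b) = h a + h b"
      "\<And>i p a. p \<in> polys V ==> a \<in> car K i ==> h (psmul p a) = psmul p (h a)"
    and ar: "\<And>i m. m \<in> car K i ==> a (r m) = m - bd K (h m) - h (bd K m)"
    and K: "factorization n w K" and N: "bd_closed N" and w: "w \<in> polys V"
  shows "hinverse n V N K (\<lambda>i. a) (\<lambda>i. r)"
proof -
  have bdK: "bd K m \<in> car K (\<not> i)" if "m \<in> car K i" for i m using K that by (rule bd_car)
  have bdN: "bd N m \<in> car N (\<not> i)" if "m \<in> car N i" for i m using N that by (auto simp: bd_closed_def)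
  have "r (bd K m) = bd N (r m)" if m: "m \<in> car K i" for i m
  proof -
    have "a (r (bd K m)) = bd K m - bd K (h (bd K m)) - h (bd K (bd K m))" using bdK[OF m] by (rule ar)
    also have "h (bd K (bd K m)) = psmul w (h m)" using bd_bd[OF K car_keys[OF m]] h(4)[OF w m] by simp
    also have "psmul w (h m) = bd K (bd K (h m))" using bd_bd[OF K car_keys[OF h(1)[OF m]]] by simp
    finally have "a (r (bd K m)) = bd K (a (r m))" unfolding ar[OF m] by (simp add: lin_ext_diff)
    also have "\<dots> = a (bd N (r m))" using gmor_bd[OF a r(1)[OF m]] by simp
    finally have "r (a (r (bd K m))) = r (a (bd N (r m)))" by simp
    thus ?thesis using ra[OF r(1)[OF bdK[OF m]]] ra[OF bdN[OF r(1)[OF m]]] by simp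
  qed
  hence r_mor: "mor V K N (\<lambda>i. r)" using r by (intro gmorI) auto
  have "htpy n V K K (\<lambda>i. a \<circ> r) (\<lambda>i m. m)" by (rule homotopicI[where h="\<lambda>i m. - h m"])
       (use h ar in \<open>auto simp: psmul_minus_right lin_ext_uminus\<close>)
  moreover have "htpy n V N N (\<lambda>i. r \<circ> a) (\<lambda>i m. m)" using ra by (intro homotopic_eqI) auto
  ultimately show ?thesis using a r_mor by (auto simp: hmf_inverse_def)
qed

section \<open>Objects of the homotopy category\<close>

lemma submodule_laws_car:
  assumes "V \<subseteq> bvars K"
  shows "submodule_laws V psmul (car K i)" unfolding submodule_laws_def using assms
  by (auto simp: psmul_add_right psmul_add_left intro!: car_psmul intro: polys_mono)

text \<open>Together with \<open>mres (- V)\<close> it factors a monomial into its parts inside and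
  outside V.\<close>

definition mres :: "'v set => ('v \<Rightarrow>\<^sub>0 nat) => ('v \<Rightarrow>\<^sub>0 nat)" where
  "mres V m = Poly_Mapping.mapp (\<lambda>v k. if v \<in> V then k else 0) m"

lemma lookup_mres: "lookup (mres V m) v = (if v \<in> V then lookup m v else 0)" by (simp add: mres_def lookup_mapp when_def in_keys_iff)

lemma keys_mres: "keys (mres V m) = keys m \<inter> V" by (auto simp: in_keys_iff lookup_mres split: if_splits)

lemma mres_add: "mres V m + mres (- V) m = m" by (intro poly_mapping_eqI) (simp add: lookup_add lookup_mres)

lemma mres_unique:
  assumes "keys k \<subseteq> V" "keys m' \<inter> V = {}"
  shows "mres V (k + m') = k" "mres (- V) (k + m') = m'"
  using assms by (auto intro!: poly_mapping_eqI simp: lookup_add lookup_mres in_keys_iff) (metis in_keys_iff subsetD disjoint_iff)+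

lemma mon_deg_mres: "mon_deg (mres V m) + mon_deg (mres (- V) m) = mon_deg m" by (simp add: mres_add flip: mon_deg_add)

lemma lookup_mult_single_mono:
  assumes q: "q \<in> polys V" and m': "keys m' \<inter> V = {}"
  shows "lookup (q * single m' 1) m = (lookup q (mres V m) when mres (- V) m = m')"
proof -
  have "keys q \<subseteq> {k. keys k \<subseteq> V}" using q by (auto simp: polys_def)
  thus ?thesis
  proof (induction q rule: module_basis_induct)
    case (single k c)
    have "k + m' = m \<longleftrightarrow> k = mres V m \<and> mres (- V) m = m'" using mres_unique[of k V m'] mres_add[of V m] single m' by auto
    thus ?case by (auto simp: mult_single lookup_single when_def)
  qed (auto simp: lookup_add distrib_right when_def)
qed

context
  fixes V :: "'v set" and K :: "('v, 'b) bfact" and i :: bool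
begin

text \<open>Over Q[V] the full polynomial ring is free on the monomials in the remaining variables,
  so these multiply the given basis.\<close>

definition res_basis :: "('b \<Rightarrow>\<^sub>0 'v mpoly) set" where
  "res_basis = {single b (single m 1) | b m. b \<in> bas K \<and> bpar K b = i \<and> keys m \<subseteq> bvars K - V}"

text \<open>The degree has to be a function of the basis element alone, so b and m are recovered
  from it.\<close>

definition res_deg :: "('b \<Rightarrow>\<^sub>0 'v mpoly) => int" where
  "res_deg x = (THE z. \<exists>b m. x = single b (single m (1::rat)) \<and> z = bdeg K b + mon_deg m)"

lemma single_single_inject: "single b (single m (1::rat)) = single b' (single m' 1) \<longleftrightarrow> b = b' \<and> m = m'"
proof
  assume eq: "single b (single m (1::rat)) = single b' (single m' 1)"
  have nz: "single m (1::rat) \<noteq> 0" "single m' (1::rat) \<noteq> 0" by (metis lookup_single_eq lookup_zero zero_neq_one)+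
  have "keys (single b (single m (1::rat))) = keys (single b' (single m' (1::rat)))" using eq by simp
  hence b: "b = b'" using nz by simp
  hence "single m (1::rat) = single m' 1" using eq by (metis lookup_single_eq)
  hence "keys (single m (1::rat)) = keys (single m' (1::rat))" by simp
  thus "b = b' \<and> m = m'" using b by simp
qed auto

lemma res_deg_single: "res_deg (single b (single m 1)) = bdeg K b + mon_deg m"
  unfolding res_deg_def by (rule the_equality) (auto simp: single_single_inject)

text \<open>Splitting m into its two parts singles out one basis element and one coefficient, so
  nothing is actually added up. Uniqueness of coordinates and the comparison of degrees can both be
  read off.\<close>

lemma lookup_comb:
  assumes c: "coeffs_in V res_basis c"
  shows "lookup (lookup (comb psmul c) b) m = lookup (lookup c (single b (single (mres (- V) m) 1))) (mres V m)"
proof -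
  let ?x = "single b (single (mres (- V) m) (1::rat))"
  have "lookup (lookup (comb psmul c) b) m = (\<Sum>x\<in>keys c. lookup (lookup c x * lookup x b) m)" by (simp add: comb_def lookup_sum)
  also have "\<dots> = (\<Sum>x\<in>keys c. if x = ?x then lookup (lookup c ?x) (mres V m) else 0)"
  proof (intro sum.cong refl)
    fix x assume "x \<in> keys c"
    hence "x \<in> res_basis" using c by (auto simp: coeffs_in_def)
    then obtain b' m' where x: "x = single b' (single m' 1)" and m': "keys m' \<inter> V = {}" by (auto simp: res_basis_def)
    have "lookup c x \<in> polys V" using c by (simp add: coeffs_in_def)
    from lookup_mult_single_mono[OF this m', of m]
    show "lookup (lookup c x * lookup x b) m = (if x = ?x then lookup (lookup c ?x) (mres V m) else 0)"
      by (cases "b = b'") (auto simp: x lookup_single single_single_inject when_def)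
  qed
  also have "\<dots> = lookup (lookup c ?x) (mres V m)" by (simp add: sum.delta in_keys_iff)
  finally show ?thesis .
qed

lemma coeffs_in_add: "coeffs_in V B c ==> coeffs_in V B c' ==> coeffs_in V B (c + c')"
  using Poly_Mapping.keys_add[of c c'] by (auto simp: coeffs_in_def lookup_add)

lemma comb_add: "comb psmul (c + c') = comb psmul c + comb psmul c'"
  unfolding comb_def by (subst setsum_keys_plus_distrib) (auto simp: psmul_add_left)

lemma res_basis_span:
  assumes a: "a \<in> car K i"
  shows "\<exists>c. coeffs_in V res_basis c \<and> a = comb psmul c"
proof -
  let ?S = "{a. \<exists>c. coeffs_in V res_basis c \<and> a = comb psmul c}"
  have 0: "0 \<in> ?S" by (auto simp: coeffs_in_def comb_def intro!: exI[of _ 0])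
  have add: "x + y \<in> ?S" if xy: "x \<in> ?S" "y \<in> ?S" for x y
  proof -
    obtain c c' where "coeffs_in V res_basis c" "x = comb psmul c" "coeffs_in V res_basis c'" "y = comb psmul c'" using xy by blast
    hence "coeffs_in V res_basis (c + c')" "x + y = comb psmul (c + c')" by (auto simp: coeffs_in_add comb_add)
    thus ?thesis by blast
  qed
  have sum: "sum f A \<in> ?S" if "\<And>x. x \<in> A ==> f x \<in> ?S" for f and A :: "'x set"
    using that by (induction A rule: infinite_finite_induct) (use 0 add in auto)
  have mono: "single b (single m q) \<in> ?S" if "b \<in> bas K" "bpar K b = i" "keys m \<subseteq> bvars K" for b m q
  proof -
    let ?x = "single b (single (mres (- V) m) (1::rat))"
    let ?c = "single ?x (single (mres V m) q) :: ('b \<Rightarrow>\<^sub>0 'v mpoly) \<Rightarrow>\<^sub>0 'v mpoly"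
    have "keys (mres (- V) m) \<subseteq> bvars K - V" using that by (auto simp: keys_mres)
    hence "?x \<in> res_basis" using that unfolding res_basis_def by blast
    hence "coeffs_in V res_basis ?c" by (auto simp: coeffs_in_def lookup_single when_def polys_def keys_mres)
    moreover have "comb psmul ?c = single b (single m q)" unfolding comb_def by (subst sum_keys_single) (auto simp: mult_single mres_add)
    ultimately show ?thesis by (metis (mono_tags, lifting) mem_Collect_eq)
  qed
  have "single b (lookup a b) \<in> ?S" if "b \<in> keys a" for b
  proof -
    have b: "b \<in> bas K" "bpar K b = i" "lookup a b \<in> polys (bvars K)" using a that by (auto simp: car_iff)
    have "single b (\<Sum>m\<in>A. single m (g m)) = (\<Sum>m\<in>A. single b (single m (g m)))" for A and g :: "('v \<Rightarrow>\<^sub>0 nat) => rat"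
      by (induction A rule: infinite_finite_induct) (auto simp: single_add)
    hence "single b (lookup a b) = (\<Sum>m\<in>keys (lookup a b). single b (single m (lookup (lookup a b) m)))" by (metis poly_mapping_sum_singles)
    also have "\<dots> \<in> ?S" using b by (intro sum mono) (auto simp: polys_def)
    finally show ?thesis .
  qed
  hence "(\<Sum>b\<in>keys a. single b (lookup a b)) \<in> ?S" by (intro sum) auto
  thus ?thesis by (simp flip: poly_mapping_sum_singles)
qed

lemma comb_car:
  assumes c: "coeffs_in V res_basis c" and V: "V \<subseteq> bvars K"
  shows "comb psmul c \<in> car K i" unfolding comb_def
proof (intro car_sum car_psmul)
  fix x assume x: "x \<in> keys c"
  show "lookup c x \<in> polys (bvars K)" using c V by (auto simp: coeffs_in_def intro: polys_mono)
  have "x \<in> res_basis" using x c by (auto simp: coeffs_in_def)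
  thus "x \<in> car K i" unfolding res_basis_def by (auto intro!: car_single simp: polys_def)
qed

lemma free_graded_gfact_of:
  assumes V: "V \<subseteq> bvars K"
  shows "free_graded V psmul (car K i) (ghom (gfact_of K) i)" unfolding free_graded_def
proof (intro conjI exI[of _ res_basis] exI[of _ res_deg] ballI allI)
  show "submodule_laws V psmul (car K i)" using V by (rule submodule_laws_car)
  show "res_basis \<subseteq> car K i" unfolding res_basis_def by (auto intro!: car_single simp: polys_def)
next
  fix a assume a: "a \<in> car K i"
  show "\<exists>!c. coeffs_in V res_basis c \<and> a = comb psmul c"
  proof (rule ex_ex1I[OF res_basis_span[OF a]])
    fix c c' assume c: "coeffs_in V res_basis c \<and> a = comb psmul c" and c': "coeffs_in V res_basis c' \<and> a = comb psmul c'"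
    show "c = c'"
    proof (intro poly_mapping_eqI)
      fix x k
      show "lookup (lookup c x) k = lookup (lookup c' x) k"
      proof (cases "x \<in> res_basis \<and> keys k \<subseteq> V")
        case True
        then obtain b m' where x: "x = single b (single m' 1)" and m': "keys m' \<inter> V = {}" by (auto simp: res_basis_def)
        have k: "keys k \<subseteq> V" using True by simp
        have "lookup (lookup c x) k = lookup (lookup (comb psmul c) b) (k + m')"
          using lookup_comb[of c b "k + m'"] c by (simp add: mres_unique[OF k m'] x)
        also have "\<dots> = lookup (lookup c' x) k" using lookup_comb[of c' b "k + m'"] c c' by (simp add: mres_unique[OF k m'] x)
        finally show ?thesis .
      next
        \<comment> \<open>Both families vanish off the basis and off monomials in V, so there is
          nothing to compare.\<close>
        case False
        have "lookup (lookup c x) k = 0" if "coeffs_in V res_basis c" for c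
        proof (rule ccontr)
          assume nz: "lookup (lookup c x) k \<noteq> 0"
          hence "x \<in> keys c" "k \<in> keys (lookup c x)" by (auto simp: in_keys_iff)
          thus False using that False unfolding coeffs_in_def polys_def by blast
        qed
        thus ?thesis using c c' by simp
      qed
    qed
  qed
next
  fix k
  show "hom K i k = comb psmul ` {c. coeffs_in V res_basis c \<and> (\<forall>b\<in>res_basis. homog (k - res_deg b) (lookup c b))}"
  proof (intro equalityI subsetI)
    fix a assume a: "a \<in> hom K i k"
    obtain c where c: "coeffs_in V res_basis c" "a = comb psmul c" using res_basis_span[OF hom_car[OF a]] by blast
    have "homog (k - res_deg x) (lookup c x)" if "x \<in> res_basis" for x unfolding homog_def
    proof
      fix l assume l: "l \<in> keys (lookup c x)"
      obtain b m' where x: "x = single b (single m' 1)" and m': "keys m' \<inter> V = {}" using \<open>x \<in> res_basis\<close> by (auto simp: res_basis_def)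
      have kl: "keys l \<subseteq> V" using c l by (auto simp: coeffs_in_def polys_def)
      have "lookup (lookup a b) (l + m') \<noteq> 0"
        using lookup_comb[OF c(1), of b "l + m'"] l by (simp add: mres_unique[OF kl m'] x c(2) in_keys_iff)
      hence "mon_deg (l + m') = k - bdeg K b" using a by (auto simp: hom_iff homog_def in_keys_iff)
      thus "mon_deg l = k - res_deg x" by (simp add: x res_deg_single mon_deg_add)
    qed
    thus "a \<in> comb psmul ` {c. coeffs_in V res_basis c \<and> (\<forall>b\<in>res_basis. homog (k - res_deg b) (lookup c b))}" using c by blast
  next
    fix a assume "a \<in> comb psmul ` {c. coeffs_in V res_basis c \<and> (\<forall>b\<in>res_basis. homog (k - res_deg b) (lookup c b))}"
    then obtain c where c: "coeffs_in V res_basis c" "\<And>x. x \<in> res_basis ==> homog (k - res_deg x) (lookup c x)" "a = comb psmul c" by blast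
    show "a \<in> hom K i k" unfolding hom_iff
    proof (intro conjI allI)
      show "a \<in> car K i" using comb_car[OF c(1) V] c(3) by simp
      fix b show "homog (k - bdeg K b) (lookup a b)" unfolding homog_def
      proof
        fix m assume "m \<in> keys (lookup a b)"
        let ?x = "single b (single (mres (- V) m) (1::rat))"
        have nz: "lookup (lookup c ?x) (mres V m) \<noteq> 0"
          using lookup_comb[OF c(1), of b m] \<open>m \<in> keys (lookup a b)\<close> by (simp add: c(3) in_keys_iff)
        hence "?x \<in> keys c" by (auto simp: in_keys_iff)
        hence "?x \<in> res_basis" using c(1) by (auto simp: coeffs_in_def)
        hence "mon_deg (mres V m) = k - (bdeg K b + mon_deg (mres (- V) m))" using c(2) nz by (auto simp: homog_def in_keys_iff res_deg_single)
        thus "mon_deg m = k - bdeg K b" using mon_deg_mres[of V m] by simp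
      qed
    qed
  qed
qed

end

lemma graded_factorization_gfact_of:
  assumes K: "factorization n w K" and "V \<subseteq> bvars K" "w \<in> polys V" "homog (2 * (int n + 1)) w"
  shows "graded_factorization n V w (gfact_of K)" unfolding graded_factorization_def gsmul_gfact_of gdif_gfact_of
proof (intro conjI allI ballI)
  show "finite V" using assms by (auto simp: factorization_def intro: finite_subset)
  fix i
  show "free_graded V psmul (car K i) (ghom (gfact_of K) i)" using assms by (intro free_graded_gfact_of)
  show "rlinear V psmul psmul (car K i) (car K (\<not> i)) (bd K)" unfolding rlinear_def using bd_car[OF K] by (auto simp: lin_ext_add lin_ext_psmul)
  show "bd K ` hom K i k \<subseteq> hom K (\<not> i) (k + int n + 1)" for k using bd_hom[OF K] by auto
  show "bd K (bd K m) = psmul w m" if "m \<in> car K i" for m using bd_bd[OF K car_keys[OF that]] .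
qed (use assms in auto)

subsection \<open>Finite-dimensionality of the cohomology\<close>

text \<open>A monomial lies in the ideal generated by \<open>x\<^sub>v\<^bsup>ex v\<^esup>\<close>, \<open>v \<in> J\<close>, if one exponent is large enough.\<close>

definition in_powers :: "('v => nat) => 'v set => ('b \<Rightarrow>\<^sub>0 'v mpoly) => bool" where
  "in_powers ex J f \<longleftrightarrow> (\<forall>b. \<forall>m\<in>keys (lookup f b). \<exists>v\<in>J. ex v \<le> lookup m v)"

definition in_powers_poly :: "('v => nat) => 'v set => 'v mpoly => bool" where
  "in_powers_poly ex J p \<longleftrightarrow> (\<forall>m\<in>keys p. \<exists>v\<in>J. ex v \<le> lookup m v)"

lemma in_powers_iff: "in_powers ex J f \<longleftrightarrow> (\<forall>b. in_powers_poly ex J (lookup f b))"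
  by (simp add: in_powers_def in_powers_poly_def)

lemma in_powers_poly_add: "in_powers_poly ex J p ==> in_powers_poly ex J q ==> in_powers_poly ex J (p + q)"
  using Poly_Mapping.keys_add[of p q] by (auto simp: in_powers_poly_def)

lemma in_powers_poly_mult: "in_powers_poly ex J p ==> in_powers_poly ex J (q * p)" unfolding in_powers_poly_def
proof
  fix m assume p: "\<forall>m\<in>keys p. \<exists>v\<in>J. ex v \<le> lookup m v" and "m \<in> keys (q * p)"
  then obtain a b where "m = a + b" "b \<in> keys p" using Poly_Mapping.keys_mult[of q p] by blast
  thus "\<exists>v\<in>J. ex v \<le> lookup m v" using p by (auto simp: lookup_add intro: trans_le_add2)
qed

lemma in_powers_0 [simp]: "in_powers ex J 0" by (simp add: in_powers_def)

lemma in_powers_add: "in_powers ex J f ==> in_powers ex J g ==> in_powers ex J (f + g)" by (simp add: in_powers_iff lookup_add in_powers_poly_add)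

lemma in_powers_psmul: "in_powers ex J f ==> in_powers ex J (psmul p f)" by (simp add: in_powers_iff in_powers_poly_mult)

lemma in_powers_psmul_poly: "in_powers_poly ex J p ==> in_powers ex J (psmul p f)" by (simp add: in_powers_iff in_powers_poly_mult mult.commute[of p])

lemma in_powers_uminus: "in_powers ex J f ==> in_powers ex J (- f)" by (auto simp: in_powers_def in_keys_iff)

lemma in_powers_diff: "in_powers ex J f ==> in_powers ex J g ==> in_powers ex J (f - g)"
  using in_powers_add[of ex J f "- g"] in_powers_uminus[of ex J g] by simp

lemma in_powers_sum: "(\<And>a. a \<in> A ==> in_powers ex J (g a)) ==> in_powers ex J (sum g A)"
  by (induction A rule: infinite_finite_induct) (auto intro: in_powers_add)

lemma in_powers_lin_ext: "in_powers ex J f ==> in_powers ex J (lin_ext id \<phi> f)"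
  unfolding lin_ext_def by (intro in_powers_sum in_powers_psmul_poly) (simp add: in_powers_iff)

lemma in_powers_mono: "in_powers ex J f ==> J \<subseteq> J' ==> in_powers ex J' f" unfolding in_powers_def by blast

text \<open>A variable is regular modulo a monomial ideal generated by powers of the other
  variables.\<close>

lemma in_powers_cancel:
  assumes "in_powers ex J (psmul (X v ^ k) f)" "v \<notin> J"
  shows "in_powers ex J f" unfolding in_powers_def
proof (intro allI ballI)
  fix b m assume "m \<in> keys (lookup f b)"
  hence "m + single v k \<in> keys (lookup (psmul (X v ^ k) f) b)" by (simp add: in_keys_iff lookup_X_power_mult)
  then obtain u where "u \<in> J" "ex u \<le> lookup (m + single v k) u" using assms(1) unfolding in_powers_def by blast
  thus "\<exists>v\<in>J. ex v \<le> lookup m v" using assms(2) by (intro bexI[of _ u]) (auto simp: lookup_add lookup_single when_def split: if_splits)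
qed

lemma cmap_split: "cmap (vrem v k) f + psmul (X v ^ k) (cmap (vquo v k) f) = f"
  by (intro poly_mapping_eqI) (simp add: lookup_add lookup_cmap vrem_vquo)

lemma in_powers_vrem:
  assumes "in_powers ex (insert v J) f"
  shows "in_powers ex J (cmap (vrem v (ex v)) f)"
  using assms unfolding in_powers_def by (fastforce simp: lookup_cmap in_keys_iff lookup_vrem when_def split: if_splits)

definition null_homotopy :: "('v, 'b) bfact => 'v mpoly => (('b \<Rightarrow>\<^sub>0 'v mpoly) => ('b \<Rightarrow>\<^sub>0 'v mpoly)) => bool" where
  "null_homotopy K t H \<longleftrightarrow> (\<exists>\<phi>. H = lin_ext id \<phi> \<and> car_map K K True \<phi>) \<and>
     (\<forall>f. keys f \<subseteq> bas K \<longrightarrow> H (bd K f) + bd K (H f) = psmul t f)"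

lemma null_homotopy_car: "null_homotopy K t H ==> f \<in> car K i ==> H f \<in> car K (\<not> i)"
  unfolding null_homotopy_def using car_map_apply[of K K True _ f i id] by auto

text \<open>Write a = a_0 + x^k r with x = x_v, k = \<open>ex v\<close> and a_0 already in the
  smaller ideal. Applying d and cancelling x^k puts dr in that ideal. The homotopy rewrites x^k r as
  a coboundary plus a multiple of H(dr), which lies in the ideal, so the variable v is no longer
  required.\<close>

lemma coboundary_step:
  assumes K: "factorization n w K" and w: "in_powers_poly ex J w"
    and H: "null_homotopy K (Const c * X v ^ ex v) H" "c \<noteq> 0" and v: "v \<notin> J"
    and dz: "in_powers ex J (bd K (bd K q + a))"
    and qa: "q \<in> car K (\<not> i)" "a \<in> car K i" "in_powers ex (insert v J) a"
  shows "\<exists>q'\<in>car K (\<not> i). \<exists>a'\<in>car K i. in_powers ex J a' \<and> bd K q + a = bd K q' + a'"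
proof -
  define r where "r = cmap (vquo v (ex v)) a"
  define a0 where "a0 = cmap (vrem v (ex v)) a"
  have a: "a = a0 + psmul (X v ^ ex v) r" unfolding a0_def r_def by (simp add: cmap_split)
  have a0: "in_powers ex J a0" unfolding a0_def using qa(3) by (rule in_powers_vrem)
  have car: "r \<in> car K i" "a0 \<in> car K i" unfolding r_def a0_def using qa(2) by (auto intro!: car_cmap vquo_polys vrem_polys)
  have "bd K (bd K q) = psmul w q" using bd_bd[OF K car_keys[OF qa(1)]] .
  hence "psmul (X v ^ ex v) (bd K r) = bd K (bd K q + a) - psmul w q - bd K a0" by (simp add: a lin_ext_add lin_ext_psmul)
  moreover have "in_powers ex J \<dots>" by (intro in_powers_diff dz in_powers_psmul_poly w in_powers_lin_ext a0)
  ultimately have dr: "in_powers ex J (bd K r)" using in_powers_cancel v by metis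
  obtain \<phi> where \<phi>: "H = lin_ext id \<phi>" using H(1) by (auto simp: null_homotopy_def)
  have "psmul (Const (1 / c)) (H (bd K r) + bd K (H r)) = psmul (Const (1 / c)) (psmul (Const c * X v ^ ex v) r)"
    using H(1) car_keys[OF car(1)] by (auto simp: null_homotopy_def)
  also have "\<dots> = psmul (X v ^ ex v) r" using H(2) by (simp flip: Const_mult mult.assoc)
  finally have tr: "psmul (X v ^ ex v) r = bd K (psmul (Const (1 / c)) (H r)) + psmul (Const (1 / c)) (H (bd K r))"
    by (simp add: psmul_add_right lin_ext_psmul add.commute)
  let ?q = "q + psmul (Const (1 / c)) (H r)" and ?a = "a0 + psmul (Const (1 / c)) (H (bd K r))"
  have "bd K q + a = bd K ?q + ?a" by (simp add: a tr lin_ext_add)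
  moreover have "?q \<in> car K (\<not> i)" using qa(1) null_homotopy_car[OF H(1) car(1)] by auto
  moreover have "?a \<in> car K i" using null_homotopy_car[OF H(1) bd_car[OF K car(1)]] car(2) by auto
  moreover have "in_powers ex J ?a" using a0 dr by (auto intro!: in_powers_add in_powers_psmul in_powers_lin_ext simp: \<phi>)
  ultimately show ?thesis by blast
qed

text \<open>Iterating over the internal variables, a cocycle modulo the boundary ideal that lies in
  the ideal of all prescribed powers is a coboundary modulo the boundary ideal. Hence the cohomology
  is a quotient of the space of truncated cocycles.\<close>

lemma coboundary_descend:
  assumes K: "factorization n w K" and w: "in_powers_poly ex V w" and U: "finite U" "U \<inter> V = {}"
    and H: "\<And>v. v \<in> U ==> \<exists>H c. c \<noteq> 0 \<and> null_homotopy K (Const c * X v ^ ex v) H"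
    and dz: "in_powers ex V (bd K z)" and z: "z = bd K q + a" "q \<in> car K (\<not> i)" "a \<in> car K i" "in_powers ex (U \<union> V) a"
  shows "\<exists>q'\<in>car K (\<not> i). \<exists>a'\<in>car K i. in_powers ex V a' \<and> z = bd K q' + a'" using U H z
proof (induction U arbitrary: q a rule: finite_induct)
  case empty
  thus ?case by (metis Un_empty_left)
next
  case (insert v U)
  obtain H c where H: "c \<noteq> 0" "null_homotopy K (Const c * X v ^ ex v) H" using insert.prems by blast
  have "\<exists>q'\<in>car K (\<not> i). \<exists>a'\<in>car K i. in_powers ex (U \<union> V) a' \<and> bd K q + a = bd K q' + a'"
  proof (rule coboundary_step[where ex=ex and v=v and H=H and c=c, OF K])
    show "in_powers_poly ex (U \<union> V) w" using w unfolding in_powers_poly_def by blast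
    show "v \<notin> U \<union> V" using insert by auto
    show "in_powers ex (U \<union> V) (bd K (bd K q + a))" using dz insert.prems(3) by (auto intro: in_powers_mono)
  qed (use insert.prems H in auto)
  then obtain q' a' where "q' \<in> car K (\<not> i)" "a' \<in> car K i" "in_powers ex (U \<union> V) a'" "bd K q + a = bd K q' + a'" by blast
  thus ?case using insert.IH[of q' a'] insert.prems by auto
qed

lemma vector_space_psmul: "vector_space (\<lambda>c. psmul (Const c) :: ('b \<Rightarrow>\<^sub>0 'v mpoly) => _)"
  by unfold_locales (auto simp: psmul_add_right psmul_add_left Const_add Const_mult)

text \<open>The representatives have to lie in Z themselves, so a maximal independent subset of the
  image is lifted back to Z.\<close>

lemma finite_image_span:
  fixes \<tau> :: "('b \<Rightarrow>\<^sub>0 'v mpoly) => ('b \<Rightarrow>\<^sub>0 'v mpoly)"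
  assumes E: "finite E" "\<And>z. z \<in> Z ==> \<exists>c. \<tau> z = (\<Sum>x\<in>E. psmul (Const (c x)) x)"
  shows "\<exists>F. finite F \<and> F \<subseteq> Z \<and> (\<forall>z\<in>Z. \<exists>c. \<tau> z = (\<Sum>f\<in>F. psmul (Const (c f)) (\<tau> f)))"
proof -
  interpret vector_space "\<lambda>c. psmul (Const c) :: ('b \<Rightarrow>\<^sub>0 'v mpoly) => _" by (rule vector_space_psmul)
  obtain B where B: "B \<subseteq> \<tau> ` Z" "independent B" "\<tau> ` Z \<subseteq> span B" by (rule maximal_independent_subset)
  have "\<tau> ` Z \<subseteq> span E" using E(2) unfolding span_finite[OF E(1)] by auto
  with B(1) have BE: "B \<subseteq> span E" by (rule order_trans)
  have "finite B" using independent_span_bound[OF E(1) B(2) BE] by simp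
  define g where "g b = (SOME z. z \<in> Z \<and> \<tau> z = b)" for b
  have g: "g b \<in> Z \<and> \<tau> (g b) = b" if "b \<in> B" for b
  proof -
    have "\<exists>z. z \<in> Z \<and> \<tau> z = b" using that B(1) by blast
    thus ?thesis unfolding g_def by (rule someI_ex)
  qed
  have inj: "inj_on g B" using g by (metis inj_onI)
  show ?thesis
  proof (intro exI[of _ "g ` B"] conjI ballI)
    fix z assume "z \<in> Z"
    hence "\<tau> z \<in> span B" using B(3) by auto
    then obtain c where "\<tau> z = (\<Sum>b\<in>B. psmul (Const (c b)) b)" unfolding span_finite[OF \<open>finite B\<close>] by auto
    also have "\<dots> = (\<Sum>f\<in>g ` B. psmul (Const (c (\<tau> f))) (\<tau> f))"
      unfolding sum.reindex[OF inj] comp_def by (rule sum.cong) (simp_all add: g)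
    finally show "\<exists>c. \<tau> z = (\<Sum>f\<in>g ` B. psmul (Const (c f)) (\<tau> f))" by (rule exI[of _ "\<lambda>f. c (\<tau> f)"])
  qed (use g \<open>finite B\<close> in auto)
qed

lemma finite_bounded_monomials:
  assumes "finite P"
  shows "finite {m :: 'v \<Rightarrow>\<^sub>0 nat. keys m \<subseteq> P \<and> (\<forall>v. lookup m v \<le> N)}"
proof (rule finite_imageD[where f=lookup])
  have "lookup ` {m :: 'v \<Rightarrow>\<^sub>0 nat. keys m \<subseteq> P \<and> (\<forall>v. lookup m v \<le> N)} \<subseteq>
      {g. \<forall>v. (v \<in> P \<longrightarrow> g v \<in> {..N}) \<and> (v \<notin> P \<longrightarrow> g v = 0)}" by (auto simp: in_keys_iff)
  thus "finite (lookup ` {m :: 'v \<Rightarrow>\<^sub>0 nat. keys m \<subseteq> P \<and> (\<forall>v. lookup m v \<le> N)})"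
    using finite_set_of_finite_funs[OF assms, of "{..N}" 0] finite_subset by blast
  show "inj_on lookup {m :: 'v \<Rightarrow>\<^sub>0 nat. keys m \<subseteq> P \<and> (\<forall>v. lookup m v \<le> N)}"
    by (intro inj_onI) (simp only: poly_mapping_eq_iff)
qed

text \<open>Normal form modulo the monomial ideal generated by the prescribed powers.\<close>

definition truncate :: "('v => nat) => 'v set => 'v mpoly => 'v mpoly" where
  "truncate ex J p = (\<Sum>m\<in>keys p. if \<exists>v\<in>J. ex v \<le> lookup m v then 0 else single m (lookup p m))"

lemma truncate_add: "truncate ex J (p + q) = truncate ex J p + truncate ex J q"
  unfolding truncate_def by (subst setsum_keys_plus_distrib) (auto simp: single_add)

lemma truncate_0 [simp]: "truncate ex J 0 = 0" by (simp add: truncate_def)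

lemma lookup_truncate: "lookup (truncate ex J p) m = (if \<exists>v\<in>J. ex v \<le> lookup m v then 0 else lookup p m)"
proof (induction p rule: pm_induct)
  case (single k c)
  show ?case unfolding truncate_def by (subst sum_keys_single) (auto simp: lookup_single when_def)
qed (simp add: truncate_add lookup_add)

lemma in_powers_truncate: "in_powers ex J f \<longleftrightarrow> cmap (truncate ex J) f = 0"
proof
  assume f: "in_powers ex J f"
  show "cmap (truncate ex J) f = 0" using f unfolding in_powers_def
    by (intro poly_mapping_eqI) (simp add: lookup_cmap lookup_truncate, metis in_keys_iff)
next
  assume "cmap (truncate ex J) f = 0"
  hence "truncate ex J (lookup f b) = 0" for b by (metis lookup_cmap lookup_zero truncate_0)
  thus "in_powers ex J f" unfolding in_powers_def by (metis in_keys_iff lookup_truncate lookup_zero)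
qed

lemma truncate_span:
  fixes K :: "('v, 'b) bfact"
  assumes "finite (bvars K)" "finite (bas K)" "z \<in> car K i"
  shows "\<exists>c. cmap (truncate ex (bvars K)) z =
    (\<Sum>x\<in>(\<lambda>(b, m). single b (single m 1)) ` (bas K \<times> {m. keys m \<subseteq> bvars K \<and> (\<forall>v. lookup m v \<le> Max (ex ` bvars K))}). psmul (Const (c x)) x)"
proof -
  interpret vector_space "\<lambda>c. psmul (Const c) :: ('b \<Rightarrow>\<^sub>0 'v mpoly) => _" by (rule vector_space_psmul)
  let ?M = "{m. keys m \<subseteq> bvars K \<and> (\<forall>v. lookup m v \<le> Max (ex ` bvars K))}"
  let ?E = "(\<lambda>(b, m). single b (single m (1::rat))) ` (bas K \<times> ?M)"
  have fin: "finite ?E" using assms finite_bounded_monomials by blast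
  define f where "f = cmap (truncate ex (bvars K)) z"
  have kf: "keys f \<subseteq> bas K" unfolding f_def using keys_cmap[of "truncate ex (bvars K)" z] assms(3) by (auto simp: car_iff)
  have km: "keys (lookup f b) \<subseteq> ?M" for b
  proof
    fix m assume "m \<in> keys (lookup f b)"
    hence m: "m \<in> keys (lookup z b)" "\<And>v. v \<in> bvars K ==> lookup m v < ex v"
      by (auto simp: f_def lookup_cmap in_keys_iff lookup_truncate not_le split: if_splits)
    have k: "keys m \<subseteq> bvars K" using m(1) assms(3) by (auto simp: car_iff polys_def)
    have "lookup m v \<le> Max (ex ` bvars K)" for v
    proof (cases "v \<in> bvars K")
      case True
      hence "lookup m v \<le> ex v" "ex v \<le> Max (ex ` bvars K)" using m(2)[of v] assms(1) by auto
      thus ?thesis by simp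
    next
      case False
      hence "lookup m v = 0" using k by (auto simp: in_keys_iff)
      thus ?thesis by simp
    qed
    thus "m \<in> ?M" using k by simp
  qed
  have s1: "single b (\<Sum>m\<in>A. single m (g m)) = (\<Sum>m\<in>A. single b (single m (g m)))" for A and b :: 'b and g :: "('v \<Rightarrow>\<^sub>0 nat) => rat"
    by (induction A rule: infinite_finite_induct) (auto simp: single_add)
  have "f = (\<Sum>b\<in>keys f. single b (\<Sum>m\<in>keys (lookup f b). single m (lookup (lookup f b) m)))" by (simp flip: poly_mapping_sum_singles)
  also have "\<dots> = (\<Sum>b\<in>keys f. \<Sum>m\<in>keys (lookup f b). psmul (Const (lookup (lookup f b) m)) (single b (single m 1)))"
    unfolding s1 by (simp add: Const_def mult_single)
  also have "\<dots> \<in> span ?E"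
  proof (intro span_sum span_scale span_base)
    fix b m assume "b \<in> keys f" "m \<in> keys (lookup f b)"
    hence "(b, m) \<in> bas K \<times> ?M" using kf km by blast
    thus "single b (single m 1) \<in> ?E" by (rule rev_image_eqI) simp
  qed
  finally have "f \<in> span ?E" .
  thus ?thesis unfolding span_finite[OF fin] f_def by auto
qed

text \<open>Translates a sum over V into a condition on monomials, namely \<open>in_powers\<close>
  with all exponents 1. The summands are found by splitting off one variable at a time through
  division.\<close>

lemma max_ideal_part_iff:
  assumes V: "finite V" "V \<subseteq> bvars K"
  shows "f \<in> max_ideal_part V (gfact_of K) i \<longleftrightarrow> f \<in> car K i \<and> (\<forall>b. \<forall>m\<in>keys (lookup f b). \<exists>v\<in>V. 1 \<le> lookup m v)"
proof -
  have *: "f \<in> max_ideal_part V (gfact_of K) i \<longleftrightarrow> f \<in> car K i \<and> in_powers (\<lambda>_. 1) V f"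
  proof
    assume "f \<in> max_ideal_part V (gfact_of K) i"
    then obtain m where f: "f = (\<Sum>v\<in>V. psmul (X v) (m v))" "\<And>v. v \<in> V ==> m v \<in> car K i" by (auto simp: max_ideal_part_def)
    have "in_powers_poly (\<lambda>_. 1) V (X v)" if "v \<in> V" for v using that by (auto simp: in_powers_poly_def X_def intro!: bexI[of _ v])
    thus "f \<in> car K i \<and> in_powers (\<lambda>_. 1) V f" using f V by (auto intro!: car_sum car_psmul in_powers_sum in_powers_psmul_poly)
  next
    assume "f \<in> car K i \<and> in_powers (\<lambda>_. 1) V f"
    hence f: "f \<in> car K i" "in_powers (\<lambda>_. 1) V f" by auto
    have "\<exists>m. (\<forall>v\<in>V. m v \<in> car K i) \<and> f = (\<Sum>v\<in>V. psmul (X v) (m v))" using V(1) f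
    proof (induction V arbitrary: f rule: finite_induct)
      case empty
      hence "lookup f b = 0" for b by (auto simp: in_powers_def simp flip: keys_eq_empty)
      hence "f = 0" by (intro poly_mapping_eqI) simp
      thus ?case by simp
    next
      case (insert v V)
      let ?f0 = "cmap (vrem v 1) f"
      have "in_powers (\<lambda>_. 1) V ?f0" using insert.prems(2) in_powers_vrem by force
      moreover have "?f0 \<in> car K i" using insert.prems(1) by (auto intro!: car_cmap vrem_polys)
      ultimately obtain m where m: "\<forall>v\<in>V. m v \<in> car K i" "?f0 = (\<Sum>v\<in>V. psmul (X v) (m v))" using insert.IH by blast
      let ?m = "m(v := cmap (vquo v 1) f)"
      have "f = psmul (X v) (cmap (vquo v 1) f) + (\<Sum>v\<in>V. psmul (X v) (m v))" using cmap_split[of v 1 f] m(2) by (simp add: add.commute)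
      also have "\<dots> = (\<Sum>u\<in>insert v V. psmul (X u) (?m u))" using insert.hyps by (auto intro!: sum.cong)
      finally have "f = (\<Sum>u\<in>insert v V. psmul (X u) (?m u))" .
      moreover have "\<forall>u\<in>insert v V. ?m u \<in> car K i" using m(1) insert.prems(1) by (auto intro!: car_cmap vquo_polys)
      ultimately show ?case by blast
    qed
    thus "f \<in> max_ideal_part V (gfact_of K) i" by (auto simp: max_ideal_part_def)
  qed
  thus ?thesis by (simp add: in_powers_def)
qed

lemma hmf_object_gfact_of:
  assumes n: "n \<ge> 1" and K: "factorization n w K" and V: "V \<subseteq> bvars K" and w: "w \<in> polys V" "homog (2 * (int n + 1)) w"
    and H: "\<And>v. v \<in> bvars K - V ==> \<exists>H c. c \<noteq> 0 \<and> null_homotopy K (Const c * X v ^ n) H"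
  shows "hmf_object n V w (gfact_of K)"
proof -
  have fin: "finite V" "finite (bvars K)" "finite (bas K)" using K V by (auto simp: factorization_def intro: finite_subset)
  \<comment> \<open>Cohomology is taken modulo the boundary variables, so these get exponent 1;
    internal ones are nilpotent only to order n.\<close>
  define ex where "ex v = (if v \<in> V then 1 else n)" for v
  define U where "U = bvars K - V"
  have UV: "U \<union> V = bvars K" "U \<inter> V = {}" "finite U" using V fin by (auto simp: U_def)
  have exV: "in_powers ex V f \<longleftrightarrow> (\<forall>b. \<forall>m\<in>keys (lookup f b). \<exists>v\<in>V. 1 \<le> lookup m v)" for f :: "'b \<Rightarrow>\<^sub>0 'a mpoly"
    by (simp add: in_powers_def ex_def)
  have mip: "f \<in> max_ideal_part V (gfact_of K) i \<longleftrightarrow> f \<in> car K i \<and> in_powers ex V f" for f i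
    unfolding exV using fin(1) V by (rule max_ideal_part_iff)
  \<comment> \<open>The potential is homogeneous of positive degree and hence has no constant
    term.\<close>
  have wV: "in_powers_poly ex V w" unfolding in_powers_poly_def
  proof
    fix m assume m: "m \<in> keys w"
    hence "mon_deg m \<noteq> 0" "keys m \<subseteq> V" using w by (auto simp: homog_def polys_def)
    then obtain v where "v \<in> keys m" by (metis all_not_in_conv keys_eq_empty mon_deg_0)
    moreover from this have "v \<in> V" using \<open>keys m \<subseteq> V\<close> by blast
    ultimately have "v \<in> V" "ex v \<le> lookup m v" by (auto simp: ex_def in_keys_iff Suc_leI)
    thus "\<exists>v\<in>V. ex v \<le> lookup m v" by blast
  qed
  have "fin_dim_quotient (\<lambda>c. psmul (Const c)) (cocycles_mod V (gfact_of K) i) (coboundaries_mod V (gfact_of K) i)" for i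
  proof -
    let ?Z = "cocycles_mod V (gfact_of K) i" and ?\<tau> = "cmap (truncate ex (bvars K)) :: ('b \<Rightarrow>\<^sub>0 'a mpoly) => _"
    let ?E = "(\<lambda>(b, m). single b (single m (1::rat))) ` (bas K \<times> {m. keys m \<subseteq> bvars K \<and> (\<forall>v. lookup m v \<le> Max (ex ` bvars K))})"
    have Z: "z \<in> ?Z \<longleftrightarrow> z \<in> car K i \<and> in_powers ex V (bd K z)" for z
      using bd_car[OF K] by (auto simp: cocycles_mod_def mip)
    have fE: "finite ?E" using fin finite_bounded_monomials by blast
    have tspan: "\<exists>c. ?\<tau> z = (\<Sum>x\<in>?E. psmul (Const (c x)) x)" if "z \<in> ?Z" for z
      using truncate_span[OF fin(2,3), of z i ex] that Z by auto
    obtain F where F: "finite F" "F \<subseteq> ?Z" "\<And>z. z \<in> ?Z ==> \<exists>c. ?\<tau> z = (\<Sum>f\<in>F. psmul (Const (c f)) (?\<tau> f))"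
      using finite_image_span[of ?E ?Z ?\<tau>] fE tspan by auto
    have tlin: "?\<tau> (f + g) = ?\<tau> f + ?\<tau> g" "?\<tau> (psmul (Const c) f) = psmul (Const c) (?\<tau> f)" for f g c
    proof -
      show "?\<tau> (f + g) = ?\<tau> f + ?\<tau> g" by (rule cmap_add) (auto simp: truncate_add)
      have "truncate ex (bvars K) (Const c * p) = Const c * truncate ex (bvars K) p" for p by (intro poly_mapping_eqI) (simp add: lookup_truncate)
      thus "?\<tau> (psmul (Const c) f) = psmul (Const c) (?\<tau> f)" by (intro poly_mapping_eqI) (simp add: lookup_cmap)
    qed
    have tsum: "?\<tau> (sum g A) = (\<Sum>a\<in>A. ?\<tau> (g a))" for g and A :: "('b \<Rightarrow>\<^sub>0 'a mpoly) set"
      by (induction A rule: infinite_finite_induct) (auto simp: tlin)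
    show ?thesis unfolding fin_dim_quotient_def
    proof (intro exI[of _ F] conjI ballI F(1,2))
      fix z assume z: "z \<in> ?Z"
      then obtain c where c: "?\<tau> z = (\<Sum>f\<in>F. psmul (Const (c f)) (?\<tau> f))" using F(3) by blast
      let ?y = "z - (\<Sum>f\<in>F. psmul (Const (c f)) f)"
      have FZ: "f \<in> car K i" "in_powers ex V (bd K f)" if "f \<in> F" for f using F(2) Z that by auto
      have y: "?y \<in> car K i" using z Z FZ by (intro car_diff car_sum car_psmul) auto
      have "in_powers ex V (bd K ?y)" using z Z FZ unfolding lin_ext_diff[OF ringhom_id] lin_ext_sum[OF ringhom_id] lin_ext_psmul[OF ringhom_id]
        by (intro in_powers_diff in_powers_sum in_powers_psmul) auto
      moreover have "?\<tau> ?y = 0" using tlin(1)[of ?y "\<Sum>f\<in>F. psmul (Const (c f)) f"] c by (simp add: tsum tlin)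
      hence "in_powers ex (U \<union> V) ?y" unfolding UV in_powers_truncate .
      moreover have "\<exists>H c. c \<noteq> 0 \<and> null_homotopy K (Const c * X v ^ ex v) H" if "v \<in> U" for v
        using H[of v] that by (simp add: U_def ex_def)
      \<comment> \<open>The difference has zero truncation, so the descent can start with it as the
        ideal part and with zero coboundary part.\<close>
      ultimately have "\<exists>q'\<in>car K (\<not> i). \<exists>a'\<in>car K i. in_powers ex V a' \<and> ?y = bd K q' + a'"
        using y by (intro coboundary_descend[OF K wV UV(3,2), where q=0 and a="?y"]) auto
      hence "?y \<in> coboundaries_mod V (gfact_of K) i" unfolding coboundaries_mod_def by (auto simp: mip)
      thus "\<exists>c. z - (\<Sum>f\<in>F. psmul (Const (c f)) f) \<in> coboundaries_mod V (gfact_of K) i" by blast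
    qed
  qed
  thus ?thesis unfolding hmf_object_def using graded_factorization_gfact_of[OF K V w] by simp
qed

section \<open>Reindexing tensor factors\<close>

declare One_nat_def [simp del]

lemma lin_ext_cmap: "lin_ext (psubst g) \<phi> f = lin_ext id \<phi> (cmap (psubst g) f)"
  by (induction f rule: pm_induct) (auto simp: lin_ext_add cmap_add cmap_single psubst_add)

text \<open>Koszul sign of moving odd entries at the positions in S along the map, a count of
  inversions.\<close>

definition inv_sgn :: "nat set => (nat => nat) => 'v mpoly" where
  "inv_sgn S \<tau> = (- 1) ^ card {(k, l). k \<in> S \<and> l \<in> S \<and> k < l \<and> \<tau> l < \<tau> k}"

text \<open>The inversions involving k come from the elements in front of k before or after the
  move, but not both. The symmetric difference of these two sets has the parity of the sum of their
  sizes.\<close>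

lemma inv_sgn_insert:
  assumes "finite S" "k \<notin> S" "inj_on \<tau> (insert k S)"
  shows "inv_sgn (insert k S) \<tau> = inv_sgn S \<tau> * (- 1) ^ card {j \<in> S. j < k} * (- 1) ^ card {j \<in> S. \<tau> j < \<tau> k}"
proof -
  let ?X = "{j \<in> S. j < k}" and ?Y = "{j \<in> S. \<tau> j < \<tau> k}"
  let ?I = "\<lambda>S. {(k, l). k \<in> S \<and> l \<in> S \<and> k < l \<and> \<tau> l < \<tau> k}"
  have ne: "\<tau> j \<noteq> \<tau> k" if "j \<in> S" for j using assms that by (metis inj_onD insertI1 insertI2)
  have fI: "finite (?I S)" by (rule finite_subset[of _ "S \<times> S"]) (use assms in auto)
  let ?U = "(\<lambda>j. (j, k)) ` (?X - ?Y)" and ?W = "(\<lambda>j. (k, j)) ` (?Y - ?X)"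
  have split: "?I (insert k S) = ?I S \<union> (?U \<union> ?W)"
  proof (intro equalityI subsetI)
    fix z assume "z \<in> ?I (insert k S)"
    then obtain i j where z: "z = (i, j)" "i \<in> insert k S" "j \<in> insert k S" "i < j" "\<tau> j < \<tau> i" by auto
    then consider "i \<in> S" "j \<in> S" | "i = k" "j \<in> S" | "i \<in> S" "j = k" by auto
    thus "z \<in> ?I S \<union> (?U \<union> ?W)" using z by cases auto
  next
    fix z assume "z \<in> ?I S \<union> (?U \<union> ?W)"
    moreover have "\<tau> k < \<tau> j" if "j \<in> ?X - ?Y" for j using that ne[of j] by (auto simp: not_less)
    moreover have "k < j" if "j \<in> ?Y - ?X" for j
    proof -
      have "j \<noteq> k" using that assms(2) by auto
      thus ?thesis using that by auto
    qed
    ultimately show "z \<in> ?I (insert k S)" by auto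
  qed
  have fU: "finite ?U" "finite ?W" using assms(1) by auto
  have dU: "?U \<inter> ?W = {}" "?I S \<inter> (?U \<union> ?W) = {}" using assms(2) by auto
  have cU: "card ?U = card (?X - ?Y)" "card ?W = card (?Y - ?X)" by (auto intro!: card_image inj_onI)
  have c: "card (?I (insert k S)) = card (?I S) + card (?X - ?Y) + card (?Y - ?X)"
    unfolding split using card_Un_disjoint[OF fI _ dU(2)] card_Un_disjoint[OF fU dU(1)] fU cU by simp
  have "finite ?X" "finite ?Y" using assms(1) by auto
  \<comment> \<open>The common part of the two sets is counted twice and drops out modulo 2.\<close>
  hence "card ?X = card (?X \<inter> ?Y) + card (?X - ?Y)" "card ?Y = card (?Y \<inter> ?X) + card (?Y - ?X)"
    by (simp_all only: card_Int_Diff[of ?X ?Y] card_Int_Diff[of ?Y ?X])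
  hence e: "card (?I (insert k S)) + 2 * card (?X \<inter> ?Y) = card (?I S) + (card ?X + card ?Y)" using c by (simp add: Int_commute)
  have "even (card (?I (insert k S))) \<longleftrightarrow> even (card (?I S) + (card ?X + card ?Y))" unfolding e[symmetric] by simp
  hence "(- 1 :: 'a mpoly) ^ card (?I (insert k S)) = (- 1) ^ (card (?I S) + (card ?X + card ?Y))" by (rule minus_one_power_eq)
  thus ?thesis by (simp add: inv_sgn_def power_add mult.assoc)
qed

lemma neg_one_power_sq: "(- 1 :: 'a::comm_ring_1) ^ k * (- 1) ^ k = 1" by (simp flip: power_add)

lemma inv_sgn_sq: "inv_sgn S \<tau> * inv_sgn S \<tau> = 1" by (simp add: inv_sgn_def neg_one_power_sq)

lemma inv_sgn_empty [simp]: "inv_sgn {} \<tau> = 1" by (simp add: inv_sgn_def)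

lemma inv_sgn_cong: "(\<And>k. k \<in> S ==> \<tau> k = \<tau>' k) ==> inv_sgn S \<tau> = inv_sgn S \<tau>'"
proof -
  assume "\<And>k. k \<in> S ==> \<tau> k = \<tau>' k"
  hence "{(k, l). k \<in> S \<and> l \<in> S \<and> k < l \<and> \<tau> l < \<tau> k} = {(k, l). k \<in> S \<and> l \<in> S \<and> k < l \<and> \<tau>' l < \<tau>' k}" by auto
  thus ?thesis by (simp add: inv_sgn_def)
qed

text \<open>By \<open>inv_sgn_insert\<close> the count at the intermediate stage appears in both
  factors and squares to 1; the outer counts are those of the composite.\<close>

lemma inv_sgn_comp:
  assumes "finite S" "inj_on \<tau> S" "inj_on \<tau>' (\<tau> ` S)"
  shows "inv_sgn S \<tau> * inv_sgn (\<tau> ` S) \<tau>' = (inv_sgn S (\<tau>' \<circ> \<tau>) :: 'v mpoly)" using assms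
proof (induction S rule: finite_induct)
  case (insert k S)
  have t: "\<tau> k \<notin> \<tau> ` S" using insert by auto
  have i1: "inj_on \<tau> S" "inj_on \<tau>' (\<tau> ` S)" using insert.prems by (auto intro: inj_on_subset)
  have i2: "inj_on \<tau>' (insert (\<tau> k) (\<tau> ` S))" using insert.prems by simp
  have i3: "inj_on (\<tau>' \<circ> \<tau>) (insert k S)" using insert.prems by (intro comp_inj_on) auto
  have "{b \<in> \<tau> ` S. b < \<tau> k} = \<tau> ` {j \<in> S. \<tau> j < \<tau> k}" by auto
  hence c1: "card {b \<in> \<tau> ` S. b < \<tau> k} = card {j \<in> S. \<tau> j < \<tau> k}"
    using card_image[OF inj_on_subset[OF i1(1)], of "{j \<in> S. \<tau> j < \<tau> k}"] by auto
  have "{b \<in> \<tau> ` S. \<tau>' b < \<tau>' (\<tau> k)} = \<tau> ` {j \<in> S. \<tau>' (\<tau> j) < \<tau>' (\<tau> k)}" by auto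
  hence c2: "card {b \<in> \<tau> ` S. \<tau>' b < \<tau>' (\<tau> k)} = card {j \<in> S. \<tau>' (\<tau> j) < \<tau>' (\<tau> k)}"
    using card_image[OF inj_on_subset[OF i1(1)], of "{j \<in> S. \<tau>' (\<tau> j) < \<tau>' (\<tau> k)}"] by auto
  let ?x = "(- 1 :: 'v mpoly) ^ card {j \<in> S. j < k}" and ?y = "(- 1 :: 'v mpoly) ^ card {j \<in> S. \<tau> j < \<tau> k}"
    and ?z = "(- 1 :: 'v mpoly) ^ card {j \<in> S. \<tau>' (\<tau> j) < \<tau>' (\<tau> k)}"
  have "inv_sgn (insert k S) \<tau> * inv_sgn (\<tau> ` insert k S) \<tau>'
     = (inv_sgn S \<tau> * ?x * ?y) * (inv_sgn (\<tau> ` S) \<tau>' * ?y * ?z)"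
    using insert(1) c1 c2 by (simp add: inv_sgn_insert[OF insert(1,2) insert.prems(1)] inv_sgn_insert[OF _ t i2])
  also have "\<dots> = (inv_sgn S \<tau> * inv_sgn (\<tau> ` S) \<tau>') * ?x * ?z * (?y * ?y)" by (simp only: ac_simps)
  also have "\<dots> = inv_sgn S (\<tau>' \<circ> \<tau>) * ?x * ?z" using insert.IH[OF i1] by (simp only: neg_one_power_sq mult_1_right)
  also have "\<dots> = inv_sgn (insert k S) (\<tau>' \<circ> \<tau>)" by (simp add: inv_sgn_insert[OF insert(1,2) i3])
  finally show ?case .
qed simp

definition reidx_list :: "nat set => (nat => nat) => nat => 'b list => 'b list" where
  "reidx_list A \<tau> L bs = map (\<lambda>l. bs ! inv_into A \<tau> l) [0..<L]"

definition oddset :: "('v, 'b) bfact list => nat set => 'b list => nat set" where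
  "oddset Ms A bs = {k \<in> A. bpar (Ms ! k) (bs ! k)}"

text \<open>Kill the odd part of the factors outside \<open>A\<close>, and move the factor at position \<open>k \<in> A\<close> to
  position \<open>\<tau> k\<close>.\<close>

definition reindex :: "('v, 'b) bfact list => nat set => (nat => nat) => nat => 'b list => ('b list \<Rightarrow>\<^sub>0 'v mpoly)" where
  "reindex Ms A \<tau> L bs = (if \<exists>k<length Ms. k \<notin> A \<and> bpar (Ms ! k) (bs ! k) then 0
     else single (reidx_list A \<tau> L bs) (inv_sgn (oddset Ms A bs) \<tau>))"

lemma reindex_killed: "k < length Ms ==> k \<notin> A ==> bpar (Ms ! k) (bs ! k) ==> reindex Ms A \<tau> L bs = 0" by (auto simp: reindex_def)

lemma reindex_alive:
  "(\<And>k. k < length Ms ==> k \<notin> A ==> \<not> bpar (Ms ! k) (bs ! k)) ==>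
    reindex Ms A \<tau> L bs = single (reidx_list A \<tau> L bs) (inv_sgn (oddset Ms A bs) \<tau>)" by (auto simp: reindex_def)

lemma inv_sgn_Const: "\<exists>c. inv_sgn S \<tau> = Const c"
proof -
  have "Const ((- 1) ^ k) = (- 1) ^ k" for k by (simp add: Const_power Const_uminus)
  thus ?thesis unfolding inv_sgn_def by metis
qed

lemma psubst_inv_sgn [simp]: "psubst f (inv_sgn S \<tau>) = inv_sgn S \<tau>"
proof -
  have "psubst f (- 1) = - 1" by (simp add: psubst_uminus)
  thus ?thesis by (simp add: inv_sgn_def psubst_power)
qed

lemma psubst_osgn [simp]: "psubst f (osgn Ms k bs) = osgn Ms k bs" by (simp add: osgn_Const)

text \<open>The combinatorics of a mark removal without its homotopies: positions in A survive and
  move along a bijection, the others vanish, and variables are renamed. Comparing two orders of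
  removal then becomes a comparison of maps on positions.\<close>

locale reindexing =
  fixes Ms Ns :: "('v, 'b) bfact list" and A :: "nat set" and \<tau> :: "nat => nat" and \<rho> :: "'v => 'v"
  assumes A: "A \<subseteq> {..<length Ms}" and \<tau>: "bij_betw \<tau> A {..<length Ns}"
    and Ns: "\<And>k. k \<in> A ==> Ns ! \<tau> k = brename \<rho> (Ms ! k)"
begin

abbreviation \<psi> :: "'v mpoly => 'v mpoly" where "\<psi> \<equiv> psubst (\<lambda>v. X (\<rho> v))"

definition E :: "('b list \<Rightarrow>\<^sub>0 'v mpoly) => ('b list \<Rightarrow>\<^sub>0 'v mpoly)" where
  "E = lin_ext \<psi> (reindex Ms A \<tau> (length Ns))"

lemma E_single: "E (single bs p) = psmul (\<psi> p) (reindex Ms A \<tau> (length Ns) bs)"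
  and E_add: "E (f + g) = E f + E g" and E_diff: "E (f - g) = E f - E g" and E_uminus: "E (- f) = - E f"
  and E_psmul: "E (psmul p f) = psmul (\<psi> p) (E f)" and E_0 [simp]: "E 0 = 0"
  and E_sum: "E (\<Sum>a\<in>B. h a) = (\<Sum>a\<in>B. E (h a))"
  by (simp_all add: E_def lin_ext_add lin_ext_diff lin_ext_uminus lin_ext_psmul lin_ext_sum)

lemma inj_\<tau>: "inj_on \<tau> A" and \<tau>_less: "k \<in> A ==> \<tau> k < length Ns" and finA: "finite A"
  and \<tau>_image: "\<tau> ` A = {..<length Ns}" using \<tau> A by (auto simp: bij_betw_def intro: finite_subset)

lemma A_less: "k \<in> A ==> k < length Ms" using A by auto

lemma length_reidx [simp]: "length (reidx_list A \<tau> L bs) = L" by (simp add: reidx_list_def)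

lemma nth_reidx: "k \<in> A ==> reidx_list A \<tau> (length Ns) bs ! \<tau> k = bs ! k" using inj_\<tau> \<tau>_less by (simp add: reidx_list_def)

lemma reidx_eqI:
  assumes "length cs = length Ns" "\<And>k. k \<in> A ==> cs ! \<tau> k = bs ! k"
  shows "reidx_list A \<tau> (length Ns) bs = cs"
proof (rule nth_equalityI)
  fix l assume "l < length (reidx_list A \<tau> (length Ns) bs)"
  hence "l \<in> \<tau> ` A" by (simp add: \<tau>_image)
  thus "reidx_list A \<tau> (length Ns) bs ! l = cs ! l" using assms(2) nth_reidx by auto
qed (use assms in simp)

lemma reidx_update:
  assumes "k \<in> A" "length bs = length Ms"
  shows "reidx_list A \<tau> (length Ns) (bs[k := c]) = (reidx_list A \<tau> (length Ns) bs)[\<tau> k := c]"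
proof (rule reidx_eqI)
  fix j assume "j \<in> A"
  thus "(reidx_list A \<tau> (length Ns) bs)[\<tau> k := c] ! \<tau> j = bs[k := c] ! j"
    using assms nth_reidx[of j bs] \<tau>_less A_less inj_onD[OF inj_\<tau>, of j k] by (cases "j = k") (auto simp: nth_list_update)
qed simp

lemma finite_oddset: "finite (oddset Ms A bs)" using finA by (simp add: oddset_def)

lemma osgn_reidx:
  assumes "k \<in> A"
  shows "osgn Ns (\<tau> k) (reidx_list A \<tau> (length Ns) bs) = (- 1) ^ card {j \<in> oddset Ms A bs. \<tau> j < \<tau> k}"
proof -
  let ?cs = "reidx_list A \<tau> (length Ns) bs"
  have "{l. l < \<tau> k \<and> bpar (Ns ! l) (?cs ! l)} = \<tau> ` {j \<in> oddset Ms A bs. \<tau> j < \<tau> k}"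
  proof (intro equalityI subsetI)
    fix l assume l: "l \<in> {l. l < \<tau> k \<and> bpar (Ns ! l) (?cs ! l)}"
    hence "l \<in> \<tau> ` A" using \<tau>_less[OF assms] by (auto simp: \<tau>_image)
    then obtain j where j: "j \<in> A" "l = \<tau> j" by auto
    thus "l \<in> \<tau> ` {j \<in> oddset Ms A bs. \<tau> j < \<tau> k}" using l Ns by (auto simp: oddset_def nth_reidx)
  next
    fix l assume "l \<in> \<tau> ` {j \<in> oddset Ms A bs. \<tau> j < \<tau> k}"
    thus "l \<in> {l. l < \<tau> k \<and> bpar (Ns ! l) (?cs ! l)}" using Ns by (auto simp: oddset_def nth_reidx)
  qed
  moreover have "inj_on \<tau> {j \<in> oddset Ms A bs. \<tau> j < \<tau> k}" using inj_\<tau> by (rule inj_on_subset) (auto simp: oddset_def)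
  ultimately show ?thesis by (simp add: osgn_def card_image)
qed

lemma osgn_oddset:
  assumes "k \<in> A" "\<And>j. j < length Ms ==> j \<notin> A ==> \<not> bpar (Ms ! j) (bs ! j)"
  shows "osgn Ms k bs = (- 1) ^ card {j \<in> oddset Ms A bs. j < k}"
proof -
  have "{j. j < k \<and> bpar (Ms ! j) (bs ! j)} = {j \<in> oddset Ms A bs. j < k}"
    using assms A_less[of k] by (auto simp: oddset_def) (metis less_trans)
  thus ?thesis by (simp add: osgn_def)
qed

text \<open>Changing the parity of entry k inserts k into the odd set or deletes it; since signs are
  their own inverses, \<open>inv_sgn_insert\<close> gives the same factor both times.\<close>

lemma inv_sgn_oddset_update:
  assumes k: "k \<in> A" "length bs = length Ms" and par: "bpar (Ms ! k) c \<noteq> bpar (Ms ! k) (bs ! k)"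
  shows "inv_sgn (oddset Ms A (bs[k := c])) \<tau> = inv_sgn (oddset Ms A bs) \<tau> *
    (- 1) ^ card {j \<in> oddset Ms A bs. j < k} * ((- 1) ^ card {j \<in> oddset Ms A bs. \<tau> j < \<tau> k} :: 'v mpoly)"
proof -
  let ?S = "oddset Ms A bs - {k}"
  have S: "finite ?S" "k \<notin> ?S" using finite_oddset by auto
  have inj: "inj_on \<tau> (insert k ?S)" using inj_\<tau> by (rule inj_on_subset) (use k in \<open>auto simp: oddset_def\<close>)
  have sets: "{j \<in> ?S. j < k} = {j \<in> oddset Ms A bs. j < k}" "{j \<in> ?S. \<tau> j < \<tau> k} = {j \<in> oddset Ms A bs. \<tau> j < \<tau> k}" by auto
  have ins: "inv_sgn (insert k ?S) \<tau> = inv_sgn ?S \<tau> * (- 1) ^ card {j \<in> oddset Ms A bs. j < k} * ((- 1) ^ card {j \<in> oddset Ms A bs. \<tau> j < \<tau> k} :: 'v mpoly)"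
    using inv_sgn_insert[OF S inj] unfolding sets .
  have upd: "oddset Ms A (bs[k := c]) - {k} = ?S" using k by (auto simp: oddset_def nth_list_update)
  have kc: "k \<in> oddset Ms A (bs[k := c]) \<longleftrightarrow> k \<notin> oddset Ms A bs" using k par A_less by (auto simp: oddset_def)
  show ?thesis
  proof (cases "k \<in> oddset Ms A bs")
    case True
    hence *: "oddset Ms A (bs[k := c]) = ?S" "insert k ?S = oddset Ms A bs" using kc upd by auto
    let ?x = "(- 1) ^ card {j \<in> oddset Ms A bs. j < k} :: 'v mpoly" and ?y = "(- 1) ^ card {j \<in> oddset Ms A bs. \<tau> j < \<tau> k} :: 'v mpoly"
    have "inv_sgn (oddset Ms A bs) \<tau> * ?x * ?y = inv_sgn ?S \<tau> * (?x * ?x) * (?y * ?y)" using ins unfolding *(2) by (simp only: ac_simps)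
    thus ?thesis unfolding *(1) by (simp add: neg_one_power_sq)
  next
    case False
    hence "oddset Ms A (bs[k := c]) = insert k ?S" "?S = oddset Ms A bs" using kc upd by auto
    thus ?thesis using ins by simp
  qed
qed

text \<open>The Koszul sign at k before the move, the change of the reordering sign and the Koszul
  sign at the new place cancel, so the operator is simply carried along.\<close>

lemma E_lop:
  assumes k: "k \<in> A" and bs: "length bs = length Ms"
    and T: "\<And>c. c \<in> keys (T (bs ! k)) ==> bpar (Ms ! k) c \<noteq> bpar (Ms ! k) (bs ! k)"
  shows "E (lop Ms k T bs) = LO Ns (\<tau> k) (\<lambda>b. cmap \<psi> (T b)) (reindex Ms A \<tau> (length Ns) bs)"
proof -
  let ?R = "reindex Ms A \<tau> (length Ns)" and ?cs = "reidx_list A \<tau> (length Ns) bs"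
  have 1: "E (lop Ms k T bs) = psmul (osgn Ms k bs) (lin_ext \<psi> (\<lambda>c. ?R (bs[k := c])) (T (bs ! k)))"
    by (simp add: lop_def E_psmul) (simp add: E_def lin_ext_put)
  show ?thesis
  proof (cases "\<exists>j<length Ms. j \<notin> A \<and> bpar (Ms ! j) (bs ! j)")
    case True
    then obtain j where j: "j < length Ms" "j \<notin> A" "bpar (Ms ! j) (bs ! j)" by blast
    hence "j \<noteq> k" using k by auto
    hence R0: "?R (bs[k := c]) = 0" for c using j by (intro reindex_killed[of j]) auto
    have "lin_ext \<psi> (\<lambda>c. ?R (bs[k := c])) (T (bs ! k)) = 0" by (simp add: lin_ext_def R0)
    thus ?thesis using 1 by (simp add: reindex_killed[OF j])
  next
    case False
    let ?x = "(- 1) ^ card {j \<in> oddset Ms A bs. j < k} :: 'v mpoly" and ?y = "(- 1) ^ card {j \<in> oddset Ms A bs. \<tau> j < \<tau> k} :: 'v mpoly"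
    let ?i = "inv_sgn (oddset Ms A bs) \<tau> :: 'v mpoly"
    have R: "?R (bs[k := c]) = single (?cs[\<tau> k := c]) (?i * ?x * ?y)" if "c \<in> keys (T (bs ! k))" for c
    proof -
      have "\<not> bpar (Ms ! j) (bs[k := c] ! j)" if "j < length Ms" "j \<notin> A" for j using False k that by (cases "j = k") auto
      hence "?R (bs[k := c]) = single (reidx_list A \<tau> (length Ns) (bs[k := c])) (inv_sgn (oddset Ms A (bs[k := c])) \<tau>)"
        by (rule reindex_alive)
      thus ?thesis by (simp only: inv_sgn_oddset_update[OF k bs T[OF that]] reidx_update[OF k bs])
    qed
    have "lin_ext \<psi> (\<lambda>c. ?R (bs[k := c])) (T (bs ! k)) = lin_ext \<psi> (\<lambda>c. psmul (?i * ?x * ?y) (single (?cs[\<tau> k := c]) 1)) (T (bs ! k))"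
      using R by (intro lin_ext_cong) auto
    also have "\<dots> = psmul (?i * ?x * ?y) (put (\<tau> k) ?cs (cmap \<psi> (T (bs ! k))))" unfolding lin_ext_cmap lin_ext_fun_psmul put_def ..
    finally have "E (lop Ms k T bs) = psmul (osgn Ms k bs * (?i * ?x * ?y)) (put (\<tau> k) ?cs (cmap \<psi> (T (bs ! k))))" unfolding 1 by simp
    also have "osgn Ms k bs = ?x" using osgn_oddset[OF k] False by blast
    also have "?x * (?i * ?x * ?y) = (?x * ?x) * (?i * ?y)" by (simp only: ac_simps)
    also have "\<dots> = ?i * ?y" by (simp only: neg_one_power_sq mult_1_left)
    finally have lhs: "E (lop Ms k T bs) = psmul (?i * ?y) (put (\<tau> k) ?cs (cmap \<psi> (T (bs ! k))))" .
    have "?R bs = single ?cs ?i" using False by (intro reindex_alive) auto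
    hence "LO Ns (\<tau> k) (\<lambda>b. cmap \<psi> (T b)) (?R bs) = psmul ?i (psmul (osgn Ns (\<tau> k) ?cs) (put (\<tau> k) ?cs (cmap \<psi> (T (bs ! k)))))"
      by (simp add: lop_def nth_reidx[OF k])
    thus ?thesis unfolding lhs by (simp add: osgn_reidx[OF k])
  qed
qed

end

text \<open>Wherever the composite is nonzero the entries killed on the way are even, so all signs
  are computed from one set of odd positions and \<open>inv_sgn_comp\<close> applies.\<close>

lemma reindex_comp:
  assumes R: "reindexing Ms Ns A \<tau> \<rho>" and R': "reindexing Ns Os A' \<tau>' \<rho>'"
    and bs: "length bs = length Ms"
  shows "reindexing.E Ns Os A' \<tau>' \<rho>' (reindexing.E Ms Ns A \<tau> \<rho> (single bs p)) =
    lin_ext (psubst (\<lambda>v. X (\<rho>' (\<rho> v)))) (reindex Ms {k \<in> A. \<tau> k \<in> A'} (\<tau>' \<circ> \<tau>) (length Os)) (single bs p)"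
proof -
  interpret R: reindexing Ms Ns A \<tau> \<rho> by (rule R)
  interpret R': reindexing Ns Os A' \<tau>' \<rho>' by (rule R')
  let ?A = "{k \<in> A. \<tau> k \<in> A'}" and ?cs = "reidx_list A \<tau> (length Ns) bs"
  have imA: "\<tau> ` ?A = A'" using R.\<tau>_image R'.A by auto
  have "inj_on (\<tau>' \<circ> \<tau>) ?A" using R.inj_\<tau> R'.inj_\<tau> by (intro comp_inj_on) (auto intro: inj_on_subset simp: imA)
  hence bij: "bij_betw (\<tau>' \<circ> \<tau>) ?A {..<length Os}" unfolding bij_betw_def image_comp[symmetric] imA R'.\<tau>_image by simp
  show ?thesis
  proof (cases "\<exists>k<length Ms. k \<notin> ?A \<and> bpar (Ms ! k) (bs ! k)")
    case False
    hence nk: "\<not> bpar (Ms ! k) (bs ! k)" if "k < length Ms" "k \<notin> A" for k using that by auto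
    have nk': "\<not> bpar (Ns ! l) (?cs ! l)" if l: "l < length Ns" "l \<notin> A'" for l
    proof
      assume lp: "bpar (Ns ! l) (?cs ! l)"
      obtain k where k: "k \<in> A" "l = \<tau> k" using R.\<tau>_image l(1) by (metis imageE lessThan_iff)
      hence "bpar (Ms ! k) (bs ! k)" using lp by (simp add: R.nth_reidx R.Ns)
      thus False using False k l R.A_less by auto
    qed
    have odd: "oddset Ms A bs = oddset Ms ?A bs" using False R.A_less by (auto simp: oddset_def)
    have odd': "oddset Ns A' ?cs = \<tau> ` oddset Ms ?A bs"
    proof -
      have "oddset Ns A' ?cs = {l \<in> \<tau> ` ?A. bpar (Ns ! l) (?cs ! l)}" by (simp add: oddset_def imA)
      also have "\<dots> = \<tau> ` oddset Ms ?A bs" by (auto simp: oddset_def R.nth_reidx R.Ns)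
      finally show ?thesis .
    qed
    have sub: "oddset Ms ?A bs \<subseteq> ?A" by (auto simp: oddset_def)
    have "inv_sgn (oddset Ms ?A bs) \<tau> * inv_sgn (\<tau> ` oddset Ms ?A bs) \<tau>' = (inv_sgn (oddset Ms ?A bs) (\<tau>' \<circ> \<tau>) :: 'a mpoly)"
    proof (rule inv_sgn_comp)
      show "finite (oddset Ms ?A bs)" using R.finA by (simp add: oddset_def)
      show "inj_on \<tau> (oddset Ms ?A bs)" using R.inj_\<tau> sub by (auto intro: inj_on_subset)
      show "inj_on \<tau>' (\<tau> ` oddset Ms ?A bs)" using R'.inj_\<tau> sub imA by (auto intro!: inj_on_subset[of \<tau>' A'])
    qed
    moreover have "reidx_list A' \<tau>' (length Os) ?cs = reidx_list ?A (\<tau>' \<circ> \<tau>) (length Os) bs"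
    proof (rule R'.reidx_eqI)
      fix l assume "l \<in> A'"
      then obtain k where k: "k \<in> ?A" "l = \<tau> k" using imA by auto
      have inv: "inv_into ?A (\<tau>' \<circ> \<tau>) (\<tau>' l) = k" using inv_into_f_f[OF _ k(1), of "\<tau>' \<circ> \<tau>"] bij k(2) by (simp add: bij_betw_def)
      show "reidx_list ?A (\<tau>' \<circ> \<tau>) (length Os) bs ! \<tau>' l = ?cs ! l"
        using k R.nth_reidx[of k bs] R'.\<tau>_less[OF \<open>l \<in> A'\<close>] inv by (simp add: reidx_list_def)
    qed (simp add: reidx_list_def)
    ultimately have *: "single (reidx_list A' \<tau>' (length Os) ?cs) (psubst (\<lambda>v. X (\<rho>' (\<rho> v))) p * inv_sgn (oddset Ms ?A bs) \<tau> * inv_sgn (\<tau> ` oddset Ms ?A bs) \<tau>')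
      = single (reidx_list ?A (\<tau>' \<circ> \<tau>) (length Os) bs) (psubst (\<lambda>v. X (\<rho>' (\<rho> v))) p * inv_sgn (oddset Ms ?A bs) (\<tau>' \<circ> \<tau>))"
      by (simp add: mult.assoc)
    have r1: "reindex Ms A \<tau> (length Ns) bs = single ?cs (inv_sgn (oddset Ms ?A bs) \<tau>)" using reindex_alive[OF nk] odd by simp
    have r2: "reindex Ns A' \<tau>' (length Os) ?cs = single (reidx_list A' \<tau>' (length Os) ?cs) (inv_sgn (\<tau> ` oddset Ms ?A bs) \<tau>')"
      using reindex_alive[OF nk'] odd' by simp
    have r3: "reindex Ms ?A (\<tau>' \<circ> \<tau>) (length Os) bs = single (reidx_list ?A (\<tau>' \<circ> \<tau>) (length Os) bs) (inv_sgn (oddset Ms ?A bs) (\<tau>' \<circ> \<tau>))"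
      using False by (intro reindex_alive) blast
    show ?thesis using * by (simp add: R.E_single R'.E_single r1 r2 r3 psubst_mult psubst_psubst)
  next
    case True
    then obtain k where k: "k < length Ms" "k \<notin> ?A" "bpar (Ms ! k) (bs ! k)" by blast
    have 0: "reindex Ms ?A (\<tau>' \<circ> \<tau>) (length Os) bs = 0" by (rule reindex_killed[OF k])
    show ?thesis
    proof (cases "k \<in> A")
      case False
      hence "reindex Ms A \<tau> (length Ns) bs = 0" using k by (intro reindex_killed[of k])
      thus ?thesis using 0 by (simp add: R.E_single)
    next
      case True
      hence "\<tau> k < length Ns" "\<tau> k \<notin> A'" "bpar (Ns ! \<tau> k) (?cs ! \<tau> k)"
        using k by (auto simp: R.\<tau>_less R.nth_reidx R.Ns)
      hence "reindex Ns A' \<tau>' (length Os) ?cs = 0" by (rule reindex_killed)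
      hence "R'.E (R.E (single bs p)) = 0" unfolding R.E_single reindex_def[of Ms] by (simp add: R'.E_single)
      thus ?thesis using 0 by simp
    qed
  qed
qed

section \<open>Removal of a mark\<close>

text \<open>A contraction of the arc: its anticommutator with the differential is multiplication by
  the second entry x - y. For \<open>lower\<close> it is the first entry, the divided power
  difference.\<close>

definition raise :: "nat list => (nat list \<Rightarrow>\<^sub>0 complex mpoly)" where
  "raise b = (if b = [0] then single [1] 1 else 0)"

definition lower :: "nat list => (nat list \<Rightarrow>\<^sub>0 complex mpoly)" where
  "lower b = (if b = [1] then single [0] 1 else 0)"

lemma raise_hom_map: "hom_map (arc_fact n x y) (arc_fact n x y) True (1 - int n) raise" unfolding hom_map_def arc_fact_simps
  by (auto simp: raise_def hom_iff car_iff arc_fact_simps lookup_single when_def split: if_splits)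

lemma lower_hom_map: "hom_map (arc_fact n x y) (arc_fact n x y) True (int n - 1) lower" unfolding hom_map_def arc_fact_simps
  by (auto simp: lower_def hom_iff car_iff arc_fact_simps lookup_single when_def split: if_splits)

lemma raise_odd: "odd_map (arc_fact n x y) raise" and lower_odd: "odd_map (arc_fact n x y) lower"
  using raise_hom_map lower_hom_map hom_map_car_map car_map_odd_map by blast+

lemma raise_bdif:
  assumes "b \<in> bas (arc_fact n x y)"
  shows "lin_ext id raise (bdif (arc_fact n x y) b) + bd (arc_fact n x y) (raise b) = single b (X x - X y)"
  using assms by (auto simp: arc_fact_simps raise_def)

lemma raise_const: "lookup (raise b) c \<in> polys {}" and lower_const: "lookup (lower b) c \<in> polys {}"
  by (auto simp: raise_def lower_def lookup_single when_def)

lemma LO_cmap_commute: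
  assumes D: "D 0 = 0" "\<And>p q. D (p + q) = D p + D q" and lin: "\<And>g p. g \<in> polys V ==> D (g * p) = g * D p"
    and T: "\<And>b c. b \<in> bas (Ms ! k) ==> lookup (T b) c \<in> polys V" and k: "k < length Ms" and f: "keys f \<subseteq> bas (btensor Ms)"
  shows "cmap D (LO Ms k T f) = LO Ms k T (cmap D f)" unfolding LO_def
proof (rule cmap_lin_ext_commute[OF D f lin])
  fix bs c assume "bs \<in> bas (btensor Ms)"
  hence "length bs = length Ms" "bs ! k \<in> bas (Ms ! k)" using k by (auto simp: bas_btensor)
  thus "lookup (lop Ms k T bs) c \<in> polys V" using T[of "bs ! k"] k by (auto simp: lop_def lookup_put when_def osgn_Const)
qed

text \<open>The arc at position a runs from y to x; p is whichever end is removed and q the one that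
  stays, so both orientations are covered. The potential and the scalars are free of p, which makes
  the homotopies linear over them.\<close>

locale mark_removal = reindexing Ms Ns A \<tau> \<rho>
  for Ms Ns :: "(complex, nat list) bfact list" and A \<tau> \<rho> +
  fixes p q :: complex and n a :: nat and w :: "nat => complex mpoly" and x y :: complex and V :: "complex set"
  assumes \<rho>: "\<rho> = id(p := q)" and a: "a < length Ms" and Aa: "A = {..<length Ms} - {a}" and arc: "Ms ! a = arc_fact n x y"
    and xy: "x = p \<and> y = q \<or> x = q \<and> y = p" and pq: "p \<noteq> q"
    and fact: "\<And>k. k < length Ms ==> factorization n (w k) (Ms ! k)"
    and w: "(\<Sum>k<length Ms. w k) \<in> polys V" and V: "V \<subseteq> bvars (btensor Ms)" "p \<notin> V"
    and q: "q \<in> bvars (btensor Ns)"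
begin

abbreviation K where "K \<equiv> btensor Ms"
abbreviation N where "N \<equiv> btensor Ns"

lemma \<psi>_identify: "\<psi> = identify p q" by (rule ext) (simp only: identify_def \<rho>)

lemma K_fact: "factorization n (\<Sum>k<length Ms. w k) K" using fact by (rule factorization_btensor)

lemma odd_bdif: "k < length Ms ==> odd_map (Ms ! k) (bdif (Ms ! k))" using fact factorization_odd_map by blast

definition sg :: "complex mpoly" where "sg = (if x = q then 1 else - 1)"

lemma sg: "X x - X y = sg * (X q - X p)" "sg * sg = 1" "sg \<in> polys {}" "homog 0 sg" using xy pq by (auto simp: sg_def intro: homog_uminus)

definition up :: "graph_module => graph_module" where
  "up f = psmul sg (LO Ms a raise f)"

definition dd :: "graph_module => graph_module" where
  "dd = cmap (divdiff p q)"

text \<open>\<open>up\<close> contracts q - p, and \<open>dd\<close> divides by q - p up to sign;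
  the minus sign gives h ((q - p) f) = up f.\<close>

definition h :: "graph_module => graph_module" where
  "h f = - up (dd f)"

text \<open>It vanishes on multiples of q - p and on the image of \<open>up\<close>, hence factors
  through E and supplies the section \<open>proj o iota\<close>.\<close>

definition proj :: "graph_module => graph_module" where
  "proj f = f - bd K (h f) - h (bd K f)"

lemma up_add: "up (f + g) = up f + up g" and up_uminus: "up (- f) = - up f" and up_psmul: "up (psmul r f) = psmul r (up f)" and up_0 [simp]: "up 0 = 0"
  by (simp_all add: up_def LO_add LO_uminus LO_psmul psmul_add_right psmul_minus_right mult.commute)

lemma dd_add: "dd (f + g) = dd f + dd g" and dd_0 [simp]: "dd 0 = 0"
  and dd_single: "dd (single bs r) = single bs (divdiff p q r)" by (simp_all add: dd_def cmap_add cmap_single divdiff_add[OF pq] divdiff_0[OF pq])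

lemma dd_const: "r \<in> polys W ==> p \<notin> W ==> dd (psmul r f) = psmul r (dd f)"
  by (intro poly_mapping_eqI) (simp add: dd_def lookup_cmap divdiff_0[OF pq] divdiff_mult_const[OF pq])

lemma dd_diff: "dd (psmul (X q - X p) f) = - f"
  by (intro poly_mapping_eqI) (simp only: dd_def lookup_cmap[of "divdiff p q", OF divdiff_0[OF pq]] lookup_psmul divdiff_mult_diff[OF pq] lookup_uminus)

lemma dd_keys: "keys (dd f) \<subseteq> keys f" unfolding dd_def by (rule keys_cmap) (rule divdiff_0[OF pq])

lemma dd_up: "keys f \<subseteq> bas K ==> dd (up f) = up (dd f)"
proof -
  assume "keys f \<subseteq> bas K"
  hence "dd (LO Ms a raise f) = LO Ms a raise (dd f)"
    unfolding dd_def using divdiff_add[OF pq] divdiff_0[OF pq] divdiff_mult_const[OF pq] raise_const a by (intro LO_cmap_commute[where V="{}"]) auto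
  thus ?thesis unfolding up_def using sg(3) by (simp add: dd_const)
qed

lemma up_up: "keys f \<subseteq> bas K ==> up (up f) = 0"
proof -
  assume f: "keys f \<subseteq> bas K"
  have "put a bs (lin_ext id raise (raise b)) = 0" for bs b by (simp add: raise_def)
  hence "LO Ms a raise (LO Ms a raise f) = 0" unfolding LO_LO_same[OF a f] by (simp add: lin_ext_def)
  thus ?thesis by (simp add: up_def LO_psmul)
qed

lemma LO_raise_keys: "keys f \<subseteq> bas K ==> keys (LO Ms a raise f) \<subseteq> bas K"
proof (induction f rule: module_basis_induct)
  case (single bs r)
  have "car_map K K True (lop Ms a raise)" using a by (intro lop_car_map) (simp_all add: arc hom_map_car_map[OF raise_hom_map])
  hence "keys (lop Ms a raise bs) \<subseteq> bas K" using single by (auto simp: car_map_def car_iff)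
  thus ?case using keys_psmul[of r "lop Ms a raise bs"] by auto
qed (simp_all add: LO_add keys_plus)

lemma up_keys: "keys f \<subseteq> bas K ==> keys (up f) \<subseteq> bas K" unfolding up_def using LO_raise_keys by (rule order_trans[OF keys_psmul])

lemma bd_up: "keys f \<subseteq> bas K ==> up (bd K f) + bd K (up f) = psmul (X q - X p) f"
proof -
  assume f: "keys f \<subseteq> bas K"
  have "LO Ms a raise (bd K f) + bd K (LO Ms a raise f) = psmul (X x - X y) f"
    using a odd_bdif raise_odd raise_bdif f by (intro btensor_anticommutator) (auto simp: arc)
  hence "psmul sg (LO Ms a raise (bd K f) + bd K (LO Ms a raise f)) = psmul sg (psmul (sg * (X q - X p)) f)" by (simp add: sg)
  thus ?thesis by (simp add: up_def psmul_add_right lin_ext_psmul sg(2) flip: mult.assoc)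
qed

lemma bd_keys: "keys f \<subseteq> bas K ==> keys (bd K f) \<subseteq> bas K"
proof (induction f rule: module_basis_induct)
  case (single bs r)
  have "keys (bdif K bs) \<subseteq> bas K" using factorization_odd_map[OF K_fact] single by (auto simp: odd_map_def)
  thus ?case using keys_psmul[of r "bdif K bs"] by auto
qed (simp_all add: lin_ext_add keys_plus)

lemma h_add: "h (f + g) = h f + h g" and h_0 [simp]: "h 0 = 0" by (simp_all add: h_def dd_add up_add)

lemma h_const: "r \<in> polys W ==> p \<notin> W ==> h (psmul r f) = psmul r (h f)" by (simp add: h_def dd_const up_psmul psmul_minus_right)

lemma h_uminus: "h (- f) = - h f" using h_add[of f "- f"] by (simp add: eq_neg_iff_add_eq_0 add.commute)

lemma h_diff: "h (f - g) = h f - h g" using h_add[of f "- g"] by (simp add: h_uminus)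

lemma h_psmul_diff: "h (psmul (X q - X p) f) = up f" by (simp add: h_def dd_diff up_uminus)

lemma proj_add: "proj (f + g) = proj f + proj g" and proj_0 [simp]: "proj 0 = 0" by (simp_all add: proj_def h_add lin_ext_add)

lemma proj_const: "r \<in> polys W ==> p \<notin> W ==> proj (psmul r f) = psmul r (proj f)"
  by (simp add: proj_def h_const lin_ext_psmul psmul_diff_right)

lemma proj_psmul_diff:
  assumes "keys f \<subseteq> bas K"
  shows "proj (psmul (X q - X p) f) = 0"
proof -
  have "proj (psmul (X q - X p) f) = psmul (X q - X p) f - bd K (up f) - up (bd K f)"
    unfolding proj_def lin_ext_psmul[OF ringhom_id] h_psmul_diff id_apply ..
  also have "\<dots> = 0" unfolding bd_up[OF assms, symmetric] by simp
  finally show ?thesis .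
qed

text \<open>The entries of \<open>up\<close> are constants, so \<open>dd\<close> commutes with it,
  and \<open>up\<close> squares to zero; thus h kills the image of \<open>up\<close>. What remains
  of h d (up f) is h ((q - p) f) = up f.\<close>

lemma proj_up: "keys f \<subseteq> bas K ==> proj (up f) = 0"
proof -
  assume f: "keys f \<subseteq> bas K"
  have "keys (dd f) \<subseteq> bas K" using f dd_keys by blast
  hence "h (up f) = 0" using f by (simp add: h_def dd_up up_up)
  moreover have "bd K (up f) = psmul (X q - X p) f - up (bd K f)" using bd_up[OF f] by (simp add: algebra_simps)
  hence "h (bd K (up f)) = up f - h (up (bd K f))" by (simp add: h_diff h_psmul_diff)
  moreover have "h (up (bd K f)) = 0"
  proof -
    have "keys (dd (bd K f)) \<subseteq> bas K" using bd_keys[OF f] dd_keys by blast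
    thus ?thesis using bd_keys[OF f] by (simp add: h_def dd_up up_up)
  qed
  ultimately show ?thesis by (simp add: proj_def)
qed

lemma E_up: "keys f \<subseteq> bas K ==> E (up f) = 0"
proof -
  assume "keys f \<subseteq> bas K"
  hence "E (LO Ms a raise f) = 0"
  proof (induction f rule: module_basis_induct)
    case (single bs r)
    have "reindex Ms A \<tau> (length Ns) (bs[a := [1]]) = 0"
      using a single by (intro reindex_killed[of a]) (auto simp: Aa bas_btensor arc_fact_simps arc)
    hence "E (lop Ms a raise bs) = 0" by (simp add: lop_def raise_def E_psmul E_single)
    thus ?case by (simp add: E_psmul)
  qed (auto simp: LO_add E_add)
  thus ?thesis by (simp add: up_def E_psmul)
qed

lemma E_h: "keys f \<subseteq> bas K ==> E (h f) = 0" using E_up[of "dd f"] dd_keys[of f] by (simp add: h_def E_uminus)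

text \<open>The differentials of the surviving factors are carried along by \<open>E_lop\<close>,
  and the bijection on positions reindexes their sum. Only the arc at a needs an argument of its
  own.\<close>

lemma E_bd: "keys f \<subseteq> bas K ==> E (bd K f) = bd N (E f)"
proof (induction f rule: module_basis_induct)
  case (single bs r)
  hence bs: "length bs = length Ms" "\<And>k. k < length Ms ==> bs ! k \<in> bas (Ms ! k)" by (auto simp: bas_btensor)
  let ?R = "reindex Ms A \<tau> (length Ns) bs"
  have lop: "E (lop Ms k (bdif (Ms ! k)) bs) = LO Ns (\<tau> k) (bdif (Ns ! \<tau> k)) ?R" if k: "k \<in> A" for k
    using E_lop[OF k bs(1), of "bdif (Ms ! k)"] odd_bdif[OF A_less[OF k]] bs(2)[OF A_less[OF k]] Ns[OF k] by (auto simp: odd_map_def)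
  \<comment> \<open>From the even generator the arc's differential reaches the odd part, which is
    killed; from the odd one it has coefficient x - y, which becomes zero at p = q.\<close>
  have 0: "E (lop Ms a (bdif (Ms ! a)) bs) = 0"
  proof (cases "bs ! a = [0]")
    case True
    have "reindex Ms A \<tau> (length Ns) (bs[a := [1]]) = 0" using a bs by (intro reindex_killed[of a]) (auto simp: Aa arc_fact_simps arc)
    thus ?thesis using True by (simp add: lop_def arc arc_fact_simps E_psmul E_single)
  next
    case False
    hence "bs ! a = [1]" using bs(2)[OF a] arc by (simp add: arc_fact_simps)
    moreover have "\<psi> (X x - X y) = 0" using xy by (auto simp: \<psi>_identify)
    ultimately show ?thesis by (simp add: lop_def arc arc_fact_simps E_psmul E_single psubst_mult)
  qed
  have "E (bdif K bs) = (\<Sum>k<length Ms. E (lop Ms k (bdif (Ms ! k)) bs))" by (simp add: bdif_btensor E_sum)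
  also have "\<dots> = (\<Sum>k\<in>A. E (lop Ms k (bdif (Ms ! k)) bs))" using 0 by (intro sum.mono_neutral_right) (auto simp: Aa)
  also have "\<dots> = (\<Sum>k\<in>A. LO Ns (\<tau> k) (bdif (Ns ! \<tau> k)) ?R)" using lop by (intro sum.cong) auto
  also have "\<dots> = (\<Sum>l<length Ns. LO Ns l (bdif (Ns ! l)) ?R)" by (rule sum.reindex_bij_betw[OF \<tau>])
  also have "\<dots> = bd N ?R" by (simp add: bd_btensor)
  finally show ?case by (simp add: E_psmul E_single lin_ext_psmul)
qed (auto simp: lin_ext_add E_add)

lemma h_keys: "keys f \<subseteq> bas K ==> keys (h f) \<subseteq> bas K"
proof -
  assume "keys f \<subseteq> bas K"
  hence "keys (up (dd f)) \<subseteq> bas K" using dd_keys by (intro up_keys) blast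
  thus ?thesis by (auto simp: h_def in_keys_iff)
qed

lemma E_proj: "keys f \<subseteq> bas K ==> E (proj f) = E f" using E_h[of f] E_h[of "bd K f"] E_bd[of "h f"] h_keys bd_keys
  by (simp add: proj_def E_diff)

text \<open>\<open>iota\<close> is the inverse of \<open>E\<close> on basis elements with even entry at \<open>a\<close>.\<close>

definition lift_list :: "nat list list => nat list list" where
  "lift_list cs = map (\<lambda>k. if k = a then [0] else cs ! \<tau> k) [0..<length Ms]"

definition iota :: "graph_module => graph_module" where
  "iota = lin_ext id (\<lambda>cs. single (lift_list cs) (inv_sgn (oddset Ms A (lift_list cs)) \<tau>))"

lemma nth_lift_list: "k \<in> A ==> lift_list cs ! k = cs ! \<tau> k" "lift_list cs ! a = [0]" "length (lift_list cs) = length Ms"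
  using a by (auto simp: lift_list_def Aa)

lemma lift_list_bas: "cs \<in> bas N ==> lift_list cs \<in> bas K" unfolding bas_btensor
proof (intro conjI allI impI)
  fix k assume cs: "length cs = length Ns \<and> (\<forall>k<length Ns. cs ! k \<in> bas (Ns ! k))" and k: "k < length Ms"
  show "lift_list cs ! k \<in> bas (Ms ! k)"
  proof (cases "k = a")
    case True thus ?thesis by (simp add: nth_lift_list arc arc_fact_simps)
  next
    case False
    hence "k \<in> A" using k by (simp add: Aa)
    hence "cs ! \<tau> k \<in> bas (Ns ! \<tau> k)" using cs \<tau>_less by blast
    thus ?thesis using \<open>k \<in> A\<close> by (simp add: nth_lift_list Ns)
  qed
qed (simp add: nth_lift_list)

lemma reidx_lift_list: "cs \<in> bas N ==> reidx_list A \<tau> (length Ns) (lift_list cs) = cs"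
  by (rule reidx_eqI) (auto simp: bas_btensor nth_lift_list)

lemma lift_list_reidx:
  assumes "bs \<in> bas K" "bs ! a = [0]"
  shows "lift_list (reidx_list A \<tau> (length Ns) bs) = bs"
proof (rule nth_equalityI)
  fix i assume "i < length (lift_list (reidx_list A \<tau> (length Ns) bs))"
  thus "lift_list (reidx_list A \<tau> (length Ns) bs) ! i = bs ! i"
    using assms nth_reidx[of i bs] by (cases "i = a") (auto simp: lift_list_def Aa nth_lift_list)
qed (use assms in \<open>simp add: nth_lift_list bas_btensor\<close>)

lemma not_killed: "bs ! a = [0] ==> \<not> (\<exists>k<length Ms. k \<notin> A \<and> bpar (Ms ! k) (bs ! k))" by (auto simp: Aa arc arc_fact_simps)

lemma reindex_even: "bs ! a = [0] ==> reindex Ms A \<tau> (length Ns) bs = single (reidx_list A \<tau> (length Ns) bs) (inv_sgn (oddset Ms A bs) \<tau>)"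
  using not_killed by (intro reindex_alive) blast

lemma E_iota_single: "cs \<in> bas N ==> E (iota (single cs r)) = single cs (\<psi> r)"
  by (simp add: iota_def E_psmul E_single reindex_even nth_lift_list reidx_lift_list psubst_mult inv_sgn_sq mult.assoc)

lemma iota_add: "iota (f + g) = iota f + iota g" and iota_psmul: "iota (psmul r f) = psmul r (iota f)"
  and iota_0 [simp]: "iota 0 = 0" by (simp_all add: iota_def lin_ext_add lin_ext_psmul)

lemma iota_keys: "keys f \<subseteq> bas N ==> keys (iota f) \<subseteq> bas K"
proof (induction f rule: module_basis_induct)
  case (single cs r)
  thus ?case using lift_list_bas[of cs] by (auto simp: iota_def keys_single)
qed (simp_all add: iota_add keys_plus)

lemma bvars_N: "bvars N \<subseteq> bvars K" "p \<notin> bvars N"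
proof -
  have *: "bvars N = (\<Union>k\<in>A. \<rho> ` bvars (Ms ! k))"
  proof -
    have "set Ns = (\<lambda>k. Ns ! k) ` {..<length Ns}" by (auto simp: set_conv_nth)
    also have "\<dots> = (\<lambda>k. Ns ! \<tau> k) ` A" unfolding \<tau>_image[symmetric] by (simp add: image_comp)
    finally have "set Ns = (\<lambda>k. brename \<rho> (Ms ! k)) ` A" using Ns by (auto simp: image_iff)
    thus ?thesis by simp
  qed
  have "q \<in> bvars (Ms ! a)" using xy by (auto simp: arc arc_fact_simps)
  hence "q \<in> bvars K" using bvars_nth[OF a] by blast
  moreover have "bvars (Ms ! k) \<subseteq> bvars K" if "k \<in> A" for k using bvars_nth[OF A_less[OF that]] .
  ultimately show "bvars N \<subseteq> bvars K" unfolding * \<rho> by (auto split: if_splits)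
  show "p \<notin> bvars N" unfolding * \<rho> using pq by (auto split: if_splits)
qed

lemma bvars_K: "bvars K - {p} \<subseteq> bvars N"
proof
  fix v assume v: "v \<in> bvars K - {p}"
  then obtain k where k: "k < length Ms" "v \<in> bvars (Ms ! k)" by (auto simp: in_set_conv_nth)
  show "v \<in> bvars N"
  proof (cases "k = a")
    case True
    hence "v = q" using v k xy by (auto simp: arc arc_fact_simps)
    thus ?thesis using q by simp
  next
    case False
    hence "k \<in> A" using k by (simp add: Aa)
    hence "v \<in> bvars (Ns ! \<tau> k)" using Ns v k by (auto simp: image_iff \<rho>)
    thus ?thesis using bvars_nth[OF \<tau>_less[OF \<open>k \<in> A\<close>]] by blast
  qed
qed

lemma V_N: "V \<subseteq> bvars N" using V bvars_K by auto

lemma \<psi>_polys: "r \<in> polys (bvars K) ==> \<psi> r \<in> polys (bvars N)" unfolding \<psi>_identify by (rule identify_polys[OF _ q bvars_K])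

lemma \<psi>_self: "r \<in> polys (bvars N) ==> \<psi> r = r" unfolding \<psi>_identify using bvars_N(2) by (intro identify_self[OF pq])

lemma E_iota: "f \<in> car N i ==> E (iota f) = f"
proof -
  assume f: "f \<in> car N i"
  have "E (iota f) = lin_ext \<psi> (\<lambda>cs. single cs 1) f" using car_keys[OF f] by (induction f rule: module_basis_induct)
      (auto simp: E_add iota_add lin_ext_add E_iota_single)
  also have "\<dots> = lin_ext id (\<lambda>cs. single cs 1) f" using f \<psi>_self by (intro lin_ext_cong) (auto simp: car_iff)
  finally show ?thesis by simp
qed

text \<open>On an even entry at a, \<open>iota o E\<close> merely sets p = q in the coefficient. The
  difference is q - p times a divided difference, which \<open>proj\<close> does not see.\<close>

lemma proj_iota_E: "keys f \<subseteq> bas K ==> proj (iota (E f)) = proj f"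
proof (induction f rule: module_basis_induct)
  case (single bs r)
  have bs: "length bs = length Ms" using single by (simp add: bas_btensor)
  show ?case
  proof (cases "bs ! a = [0]")
    case True
    hence "iota (E (single bs r)) = single bs (\<psi> r)" by (simp add: E_single iota_def reindex_even lift_list_reidx single inv_sgn_sq mult.assoc)
    also have "\<dots> = psmul (X q - X p) (single bs (divdiff p q r)) + single bs r"
      using divdiff[OF pq, of r] by (simp add: \<psi>_identify mult.commute flip: single_add)
    finally show ?thesis using proj_psmul_diff[of "single bs (divdiff p q r)"] single by (simp add: proj_add keys_single)
  next
    case False
    hence b1: "bs ! a = [1]" using single a by (auto simp: bas_btensor arc arc_fact_simps)
    \<comment> \<open>An odd entry at a arises by raising the even one, so the basis element lies in
      the image of \<open>up\<close>, which both sides kill.\<close>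
    have "bs = bs[a := [0], a := [1]]" using b1 by (metis list_update_id list_update_overwrite)
    hence "single bs r = up (single (bs[a := [0]]) (sg * osgn Ms a bs * r))"
      using a bs b1 by (simp add: up_def lop_def raise_def osgn_ge sg(2) mult.assoc[symmetric] osgn_sq)
         (simp add: ac_simps sg(2) osgn_sq)
    moreover have "keys (single (bs[a := [0]]) (sg * osgn Ms a bs * r)) \<subseteq> bas K"
      using single a by (auto simp: bas_btensor nth_list_update arc arc_fact_simps)
    ultimately show ?thesis using proj_up E_up by simp
  qed
qed (auto simp: E_add iota_add proj_add)

lemma par_deg_reidx:
  assumes bs: "length bs = length Ms" "bs ! a = [0]"
  shows "bpar N (reidx_list A \<tau> (length Ns) bs) = bpar K bs" "bdeg N (reidx_list A \<tau> (length Ns) bs) = bdeg K bs"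
proof -
  let ?cs = "reidx_list A \<tau> (length Ns) bs"
  have "{l. l < length Ns \<and> bpar (Ns ! l) (?cs ! l)} = \<tau> ` {k. k < length Ms \<and> bpar (Ms ! k) (bs ! k)}"
  proof (intro equalityI subsetI)
    fix l assume l: "l \<in> {l. l < length Ns \<and> bpar (Ns ! l) (?cs ! l)}"
    then obtain k where "k \<in> A" "l = \<tau> k" using \<tau>_image by (metis (no_types, lifting) imageE lessThan_iff mem_Collect_eq)
    thus "l \<in> \<tau> ` {k. k < length Ms \<and> bpar (Ms ! k) (bs ! k)}" using l by (auto simp: nth_reidx A_less Ns)
  next
    fix l assume "l \<in> \<tau> ` {k. k < length Ms \<and> bpar (Ms ! k) (bs ! k)}"
    then obtain k where k: "k < length Ms" "bpar (Ms ! k) (bs ! k)" "l = \<tau> k" by auto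
    hence "k \<in> A" using not_killed[OF bs(2)] by blast
    thus "l \<in> {l. l < length Ns \<and> bpar (Ns ! l) (?cs ! l)}" using k by (auto simp: Ns nth_reidx \<tau>_less)
  qed
  moreover have "inj_on \<tau> {k. k < length Ms \<and> bpar (Ms ! k) (bs ! k)}" using inj_\<tau> not_killed[OF bs(2)] by (auto intro: inj_on_subset)
  ultimately have "card {l. l < length Ns \<and> bpar (Ns ! l) (?cs ! l)} = card {k. k < length Ms \<and> bpar (Ms ! k) (bs ! k)}"
    by (simp add: card_image)
  thus "bpar N ?cs = bpar K bs" by (simp add: btensor_def)
  have "(\<Sum>l<length Ns. bdeg (Ns ! l) (?cs ! l)) = (\<Sum>k\<in>A. bdeg (Ns ! \<tau> k) (?cs ! \<tau> k))"
    by (rule sum.reindex_bij_betw[OF \<tau>, symmetric])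
  also have "\<dots> = (\<Sum>k\<in>A. bdeg (Ms ! k) (bs ! k))" by (intro sum.cong) (auto simp: Ns nth_reidx)
  also have "\<dots> = (\<Sum>k<length Ms. bdeg (Ms ! k) (bs ! k))" using bs by (intro sum.mono_neutral_left) (auto simp: Aa arc arc_fact_simps)
  finally show "bdeg N ?cs = bdeg K bs" by (simp add: btensor_def)
qed

lemma reidx_bas: "bs \<in> bas K ==> reidx_list A \<tau> (length Ns) bs \<in> bas N" unfolding bas_btensor
proof (intro conjI allI impI)
  fix l assume bs: "length bs = length Ms \<and> (\<forall>k<length Ms. bs ! k \<in> bas (Ms ! k))" and "l < length Ns"
  then obtain k where "k \<in> A" "l = \<tau> k" using \<tau>_image by (metis imageE lessThan_iff)
  thus "reidx_list A \<tau> (length Ns) bs ! l \<in> bas (Ns ! l)" using bs by (auto simp: Ns nth_reidx A_less)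
qed simp

lemma single_Const_hom: "b \<in> bas M ==> single b (Const c) \<in> hom M (bpar M b) (bdeg M b)"
  by (auto simp: hom_iff car_iff lookup_single when_def)

lemma reindex_hom_map: "hom_map K N False 0 (reindex Ms A \<tau> (length Ns))" unfolding hom_map_def
proof
  fix bs assume bs: "bs \<in> bas K"
  hence len: "length bs = length Ms" by (simp add: bas_btensor)
  obtain c where c: "inv_sgn (oddset Ms A bs) \<tau> = (Const c :: complex mpoly)" using inv_sgn_Const by blast
  show "reindex Ms A \<tau> (length Ns) bs \<in> hom N (bpar K bs \<noteq> False) (bdeg K bs + 0)"
  proof (cases "bs ! a = [0]")
    case True
    thus ?thesis using single_Const_hom[OF reidx_bas[OF bs], of c] par_deg_reidx[OF len True] c by (simp add: reindex_even)
  next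
    case False
    hence "bs ! a = [1]" using bs a by (auto simp: bas_btensor arc arc_fact_simps)
    hence "reindex Ms A \<tau> (length Ns) bs = 0" using a by (intro reindex_killed[of a]) (auto simp: Aa arc arc_fact_simps)
    thus ?thesis by simp
  qed
qed

lemma iota_hom_map: "hom_map N K False 0 (\<lambda>cs. single (lift_list cs) (inv_sgn (oddset Ms A (lift_list cs)) \<tau>))" unfolding hom_map_def
proof
  fix cs assume cs: "cs \<in> bas N"
  obtain c where c: "inv_sgn (oddset Ms A (lift_list cs)) \<tau> = (Const c :: complex mpoly)" using inv_sgn_Const by blast
  have "bpar K (lift_list cs) = bpar N cs" "bdeg K (lift_list cs) = bdeg N cs"
    using par_deg_reidx[of "lift_list cs"] by (simp_all add: nth_lift_list reidx_lift_list[OF cs])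
  thus "single (lift_list cs) (inv_sgn (oddset Ms A (lift_list cs)) \<tau>) \<in> hom K (bpar N cs \<noteq> False) (bdeg N cs + 0)"
    using single_Const_hom[OF lift_list_bas[OF cs], of c] c by simp
qed

lemma E_gmor: "mor V K N (\<lambda>i. E)"
proof (rule gmorI)
  fix i m assume m: "m \<in> car K i"
  show "E m \<in> car N i" unfolding E_def using car_map_apply[OF hom_map_car_map[OF reindex_hom_map] m, of \<psi>] \<psi>_polys by simp
  show "E (bd K m) = bd N (E m)" using E_bd[OF car_keys[OF m]] .
next
  fix i k m assume m: "m \<in> hom K i k"
  show "E m \<in> hom N i k" unfolding E_def using hom_map_apply[OF reindex_hom_map m, of \<psi>] \<psi>_polys by (auto intro: homog_psubst)
next
  fix r m assume "r \<in> polys V"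
  hence "\<psi> r = r" using \<psi>_self V_N polys_mono by blast
  thus "E (psmul r m) = psmul r (E m)" by (simp add: E_psmul)
qed (simp add: E_add)

lemma dd_hom: "m \<in> hom K i k ==> dd m \<in> hom K i (k - 2)" and dd_car: "m \<in> car K i ==> dd m \<in> car K i"
proof -
  have pqK: "p \<in> bvars K" "q \<in> bvars K" using bvars_nth[OF a] xy by (auto simp: arc arc_fact_simps)
  show "m \<in> car K i ==> dd m \<in> car K i" unfolding dd_def using divdiff_polys[OF pq _ pqK] divdiff_0[OF pq] by (intro car_cmap)
  show "m \<in> hom K i k ==> dd m \<in> hom K i (k - 2)"
    using hom_cmap[of m K i k "divdiff p q" "-2"] divdiff_polys[OF pq _ pqK] divdiff_0[OF pq] divdiff_homog[OF pq] by (simp add: dd_def)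
qed

lemma h_car: "m \<in> car K i ==> h m \<in> car K (\<not> i)" unfolding h_def up_def using LO_car[OF a, of raise "dd m" i] dd_car sg(3)
  by (auto simp: arc hom_map_car_map[OF raise_hom_map] intro!: car_uminus car_psmul intro: polys_mono)

text \<open>\<open>dd\<close> lowers the degree by 2 and \<open>raise\<close> adds 1 - n, in total
  -n - 1.\<close>

lemma h_hom: "m \<in> hom K i k ==> h m \<in> hom K (\<not> i) (k - int n - 1)"
proof -
  assume m: "m \<in> hom K i k"
  have "LO Ms a raise (dd m) \<in> hom K (\<not> i) (k - 2 + (1 - int n))"
    using LO_hom[OF a, of "1 - int n" raise "dd m" i "k - 2"] raise_hom_map dd_hom[OF m] by (simp add: arc)
  hence "psmul sg (LO Ms a raise (dd m)) \<in> hom K (\<not> i) (k - 2 + (1 - int n) + 0)" using sg(3,4) by (intro hom_psmul) (auto intro: polys_mono)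
  thus ?thesis unfolding h_def up_def by (auto simp: algebra_simps intro: hom_uminus)
qed

lemma iota_car: "m \<in> car N i ==> iota m \<in> car K i" and iota_hom: "m \<in> hom N i k ==> iota m \<in> hom K i k"
proof -
  have V: "r \<in> polys (bvars N) ==> id r \<in> polys (bvars K)" for r using polys_mono[OF _ bvars_N(1)] by simp
  show "m \<in> car N i ==> iota m \<in> car K i" using car_map_apply[OF hom_map_car_map[OF iota_hom_map] _ V, of m i] unfolding iota_def by simp
  show "m \<in> hom N i k ==> iota m \<in> hom K i k" using hom_map_apply[OF iota_hom_map _ V, of m i k] unfolding iota_def by simp
qed

text \<open>E is onto and commutes with d, so the target inherits the property from K.\<close>

lemma N_bd_closed: "bd_closed N" unfolding bd_closed_def
proof (intro allI ballI)
  fix i m assume m: "m \<in> car N i"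
  have "bd N m = E (bd K (iota m))" using E_bd[OF iota_keys[OF car_keys[OF m]]] E_iota[OF m] by simp
  thus "bd N m \<in> car N (\<not> i)" using gmor_car[OF E_gmor bd_car[OF K_fact iota_car[OF m]]] by simp
qed

lemma proj_car: "m \<in> car K i ==> proj m \<in> car K i" unfolding proj_def using h_car[OF bd_car[OF K_fact]] bd_car[OF K_fact h_car]
  by (metis (full_types) car_diff)

lemma proj_hom: "m \<in> hom K i k ==> proj m \<in> hom K i k"
proof -
  assume m: "m \<in> hom K i k"
  have "h (bd K m) \<in> hom K i k" using h_hom[OF bd_hom[OF K_fact m]] by simp
  moreover have "bd K (h m) \<in> hom K i k" using bd_hom[OF K_fact h_hom[OF m]] by simp
  ultimately show ?thesis unfolding proj_def using m by (intro hom_diff)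
qed

lemma removal_inverse: "hinverse n V K N (\<lambda>i. E) (\<lambda>i. proj \<circ> iota)"
proof (rule hmf_inverse_retract[where K=K and N=N and e=E and s="proj \<circ> iota" and h=h and w="\<Sum>k<length Ms. w k"])
  show "mor V K N (\<lambda>i. E)" by (rule E_gmor)
next
  fix i m assume "m \<in> car N i"
  thus "(proj \<circ> iota) m \<in> car K i" using iota_car proj_car by simp
next
  fix i k m assume "m \<in> hom N i k"
  thus "(proj \<circ> iota) m \<in> hom K i k" using iota_hom proj_hom by simp
next
  fix i m m' assume "m \<in> car N i" "m' \<in> car N i"
  show "(proj \<circ> iota) (m + m') = (proj \<circ> iota) m + (proj \<circ> iota) m'" by (simp add: iota_add proj_add)
next
  fix i r m assume "r \<in> polys V"
  thus "(proj \<circ> iota) (psmul r m) = psmul r ((proj \<circ> iota) m)" using V(2) by (simp add: iota_psmul proj_const)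
next
  fix i m assume "m \<in> car N i"
  thus "E ((proj \<circ> iota) m) = m" using E_proj[OF iota_keys[OF car_keys]] E_iota by simp
next
  fix i m assume "m \<in> car K i"
  thus "h m \<in> car K (\<not> i)" by (rule h_car)
next
  fix i k m assume "m \<in> hom K i k"
  thus "h m \<in> hom K (\<not> i) (k - int n - 1)" by (rule h_hom)
next
  fix i m m' assume "m \<in> car K i" "m' \<in> car K i"
  show "h (m + m') = h m + h m'" by (rule h_add)
next
  fix i r m assume "r \<in> polys V"
  thus "h (psmul r m) = psmul r (h m)" using V(2) by (rule h_const)
next
  fix i m assume "m \<in> car K i"
  thus "(proj \<circ> iota) (E m) = m - bd K (h m) - h (bd K m)" using proj_iota_E[OF car_keys] by (simp add: proj_def)
next
  show "factorization n (\<Sum>k<length Ms. w k) K" by (rule K_fact)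
  show "bd_closed N" by (rule N_bd_closed)
  show "(\<Sum>k<length Ms. w k) \<in> polys V" by (rule w)
qed

end

lemma car_induct [consumes 1, case_names zero single add]:
  assumes "f \<in> car M i" "P 0" "\<And>b r. b \<in> bas M ==> bpar M b = i ==> r \<in> polys (bvars M) ==> P (single b r)"
    "\<And>f g. P f ==> P g ==> P (f + g)"
  shows "P f"
proof -
  have "P (\<Sum>b\<in>B. single b (lookup f b))" if "finite B" "B \<subseteq> keys f" for B
    using that assms by (induction B rule: finite_induct) (auto simp: car_iff)
  from this[of "keys f"] show ?thesis by (simp flip: poly_mapping_sum_singles)
qed

lemma reindex_cong:
  fixes Ms :: "('v, 'b) bfact list"
  assumes "\<And>k. k \<in> A ==> \<tau> k = \<tau>' k"
  shows "reindex Ms A \<tau> L = reindex Ms A \<tau>' L"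
proof -
  have "inv_into A \<tau> = inv_into A \<tau>'" unfolding inv_into_def using assms by (intro ext arg_cong[where f=Eps]) auto
  moreover have "inv_sgn (oddset Ms A bs) \<tau> = (inv_sgn (oddset Ms A bs) \<tau>' :: 'v mpoly)" for bs
    by (rule inv_sgn_cong) (simp add: oddset_def assms)
  ultimately show ?thesis by (simp only: reindex_def reidx_list_def fun_eq_iff) simp
qed

text \<open>By \<open>reindex_comp\<close> a composite is determined by the surviving positions,
  their final places and the composite renaming of the variables that occur.\<close>

lemma reindexing_commute:
  assumes R: "reindexing Ms Ns A \<tau> \<rho>" "reindexing Ns Os B \<sigma> \<rho>2"
    and R': "reindexing Ms Ns' A' \<tau>' \<rho>'" "reindexing Ns' Os B' \<sigma>' \<rho>2'"
    and A: "{k \<in> A. \<tau> k \<in> B} = {k \<in> A'. \<tau>' k \<in> B'}"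
    and \<tau>: "\<And>k. k \<in> A ==> \<tau> k \<in> B ==> \<sigma> (\<tau> k) = \<sigma>' (\<tau>' k)"
    and \<rho>: "\<And>v. v \<in> bvars (btensor Ms) ==> \<rho>2 (\<rho> v) = \<rho>2' (\<rho>' v)"
    and f: "f \<in> car (btensor Ms) i"
  shows "reindexing.E Ns Os B \<sigma> \<rho>2 (reindexing.E Ms Ns A \<tau> \<rho> f) = reindexing.E Ns' Os B' \<sigma>' \<rho>2' (reindexing.E Ms Ns' A' \<tau>' \<rho>' f)"
  using f
proof (induction f rule: car_induct)
  case zero
  show ?case using R R' by (simp add: reindexing.E_0)
next
  case (single bs r)
  hence len: "length bs = length Ms" by (simp add: bas_btensor)
  have "reindex Ms {k \<in> A. \<tau> k \<in> B} (\<sigma> \<circ> \<tau>) (length Os) = reindex Ms {k \<in> A'. \<tau>' k \<in> B'} (\<sigma>' \<circ> \<tau>') (length Os)"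
    unfolding A[symmetric] by (rule reindex_cong) (simp add: \<tau>)
  moreover have "psubst (\<lambda>v. X (\<rho>2 (\<rho> v))) r = psubst (\<lambda>v. X (\<rho>2' (\<rho>' v))) r"
    using single(3) \<rho> by (intro psubst_cong) auto
  ultimately show ?case unfolding reindex_comp[OF R len] reindex_comp[OF R' len] by simp
next
  case (add f g)
  thus ?case using R R' by (simp add: reindexing.E_add)
qed

text \<open>An interior mark can be merged with either of its neighbours. The two maps are homotopic,
  because the second one sends the section of the first one to the identity.\<close>

lemma removals_homotopic:
  assumes Amr: "mark_removal Ms Ns A \<tau> \<rho> y x n a w x y V" and Bmr: "mark_removal Ms Ns B \<tau>' \<rho>' y z n b w y z V"
    and ab: "a \<noteq> b" and other: "\<And>k. k < length Ms ==> k \<noteq> a ==> k \<noteq> b ==> y \<notin> bvars (Ms ! k)"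
    and \<tau>\<tau>': "\<And>k. k < length Ms ==> k \<noteq> a ==> k \<noteq> b ==> \<tau> k = \<tau>' k" "\<tau> b = \<tau>' a"
  shows "htpy n V (btensor Ms) (btensor Ns) (\<lambda>i. reindexing.E Ms Ns A \<tau> \<rho>) (\<lambda>i. reindexing.E Ms Ns B \<tau>' \<rho>')"
proof -
  interpret A: mark_removal Ms Ns A \<tau> \<rho> y x n a w x y V by (rule Amr)
  interpret B: mark_removal Ms Ns B \<tau>' \<rho>' y z n b w y z V by (rule Bmr)
  have aB: "a \<in> B" and bA: "b \<in> A" using ab A.a B.a by (auto simp: A.Aa B.Aa)
  \<comment> \<open>Where both arcs carry their even generators the two maps agree literally: the
    same odd entries end up in the same places.\<close>
  have both: "A.E (single bs 1) = B.E (single bs 1)" if bs: "length bs = length Ms" "bs ! a = [0]" "bs ! b = [0]" for bs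
  proof -
    have ev: "\<not> bpar (Ms ! a) (bs ! a)" "\<not> bpar (Ms ! b) (bs ! b)" using bs by (auto simp: A.arc B.arc arc_fact_simps)
    have odd: "oddset Ms A bs = oddset Ms B bs" using ev by (auto simp: oddset_def A.Aa B.Aa)
    have S: "\<tau> k = \<tau>' k" if "k \<in> oddset Ms A bs" for k using that ev by (intro \<tau>\<tau>'(1)) (auto simp: oddset_def A.Aa)
    have "reidx_list A \<tau> (length Ns) bs = reidx_list B \<tau>' (length Ns) bs"
    proof (rule A.reidx_eqI)
      fix k assume k: "k \<in> A"
      show "reidx_list B \<tau>' (length Ns) bs ! \<tau> k = bs ! k"
      proof (cases "k = b")
        case True
        thus ?thesis using B.nth_reidx[OF aB, of bs] bs by (simp add: \<tau>\<tau>'(2))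
      next
        case False
        hence "\<tau> k = \<tau>' k" "k \<in> B" using k \<tau>\<tau>'(1) by (auto simp: A.Aa B.Aa)
        thus ?thesis using B.nth_reidx[of k bs] by simp
      qed
    qed (simp add: reidx_list_def)
    thus ?thesis by (simp add: A.E_single B.E_single A.reindex_even[OF bs(2)] B.reindex_even[OF bs(3)] odd inv_sgn_cong[OF S] flip: odd)
  qed
  have osg: "A.sg = 1" by (simp add: A.sg_def)
  have dd_lop: "A.dd (lop Ms k T bs) = lop Ms k (\<lambda>b. cmap (divdiff y x) (T b)) bs" if "k < length Ms" "length bs = length Ms" for k T bs
  proof -
    have "osgn Ms k bs \<in> polys {}" by (simp add: osgn_Const)
    hence "A.dd (lop Ms k T bs) = psmul (osgn Ms k bs) (A.dd (put k bs (T (bs ! k))))" unfolding lop_def by (intro A.dd_const[of _ "{}"]) auto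
    also have "A.dd (put k bs (T (bs ! k))) = put k bs (cmap (divdiff y x) (T (bs ! k)))" by (intro poly_mapping_eqI)
         (simp add: A.dd_def lookup_cmap divdiff_0[OF A.pq] lookup_put that when_def)
    finally show ?thesis by (simp add: lop_def)
  qed
  \<comment> \<open>The coefficient 1 has divided difference zero, so the section differs from the
    basis element only by \<open>up\<close> of the divided difference of its boundary. Only the arcs
    a and b involve y and contribute to it.\<close>
  have key: "B.E (A.proj (single bs 1)) = A.E (single bs 1)" if bs: "bs \<in> bas A.K" "bs ! a = [0]" for bs
  proof -
    let ?D = "\<lambda>k. lop Ms k (\<lambda>c. cmap (divdiff y x) (bdif (Ms ! k) c)) bs"
    have len: "length bs = length Ms" and bk: "\<And>k. k < length Ms ==> bs ! k \<in> bas (Ms ! k)" using bs by (auto simp: bas_btensor)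
    have "A.dd (single bs 1) = 0" by (simp add: A.dd_single divdiff_const[OF A.pq polys_1[of "{}"]])
    hence "A.h (single bs 1) = 0" by (simp add: A.h_def)
    hence "A.proj (single bs 1) = single bs 1 + A.up (A.dd (bdif A.K bs))" by (simp add: A.proj_def A.h_def)
    also have "A.dd (bdif A.K bs) = (\<Sum>k<length Ms. ?D k)"
    proof -
      have "A.dd (\<Sum>k\<in>J. g k) = (\<Sum>k\<in>J. A.dd (g k))" for J :: "nat set" and g
        by (induction J rule: infinite_finite_induct) (auto simp: A.dd_add)
      thus ?thesis using dd_lop len by (simp add: bdif_btensor)
    qed
    also have "\<dots> = (\<Sum>k\<in>{a, b}. ?D k)"
    proof (intro sum.mono_neutral_right ballI)
      fix k assume k: "k \<in> {..<length Ms} - {a, b}"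
      hence "bdif (Ms ! k) (bs ! k) \<in> car (Ms ! k) (\<not> bpar (Ms ! k) (bs ! k))"
        using factorization_car_map[OF A.fact[of k]] bk[of k] by (auto simp: car_map_def)
      hence "cmap (divdiff y x) (bdif (Ms ! k) (bs ! k)) = 0"
      proof (intro poly_mapping_eqI[of _ 0])
        fix c
        have "lookup (bdif (Ms ! k) (bs ! k)) c \<in> polys (bvars (Ms ! k))"
          using \<open>bdif (Ms ! k) (bs ! k) \<in> _\<close> by (simp add: car_iff)
        moreover have "y \<notin> bvars (Ms ! k)" using other[of k] k by simp
        ultimately have "divdiff y x (lookup (bdif (Ms ! k) (bs ! k)) c) = 0" by (rule divdiff_const[OF A.pq])
        thus "lookup (cmap (divdiff y x) (bdif (Ms ! k) (bs ! k))) c = lookup 0 c" by (simp add: lookup_cmap divdiff_0[OF A.pq])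
      qed
      thus "?D k = 0" by (simp add: lop_def)
    qed (use A.a B.a in auto)
    also have "\<dots> = ?D a + ?D b" using ab by simp
    finally have proj: "A.proj (single bs 1) = single bs 1 + (A.up (?D a)
       + A.up (?D b))" by (simp add: A.up_add)
    \<comment> \<open>The arc at a is mapped to its odd part by the differential, and
      \<open>raise\<close> kills that part.\<close>
    have "A.up (?D a) = 0" using len A.a by (simp add: A.up_def LO_lop_same bs arc_fact_simps A.arc cmap_single divdiff_0[OF A.pq] raise_def)
    hence 1: "B.E (A.proj (single bs 1)) = B.E (single bs 1) + B.E (A.up (?D b))" unfolding proj by (simp add: B.E_add)
    show ?thesis
    proof (cases "bs ! b = [0]")
      case True
      let ?c = "osgn Ms b bs * divdiff y x (arc_pi_at n y z)"
      have "?D b = single (bs[b := [1]]) ?c" by (simp add: lop_def True B.arc arc_fact_simps cmap_single divdiff_0[OF A.pq])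
      hence "A.up (?D b) = psmul ?c (lop Ms a raise (bs[b := [1]]))" by (simp add: A.up_def osg)
      moreover have "B.E (lop Ms a raise (bs[b := [1]])) = 0"
      proof -
        have "reindex Ms B \<tau>' (length Ns) (bs[b := [1], a := [1]]) = 0"
          using B.a len ab by (intro reindex_killed[of b]) (auto simp: B.Aa B.arc arc_fact_simps)
        thus ?thesis using ab bs by (simp add: lop_def raise_def B.E_psmul B.E_single)
      qed
      ultimately have "B.E (A.up (?D b)) = 0" by (simp add: B.E_psmul)
      thus ?thesis using 1 both[OF len bs(2) True] by simp
    next
      case False
      hence b1: "bs ! b = [1]" using bk[OF B.a] by (simp add: B.arc arc_fact_simps)
      let ?b0 = "bs[b := [0]]"
      have b0: "length ?b0 = length Ms" "?b0 ! a = [0]" "?b0 ! b = [0]" using len bs ab B.a by auto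
      \<comment> \<open>The coefficient y - z of the arc at b has divided difference 1, so the
        correction moves the odd entry from b to a with no polynomial factor.\<close>
      have dx: "divdiff y x (X y - X z) = 1" using B.pq by (intro divdiff_unique[OF A.pq]) auto
      have "?D b = single ?b0 (osgn Ms b bs)" by (simp add: lop_def b1 B.arc arc_fact_simps cmap_single divdiff_0[OF A.pq] dx)
      hence "A.up (?D b) = psmul (osgn Ms b bs) (lop Ms a raise ?b0)" by (simp add: A.up_def osg)
      hence "B.E (A.up (?D b)) = psmul (osgn Ms b bs) (B.E (lop Ms a raise ?b0))" by (simp add: B.E_psmul)
      \<comment> \<open>The arc that survives one removal occupies the same final place as the arc
        that survives the other, so raising at a under the second map is raising at b under the
        first.\<close>
      also have "B.E (lop Ms a raise ?b0) = LO Ns (\<tau>' a) (\<lambda>c. cmap B.\<psi> (raise c)) (reindex Ms B \<tau>' (length Ns) ?b0)"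
        using b0 by (intro B.E_lop[OF aB]) (auto simp: raise_def A.arc arc_fact_simps)
      also have "reindex Ms B \<tau>' (length Ns) ?b0 = reindex Ms A \<tau> (length Ns) ?b0" using both[OF b0] by (simp add: A.E_single B.E_single)
      also have "(\<lambda>c. cmap B.\<psi> (raise c)) = (\<lambda>c. cmap A.\<psi> (raise c))" by (rule ext) (simp add: raise_def cmap_single)
      also have "LO Ns (\<tau>' a) (\<lambda>c. cmap A.\<psi> (raise c)) (reindex Ms A \<tau> (length Ns) ?b0) = A.E (lop Ms b raise ?b0)"
        unfolding \<tau>\<tau>'(2)[symmetric] using b0 by (intro A.E_lop[OF bA, symmetric]) (auto simp: raise_def B.arc arc_fact_simps)
      also have "lop Ms b raise ?b0 = psmul (osgn Ms b bs) (single bs 1)"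
      proof -
        have "bs[b := [1]] = bs" using b1 by (metis list_update_id)
        thus ?thesis using len B.a by (simp add: lop_def raise_def osgn_ge)
      qed
      also have "psmul (osgn Ms b bs) (A.E (psmul (osgn Ms b bs) (single bs 1))) = A.E (single bs 1)"
        by (simp only: A.E_psmul psubst_osgn psmul_psmul osgn_sq psmul_1)
      finally have "B.E (A.up (?D b)) = A.E (single bs 1)" .
      moreover have "B.E (single bs 1) = 0"
      proof -
        have "reindex Ms B \<tau>' (length Ns) bs = 0" using B.a b1 by (intro reindex_killed[of b]) (auto simp: B.Aa B.arc arc_fact_simps)
        thus ?thesis by (simp add: B.E_single)
      qed
      ultimately show ?thesis using 1 by simp
    qed
  qed
  have id: "B.E (A.proj (A.iota v)) = v" if "v \<in> car A.N i" for v i using that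
  proof (induction v rule: car_induct)
    case (single cs r)
    let ?bs = "A.lift_list cs" and ?s = "inv_sgn (oddset Ms A (A.lift_list cs)) \<tau> :: complex mpoly"
    obtain c where c: "?s = Const c" using inv_sgn_Const by blast
    have "A.iota (single cs r) = psmul (r * ?s) (single ?bs 1)" by (simp add: A.iota_def)
    moreover have "r * ?s \<in> polys (bvars A.N)" using single(3) c by auto
    ultimately have "A.proj (A.iota (single cs r)) = psmul (r * ?s) (A.proj (single ?bs 1))" using A.proj_const[OF _ A.bvars_N(2)] by metis
    hence "B.E (A.proj (A.iota (single cs r))) = psmul (r * ?s) (A.E (single ?bs 1))"
      using key[OF A.lift_list_bas[OF single(1)]] B.\<psi>_self[OF \<open>r * ?s \<in> _\<close>] by (simp add: B.E_psmul A.nth_lift_list)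
    also have "\<dots> = A.E (psmul (r * ?s) (single ?bs 1))" by (simp only: A.E_psmul A.\<psi>_self[OF \<open>r * ?s \<in> _\<close>])
    also have "\<dots> = single cs r"
      using A.E_iota_single[OF single(1), of r] A.\<psi>_self[OF single(3)] \<open>A.iota (single cs r) = _\<close> by simp
    finally show ?case .
  qed (auto simp: A.iota_add A.proj_add B.E_add)
  have "htpy n V A.K A.N (\<lambda>i. B.E \<circ> (A.proj \<circ> A.iota \<circ> A.E)) (\<lambda>i. B.E \<circ> (\<lambda>m. m))"
  proof (rule homotopic_comp_left)
    show "htpy n V A.K A.K (\<lambda>i. A.proj \<circ> A.iota \<circ> A.E) (\<lambda>i m. m)" using A.removal_inverse by (simp add: hmf_inverse_def)
    show "mor V A.K A.N (\<lambda>i. B.E)" by (rule B.E_gmor)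
    fix i m assume "m \<in> car A.K i"
    thus "(A.proj \<circ> A.iota \<circ> A.E) m \<in> car A.K i" using A.proj_car[OF A.iota_car[OF gmor_car[OF A.E_gmor]]] by simp
  qed (use bd_car[OF A.K_fact] in auto)
  hence "htpy n V A.K A.N (\<lambda>i. B.E \<circ> (A.proj \<circ> A.iota \<circ> A.E)) (\<lambda>i. B.E)" by (simp add: comp_def)
  moreover have "htpy n V A.K A.N (\<lambda>i. A.E) (\<lambda>i. B.E \<circ> (A.proj \<circ> A.iota \<circ> A.E))"
    using id[OF gmor_car[OF A.E_gmor]] by (intro homotopic_eqI) simp
  ultimately show ?thesis by (rule homotopic_trans[rotated])
qed

declare bvars_btensor [simp del]

section \<open>Adding the first mark to a circle\<close>

text \<open>The coefficient of the i-th power of v, as a polynomial in the other variables.\<close>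

definition vcoeff :: "'v => nat => 'v mpoly => 'v mpoly" where
  "vcoeff v i p = vrem v 1 (vquo v i p)"

lemma vcoeff_0 [simp]: "vcoeff v i 0 = 0" and vcoeff_add: "vcoeff v i (p + q) = vcoeff v i p + vcoeff v i q"
  by (simp_all add: vcoeff_def vrem_add vquo_add)

lemma vcoeff_mult_const: "g \<in> polys V ==> v \<notin> V ==> vcoeff v i (g * p) = g * vcoeff v i p" by (simp add: vcoeff_def vrem_vquo_mult_const)

lemma lookup_vcoeff: "lookup (vcoeff v i p) m = (lookup p (m + single v i) when lookup m v = 0)" by (simp add: vcoeff_def lookup_vrem lookup_vquo)

lemma vcoeff_monomial:
  assumes "p \<in> polys V" "v \<notin> V"
  shows "vcoeff v i (p * X v ^ j) = (if i = j then p else 0)"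
proof -
  have "vcoeff v i (X v ^ j) = (if i = j then 1 else 0)"
  proof (intro poly_mapping_eqI)
    fix m
    have "single v j = m + single v i \<longleftrightarrow> m = 0 \<and> i = j" if "lookup m v = 0"
    proof
      assume eq: "single v j = m + single v i"
      have "lookup (single v j) v = lookup (m + single v i) v" using eq by simp
      hence "i = j" using that by (simp add: lookup_add)
      thus "m = 0 \<and> i = j" using eq by simp
    qed auto
    thus "lookup (vcoeff v i (X v ^ j)) m = lookup (if i = j then 1 else 0) m" by (auto simp: lookup_vcoeff X_power lookup_single when_def lookup_one)
  qed
  thus ?thesis using vcoeff_mult_const[OF assms, of i "X v ^ j"] by auto
qed

lemma vrem_sum_vcoeff: "vrem v n p = (\<Sum>i<n. X v ^ i * vcoeff v i p)"
proof (induction n)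
  case 0
  show ?case by (intro poly_mapping_eqI) (simp add: lookup_vrem)
next
  case (Suc n)
  have "vquo v 1 (vquo v n p) = vquo v (Suc n) p"
    by (intro poly_mapping_eqI) (simp add: lookup_vquo single_add[symmetric] add.assoc flip: Suc_eq_plus1_left)
  hence "vquo v n p = vcoeff v n p + X v * vquo v (Suc n) p" using vrem_vquo[of v 1 "vquo v n p"] by (simp add: vcoeff_def)
  hence "vrem v n p + X v ^ n * (vcoeff v n p + X v * vquo v (Suc n) p) = vrem v (Suc n) p + X v ^ Suc n * vquo v (Suc n) p"
    using vrem_vquo[of v n p] vrem_vquo[of v "Suc n" p] by simp
  thus ?case using Suc by (simp add: algebra_simps)
qed

lemma vcoeff_polys: "p \<in> polys V ==> vcoeff v i p \<in> polys (V - {v})"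
proof -
  assume p: "p \<in> polys V"
  have "vcoeff v i p \<in> polys V" unfolding vcoeff_def using p by (intro vrem_polys vquo_polys)
  moreover have "lookup m v = 0" if "m \<in> keys (vcoeff v i p)" for m using that by (auto simp: in_keys_iff lookup_vcoeff when_def split: if_splits)
  ultimately show ?thesis unfolding polys_def by (fastforce simp: in_keys_iff)
qed

lemma vcoeff_homog: "homog k p ==> homog (k - 2 * int i) (vcoeff v i p)" unfolding vcoeff_def by (intro vrem_homog vquo_homog)

definition circle_map :: "nat => complex => graph_module => graph_module" where
  "circle_map k x = lin_ext id (\<lambda>bs. single (bs[k := [1]]) (X x ^ hd (bs ! k)))"

lemma circle_map_single: "circle_map k x (single bs p) = single (bs[k := [1]]) (p * X x ^ hd (bs ! k))"
  and circle_map_add: "circle_map k x (f + g) = circle_map k x f + circle_map k x g"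
  and circle_map_psmul: "circle_map k x (psmul p f) = psmul p (circle_map k x f)"
  and circle_map_0 [simp]: "circle_map k x 0 = 0" by (simp_all add: circle_map_def lin_ext_add lin_ext_psmul)

text \<open>The circle and the arc from x to x both have potential zero, so one family w serves the
  factors before and after marking.\<close>

locale circle_marking =
  fixes Ms :: "(complex, nat list) bfact list" and k n :: nat and x :: complex and w :: "nat => complex mpoly" and V :: "complex set"
  assumes k: "k < length Ms" and circle: "Ms ! k = bflip (circle_algebra n)" and x: "x \<notin> bvars (btensor Ms)"
    and fact: "\<And>l. l < length Ms ==> factorization n (w l) (Ms ! l)" and wk: "w k = 0"
    and w: "(\<Sum>l<length Ms. w l) \<in> polys V" and V: "V \<subseteq> bvars (btensor Ms)" and n: "n \<ge> 1"
begin

abbreviation Ns where "Ns \<equiv> Ms[k := arc_fact n x x]"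
abbreviation K where "K \<equiv> btensor Ms"
abbreviation N where "N \<equiv> btensor Ns"

lemma K_fact: "factorization n (\<Sum>l<length Ms. w l) K" using fact by (rule factorization_btensor)

lemma Ns_nth: "l < length Ms ==> Ns ! l = (if l = k then arc_fact n x x else Ms ! l)" by (simp add: nth_list_update)

lemma Ns_fact: "l < length Ns ==> factorization n (w l) (Ns ! l)" using k fact factorization_arc_fact[of n x x] wk by (cases "l = k") auto

lemma N_fact: "factorization n (\<Sum>l<length Ms. w l) N" using factorization_btensor[of Ns n w] Ns_fact by simp

lemma bvars_N: "bvars N = insert x (bvars K)"
proof -
  have "bvars N = (\<Union>l<length Ms. bvars (Ns ! l))" unfolding bvars_btensor set_conv_nth by auto
  also have "\<dots> = insert x (\<Union>l<length Ms. bvars (Ms ! l))"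
    using k by (force simp: Ns_nth arc_fact_simps circle circle_simps split: if_splits)
  also have "(\<Union>l<length Ms. bvars (Ms ! l)) = bvars K" unfolding bvars_btensor set_conv_nth by auto
  finally show ?thesis .
qed

lemma par_N: "length bs = length Ms ==> bpar N (bs[k := [1]]) = bpar K bs"
proof -
  assume "length bs = length Ms"
  hence "{l. l < length Ns \<and> bpar (Ns ! l) (bs[k := [1]] ! l)} = {l. l < length Ms \<and> bpar (Ms ! l) (bs ! l)}"
    using k by (auto simp: nth_list_update arc_fact_simps circle circle_simps split: if_splits)
  thus ?thesis by (simp add: btensor_def)
qed

text \<open>The odd generator of the arc has degree 1 - n and x^j has degree 2j, which is the degree
  2j + 1 - n of the basis element \<open>[j]\<close> of the circle.\<close>

lemma deg_N: "length bs = length Ms ==> bs ! k = [j] ==> bdeg N (bs[k := [1]]) + 2 * int j = bdeg K bs"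
proof -
  assume bs: "length bs = length Ms" "bs ! k = [j]"
  have "(\<Sum>l<length Ms. bdeg (Ns ! l) (bs[k := [1]] ! l)) + (\<Sum>l<length Ms. if l = k then 2 * int j else 0)
      = (\<Sum>l<length Ms. bdeg (Ms ! l) (bs ! l))" unfolding sum.distrib[symmetric]
    using k bs by (intro sum.cong) (auto simp: nth_list_update arc_fact_simps circle circle_simps)
  thus ?thesis using k by (simp add: btensor_def)
qed

lemma bas_K: "bs \<in> bas K ==> length bs = length Ms \<and> (\<exists>j<n. bs ! k = [j])"
  using k by (auto simp: bas_btensor circle circle_simps dest!: spec[of _ k])

lemma bas_N: "bs \<in> bas N ==> length bs = length Ms \<and> bs ! k \<in> {[0], [1]}"
  using k by (auto simp: bas_btensor arc_fact_simps dest!: spec[of _ k])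

lemma update_bas: "bs \<in> bas K ==> bs[k := [1]] \<in> bas N" using k unfolding bas_btensor by (auto simp: nth_list_update arc_fact_simps)

lemma update_bas': "bs \<in> bas N ==> j < n ==> bs[k := [j]] \<in> bas K"
  using k unfolding bas_btensor by (auto simp: nth_list_update circle circle_simps)

lemma circle_map_hom_map: "hom_map K N False 0 (\<lambda>bs. single (bs[k := [1]]) (X x ^ hd (bs ! k)))" unfolding hom_map_def
proof
  fix bs assume bs: "bs \<in> bas K"
  then obtain j where j: "length bs = length Ms" "bs ! k = [j]" using bas_K by blast
  have "homog (2 * int j) (X x ^ j)" using homog_power[OF homog_X, of j x] by (simp add: mult.commute)
  thus "single (bs[k := [1]]) (X x ^ hd (bs ! k)) \<in> hom N (bpar K bs \<noteq> False) (bdeg K bs + 0)"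
    using update_bas[OF bs] par_N[OF j(1)] deg_N[OF j, symmetric] by (auto simp: hom_iff car_iff lookup_single when_def j bvars_N)
qed

lemma osgn_N: "length bs = length Ms ==> osgn Ns l (bs[k := [1]]) = osgn Ms l bs"
proof -
  assume bs: "length bs = length Ms"
  have "{j. j < l \<and> bpar (Ns ! j) (bs[k := [1]] ! j)} = {j. j < l \<and> bpar (Ms ! j) (bs ! j)}"
  proof (intro Collect_cong conj_cong refl)
    fix j show "bpar (Ns ! j) (bs[k := [1]] ! j) = bpar (Ms ! j) (bs ! j)"
      using k bs by (cases "j = k") (auto simp: arc_fact_simps circle circle_simps)
  qed
  thus ?thesis by (simp add: osgn_def)
qed

lemma circle_map_bd: "keys f \<subseteq> bas K ==> circle_map k x (bd K f) = bd N (circle_map k x f)"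
proof (induction f rule: module_basis_induct)
  case (single bs p)
  then obtain j where j: "length bs = length Ms" "bs ! k = [j]" using bas_K by blast
  have lop: "circle_map k x (lop Ms l (bdif (Ms ! l)) bs) = psmul (X x ^ j) (lop Ns l (bdif (Ns ! l)) (bs[k := [1]]))" if l: "l < length Ms" for l
  proof (cases "l = k")
    case True
    thus ?thesis using k j by (simp add: lop_def circle circle_simps arc_fact_simps)
  next
    case False
    have "circle_map k x (put l bs f) = psmul (X x ^ j) (put l (bs[k := [1]]) f)" for f by (induction f rule: pm_induct)
         (use False j l k in \<open>auto simp: circle_map_single put_add circle_map_add psmul_add_right list_update_swap[of l k] mult.commute\<close>)
    thus ?thesis using False j l by (simp add: lop_def circle_map_psmul osgn_N mult.commute)
  qed
  have sum: "circle_map k x (\<Sum>l\<in>L. g l) = (\<Sum>l\<in>L. circle_map k x (g l))" for g and L :: "nat set"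
    by (induction L rule: infinite_finite_induct) (auto simp: circle_map_add)
  have "circle_map k x (bdif K bs) = psmul (X x ^ j) (bdif N (bs[k := [1]]))" by (simp add: bdif_btensor sum lop psmul_sum_right)
  thus ?case using j by (simp add: circle_map_psmul circle_map_single mult.commute)
qed (auto simp: lin_ext_add circle_map_add)

lemma circle_map_gmor: "mor V K N (\<lambda>i. circle_map k x)"
proof (rule gmorI)
  have id: "p \<in> polys (bvars K) ==> id p \<in> polys (bvars N)" for p using polys_mono[of p "bvars K" "bvars N"] by (auto simp: bvars_N)
  show "circle_map k x m \<in> car N i" if "m \<in> car K i" for m i
    using car_map_apply[OF hom_map_car_map[OF circle_map_hom_map] that id] by (simp add: circle_map_def)
  show "circle_map k x m \<in> hom N i l" if "m \<in> hom K i l" for m i l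
    using hom_map_apply[OF circle_map_hom_map that id] by (simp add: circle_map_def)
  show "circle_map k x (bd K m) = bd N (circle_map k x m)" if "m \<in> car K i" for m i using circle_map_bd[OF car_keys[OF that]] .
qed (auto simp: circle_map_add circle_map_psmul)

text \<open>Discards the even part of the arc and reduces the odd part modulo x^n, written in the
  basis of powers.\<close>

definition ret :: "graph_module => graph_module" where
  "ret f = (\<Sum>i<n. lin_ext id (\<lambda>bs. if bs ! k = [1] then single (bs[k := [i]]) 1 else 0) (cmap (vcoeff x i) f))"

lemma ret_add: "ret (f + g) = ret f + ret g" and ret_0 [simp]: "ret 0 = 0" by (simp_all add: ret_def cmap_add vcoeff_add lin_ext_add sum.distrib)

lemma ret_single: "ret (single bs p) = (if bs ! k = [1] then \<Sum>i<n. single (bs[k := [i]]) (vcoeff x i p) else 0)"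
  by (simp add: ret_def cmap_single)

lemma ret_psmul: "r \<in> polys W ==> x \<notin> W ==> ret (psmul r f) = psmul r (ret f)"
proof -
  assume r: "r \<in> polys W" "x \<notin> W"
  have "cmap (vcoeff x i) (psmul r f) = psmul r (cmap (vcoeff x i) f)" for i
    by (intro poly_mapping_eqI) (simp add: lookup_cmap vcoeff_mult_const[OF r])
  thus ?thesis by (simp add: ret_def lin_ext_psmul psmul_sum_right)
qed

lemma ret_circle_map: "f \<in> car K i ==> ret (circle_map k x f) = f"
proof (induction f rule: car_induct)
  case (single bs p)
  then obtain j where j: "length bs = length Ms" "j < n" "bs ! k = [j]" using bas_K by blast
  have "ret (circle_map k x (single bs p)) = (\<Sum>i<n. single (bs[k := [i]]) (if i = j then p else 0))"
    using k j vcoeff_monomial[OF single(3) x] by (simp add: circle_map_single ret_single)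
  also have "\<dots> = (\<Sum>i<n. if i = j then single (bs[k := [j]]) p else 0)" by (intro sum.cong) auto
  also have "\<dots> = single bs p" using j by (simp add: list_update_id flip: j(3))
  finally show ?case .
qed (auto simp: circle_map_add ret_add)

text \<open>On the closed arc \<open>lower\<close> is a contraction of (n+1) x^n. Dividing by x^n
  with remainder and by n+1 makes it a contraction of the identity up to the remainder.\<close>

definition hh :: "graph_module => graph_module" where
  "hh f = psmul (Const (1 / of_nat (n + 1))) (LO Ns k lower (cmap (vquo x n) f))"

lemma hh_add: "hh (f + g) = hh f + hh g" and hh_0 [simp]: "hh 0 = 0" by (simp_all add: hh_def cmap_add vquo_add LO_add psmul_add_right)

lemma hh_psmul: "r \<in> polys W ==> x \<notin> W ==> hh (psmul r f) = psmul r (hh f)"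
proof -
  assume r: "r \<in> polys W" "x \<notin> W"
  have "cmap (vquo x n) (psmul r f) = psmul r (cmap (vquo x n) f)" by (intro poly_mapping_eqI) (simp add: lookup_cmap vrem_vquo_mult_const[OF r])
  thus ?thesis by (simp add: hh_def LO_psmul mult.commute)
qed

lemma hh_car: "f \<in> car N i ==> hh f \<in> car N (\<not> i)" unfolding hh_def using k
  by (intro car_psmul LO_car car_cmap vquo_polys) (auto simp: hom_map_car_map[OF lower_hom_map])

text \<open>The quotient lowers the degree by 2n and \<open>lower\<close> adds n - 1, in total -n -
  1.\<close>

lemma hh_hom: "f \<in> hom N i l ==> hh f \<in> hom N (\<not> i) (l - int n - 1)"
proof -
  assume f: "f \<in> hom N i l"
  have "cmap (vquo x n) f \<in> hom N i (l + (- 2 * int n))" using f vquo_homog[where v=x and n=n] by (intro hom_cmap) (auto intro: vquo_polys)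
  hence "LO Ns k lower (cmap (vquo x n) f) \<in> hom N (\<not> i) (l + (- 2 * int n) + (int n - 1))"
    using k by (intro LO_hom) (auto simp: lower_hom_map)
  hence "hh f \<in> hom N (\<not> i) (l + (- 2 * int n) + (int n - 1) + 0)" unfolding hh_def by (intro hom_psmul) auto
  thus ?thesis by (simp add: algebra_simps)
qed

text \<open>Only the closed arc contributes. On its odd part the anticommutator returns x^n times
  the quotient and leaves the remainder; on its even part it returns x^n p divided by x^n, which is
  everything.\<close>

lemma circle_homotopy: "keys f \<subseteq> bas N ==> circle_map k x (ret f) = f - bd N (hh f) - hh (bd N f)"
proof (induction f rule: module_basis_induct)
  case (single bs p)
  let ?c = "Const (1 / of_nat (n + 1))" and ?f = "single bs p" and ?Q = "cmap (vquo x n)" and ?F = "LO Ns k lower"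
  have len: "length bs = length Ms" and bk: "bs ! k \<in> {[0], [1]}" using bas_N[OF single] by auto
  have odd: "odd_map (Ns ! l) (bdif (Ns ! l))" if "l < length Ns" for l using Ns_fact[OF that] factorization_odd_map by blast
  have kf: "keys ?f \<subseteq> bas N" "keys (?Q ?f) \<subseteq> bas N" using single by (auto simp: cmap_single)
  \<comment> \<open>The differentials of the other factors have coefficients free of x, so division
    by x^n commutes with them, while \<open>lower\<close> anticommutes with them.\<close>
  have cross: "?F (?Q (LO Ns l (bdif (Ns ! l)) ?f)) + LO Ns l (bdif (Ns ! l)) (?F (?Q ?f)) = 0" if l: "l < length Ms" "l \<noteq> k" for l
  proof -
    have "?Q (LO Ns l (bdif (Ns ! l)) ?f) = LO Ns l (bdif (Ns ! l)) (?Q ?f)"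
    proof (rule LO_cmap_commute[where V="bvars K"])
      fix b c assume "b \<in> bas (Ns ! l)"
      hence "bdif (Ns ! l) b \<in> car (Ms ! l) (\<not> bpar (Ms ! l) b)" using factorization_car_map[OF fact[OF l(1)]] l by (auto simp: car_map_def)
      thus "lookup (bdif (Ns ! l) b) c \<in> polys (bvars K)" using bvars_nth[OF l(1)] by (auto simp: car_iff intro: polys_mono)
    next
      show "vquo x n (g * r) = g * vquo x n r" if "g \<in> polys (bvars K)" for g r using that x by (rule vrem_vquo_mult_const(2))
    qed (use l kf in \<open>auto simp: vquo_add\<close>)
    moreover have "?F (LO Ns l (bdif (Ns ! l)) (?Q ?f)) = - LO Ns l (bdif (Ns ! l)) (?F (?Q ?f))"
      using l k kf(2) odd[of l] lower_odd by (intro LO_anticommute) auto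
    ultimately show ?thesis by simp
  qed
  have "hh (bd N ?f) + bd N (hh ?f) = psmul ?c (?F (?Q (bd N ?f)) + bd N (?F (?Q ?f)))"
    by (simp only: hh_def lin_ext_psmul[OF ringhom_id] psmul_add_right id_apply)
  also have "?F (?Q (bd N ?f)) + bd N (?F (?Q ?f))
     = (\<Sum>l<length Ms. ?F (?Q (LO Ns l (bdif (Ns ! l)) ?f)) + LO Ns l (bdif (Ns ! l)) (?F (?Q ?f)))"
  proof -
    have "?Q (\<Sum>l\<in>L. g l) = (\<Sum>l\<in>L. ?Q (g l))" for g :: "nat => graph_module" and L
      by (induction L rule: infinite_finite_induct) (auto simp: cmap_add vquo_add)
    thus ?thesis by (simp only: bd_btensor LO_sum sum.distrib length_list_update)
  qed
  also have "\<dots> = (\<Sum>l<length Ms. if l = k then ?F (?Q (LO Ns k (bdif (Ns ! k)) ?f)) + LO Ns k (bdif (Ns ! k)) (?F (?Q ?f)) else 0)"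
    using cross by (intro sum.cong) auto
  also have "\<dots> = ?F (?Q (LO Ns k (bdif (Ns ! k)) ?f)) + LO Ns k (bdif (Ns ! k)) (?F (?Q ?f))" using k by simp
  finally have *: "hh (bd N ?f) + bd N (hh ?f) = psmul ?c (?F (?Q (LO Ns k (bdif (Ns ! k)) ?f)) + LO Ns k (bdif (Ns ! k)) (?F (?Q ?f)))" .
  have Nk: "Ns ! k = arc_fact n x x" using k by simp
  have os: "osgn Ns k (bs[k := c]) = osgn Ns k bs" for c by (simp add: osgn_ge)
  have osV: "osgn Ns k bs \<in> polys {}" by (simp add: osgn_Const)
  have cc: "?c * (Const (of_nat (n + 1)) * q) = q" for q :: "complex mpoly" by (simp add: mult.assoc[symmetric] flip: Const_mult)
  show ?case
  proof (cases "bs ! k = [1]")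
    case True
    have "LO Ns k (bdif (Ns ! k)) ?f = 0" using len by (simp add: lop_def Nk True arc_fact_simps)
    moreover have "LO Ns k (bdif (Ns ! k)) (?F (?Q ?f)) = single bs (Const (of_nat (n + 1)) * (X x ^ n * vquo x n p))"
    proof -
      have "put k bs (single [1] q) = single bs q" for q :: "complex mpoly" using True by (metis list_update_id put_single)
      thus ?thesis using len k by (simp only: cmap_single[of "vquo x n", OF vquo_0] LO_single LO_psmul)
           (simp add: LO_lop_same True lower_def Nk arc_fact_simps arc_pi_at_same ac_simps)
    qed
    ultimately have h: "hh (bd N ?f) + bd N (hh ?f) = single bs (X x ^ n * vquo x n p)"
      unfolding * by (simp only: LO_0 cmap_0[of "vquo x n", OF vquo_0] add_0 psmul_single cc)
    have "circle_map k x (ret ?f) = (\<Sum>i<n. single bs (X x ^ i * vcoeff x i p))"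
    proof -
      have sum: "circle_map k x (\<Sum>l\<in>L. g l) = (\<Sum>l\<in>L. circle_map k x (g l))" for g and L :: "nat set"
        by (induction L rule: infinite_finite_induct) (auto simp: circle_map_add)
      have "bs[k := [1]] = bs" using True by (metis list_update_id)
      thus ?thesis using len k True by (simp add: ret_single sum circle_map_single mult.commute)
    qed
    also have "\<dots> = single bs (vrem x n p)" unfolding vrem_sum_vcoeff by (intro poly_mapping_eqI) (simp add: lookup_sum lookup_single when_def)
    finally have "circle_map k x (ret ?f) = single bs (vrem x n p)" .
    moreover have "?f = single bs (vrem x n p) + single bs (X x ^ n * vquo x n p)" by (simp add: vrem_vquo flip: single_add)
    ultimately have "circle_map k x (ret ?f) + (hh (bd N ?f) + bd N (hh ?f)) = ?f" unfolding h by simp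
    thus ?thesis by (simp add: algebra_simps)
  next
    case False
    hence b0: "bs ! k = [0]" using bk by auto
    have "?F (?Q ?f) = 0" using len by (simp add: cmap_single lop_def b0 lower_def)
    moreover have "?F (?Q (LO Ns k (bdif (Ns ! k)) ?f)) = single bs (Const (of_nat (n + 1)) * p)"
    proof -
      have 1: "LO Ns k (bdif (Ns ! k)) ?f = single (bs[k := [1]]) (Const (of_nat (n + 1)) * osgn Ns k bs * (X x ^ n * p))"
        by (simp add: lop_def Nk b0 arc_fact_simps arc_pi_at_same k ac_simps)
      have nx: "x \<notin> {}" by simp
      have g: "Const (of_nat (n + 1)) * osgn Ns k bs \<in> polys {}" using osV by (intro polys_mult) auto
      have 2: "?Q (LO Ns k (bdif (Ns ! k)) ?f) = single (bs[k := [1]]) (Const (of_nat (n + 1)) * osgn Ns k bs * p)"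
        unfolding 1 cmap_single[of "vquo x n", OF vquo_0] vrem_vquo_mult_const(2)[OF g nx] vquo_X_power ..
      have "bs[k := [0]] = bs" using b0 by (metis list_update_id)
      hence "lop Ns k lower (bs[k := [1]]) = single bs (osgn Ns k bs)" using len k by (simp add: lop_def lower_def os)
      thus ?thesis unfolding 2 using osgn_sq[of Ns k bs] by (simp add: ac_simps)
    qed
    ultimately have "hh (bd N ?f) + bd N (hh ?f) = ?f" unfolding * by (simp only: LO_0 add_0_right psmul_single cc)
    moreover have "ret ?f = 0" using False by (simp add: ret_single)
    ultimately show ?thesis by (simp add: algebra_simps)
  qed
qed (auto simp: ret_add circle_map_add hh_add lin_ext_add)

lemma ret_car: "f \<in> car N i ==> ret f \<in> car K i" and ret_hom: "f \<in> hom N i l ==> ret f \<in> hom K i l"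
proof -
  have base: "single (bs[k := [j]]) q \<in> hom K (bpar N bs) (bdeg N bs + 2 * int j + d)"
    if bs: "bs \<in> bas N" "bs ! k = [1]" "j < n" and q: "q \<in> polys (bvars K)" "homog d q" for bs j q d
  proof -
    have len: "length bs = length Ms" using bas_N[OF bs(1)] by simp
    have b: "bs[k := [j], k := [1]] = bs" using bs(2) by (metis list_update_id list_update_overwrite)
    have "bpar K (bs[k := [j]]) = bpar N bs" using par_N[of "bs[k := [j]]"] len b by simp
    moreover have "bdeg K (bs[k := [j]]) = bdeg N bs + 2 * int j" using deg_N[of "bs[k := [j]]" j] len b k by simp
    ultimately show ?thesis using q update_bas'[OF bs(1,3)] by (auto simp: hom_iff car_iff lookup_single when_def)
  qed
  have vp: "vcoeff x j p \<in> polys (bvars K)" if "p \<in> polys (bvars N)" for p j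
    using vcoeff_polys[OF that, of x j] by (rule polys_mono) (auto simp: bvars_N)
  have dec: "ret f = (\<Sum>b\<in>keys f. ret (single b (lookup f b)))" for f
  proof -
    have "ret (\<Sum>b\<in>B. g b) = (\<Sum>b\<in>B. ret (g b))" for B :: "nat list list set" and g
      by (induction B rule: infinite_finite_induct) (auto simp: ret_add)
    thus ?thesis by (metis poly_mapping_sum_singles)
  qed
  show "f \<in> hom N i l ==> ret f \<in> hom K i l"
  proof (subst dec, rule hom_sum)
    fix b assume f: "f \<in> hom N i l" and b: "b \<in> keys f"
    hence bN: "b \<in> bas N" "bpar N b = i" "lookup f b \<in> polys (bvars N)" "homog (l - bdeg N b) (lookup f b)" by (auto simp: hom_iff car_iff)
    show "ret (single b (lookup f b)) \<in> hom K i l"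
    proof (cases "b ! k = [1]")
      case True
      have "single (b[k := [j]]) (vcoeff x j (lookup f b)) \<in> hom K i l" if "j < n" for j
        using base[OF bN(1) True that vp[OF bN(3)] vcoeff_homog[OF bN(4), of j]] bN(2) by simp
      thus ?thesis using True by (auto simp: ret_single)
    qed (simp add: ret_single)
  qed
  show "f \<in> car N i ==> ret f \<in> car K i"
  proof (subst dec, rule car_sum)
    fix b assume f: "f \<in> car N i" and b: "b \<in> keys f"
    hence bN: "b \<in> bas N" "bpar N b = i" "lookup f b \<in> polys (bvars N)" by (auto simp: car_iff)
    show "ret (single b (lookup f b)) \<in> car K i"
    proof (cases "b ! k = [1]")
      case True
      have "single (b[k := [j]]) (vcoeff x j (lookup f b)) \<in> car K i" if "j < n" for j
      proof -
        have "b[k := [j]] \<in> bas K" "bpar K (b[k := [j]]) = i" using base[OF bN(1) True that polys_1 homog_1] bN(2) by (auto simp: hom_iff car_iff)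
        thus ?thesis using vp[OF bN(3)] by (intro car_single)
      qed
      thus ?thesis using True by (auto simp: ret_single)
    qed (simp add: ret_single)
  qed
qed

lemma circle_inverse: "hinverse n V K N (\<lambda>i. circle_map k x) (\<lambda>i. ret)"
proof (rule hmf_inverse_section[where K=N and N=K and a="circle_map k x" and r=ret and h=hh and w="\<Sum>l<length Ms. w l"])
  have xV: "x \<notin> V" using x V by blast
  show "mor V K N (\<lambda>i. circle_map k x)" by (rule circle_map_gmor)
  fix i
  show "ret m \<in> car K i" if "m \<in> car N i" for m using that by (rule ret_car)
  show "ret m \<in> hom K i l" if "m \<in> hom N i l" for m l using that by (rule ret_hom)
  show "ret (psmul p m) = psmul p (ret m)" if "p \<in> polys V" for p m using that xV by (rule ret_psmul)
  show "ret (circle_map k x m) = m" if "m \<in> car K i" for m using that by (rule ret_circle_map)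
  show "hh m \<in> car N (\<not> i)" if "m \<in> car N i" for m using that by (rule hh_car)
  show "hh m \<in> hom N (\<not> i) (l - int n - 1)" if "m \<in> hom N i l" for m l using that by (rule hh_hom)
  show "hh (psmul p m) = psmul p (hh m)" if "p \<in> polys V" for p m using that xV by (rule hh_psmul)
  show "circle_map k x (ret m) = m - bd N (hh m) - hh (bd N m)" if "m \<in> car N i" for m using circle_homotopy[OF car_keys[OF that]] .
  show "factorization n (\<Sum>l<length Ms. w l) N" by (rule N_fact)
  show "bd_closed K" using K_fact by (rule factorization_bd_closed)
  show "(\<Sum>l<length Ms. w l) \<in> polys V" by (rule w)
qed (simp_all add: ret_add hh_add)

end

declare One_nat_def [simp]

section \<open>Marks on edges and loops\<close>

lemma filter_sorted_list_of_set:
  assumes "finite T"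
  shows "filter Q (sorted_list_of_set T) = sorted_list_of_set {t \<in> T. Q t}"
  by (rule sorted_distinct_set_unique) (use assms in \<open>auto simp: sorted_wrt_filter\<close>)

text \<open>Edges and loops differ only in the parameter interval; the half-open one lists the base
  point of a loop once.\<close>

definition pmarks :: "real set => complex set => (real => complex) => complex list" where
  "pmarks I P f = map f (sorted_list_of_set {t \<in> I. f t \<in> P})"

lemma edge_marks_pmarks: "edge_marks P g = pmarks {0..1} P g" and loop_marks_pmarks: "loop_marks P g = pmarks {0..<1} P g"
  by (simp_all add: edge_marks_def loop_marks_def pmarks_def)

context
  fixes I :: "real set" and f :: "real => complex" and P :: "complex set"
  assumes inj: "inj_on f I" and fin: "finite P"
begin

lemma finite_params: "finite {t \<in> I. f t \<in> P}"
proof -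
  have "finite (f -` P \<inter> I)" using finite_vimage_IntI[OF fin inj] .
  thus ?thesis by (rule rev_finite_subset) auto
qed

lemma set_pmarks: "set (pmarks I P f) = f ` I \<inter> P" using finite_params by (auto simp: pmarks_def)

lemma distinct_pmarks: "distinct (pmarks I P f)" using finite_params inj by (auto simp: pmarks_def distinct_map intro: inj_on_subset)

lemma pmarks_remove: "pmarks I (P - {y}) f = filter (\<lambda>v. v \<noteq> y) (pmarks I P f)"
proof -
  have "filter (\<lambda>v. v \<noteq> y) (pmarks I P f) = map f (filter (\<lambda>t. f t \<noteq> y) (sorted_list_of_set {t \<in> I. f t \<in> P}))"
    by (simp add: pmarks_def filter_map comp_def)
  also have "filter (\<lambda>t. f t \<noteq> y) (sorted_list_of_set {t \<in> I. f t \<in> P}) = sorted_list_of_set {t \<in> I. f t \<in> P - {y}}"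
    unfolding filter_sorted_list_of_set[OF finite_params] by (rule arg_cong[where f=sorted_list_of_set]) auto
  finally show ?thesis by (simp add: pmarks_def)
qed

lemma pmarks_hd:
  assumes "t0 \<in> I" "f t0 \<in> P" "\<And>t. t \<in> I ==> t0 \<le> t"
  shows "pmarks I P f \<noteq> [] \<and> hd (pmarks I P f) = f t0"
proof -
  let ?T = "{t \<in> I. f t \<in> P}"
  have T: "t0 \<in> ?T" "finite ?T" using assms finite_params by auto
  hence ne: "sorted_list_of_set ?T \<noteq> []" by auto
  have "hd (sorted_list_of_set ?T) = Min ?T" using T by (subst sorted_list_of_set_nonempty) auto
  also have "Min ?T = t0" using T assms(3) by (intro Min_eqI) auto
  finally show ?thesis using ne by (simp add: pmarks_def hd_map)
qed

lemma pmarks_last: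
  assumes "t0 \<in> I" "f t0 \<in> P" "\<And>t. t \<in> I ==> t \<le> t0"
  shows "pmarks I P f \<noteq> [] \<and> last (pmarks I P f) = f t0"
proof -
  let ?T = "{t \<in> I. f t \<in> P}" and ?l = "sorted_list_of_set {t \<in> I. f t \<in> P}"
  have T: "t0 \<in> ?T" "finite ?T" using assms finite_params by auto
  hence ne: "?l \<noteq> []" by auto
  have s: "set ?l = ?T" using T by simp
  have "last ?l \<in> ?T" using last_in_set[OF ne] unfolding s .
  hence "last ?l \<le> t0" using assms(3) by auto
  moreover have "t0 \<le> last ?l"
  proof -
    have "t0 \<in> set ?l" using T(1) s by (rule ssubst[rotated])
    then obtain k where k: "k < length ?l" "?l ! k = t0" unfolding in_set_conv_nth by blast
    have "?l ! k \<le> ?l ! (length ?l - 1)" using k by (intro sorted_nth_mono) auto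
    thus ?thesis using k ne by (simp add: last_conv_nth)
  qed
  ultimately have "last ?l = t0" by simp
  thus ?thesis using ne by (simp add: pmarks_def last_map)
qed

end

subsection \<open>Lists of arcs\<close>

lemma edge_arcs_simps [simp]: "edge_arcs [] = []" "edge_arcs [x] = []" "edge_arcs (x # y # xs) = Arc_factor x y # edge_arcs (y # xs)"
  by (simp_all add: edge_arcs_def)

lemma edge_arcs_append: "edge_arcs (as @ p # bs) = edge_arcs (as @ [p]) @ edge_arcs (p # bs)"
proof (induction as)
  case (Cons a as)
  thus ?case by (cases as) auto
qed simp

lemma rename_edge_arcs: "map (rename_factor \<rho>) (edge_arcs ms) = edge_arcs (map \<rho> ms)" by (induction ms rule: induct_list012) auto

lemma arc_in_edge_arcs: "Arc_factor y x \<in> set (edge_arcs ms) \<longleftrightarrow> (y, x) \<in> set (zip ms (tl ms))"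
  and arc_in_loop_arcs: "Arc_factor y x \<in> set (loop_arcs ms) \<longleftrightarrow> (y, x) \<in> set (zip ms (rotate1 ms))"
  by (auto simp: edge_arcs_def loop_arcs_def)

lemma edge_arcs_ArcE: "\<alpha> \<in> set (edge_arcs ms) ==> \<exists>y x. \<alpha> = Arc_factor y x \<and> y \<in> set ms \<and> x \<in> set ms"
  by (induction ms rule: induct_list012) auto

lemma loop_arcs_ArcE: "\<alpha> \<in> set (loop_arcs ms) ==> \<exists>y x. \<alpha> = Arc_factor y x \<and> y \<in> set ms \<and> x \<in> set ms"
  by (auto simp: loop_arcs_def elim!: in_set_zipE)

lemma edge_arcs_split:
  "Arc_factor y x \<in> set (edge_arcs ms) ==> \<exists>as bs. ms = as @ y # x # bs"
proof (induction ms rule: induct_list012)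
  case (3 a b xs)
  thus ?case
  proof (cases "Arc_factor y x = Arc_factor a b")
    case True
    thus ?thesis by (intro exI[of _ "[]"] exI[of _ xs]) simp
  next
    case False
    then obtain as bs where "b # xs = as @ y # x # bs" using 3 by auto
    thus ?thesis by (intro exI[of _ "a # as"] exI[of _ bs]) simp
  qed
qed auto

lemma zip_unique_right: "distinct xs ==> (y, x) \<in> set (zip xs ys) ==> (y, x') \<in> set (zip xs ys) ==> x = x'"
  and zip_unique_left: "distinct ys ==> (y, x) \<in> set (zip xs ys) ==> (y', x) \<in> set (zip xs ys) ==> y = y'"
  by (auto simp: in_set_zip nth_eq_iff_index_eq)

lemma distinct_arcs: "distinct ms ==> distinct (edge_arcs ms)" "distinct ms ==> distinct (loop_arcs ms)"
  by (auto simp: edge_arcs_def loop_arcs_def distinct_map inj_on_def intro: distinct_zipI1)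

text \<open>Cuts the loop open at its first mark, which is repeated at the end, so that facts about
  paths apply to loops.\<close>

lemma loop_arcs_edge_arcs: "ms \<noteq> [] ==> loop_arcs ms = edge_arcs (ms @ [hd ms])"
proof -
  assume "ms \<noteq> []"
  hence "rotate1 ms = tl (ms @ [hd ms])" by (cases ms) auto
  moreover have "zip ms zs = zip (ms @ [a]) zs" if "length zs = length ms" for zs :: "complex list" and a using that by (simp add: zip_append1)
  ultimately show ?thesis unfolding loop_arcs_def edge_arcs_def by (metis length_rotate1)
qed

lemma zip_rotate1: "length xs = length ys ==> zip (rotate1 xs) (rotate1 ys) = rotate1 (zip xs ys)" by (cases xs; cases ys) auto

lemma set_loop_arcs_rotate: "set (loop_arcs (rotate k ms)) = set (loop_arcs ms)"
proof (induction k)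
  case (Suc k)
  have "loop_arcs (rotate1 xs) = rotate1 (loop_arcs xs)" for xs by (simp add: loop_arcs_def zip_rotate1 rotate1_map)
  thus ?case using Suc by simp
qed simp

text \<open>The place where the cyclic list is cut is immaterial, so a loop may be cut at the mark
  to be removed.\<close>

lemma set_loop_arcs_commute: "set (loop_arcs (as @ bs)) = set (loop_arcs (bs @ as))"
  using set_loop_arcs_rotate[of "length as" "as @ bs"] by (simp add: rotate_append)

lemma edge_arcs_subset_loop_arcs: "set (edge_arcs ms) \<subseteq> set (loop_arcs ms)"
proof (cases ms rule: rev_cases)
  case (snoc as p)
  hence "loop_arcs ms = edge_arcs (as @ p # [hd ms])" by (simp add: loop_arcs_edge_arcs)
  thus ?thesis using snoc edge_arcs_append[of as p "[hd ms]"] by auto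
qed simp

text \<open>Dropping the arc and renaming p to q contracts it, and another arc at p now bridges the
  gap. Only sets are compared, because the order of the factors is accounted for by the reordering
  signs.\<close>

lemma edge_remove:
  assumes ms: "distinct ms" and \<alpha>: "\<alpha> \<in> set (edge_arcs ms)" "\<alpha> = Arc_factor p q \<or> \<alpha> = Arc_factor q p" and pq: "p \<noteq> q"
  shows "rename_factor (id(p := q)) ` (set (edge_arcs ms) - {\<alpha>}) = set (edge_arcs (filter (\<lambda>v. v \<noteq> p) ms))"
proof -
  let ?r = "rename_factor (id(p := q))"
  have img: "?r ` set (edge_arcs xs) = set (edge_arcs (map (id(p := q)) xs))" for xs by (simp only: rename_edge_arcs[symmetric] set_map)
  have av: "\<alpha> \<notin> set (edge_arcs xs)" if "p \<notin> set xs \<or> q \<notin> set xs" for xs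
    using that \<alpha>(2) edge_arcs_ArcE by fastforce
  from \<alpha>(2) show ?thesis
  proof
    assume a: "\<alpha> = Arc_factor p q"
    then obtain as bs where m: "ms = as @ p # q # bs" using \<alpha>(1) edge_arcs_split by blast
    have d: "p \<notin> set as" "q \<notin> set as" "p \<notin> set (q # bs)" using ms m by auto
    have "set (edge_arcs ms) - {\<alpha>} = set (edge_arcs (as @ [p])) \<union> set (edge_arcs (q # bs))"
      unfolding m edge_arcs_append[of as p "q # bs"] using av[of "as @ [p]"] av[of "q # bs"] d pq by (auto simp: a)
    hence "?r ` (set (edge_arcs ms) - {\<alpha>}) = set (edge_arcs (as @ [q])) \<union> set (edge_arcs (q # bs))"
      using d by (simp only: image_Un img map_append) simp
    also have "\<dots> = set (edge_arcs (as @ q # bs))" unfolding edge_arcs_append[of as q bs] by simp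
    also have "as @ q # bs = filter (\<lambda>v. v \<noteq> p) ms"
    proof -
      have "filter (\<lambda>v. v \<noteq> p) as = as" "filter (\<lambda>v. v \<noteq> p) bs = bs" using d by (auto intro!: filter_True)
      thus ?thesis using m pq by simp
    qed
    finally show ?thesis .
  next
    assume a: "\<alpha> = Arc_factor q p"
    then obtain as bs where m: "ms = as @ q # p # bs" using \<alpha>(1) edge_arcs_split by blast
    have d: "p \<notin> set (as @ [q])" "q \<notin> set (p # bs)" "p \<notin> set bs" using ms m by auto
    have "set (edge_arcs ms) - {\<alpha>} = set (edge_arcs (as @ [q])) \<union> set (edge_arcs (p # bs))"
      unfolding m edge_arcs_append[of as q "p # bs"] using av[of "as @ [q]"] av[of "p # bs"] d pq by (auto simp: a)
    hence "?r ` (set (edge_arcs ms) - {\<alpha>}) = set (edge_arcs (as @ [q])) \<union> set (edge_arcs (q # bs))"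
      using d by (simp only: image_Un img list.map) simp
    also have "\<dots> = set (edge_arcs (as @ q # bs))" unfolding edge_arcs_append[of as q bs] by simp
    also have "as @ q # bs = filter (\<lambda>v. v \<noteq> p) ms"
    proof -
      have "filter (\<lambda>v. v \<noteq> p) as = as" "filter (\<lambda>v. v \<noteq> p) bs = bs" using d by (auto intro!: filter_True)
      thus ?thesis using m pq by simp
    qed
    finally show ?thesis .
  qed
qed

lemma loop_remove:
  assumes ms: "distinct ms" and \<alpha>: "\<alpha> \<in> set (loop_arcs ms)" "\<alpha> = Arc_factor p q \<or> \<alpha> = Arc_factor q p" and pq: "p \<noteq> q"
  shows "rename_factor (id(p := q)) ` (set (loop_arcs ms) - {\<alpha>}) = set (loop_arcs (filter (\<lambda>v. v \<noteq> p) ms))"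
proof -
  let ?r = "rename_factor (id(p := q))"
  have img: "?r ` set (edge_arcs xs) = set (edge_arcs (map (id(p := q)) xs))" for xs by (simp only: rename_edge_arcs[symmetric] set_map)
  have pqm: "p \<in> set ms" "q \<in> set ms" using \<alpha> loop_arcs_ArcE by fastforce+
  then obtain as bs where m: "ms = as @ p # bs" by (meson split_list)
  \<comment> \<open>The remaining marks in cyclic order starting after p, so q is the first or the
    last of them.\<close>
  define cs where "cs = bs @ as"
  have cs: "p \<notin> set cs" "distinct cs" "q \<in> set cs" using ms m pqm pq by (auto simp: cs_def)
  have arcs: "set (loop_arcs ms) = set (edge_arcs (p # cs @ [p]))"
  proof -
    have "set (loop_arcs ms) = set (loop_arcs ((p # bs) @ as))" unfolding m by (rule set_loop_arcs_commute)
    thus ?thesis by (simp add: cs_def loop_arcs_edge_arcs)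
  qed
  have filt: "set (loop_arcs (filter (\<lambda>v. v \<noteq> p) ms)) = set (loop_arcs cs)"
  proof -
    have "filter (\<lambda>v. v \<noteq> p) as = as" "filter (\<lambda>v. v \<noteq> p) bs = bs" using ms m by (auto intro!: filter_True)
    hence "filter (\<lambda>v. v \<noteq> p) ms = as @ bs" by (simp add: m)
    thus ?thesis unfolding cs_def using set_loop_arcs_commute[of as bs] by simp
  qed
  from \<alpha>(2) show ?thesis
  proof
    assume a: "\<alpha> = Arc_factor p q"
    obtain c ds where c: "cs = c # ds" using cs by (cases cs) auto
    have e: "edge_arcs (p # cs @ [p]) = Arc_factor p c # edge_arcs (cs @ [p])" by (simp add: c)
    have np: "Arc_factor p x \<notin> set (edge_arcs (cs @ [p]))" for x
    proof
      assume "Arc_factor p x \<in> set (edge_arcs (cs @ [p]))"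
      then obtain us vs where "cs @ [p] = us @ p # x # vs" using edge_arcs_split by blast
      hence "cs = us @ p # butlast (x # vs)" by (metis butlast_append butlast_snoc list.distinct(1) butlast.simps(2))
      thus False using cs(1) by simp
    qed
    have "c = q" using \<alpha>(1) np unfolding arcs a e by auto
    hence "set (loop_arcs ms) - {\<alpha>} = set (edge_arcs (cs @ [p]))" unfolding arcs e a using np by auto
    hence "?r ` (set (loop_arcs ms) - {\<alpha>}) = set (edge_arcs (cs @ [q]))" using cs(1) by (simp only: img map_append) simp
    also have "\<dots> = set (loop_arcs cs)" using c \<open>c = q\<close> by (simp add: loop_arcs_edge_arcs)
    finally show ?thesis using filt by simp
  next
    assume a: "\<alpha> = Arc_factor q p"
    obtain c ds where c: "cs = ds @ [c]" using cs by (cases cs rule: rev_cases) auto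
    have e: "edge_arcs (p # cs @ [p]) = edge_arcs (p # cs) @ [Arc_factor c p]" using edge_arcs_append[of "p # ds" c "[p]"] by (simp add: c)
    have np: "Arc_factor x p \<notin> set (edge_arcs (p # cs))" for x
    proof
      assume "Arc_factor x p \<in> set (edge_arcs (p # cs))"
      then obtain us vs where "p # cs = us @ x # p # vs" using edge_arcs_split by blast
      hence "cs = tl (us @ [x]) @ p # vs" by (cases us) auto
      thus False using cs(1) by simp
    qed
    have "c = q" using \<alpha>(1) np unfolding arcs a e by auto
    hence "set (loop_arcs ms) - {\<alpha>} = set (edge_arcs (p # cs))" unfolding arcs e a using np by auto
    hence "?r ` (set (loop_arcs ms) - {\<alpha>}) = set (edge_arcs (q # cs))" using cs(1) by (simp only: img list.map) simp
    also have "\<dots> = set (loop_arcs (q # ds))" using c \<open>c = q\<close> by (simp add: loop_arcs_edge_arcs)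
    also have "\<dots> = set (loop_arcs cs)" using set_loop_arcs_commute[of "[q]" ds] c \<open>c = q\<close> by simp
    finally show ?thesis using filt by simp
  qed
qed

text \<open>For a loop the closing arc is left out; the arcs of the opened loop suffice to find a
  neighbour whenever there are two marks.\<close>

definition neighbours :: "complex list => complex => complex => bool" where
  "neighbours ms p q \<longleftrightarrow> Arc_factor p q \<in> set (edge_arcs ms) \<or> Arc_factor q p \<in> set (edge_arcs ms)"

lemma neighbours_split: "neighbours (as @ y # x # bs) y x" "neighbours (as @ y # x # bs) x y"
proof -
  have "Arc_factor y x \<in> set (edge_arcs (as @ y # x # bs))" unfolding edge_arcs_append[of as y "x # bs"] by simp
  thus "neighbours (as @ y # x # bs) y x" "neighbours (as @ y # x # bs) x y" by (auto simp: neighbours_def)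
qed

lemma neighbour_exists: "p \<in> set ms ==> t \<in> set ms ==> t \<noteq> p ==> \<exists>q. neighbours ms p q"
proof -
  assume a: "p \<in> set ms" "t \<in> set ms" "t \<noteq> p"
  then obtain as bs where m: "ms = as @ p # bs" by (meson split_list)
  show ?thesis
  proof (cases bs)
    case (Cons b bs')
    thus ?thesis using neighbours_split(1)[of as p b bs'] m by auto
  next
    case Nil
    hence "as \<noteq> []" using a m by auto
    hence "as = butlast as @ [last as]" by simp
    thus ?thesis using neighbours_split(2)[of "butlast as" "last as" p bs] m by (metis append.assoc append_Cons append_Nil)
  qed
qed

text \<open>Removals interfere only when each mark is merged into the other. A third mark on the
  curve gives one of them a different neighbour.\<close>

lemma neighbours_noncrossing:
  assumes ms: "distinct ms" and xy: "x \<in> set ms" "y \<in> set ms" "x \<noteq> y" and t: "t \<in> set ms" "t \<noteq> x" "t \<noteq> y"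
  shows "\<exists>q q'. neighbours ms y q \<and> neighbours ms x q' \<and> \<not> (q = x \<and> q' = y)"
proof -
  obtain q where q: "neighbours ms y q" using neighbour_exists xy by metis
  obtain q' where q': "neighbours ms x q'" using neighbour_exists xy by metis
  show ?thesis
  proof (cases "q = x \<and> q' = y")
    case False
    thus ?thesis using q q' by blast
  next
    case True
    have *: "\<exists>r. (neighbours ms u r \<and> r \<noteq> v) \<or> (neighbours ms v r \<and> r \<noteq> u)"
      if m: "ms = as @ u # v # bs" and uv: "{u, v} = {x, y}" for u v as bs
    proof (cases bs)
      case (Cons b bs')
      hence "neighbours ms v b" using neighbours_split(1)[of "as @ [u]" v b bs'] m by simp
      moreover have "b \<noteq> u" using ms m Cons by auto
      ultimately show ?thesis by blast
    next
      case Nil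
      have "as \<noteq> []"
      proof
        assume "as = []"
        hence "set ms = {x, y}" using m Nil uv by simp
        thus False using t by auto
      qed
      hence as: "as = butlast as @ [last as]" by simp
      hence "ms = butlast as @ last as # u # v # bs" using m by (metis append.assoc append_Cons append_Nil)
      hence "neighbours ms u (last as)" using neighbours_split(2)[of "butlast as" "last as" u "v # bs"] by simp
      moreover have "last as \<noteq> v" using ms m \<open>as \<noteq> []\<close> last_in_set[of as] by auto
      ultimately show ?thesis by blast
    qed
    from q True have "Arc_factor y x \<in> set (edge_arcs ms) \<or> Arc_factor x y \<in> set (edge_arcs ms)" by (auto simp: neighbours_def)
    hence "\<exists>r. (neighbours ms y r \<and> r \<noteq> x) \<or> (neighbours ms x r \<and> r \<noteq> y)"
    proof
      assume "Arc_factor y x \<in> set (edge_arcs ms)"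
      then obtain as bs where "ms = as @ y # x # bs" using edge_arcs_split by blast
      from *[OF this] show ?thesis by auto
    next
      assume "Arc_factor x y \<in> set (edge_arcs ms)"
      then obtain as bs where "ms = as @ x # y # bs" using edge_arcs_split by blast
      from *[OF this] show ?thesis by auto
    qed
    thus ?thesis using q q' by blast
  qed
qed

lemma neighbours_neq: "distinct ms ==> neighbours ms p q ==> p \<noteq> q" unfolding neighbours_def by (auto dest!: edge_arcs_split)

lemma distinct_concat_map:
  assumes "distinct xs" "\<And>x. x \<in> set xs ==> distinct (f x)"
    "\<And>x y. x \<in> set xs ==> y \<in> set xs ==> x \<noteq> y ==> set (f x) \<inter> set (f y) = {}"
  shows "distinct (concat (map f xs))" using assms
proof (induction xs)
  case (Cons a xs)
  have "distinct (concat (map f xs))" using Cons by auto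
  moreover have "set (f a) \<inter> set (f y) = {}" if "y \<in> set xs" for y using Cons.prems(1) Cons.prems(3)[of a y] that by auto
  ultimately show ?case using Cons.prems(2)[of a] by auto
qed simp

section \<open>Marked planar graphs\<close>

locale planar =
  fixes G :: wide_graph and n :: nat
  assumes planar: "planar_graph G" and n: "n \<ge> 1"
begin

abbreviation names where "names P \<equiv> factor_names G P"
abbreviation facts where "facts P \<equiv> map (factor n G P) (factor_names G P)"
abbreviation curves where "curves \<equiv> set (oedges G) \<union> set (oloops G)"
abbreviation em where "em P \<equiv> edge_marks P"
abbreviation lm where "lm P \<equiv> loop_marks P"
abbreviation mk where "mk P \<equiv> marking G P"

section \<open>Geometry of the graph and its marks\<close>

lemma edge: "g \<in> set (oedges G) ==> arc g" "g \<in> set (oedges G) ==> inj_on g {0..1}"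
  "g \<in> set (oedges G) ==> pathstart g \<in> sphere 0 1 \<or> (\<exists>w\<in>set (wedges G). pathstart g = pathfinish w)"
  "g \<in> set (oedges G) ==> pathfinish g \<in> sphere 0 1 \<or> (\<exists>w\<in>set (wedges G). pathfinish g = pathstart w)"
  using planar by (auto simp: planar_graph_def arc_def)

lemma wedge: "w \<in> set (wedges G) ==> arc w" "w \<in> set (wedges G) ==> path_image w \<subseteq> ball 0 1"
  "w \<in> set (wedges G) ==> length (in_edges G w) = 2" "w \<in> set (wedges G) ==> length (out_edges G w) = 2"
  using planar by (auto simp: planar_graph_def)

lemma loop: "c \<in> set (oloops G) ==> simple_path c" "c \<in> set (oloops G) ==> inj_on c {0..<1}"
  "c \<in> set (oloops G) ==> pathfinish c = pathstart c" "c \<in> set (oloops G) ==> path_image c \<subseteq> ball 0 1"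
proof -
  show "c \<in> set (oloops G) ==> simple_path c" "c \<in> set (oloops G) ==> pathfinish c = pathstart c"
    "c \<in> set (oloops G) ==> path_image c \<subseteq> ball 0 1" using planar by (auto simp: planar_graph_def)
  assume "c \<in> set (oloops G)"
  hence "simple_path c" using planar by (auto simp: planar_graph_def)
  thus "inj_on c {0..<1}" unfolding simple_path_def loop_free_def by (fastforce intro: inj_onI)
qed

lemma distinct_lists: "distinct (oedges G)" "distinct (wedges G)" "distinct (oloops G)" using planar by (auto simp: planar_graph_def)

lemma loop_image: "c \<in> set (oloops G) ==> c ` {0..<1} = path_image c"
proof -
  assume c: "c \<in> set (oloops G)"
  have "c 1 = c 0" using loop(3)[OF c] by (simp add: pathfinish_def pathstart_def)
  hence "c ` {0..1} \<subseteq> c ` {0..<1}"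
    by (intro image_subsetI) (metis atLeastAtMost_iff atLeastLessThan_iff image_eqI less_eq_real_def zero_less_one)
  thus ?thesis by (auto simp: path_image_def)
qed

lemma wedge_vertices:
  assumes "v \<in> set (wedges G)" "w \<in> set (wedges G)"
  shows "pathstart v \<noteq> pathfinish w" "pathstart v = pathstart w ==> v = w" "pathfinish v = pathfinish w ==> v = w"
proof -
  have disj: "v \<noteq> w ==> path_image v \<inter> path_image w = {}" using planar assms by (auto simp: planar_graph_def pairwise_def)
  show "pathstart v \<noteq> pathfinish w"
    using disj pathstart_in_path_image[of v] pathfinish_in_path_image[of w] arc_distinct_ends[OF wedge(1)[OF assms(1)]] by fastforce
  show "pathstart v = pathstart w ==> v = w" using disj pathstart_in_path_image[of v] pathstart_in_path_image[of w] by fastforce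
  show "pathfinish v = pathfinish w ==> v = w" using disj pathfinish_in_path_image[of v] pathfinish_in_path_image[of w] by fastforce
qed

lemma wedge_not_sphere: "w \<in> set (wedges G) ==> pathstart w \<notin> sphere 0 1 \<and> pathfinish w \<notin> sphere 0 1"
  using wedge(2)[of w] pathstart_in_path_image[of w] pathfinish_in_path_image[of w] by fastforce

lemma mkD: "mk P ==> finite P" "mk P ==> v \<in> P ==> \<exists>g\<in>curves. v \<in> path_image g"
  "mk P ==> v \<in> P ==> w \<in> set (wedges G) ==> v \<notin> path_image w" "mk P ==> boundary_points G \<subseteq> P"
  "mk P ==> g \<in> set (oedges G) ==> ends g \<inter> sphere 0 1 = {} ==> path_image g \<inter> P \<noteq> {}" by (auto simp: marking_def)

lemma edge_loop_disjoint: "g \<in> set (oedges G) ==> c \<in> set (oloops G) ==> path_image g \<inter> path_image c = {}"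
  using planar unfolding planar_graph_def by blast

text \<open>Distinct edges meet only at vertices off the boundary circle; these lie on wide edges,
  which a marking avoids. Loops are disjoint from all other curves.\<close>

lemma curves_disjoint:
  assumes P: "mk P" and g: "g \<in> curves" "d \<in> curves" and v: "v \<in> P" "v \<in> path_image g" "v \<in> path_image d"
  shows "g = d \<and> (g \<in> set (oedges G) \<longleftrightarrow> d \<in> set (oedges G))"
proof -
  have eo: False if "g \<in> set (oedges G)" "d \<in> set (oloops G)" "v \<in> path_image g" "v \<in> path_image d" for g d
    using edge_loop_disjoint[OF that(1,2)] that(3,4) by auto
  have oo: "g = d" if "g \<in> set (oloops G)" "d \<in> set (oloops G)"
  proof (rule ccontr)
    assume "g \<noteq> d"
    hence "path_image g \<inter> path_image d = {}" using planar that by (simp add: planar_graph_def pairwise_def)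
    thus False using v by auto
  qed
  have ee: "g = d" if e: "g \<in> set (oedges G)" "d \<in> set (oedges G)"
  proof (rule ccontr)
    assume "g \<noteq> d"
    hence "path_image g \<inter> path_image d \<subseteq> ends g \<inter> ends d - sphere 0 1"
      using planar e by (auto simp: planar_graph_def pairwise_def)
    hence "v \<in> ends g" "v \<notin> sphere 0 1" using v by auto
    then obtain w where "w \<in> set (wedges G)" "v = pathstart w \<or> v = pathfinish w"
      using edge(3)[OF e(1)] edge(4)[OF e(1)] by (auto simp: ends_def)
    thus False using mkD(3)[OF P v(1)] pathstart_in_path_image[of w] pathfinish_in_path_image[of w] by auto
  qed
  show ?thesis using eo[of g d] eo[of d g] oo ee g v by blast
qed

lemma edges_loops_distinct: "g \<in> set (oedges G) ==> g \<notin> set (oloops G)"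
  using edge_loop_disjoint[of g g] pathstart_in_path_image[of g] by auto

lemma em: assumes "mk P" "g \<in> set (oedges G)"
  shows "set (em P g) = path_image g \<inter> P" "distinct (em P g)" "em (P - {y}) g = filter (\<lambda>v. v \<noteq> y) (em P g)"
  using set_pmarks[OF edge(2)[OF assms(2)] mkD(1)[OF assms(1)]] distinct_pmarks[OF edge(2)[OF assms(2)] mkD(1)[OF assms(1)]]
    pmarks_remove[OF edge(2)[OF assms(2)] mkD(1)[OF assms(1)]] by (simp_all add: edge_marks_pmarks path_image_def)

lemma lm: assumes "mk P" "c \<in> set (oloops G)"
  shows "set (lm P c) = path_image c \<inter> P" "distinct (lm P c)" "lm (P - {y}) c = filter (\<lambda>v. v \<noteq> y) (lm P c)"
  using set_pmarks[OF loop(2)[OF assms(2)] mkD(1)[OF assms(1)]] distinct_pmarks[OF loop(2)[OF assms(2)] mkD(1)[OF assms(1)]]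
    pmarks_remove[OF loop(2)[OF assms(2)] mkD(1)[OF assms(1)]] by (simp_all add: loop_marks_pmarks loop_image[OF assms(2)])

lemma em_hd:
  assumes P: "mk P" and g: "g \<in> set (oedges G)" "pathstart g \<in> sphere 0 1"
  shows "hd (em P g) = pathstart g" "pathstart g \<in> P"
proof -
  show *: "pathstart g \<in> P" using mkD(4)[OF P] g by (auto simp: boundary_points_def ends_def)
  show "hd (em P g) = pathstart g" using pmarks_hd[OF edge(2)[OF g(1)] mkD(1)[OF P], of 0] * by (simp add: edge_marks_pmarks pathstart_def)
qed

lemma em_last:
  assumes P: "mk P" and g: "g \<in> set (oedges G)" "pathfinish g \<in> sphere 0 1"
  shows "last (em P g) = pathfinish g" "pathfinish g \<in> P"
proof -
  show *: "pathfinish g \<in> P" using mkD(4)[OF P] g by (auto simp: boundary_points_def ends_def)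
  show "last (em P g) = pathfinish g" using pmarks_last[OF edge(2)[OF g(1)] mkD(1)[OF P], of 1] * by (simp add: edge_marks_pmarks pathfinish_def)
qed

text \<open>An internal edge carries a mark by the definition of a marking, and any other edge has
  an end on the boundary, which is a mark.\<close>

lemma em_nonempty: "mk P ==> g \<in> set (oedges G) ==> em P g \<noteq> []"
proof
  assume P: "mk P" and g: "g \<in> set (oedges G)" and e: "em P g = []"
  hence "path_image g \<inter> P = {}" using em(1)[OF P g] by simp
  moreover have "ends g \<inter> sphere 0 1 \<noteq> {}" using mkD(5)[OF P g] calculation by blast
  ultimately show False using em_hd(2)[OF P g] em_last(2)[OF P g] pathstart_in_path_image[of g] pathfinish_in_path_image[of g]
    by (auto simp: ends_def)
qed

lemma out_edge: "w \<in> set (wedges G) ==> k < 2 ==> out_edges G w ! k \<in> set (oedges G) \<and> pathstart (out_edges G w ! k) = pathfinish w"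
  using nth_mem[of k "out_edges G w"] wedge(4)[of w] by (auto simp: out_edges_def)

lemma in_edge: "w \<in> set (wedges G) ==> k < 2 ==> in_edges G w ! k \<in> set (oedges G) \<and> pathfinish (in_edges G w ! k) = pathstart w"
  using nth_mem[of k "in_edges G w"] wedge(3)[of w] by (auto simp: in_edges_def)

section \<open>Names of the tensor factors\<close>

definition loop_names :: "complex set => (real => complex) => factor_name list" where
  "loop_names P c = (if lm P c = [] then [Circle_factor c] else loop_arcs (lm P c))"

lemma names_eq: "names P = map Wide_factor (wedges G) @ concat (map (\<lambda>g. edge_arcs (em P g)) (oedges G)) @ concat (map (loop_names P) (oloops G))"
  by (simp add: factor_names_def loop_names_def[abs_def])

lemma set_names: "set (names P) = Wide_factor ` set (wedges G) \<union> (\<Union>g\<in>set (oedges G). set (edge_arcs (em P g))) \<union>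
    (\<Union>c\<in>set (oloops G). set (loop_names P c))" by (auto simp: names_eq)

lemma edge_arc_mark: "mk P ==> g \<in> set (oedges G) ==> \<alpha> \<in> set (edge_arcs (em P g)) ==>
    \<exists>y x. \<alpha> = Arc_factor y x \<and> y \<in> path_image g \<inter> P \<and> x \<in> path_image g \<inter> P"
  using edge_arcs_ArcE[of \<alpha> "em P g"] em(1) by simp

lemma loop_arc_mark: "mk P ==> c \<in> set (oloops G) ==> \<alpha> \<in> set (loop_names P c) ==>
    (\<alpha> = Circle_factor c \<and> lm P c = []) \<or> (\<exists>y x. \<alpha> = Arc_factor y x \<and> y \<in> path_image c \<inter> P \<and> x \<in> path_image c \<inter> P)"
  using loop_arcs_ArcE[of \<alpha> "lm P c"] lm(1) by (auto simp: loop_names_def split: if_splits)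

text \<open>Factors are addressed by name, so names must not repeat. The marks of an arc determine
  its curve, and marks do not repeat along a curve.\<close>

lemma distinct_names: assumes P: "mk P" shows "distinct (names P)"
proof -
  have e: "distinct (concat (map (\<lambda>g. edge_arcs (em P g)) (oedges G)))"
  proof (rule distinct_concat_map)
    fix g d assume *: "g \<in> set (oedges G)" "d \<in> set (oedges G)" "g \<noteq> d"
    show "set (edge_arcs (em P g)) \<inter> set (edge_arcs (em P d)) = {}"
    proof (rule ccontr)
      assume "set (edge_arcs (em P g)) \<inter> set (edge_arcs (em P d)) \<noteq> {}"
      then obtain \<alpha> where "\<alpha> \<in> set (edge_arcs (em P g))" "\<alpha> \<in> set (edge_arcs (em P d))" by blast
      then obtain y where "y \<in> path_image g \<inter> P" "y \<in> path_image d"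
        using edge_arc_mark[OF P *(1), of \<alpha>] edge_arc_mark[OF P *(2), of \<alpha>] by auto
      thus False using curves_disjoint[OF P, of g d y] * by auto
    qed
  qed (use distinct_lists distinct_arcs em(2)[OF P] in auto)
  have l: "distinct (concat (map (loop_names P) (oloops G)))"
  proof (rule distinct_concat_map)
    fix g d assume *: "g \<in> set (oloops G)" "d \<in> set (oloops G)" "g \<noteq> d"
    show "set (loop_names P g) \<inter> set (loop_names P d) = {}"
    proof (rule ccontr)
      assume "set (loop_names P g) \<inter> set (loop_names P d) \<noteq> {}"
      then obtain \<alpha> where a: "\<alpha> \<in> set (loop_names P g)" "\<alpha> \<in> set (loop_names P d)" by blast
      have "\<exists>y. y \<in> path_image g \<inter> P \<and> y \<in> path_image d"
        using loop_arc_mark[OF P *(1) a(1)] loop_arc_mark[OF P *(2) a(2)] *(3) by auto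
      thus False using curves_disjoint[OF P, of g d] * by blast
    qed
  qed (use distinct_lists distinct_arcs lm(2)[OF P] in \<open>auto simp: loop_names_def\<close>)
  have el: "set (edge_arcs (em P g)) \<inter> set (loop_names P c) = {}" if "g \<in> set (oedges G)" "c \<in> set (oloops G)" for g c
    using edge_arc_mark[OF P that(1)] loop_arc_mark[OF P that(2)] edge_loop_disjoint[OF that] by fastforce
  have w: "Wide_factor w \<notin> set (edge_arcs ms)" "Wide_factor w \<notin> set (loop_names P c)" for w ms c
    using edge_arcs_ArcE[of "Wide_factor w" ms] loop_arcs_ArcE[of "Wide_factor w" "lm P c"] by (auto simp: loop_names_def)
  show ?thesis unfolding names_eq using e l el w distinct_lists by (auto simp: distinct_map inj_on_def)
qed

lemma arc_name_cases:
  assumes "Arc_factor y x \<in> set (names P)"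
  shows "(\<exists>g\<in>set (oedges G). Arc_factor y x \<in> set (edge_arcs (em P g))) \<or> (\<exists>c\<in>set (oloops G). lm P c \<noteq> [] \<and> Arc_factor y x \<in> set (loop_arcs (lm P c)))"
  using assms by (auto simp: set_names loop_names_def split: if_splits)

lemma arc_name_marks: "mk P ==> Arc_factor y x \<in> set (names P) ==> y \<in> P \<and> x \<in> P"
  using arc_name_cases[of y x P] edge_arc_mark[of P] lm(1)[of P] loop_arcs_ArcE by fastforce

end

declare One_nat_def [simp del]

context planar
begin

subsection \<open>Uniqueness of neighbours\<close>

definition on_curve :: "complex set => (real => complex) => complex list" where
  "on_curve P g = (if g \<in> set (oedges G) then em P g else lm P g)"

lemma on_curve: assumes "mk P" "g \<in> curves"
  shows "set (on_curve P g) = path_image g \<inter> P" "distinct (on_curve P g)"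
    "on_curve (P - {y}) g = filter (\<lambda>v. v \<noteq> y) (on_curve P g)" using assms em lm by (auto simp: on_curve_def)

lemma arc_curve:
  assumes P: "mk P" and n: "Arc_factor y x \<in> set (names P)" and g: "g \<in> curves" "y \<in> path_image g \<or> x \<in> path_image g"
  shows "y \<in> path_image g \<and> x \<in> path_image g"
    "(y, x) \<in> set (zip (on_curve P g) ((if g \<in> set (oedges G) then tl else rotate1) (on_curve P g)))"
proof -
  obtain d where d: "d \<in> curves" "y \<in> path_image d \<inter> P" "x \<in> path_image d \<inter> P"
      "(y, x) \<in> set (zip (on_curve P d) ((if d \<in> set (oedges G) then tl else rotate1) (on_curve P d)))" using arc_name_cases[OF n]
  proof (elim disjE bexE conjE)
    fix d assume "d \<in> set (oedges G)" "Arc_factor y x \<in> set (edge_arcs (em P d))"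
    thus thesis using that[of d] edge_arc_mark[OF P, of d "Arc_factor y x"] by (auto simp: on_curve_def arc_in_edge_arcs)
  next
    fix c assume c: "c \<in> set (oloops G)" "Arc_factor y x \<in> set (loop_arcs (lm P c))"
    hence "c \<notin> set (oedges G)" using edges_loops_distinct by blast
    thus thesis using that[of c] c loop_arcs_ArcE[OF c(2)] lm(1)[OF P c(1)] by (auto simp: on_curve_def arc_in_loop_arcs)
  qed
  hence "d = g" using curves_disjoint[OF P d(1) g(1)] g(2) by blast
  thus "y \<in> path_image g \<and> x \<in> path_image g"
    "(y, x) \<in> set (zip (on_curve P g) ((if g \<in> set (oedges G) then tl else rotate1) (on_curve P g)))" using d by auto
qed

text \<open>A mark has a single place in the list of marks of its curve, hence one successor and one
  predecessor, cyclically on a loop.\<close>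

lemma arc_unique:
  assumes P: "mk P"
  shows "Arc_factor y x \<in> set (names P) ==> Arc_factor y x' \<in> set (names P) ==> x = x'"
    and "Arc_factor y x \<in> set (names P) ==> Arc_factor y' x \<in> set (names P) ==> y = y'"
proof -
  have d: "distinct ((if g \<in> set (oedges G) then tl else rotate1) (on_curve P g))" if "g \<in> curves" for g
    using on_curve(2)[OF P that] by (auto intro: distinct_tl)
  {
    assume a: "Arc_factor y x \<in> set (names P)" "Arc_factor y x' \<in> set (names P)"
    obtain g where g: "g \<in> curves" "y \<in> path_image g" using mkD(2)[OF P] arc_name_marks[OF P a(1)] by blast
    show "x = x'" by (rule zip_unique_right[OF on_curve(2)[OF P g(1)] arc_curve(2)[OF P a(1) g(1)] arc_curve(2)[OF P a(2) g(1)]]) (use g in auto)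
  next
    assume a: "Arc_factor y x \<in> set (names P)" "Arc_factor y' x \<in> set (names P)"
    obtain g where g: "g \<in> curves" "x \<in> path_image g" using mkD(2)[OF P] arc_name_marks[OF P a(1)] by blast
    show "y = y'" by (rule zip_unique_left[OF d[OF g(1)] arc_curve(2)[OF P a(1) g(1)] arc_curve(2)[OF P a(2) g(1)]]) (use g in auto)
  }
qed

text \<open>The arc is recorded besides its ends because two different arcs join the marks of a loop
  with exactly two marks.\<close>

definition adjacent :: "complex set => complex => complex => factor_name => bool" where
  "adjacent P p q \<alpha> \<longleftrightarrow> \<alpha> \<in> set (names P) \<and> (\<alpha> = Arc_factor p q \<or> \<alpha> = Arc_factor q p) \<and> p \<noteq> q"

lemma adjacent_marks: "mk P ==> adjacent P p q \<alpha> ==> p \<in> P \<and> q \<in> P" unfolding adjacent_def using arc_name_marks by blast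

lemma neighbours_adjacent:
  assumes P: "mk P" and g: "g \<in> curves" and nb: "neighbours (on_curve P g) p q"
  shows "\<exists>\<alpha>. adjacent P p q \<alpha>"
proof -
  have "p \<noteq> q" using neighbours_neq[OF on_curve(2)[OF P g] nb] .
  moreover have "set (edge_arcs (on_curve P g)) \<subseteq> set (names P)"
  proof (cases "g \<in> set (oedges G)")
    case True
    thus ?thesis by (auto simp: set_names on_curve_def)
  next
    case False
    hence g: "g \<in> set (oloops G)" using g by auto
    hence "set (loop_names P g) \<subseteq> set (names P)" by (auto simp: set_names)
    moreover have "set (edge_arcs (lm P g)) \<subseteq> set (loop_names P g)"
      using edge_arcs_subset_loop_arcs[of "lm P g"] by (auto simp: loop_names_def)
    ultimately show ?thesis using False by (auto simp: on_curve_def)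
  qed
  ultimately show ?thesis using nb unfolding neighbours_def adjacent_def by blast
qed

lemma adjacent_same_curve:
  assumes P: "mk P" and a: "adjacent P p q \<alpha>" and g: "g \<in> curves" "p \<in> path_image g"
  shows "q \<in> path_image g" "g \<in> set (oedges G) ==> \<alpha> \<in> set (edge_arcs (em P g))"
    "g \<in> set (oloops G) ==> \<alpha> \<in> set (loop_arcs (lm P g)) \<and> lm P g \<noteq> []"
proof -
  obtain u v where uv: "\<alpha> = Arc_factor u v" "Arc_factor u v \<in> set (names P)" "{u, v} = {p, q}" using a by (auto simp: adjacent_def)
  hence p: "u \<in> path_image g \<or> v \<in> path_image g" using g(2) by (auto simp: doubleton_eq_iff)
  note c = arc_curve[OF P uv(2) g(1) p]
  show "q \<in> path_image g" using c(1) uv(3) by (auto simp: doubleton_eq_iff)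
  show "g \<in> set (oedges G) ==> \<alpha> \<in> set (edge_arcs (em P g))" using c(2) by (simp add: uv(1) on_curve_def arc_in_edge_arcs)
  show "g \<in> set (oloops G) ==> \<alpha> \<in> set (loop_arcs (lm P g)) \<and> lm P g \<noteq> []"
  proof -
    assume "g \<in> set (oloops G)"
    hence "g \<notin> set (oedges G)" using edges_loops_distinct by blast
    thus ?thesis using c(2) by (auto simp: uv(1) on_curve_def arc_in_loop_arcs)
  qed
qed

lemma image_avoid: "(\<And>i. i \<in> S ==> f i = i) ==> f ` S = S" by (metis image_cong image_ident)

lemma rename_names:
  assumes P: "mk P" and a: "adjacent P p q \<alpha>"
  shows "rename_factor (id(p := q)) ` (set (names P) - {\<alpha>}) = set (names (P - {p}))"
proof -
  let ?r = "rename_factor (id(p := q))"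
  have pP: "p \<in> P" and pq: "p \<noteq> q" and \<alpha>: "\<alpha> \<in> set (names P)" "\<alpha> = Arc_factor p q \<or> \<alpha> = Arc_factor q p"
    using adjacent_marks[OF P a] a by (auto simp: adjacent_def)
  have e: "?r ` (set (edge_arcs (em P g)) - {\<alpha>}) = set (edge_arcs (em (P - {p}) g))" if g: "g \<in> set (oedges G)" for g
  proof (cases "p \<in> path_image g")
    case True
    thus ?thesis using edge_remove[OF em(2)[OF P g] adjacent_same_curve(2)[OF P a] \<alpha>(2) pq] g em(3)[OF P g] by simp
  next
    case False
    hence p: "p \<notin> set (em P g)" using em(1)[OF P g] by simp
    have i: "i \<noteq> \<alpha> \<and> ?r i = i" if "i \<in> set (edge_arcs (em P g))" for i using edge_arcs_ArcE[OF that] p \<alpha>(2) by auto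
    hence "set (edge_arcs (em P g)) - {\<alpha>} = set (edge_arcs (em P g))" by blast
    moreover have "em (P - {p}) g = em P g" unfolding em(3)[OF P g] using p by (intro filter_True) auto
    ultimately show ?thesis using i image_avoid[of "set (edge_arcs (em P g))" ?r] by simp
  qed
  have l: "?r ` (set (loop_names P c) - {\<alpha>}) = set (loop_names (P - {p}) c)" if c: "c \<in> set (oloops G)" for c
  proof (cases "p \<in> path_image c")
    case True
    have ne: "lm P c \<noteq> []" and q: "q \<in> path_image c" "q \<in> P" using adjacent_same_curve[OF P a _ True] c adjacent_marks[OF P a] by auto
    have "q \<in> set (lm P c)" using lm(1)[OF P c] q by simp
    \<comment> \<open>The mark q stays on the loop, so no circle factor appears.\<close>
    hence "filter (\<lambda>v. v \<noteq> p) (lm P c) \<noteq> []" unfolding filter_empty_conv using pq by metis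
    thus ?thesis using loop_remove[OF lm(2)[OF P c] _ \<alpha>(2) pq] adjacent_same_curve(3)[OF P a _ True] c lm(3)[OF P c] ne
      by (simp add: loop_names_def)
  next
    case False
    hence p: "p \<notin> set (lm P c)" using lm(1)[OF P c] by simp
    have i: "i \<noteq> \<alpha> \<and> ?r i = i" if "i \<in> set (loop_names P c)" for i using loop_arc_mark[OF P c that] False \<alpha>(2) by auto
    hence "set (loop_names P c) - {\<alpha>} = set (loop_names P c)" by blast
    moreover have "lm (P - {p}) c = lm P c" unfolding lm(3)[OF P c] using p by (intro filter_True) auto
    ultimately show ?thesis using i image_avoid[of "set (loop_names P c)" ?r] by (simp add: loop_names_def)
  qed
  have w: "?r ` (Wide_factor ` set (wedges G) - {\<alpha>}) = Wide_factor ` set (wedges G)"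
  proof -
    have "Wide_factor ` set (wedges G) - {\<alpha>} = Wide_factor ` set (wedges G)" using \<alpha>(2) by auto
    thus ?thesis by (simp add: image_image)
  qed
  have "set (names P) - {\<alpha>} = (Wide_factor ` set (wedges G) - {\<alpha>}) \<union> (\<Union>g\<in>set (oedges G). set (edge_arcs (em P g)) - {\<alpha>}) \<union>
    (\<Union>c\<in>set (oloops G). set (loop_names P c) - {\<alpha>})" by (auto simp: set_names)
  thus ?thesis unfolding set_names[of "P - {p}"] by (simp only: image_Un image_UN w) (simp add: e l)
qed

lemma rename_inj:
  assumes P: "mk P" and a: "adjacent P p q \<alpha>"
  shows "inj_on (rename_factor (id(p := q))) (set (names P) - {\<alpha>})"
proof (rule inj_onI)
  let ?\<rho> = "id(p := q)"
  fix i j assume ij: "i \<in> set (names P) - {\<alpha>}" "j \<in> set (names P) - {\<alpha>}" "rename_factor ?\<rho> i = rename_factor ?\<rho> j"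
  have u: "?\<rho> u = ?\<rho> v \<longleftrightarrow> u = v \<or> (u = p \<and> v = q) \<or> (u = q \<and> v = p)" for u v by auto
  show "i = j"
  proof (cases i; cases j)
    fix y x y' x' assume A: "i = Arc_factor y x" "j = Arc_factor y' x'"
    have m: "Arc_factor y x \<in> set (names P)" "Arc_factor y' x' \<in> set (names P)" using ij A by auto
    have "?\<rho> y = ?\<rho> y'" "?\<rho> x = ?\<rho> x'" using ij(3) unfolding A by auto
    hence "y = y' \<or> (y = p \<and> y' = q) \<or> (y = q \<and> y' = p)" "x = x' \<or> (x = p \<and> x' = q) \<or> (x = q \<and> x' = p)"
      unfolding u by auto
    moreover have "y = y' \<longleftrightarrow> x = x'" using arc_unique[OF P] m by blast
    \<comment> \<open>If both ends differ, then either one of i and j is the contracted arc, or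
      there is an arc from p to p, which excludes any other arc at p.\<close>
    moreover have "y = y'" if "y = p \<and> y' = q \<or> y = q \<and> y' = p" "x = p \<and> x' = q \<or> x = q \<and> x' = p"
    proof -
      have pq: "p \<noteq> q" and al: "\<alpha> \<in> set (names P)" "\<alpha> = Arc_factor p q \<or> \<alpha> = Arc_factor q p" using a by (auto simp: adjacent_def)
      have "Arc_factor p p \<in> set (names P) \<or> (\<alpha> = i \<or> \<alpha> = j)" using that m al(2) A by auto
      hence "Arc_factor p p \<in> set (names P)" using ij by blast
      thus ?thesis using al pq arc_unique[OF P] by metis
    qed
    ultimately show ?thesis using A by blast
  qed (use ij(3) in auto)
qed

lemma hd_filter: "distinct ms ==> p \<in> set ms ==> p \<noteq> q ==> \<alpha> = Arc_factor p q \<or> \<alpha> = Arc_factor q p ==> \<alpha> \<in> set (edge_arcs ms) ==>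
    hd (filter (\<lambda>v. v \<noteq> p) ms) = (id(p := q)) (hd ms) \<and> last (filter (\<lambda>v. v \<noteq> p) ms) = (id(p := q)) (last ms)"
proof -
  assume d: "distinct ms" and p: "p \<in> set ms" "p \<noteq> q" and \<alpha>: "\<alpha> = Arc_factor p q \<or> \<alpha> = Arc_factor q p" "\<alpha> \<in> set (edge_arcs ms)"
  from \<alpha>(1) show ?thesis
  proof
    assume "\<alpha> = Arc_factor p q"
    then obtain as bs where m: "ms = as @ p # q # bs" using \<alpha>(2) edge_arcs_split by blast
    have f: "filter (\<lambda>v. v \<noteq> p) as = as" "filter (\<lambda>v. v \<noteq> p) bs = bs" using d m by (auto intro!: filter_True)
    have "filter (\<lambda>v. v \<noteq> p) ms = as @ q # bs" using m f p by simp
    moreover have "hd ms \<noteq> p" if "as \<noteq> []" using that d m by (cases as) auto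
    moreover have "last ms \<noteq> p" using d m p last_in_set[of bs] by (cases "bs = []") auto
    ultimately show ?thesis using m by (cases "as = []") auto
  next
    assume "\<alpha> = Arc_factor q p"
    then obtain as bs where m: "ms = as @ q # p # bs" using \<alpha>(2) edge_arcs_split by blast
    have f: "filter (\<lambda>v. v \<noteq> p) as = as" "filter (\<lambda>v. v \<noteq> p) bs = bs" using d m by (auto intro!: filter_True)
    have "filter (\<lambda>v. v \<noteq> p) ms = as @ q # bs" using m f p by simp
    moreover have "hd ms \<noteq> p" using d m p by (cases as) auto
    moreover have "last ms \<noteq> p" if "bs \<noteq> []" using that d m last_in_set[of bs] by auto
    ultimately show ?thesis using m by (cases "as = []"; cases "bs = []") auto
  qed
qed

text \<open>A wide edge takes its variables from the nearest marks. If p was the nearest one,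
  contracting the arc makes q the nearest.\<close>

lemma em_ends_remove:
  assumes P: "mk P" and a: "adjacent P p q \<alpha>" and g: "g \<in> set (oedges G)"
  shows "hd (em (P - {p}) g) = (id(p := q)) (hd (em P g))" "last (em (P - {p}) g) = (id(p := q)) (last (em P g))"
proof -
  have "hd (em (P - {p}) g) = (id(p := q)) (hd (em P g)) \<and> last (em (P - {p}) g) = (id(p := q)) (last (em P g))"
  proof (cases "p \<in> path_image g")
    case True
    hence "\<alpha> \<in> set (edge_arcs (em P g))" using adjacent_same_curve(2)[OF P a _ True] g by auto
    thus ?thesis using hd_filter[OF em(2)[OF P g], of p q \<alpha>] a True adjacent_marks[OF P a] em[OF P g] by (auto simp: adjacent_def)
  next
    case False
    hence p: "p \<notin> set (em P g)" using em(1)[OF P g] by simp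
    have "em (P - {p}) g = em P g" unfolding em(3)[OF P g] using p by (intro filter_True) auto
    thus ?thesis using p hd_in_set last_in_set em_nonempty[OF P g] by (metis fun_upd_other id_apply)
  qed
  thus "hd (em (P - {p}) g) = (id(p := q)) (hd (em P g))" "last (em (P - {p}) g) = (id(p := q)) (last (em P g))" by auto
qed

lemma factor_rename:
  assumes P: "mk P" and a: "adjacent P p q \<alpha>" and i: "i \<in> set (names P)"
  shows "factor n G (P - {p}) (rename_factor (id(p := q)) i) = brename (id(p := q)) (factor n G P i)"
proof (cases i)
  case (Wide_factor w)
  hence w: "w \<in> set (wedges G)" using i edge_arcs_ArcE loop_arcs_ArcE by (fastforce simp: set_names loop_names_def split: if_splits)
  have o: "out_edges G w ! 0 \<in> set (oedges G)" "out_edges G w ! 1 \<in> set (oedges G)"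
      "in_edges G w ! 0 \<in> set (oedges G)" "in_edges G w ! 1 \<in> set (oedges G)" using out_edge[OF w] in_edge[OF w] by auto
  note e = o[THEN em_ends_remove(1)[OF P a]] o[THEN em_ends_remove(2)[OF P a]]
  show ?thesis unfolding Wide_factor rename_factor.simps factor.simps wide_fact_def brename_brename
    by (rule arg_cong[where f="\<lambda>r. brename r _"]) (simp only: fun_eq_iff comp_apply e if_distrib, auto)
next
  case (Arc_factor y x)
  show ?thesis unfolding Arc_factor rename_factor.simps factor.simps arc_fact_def brename_brename
    by (rule arg_cong[where f="\<lambda>r. brename r _"]) auto
next
  case (Circle_factor c)
  have "Poly_Mapping.map f (0 :: nat list \<Rightarrow>\<^sub>0 complex mpoly) = 0" for f :: "complex mpoly => complex mpoly"
    by (rule poly_mapping_eqI) (simp add: Poly_Mapping.map.rep_eq)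
  thus ?thesis unfolding Circle_factor by (simp add: brename_def bflip_def circle_algebra_def)
qed

subsection \<open>Potentials of the factors\<close>

definition wpot :: "complex set => factor_name => complex mpoly" where
  "wpot P i = (case i of
      Wide_factor w => X (hd (em P (out_edges G w ! 0))) ^ (n + 1) + X (hd (em P (out_edges G w ! 1))) ^ (n + 1)
        - X (last (em P (in_edges G w ! 0))) ^ (n + 1) - X (last (em P (in_edges G w ! 1))) ^ (n + 1)
    | Arc_factor y x => X x ^ (n + 1) - X y ^ (n + 1)
    | Circle_factor c => 0)"

lemma factor_factorization: "factorization n (wpot P i) (factor n G P i)"
proof (cases i)
  case (Wide_factor w)
  let ?\<rho> = "\<lambda>v::nat. if v = 1 then hd (edge_marks P (out_edges G w ! 0))
          else if v = 2 then hd (edge_marks P (out_edges G w ! 1))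
          else if v = 3 then last (edge_marks P (in_edges G w ! 0))
          else last (edge_marks P (in_edges G w ! 1))"
  have "psubst (\<lambda>v. X (?\<rho> v)) (X 1 ^ (n + 1) + X 2 ^ (n + 1) - X 3 ^ (n + 1) - X 4 ^ (n + 1)) = wpot P i"
    unfolding psubst_add psubst_diff psubst_power psubst_X by (simp add: wpot_def Wide_factor)
  thus ?thesis using factorization_brename[OF factorization_wide_generic[OF n], of ?\<rho>] by (simp add: Wide_factor wide_fact_def del: One_nat_def)
qed (use factorization_arc_fact factorization_circle in \<open>auto simp: wpot_def simp del: power_Suc\<close>)

lemma edge_arcs_telescope: "ms \<noteq> [] ==> (\<Sum>i\<leftarrow>edge_arcs ms. wpot P i) = X (last ms) ^ (n + 1) - X (hd ms) ^ (n + 1)"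
  by (induction ms rule: induct_list012) (auto simp: wpot_def simp del: power_Suc)

text \<open>Meant for sorting the edges by where they end or start: on the boundary, or at exactly
  one wide edge.\<close>

lemma sum_list_partition:
  fixes f :: "'y => 'z::comm_monoid_add"
  assumes "distinct ws" "\<And>x. x \<in> set xs ==> Q x \<or> (\<exists>w\<in>set ws. R x w)" "\<And>x w. x \<in> set xs ==> w \<in> set ws ==> R x w ==> \<not> Q x"
    "\<And>x v w. v \<in> set ws ==> w \<in> set ws ==> R x v ==> R x w ==> v = w"
  shows "sum_list (map f xs) = sum_list (map f (filter Q xs)) + (\<Sum>w\<leftarrow>ws. sum_list (map f (filter (\<lambda>x. R x w) xs)))"
  using assms(2,3)
proof (induction xs)
  case Nil
  have "(\<Sum>w\<leftarrow>ws. 0::'z) = 0" by (induction ws) auto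
  thus ?case by simp
next
  case (Cons a xs)
  have s: "(\<Sum>w\<leftarrow>ws. sum_list (map f (filter (\<lambda>x. R x w) (a # xs)))) =
      (\<Sum>w\<leftarrow>ws. if R a w then f a else 0) + (\<Sum>w\<leftarrow>ws. sum_list (map f (filter (\<lambda>x. R x w) xs)))"
    by (induction ws) (auto simp: ac_simps)
  have d: "(\<Sum>w\<leftarrow>ws. if R a w then f a else 0) = (if Q a then 0 else f a)"
  proof (cases "Q a")
    case True
    hence "\<not> R a w" if "w \<in> set ws" for w using Cons.prems(2)[of a w] that by auto
    hence "(\<Sum>w\<leftarrow>ws. if R a w then f a else 0) = (\<Sum>w\<leftarrow>ws. 0)" by (intro arg_cong[where f=sum_list] map_cong) auto
    thus ?thesis using True by simp
  next
    case False
    then obtain w where w: "w \<in> set ws" "R a w" using Cons.prems(1)[of a] by auto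
    have "(\<Sum>v\<leftarrow>ws. if R a v then f a else 0) = (\<Sum>v\<leftarrow>ws. if v = w then f a else 0)"
      using w assms(4) by (intro arg_cong[where f=sum_list] map_cong) auto
    also have "\<dots> = f a" using w(1) assms(1) by (simp add: sum_list_distinct_conv_sum_set)
    finally show ?thesis using False by simp
  qed
  show ?case using Cons.IH Cons.prems unfolding s d by (auto simp: ac_simps)
qed

lemma sum_list_concat_map: "sum_list (map f (concat xss)) = (\<Sum>xs\<leftarrow>xss. sum_list (map f xs))"
  for f :: "'y => 'z::comm_monoid_add" by (induction xss) auto

lemma sum_list_two: "length xs = 2 ==> sum_list (map f xs) = f (xs ! 0) + f (xs ! 1)" for f :: "'y => 'z::comm_monoid_add"
  by (auto simp: numeral_2_eq_2 length_Suc_conv)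

lemma boundary_unique:
  assumes "g \<in> set (oedges G)" "d \<in> set (oedges G)" "i \<in> sphere 0 1" "i \<in> ends g" "i \<in> ends d"
  shows "g = d"
proof (rule ccontr)
  assume "g \<noteq> d"
  hence "path_image g \<inter> path_image d \<subseteq> ends g \<inter> ends d - sphere 0 1"
    using planar assms by (simp add: planar_graph_def pairwise_def)
  moreover have "i \<in> path_image g" "i \<in> path_image d"
    using assms(4,5) pathstart_in_path_image pathfinish_in_path_image by (auto simp: ends_def)
  ultimately show False using assms(3) by auto
qed

text \<open>A boundary point is an end of exactly one edge and not both its start and its finish, so
  the signed sum over points splits into two sums over edges.\<close>

lemma potential_eq:
  "potential n G = (\<Sum>g\<leftarrow>filter (\<lambda>g. pathfinish g \<in> sphere 0 1) (oedges G). X (pathfinish g) ^ (n + 1))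
     - (\<Sum>g\<leftarrow>filter (\<lambda>g. pathstart g \<in> sphere 0 1) (oedges G). X (pathstart g) ^ (n + 1))"
proof -
  let ?F = "{g \<in> set (oedges G). pathfinish g \<in> sphere 0 1}" and ?S = "{g \<in> set (oedges G). pathstart g \<in> sphere 0 1}"
  let ?sg = "\<lambda>i. if \<exists>g\<in>set (oedges G). pathfinish g = i then 1 else - 1 :: complex mpoly"
  have B: "boundary_points G = pathfinish ` ?F \<union> pathstart ` ?S" by (auto simp: boundary_points_def ends_def)
  have sgS: "\<not> (\<exists>d\<in>set (oedges G). pathfinish d = pathstart g)" if "g \<in> ?S" for g
  proof
    assume "\<exists>d\<in>set (oedges G). pathfinish d = pathstart g"
    then obtain d where d: "d \<in> set (oedges G)" "pathfinish d = pathstart g" by blast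
    have "d = g" by (rule boundary_unique[of _ _ "pathstart g"]) (use that d in \<open>auto simp: ends_def\<close>)
    thus False using d arc_distinct_ends[OF edge(1), of g] that by auto
  qed
  have dis: "pathfinish ` ?F \<inter> pathstart ` ?S = {}" using sgS by fastforce
  have iF: "inj_on pathfinish ?F" using boundary_unique by (auto simp: inj_on_def ends_def)
  have iS: "inj_on pathstart ?S" using boundary_unique by (auto simp: inj_on_def ends_def)
  have "potential n G = (\<Sum>i\<in>pathfinish ` ?F. ?sg i * X i ^ (n + 1)) + (\<Sum>i\<in>pathstart ` ?S. ?sg i * X i ^ (n + 1))"
    unfolding potential_def B using dis by (intro sum.union_disjoint) auto
  also have "(\<Sum>i\<in>pathfinish ` ?F. ?sg i * X i ^ (n + 1)) = (\<Sum>g\<in>?F. X (pathfinish g) ^ (n + 1))"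
    unfolding sum.reindex[OF iF] comp_apply by (intro sum.cong refl) (auto simp del: power_Suc)
  also have "(\<Sum>i\<in>pathstart ` ?S. ?sg i * X i ^ (n + 1)) = (\<Sum>g\<in>?S. - (X (pathstart g) ^ (n + 1)))"
    unfolding sum.reindex[OF iS] comp_apply using sgS by (intro sum.cong refl) (simp del: power_Suc)
  finally show ?thesis using distinct_lists(1) by (simp add: sum_list_distinct_conv_sum_set sum_negf del: power_Suc)
qed

text \<open>The arcs of an edge telescope to its last minus its first mark, and those of a loop to
  zero. Ends at wide edges cancel against the potentials of the wide edges, which leaves the
  boundary points.\<close>

lemma sum_wpot:
  assumes P: "mk P"
  shows "(\<Sum>i\<leftarrow>names P. wpot P i) = potential n G"
proof -
  let ?f = "\<lambda>v. X v ^ (n + 1) :: complex mpoly"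
  have L: "(\<Sum>c\<leftarrow>oloops G. sum_list (map (wpot P) (loop_names P c))) = 0"
  proof -
    have "sum_list (map (wpot P) (loop_names P c)) = 0" for c
    proof (cases "lm P c = []")
      case False
      thus ?thesis using edge_arcs_telescope[of "lm P c @ [hd (lm P c)]" P] by (simp add: loop_names_def loop_arcs_edge_arcs)
    qed (simp add: loop_names_def wpot_def)
    hence "(\<Sum>c\<leftarrow>oloops G. sum_list (map (wpot P) (loop_names P c))) = (\<Sum>c\<leftarrow>oloops G. 0)" by simp
    thus ?thesis by simp
  qed
  have E: "(\<Sum>g\<leftarrow>oedges G. sum_list (map (wpot P) (edge_arcs (em P g)))) = (\<Sum>g\<leftarrow>oedges G. ?f (last (em P g))) - (\<Sum>g\<leftarrow>oedges G. ?f (hd (em P g)))"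
  proof -
    have "(\<Sum>g\<leftarrow>oedges G. sum_list (map (wpot P) (edge_arcs (em P g)))) = (\<Sum>g\<leftarrow>oedges G. ?f (last (em P g)) - ?f (hd (em P g)))"
      using edge_arcs_telescope em_nonempty[OF P] by (intro arg_cong[where f=sum_list] map_cong) auto
    thus ?thesis by (simp add: sum_list_subtractf)
  qed
  have fin: "(\<Sum>g\<leftarrow>oedges G. ?f (last (em P g))) = (\<Sum>g\<leftarrow>filter (\<lambda>g. pathfinish g \<in> sphere 0 1) (oedges G). ?f (pathfinish g)) +
      (\<Sum>w\<leftarrow>wedges G. \<Sum>g\<leftarrow>in_edges G w. ?f (last (em P g)))"
  proof -
    have "(\<Sum>g\<leftarrow>oedges G. ?f (last (em P g))) = (\<Sum>g\<leftarrow>filter (\<lambda>g. pathfinish g \<in> sphere 0 1) (oedges G). ?f (last (em P g))) +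
      (\<Sum>w\<leftarrow>wedges G. \<Sum>g\<leftarrow>filter (\<lambda>g. pathfinish g = pathstart w) (oedges G). ?f (last (em P g)))"
      by (rule sum_list_partition[OF distinct_lists(2)]) (rule edge(4), assumption, metis wedge_not_sphere, metis wedge_vertices(2))
    moreover have "map (\<lambda>g. ?f (last (em P g))) (filter (\<lambda>g. pathfinish g \<in> sphere 0 1) (oedges G)) =
       map (\<lambda>g. ?f (pathfinish g)) (filter (\<lambda>g. pathfinish g \<in> sphere 0 1) (oedges G))"
      by (rule map_cong[OF refl]) (use em_last(1)[OF P] in \<open>auto simp del: power_Suc mem_sphere_0\<close>)
    ultimately show ?thesis by (simp only: in_edges_def)
  qed
  have start: "(\<Sum>g\<leftarrow>oedges G. ?f (hd (em P g))) = (\<Sum>g\<leftarrow>filter (\<lambda>g. pathstart g \<in> sphere 0 1) (oedges G). ?f (pathstart g)) +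
      (\<Sum>w\<leftarrow>wedges G. \<Sum>g\<leftarrow>out_edges G w. ?f (hd (em P g)))"
  proof -
    have "(\<Sum>g\<leftarrow>oedges G. ?f (hd (em P g))) = (\<Sum>g\<leftarrow>filter (\<lambda>g. pathstart g \<in> sphere 0 1) (oedges G). ?f (hd (em P g))) +
      (\<Sum>w\<leftarrow>wedges G. \<Sum>g\<leftarrow>filter (\<lambda>g. pathstart g = pathfinish w) (oedges G). ?f (hd (em P g)))"
      by (rule sum_list_partition[OF distinct_lists(2)]) (rule edge(3), assumption, metis wedge_not_sphere, metis wedge_vertices(3))
    moreover have "map (\<lambda>g. ?f (hd (em P g))) (filter (\<lambda>g. pathstart g \<in> sphere 0 1) (oedges G)) =
       map (\<lambda>g. ?f (pathstart g)) (filter (\<lambda>g. pathstart g \<in> sphere 0 1) (oedges G))"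
      by (rule map_cong[OF refl]) (use em_hd(1)[OF P] in \<open>auto simp del: power_Suc mem_sphere_0\<close>)
    ultimately show ?thesis by (simp only: out_edges_def)
  qed
  have W: "(\<Sum>w\<leftarrow>wedges G. wpot P (Wide_factor w)) = (\<Sum>w\<leftarrow>wedges G. \<Sum>g\<leftarrow>out_edges G w. ?f (hd (em P g))) - (\<Sum>w\<leftarrow>wedges G. \<Sum>g\<leftarrow>in_edges G w. ?f (last (em P g)))"
  proof -
    have "(\<Sum>w\<leftarrow>wedges G. wpot P (Wide_factor w)) = (\<Sum>w\<leftarrow>wedges G. (\<Sum>g\<leftarrow>out_edges G w. ?f (hd (em P g))) - (\<Sum>g\<leftarrow>in_edges G w. ?f (last (em P g))))"
      by (intro arg_cong[where f=sum_list] map_cong refl)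
         (simp add: wpot_def sum_list_two[OF wedge(3)] sum_list_two[OF wedge(4)] algebra_simps del: power_Suc)
    thus ?thesis by (simp add: sum_list_subtractf)
  qed
  have "(\<Sum>i\<leftarrow>names P. wpot P i) = (\<Sum>w\<leftarrow>wedges G. wpot P (Wide_factor w)) + (\<Sum>g\<leftarrow>oedges G. sum_list (map (wpot P) (edge_arcs (em P g))))
      + (\<Sum>c\<leftarrow>oloops G. sum_list (map (wpot P) (loop_names P c)))" by (simp add: names_eq sum_list_concat_map comp_def add.assoc)
  thus ?thesis unfolding L E W fin start potential_eq by simp
qed

definition wp :: "complex set => nat => complex mpoly" where "wp P k = wpot P (names P ! k)"

lemma sum_wp: "mk P ==> (\<Sum>k<length (facts P). wp P k) = potential n G" using sum_wpot by (simp add: wp_def sum_list_sum_nth atLeast0LessThan)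

lemma fact_factorization: "k < length (facts P) ==> factorization n (wp P k) (facts P ! k)" by (simp add: wp_def factor_factorization)

lemma potential_polys: "potential n G \<in> polys (boundary_points G)"
  unfolding potential_def by (intro polys_sum polys_mult polys_power) (auto split: if_splits)

lemma potential_homog: "homog (2 * (int n + 1)) (potential n G)"
proof -
  have "homog (2 * (int n + 1)) (X i ^ (n + 1) :: complex mpoly)" for i
    using homog_power[OF homog_X, of "n + 1" i] by (simp add: algebra_simps del: power_Suc)
  moreover have "(if b then 1 else - 1) * p = (if b then p else - p)" for b and p :: "complex mpoly" by simp
  ultimately show ?thesis unfolding potential_def by (intro homog_sum) (auto simp del: power_Suc)
qed

subsection \<open>Variables of the factors\<close>

lemma wide_name: "Wide_factor w \<in> set (names P) \<longleftrightarrow> w \<in> set (wedges G)"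
  using edge_arcs_ArcE loop_arcs_ArcE by (fastforce simp: set_names loop_names_def split: if_splits)

lemma bvars_wide: "bvars (factor n G P (Wide_factor w)) =
    {hd (em P (out_edges G w ! 0)), hd (em P (out_edges G w ! 1)), last (em P (in_edges G w ! 0)), last (em P (in_edges G w ! 1))}"
  by (auto simp: wide_fact_def)

lemma bvars_wide_cases:
  assumes "w \<in> set (wedges G)"
  shows "v \<in> bvars (factor n G P (Wide_factor w)) \<longleftrightarrow>
    (\<exists>g\<in>set (oedges G). (pathstart g = pathfinish w \<and> v = hd (em P g)) \<or> (pathfinish g = pathstart w \<and> v = last (em P g)))"
proof -
  have "set (out_edges G w) = {out_edges G w ! 0, out_edges G w ! 1}" "set (in_edges G w) = {in_edges G w ! 0, in_edges G w ! 1}"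
    using wedge(3,4)[OF assms] by (auto simp: numeral_2_eq_2 length_Suc_conv)
  hence "bvars (factor n G P (Wide_factor w)) = (\<lambda>g. hd (em P g)) ` set (out_edges G w) \<union> (\<lambda>g. last (em P g)) ` set (in_edges G w)"
    unfolding bvars_wide by auto
  thus ?thesis by (auto simp: out_edges_def in_edges_def)
qed

lemma bvars_factor: "mk P ==> i \<in> set (names P) ==> bvars (factor n G P i) \<subseteq> P"
proof -
  assume P: "mk P" and i: "i \<in> set (names P)"
  show ?thesis
  proof (cases i)
    case (Wide_factor w)
    hence w: "w \<in> set (wedges G)" using i wide_name by simp
    have "hd (em P g) \<in> P" "last (em P g) \<in> P" if "g \<in> set (oedges G)" for g
      using hd_in_set[OF em_nonempty[OF P that]] last_in_set[OF em_nonempty[OF P that]] em(1)[OF P that] by auto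
    thus ?thesis unfolding Wide_factor using bvars_wide_cases[OF w, of _ P] by auto
  next
    case (Arc_factor y x)
    thus ?thesis using i arc_name_marks[OF P, of y x] by (simp add: arc_fact_simps)
  qed (simp add: circle_simps)
qed

text \<open>A mark with a neighbour lies on an arc. A lone mark on a loop is both ends of the
  closing arc, and a lone mark on an edge is next to a wide edge.\<close>

lemma mark_in_factor:
  assumes P: "mk P" and v: "v \<in> P"
  shows "\<exists>i\<in>set (names P). v \<in> bvars (factor n G P i)"
proof -
  obtain g where g: "g \<in> curves" "v \<in> path_image g" using mkD(2)[OF P v] by blast
  hence vm: "v \<in> set (on_curve P g)" using on_curve(1)[OF P] v by simp
  show ?thesis
  proof (cases "\<exists>t\<in>set (on_curve P g). t \<noteq> v")
    case True
    then obtain q where "neighbours (on_curve P g) v q" using neighbour_exists vm by metis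
    then obtain \<alpha> where "adjacent P v q \<alpha>" using neighbours_adjacent[OF P g(1)] by blast
    thus ?thesis by (intro bexI[of _ \<alpha>]) (auto simp: adjacent_def arc_fact_simps)
  next
    case False
    hence sv: "set (on_curve P g) = {v}" using vm by blast
    show ?thesis
    proof (cases "g \<in> set (oloops G)")
      case True
      moreover have "g \<notin> set (oedges G)" using True edges_loops_distinct by blast
      ultimately have sl: "set (lm P g) = {v}" using sv by (simp add: on_curve_def)
      hence "length (lm P g) = 1" using distinct_card[OF lm(2)[OF P True]] by simp
      then obtain u where "lm P g = [u]" by (auto simp: length_Suc_conv One_nat_def)
      hence "loop_names P g = [Arc_factor v v]" using sl by (simp add: loop_names_def loop_arcs_def)
      hence "Arc_factor v v \<in> set (loop_names P g)" by simp
      hence "Arc_factor v v \<in> set (names P)" unfolding set_names using True by blast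
      thus ?thesis by (intro bexI[of _ "Arc_factor v v"]) (auto simp: arc_fact_simps)
    next
      case False
      hence g: "g \<in> set (oedges G)" using g by auto
      hence s: "set (em P g) = {v}" using sv by (simp add: on_curve_def)
      have hl: "hd (em P g) = v" "last (em P g) = v" using hd_in_set[OF em_nonempty[OF P g]] last_in_set[OF em_nonempty[OF P g]] s by auto
      \<comment> \<open>Two ends on the boundary would be two distinct marks, so an edge with one
        mark meets a wide edge.\<close>
      have "pathstart g \<notin> sphere 0 1 \<or> pathfinish g \<notin> sphere 0 1"
        using em_hd(1)[OF P g] em_last(1)[OF P g] hl arc_distinct_ends[OF edge(1)[OF g]] by auto
      then obtain w where w: "w \<in> set (wedges G)" "pathstart g = pathfinish w \<or> pathfinish g = pathstart w" using edge(3,4)[OF g] by blast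
      hence "v \<in> bvars (factor n G P (Wide_factor w))" unfolding bvars_wide_cases[OF w(1)] using g hl by auto
      thus ?thesis using w wide_name by blast
    qed
  qed
qed

lemma bvars_facts: "mk P ==> bvars (btensor (facts P)) = P" using bvars_factor mark_in_factor by (fastforce simp: bvars_btensor)

lemma factor_nilpotent:
  assumes v: "v \<in> bvars (factor n G P i)"
  shows "nilpotent_var n (factor n G P i) v"
proof (cases i)
  case (Wide_factor w)
  obtain \<rho> where \<rho>: "factor n G P i = brename \<rho> (wide_generic n)" by (simp add: Wide_factor wide_fact_def)
  then obtain u where "u \<in> bvars (wide_generic n)" "v = \<rho> u" using v by auto
  thus ?thesis unfolding \<rho> using nilpotent_wide[OF n] by blast
next
  case (Arc_factor y x)
  obtain \<rho> where \<rho>: "factor n G P i = brename \<rho> (arc_generic n)" by (simp add: Arc_factor arc_fact_def)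
  then obtain u where "u \<in> bvars (arc_generic n)" "v = \<rho> u" using v by auto
  thus ?thesis unfolding \<rho> using nilpotent_arc by blast
qed (use v in \<open>simp add: circle_simps\<close>)

lemma K_factorization: "mk P ==> factorization n (potential n G) (btensor (facts P))"
  using factorization_btensor[OF fact_factorization, of P] sum_wp by simp

text \<open>A null-homotopy of a multiple of v^n on a single factor containing v extends to the
  whole product, and each internal mark v occurs in some factor.\<close>

lemma C_graph_hmf_object:
  assumes P: "mk P"
  shows "hmf_object n (boundary_points G) (potential n G) (C_graph n G P)" unfolding C_graph_def
proof (rule hmf_object_gfact_of[OF n K_factorization[OF P] _ potential_polys potential_homog])
  show "boundary_points G \<subseteq> bvars (btensor (facts P))" using mkD(4)[OF P] bvars_facts[OF P] by simp
  fix v assume "v \<in> bvars (btensor (facts P)) - boundary_points G"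
  hence "v \<in> P" using bvars_facts[OF P] by simp
  then obtain i where i: "i \<in> set (names P)" "v \<in> bvars (factor n G P i)" using mark_in_factor[OF P] by blast
  then obtain k where k: "k < length (facts P)" "facts P ! k = factor n G P i" by (auto simp: in_set_conv_nth)
  let ?M = "facts P ! k"
  obtain T c where T: "c \<noteq> 0" "car_map ?M ?M True T" "\<And>b. b \<in> bas ?M ==> lin_ext id T (bdif ?M b) + bd ?M (T b) = single b (Const c * X v ^ n)"
    using factor_nilpotent[OF i(2)] k(2) unfolding nilpotent_var_def by auto
  have "null_homotopy (btensor (facts P)) (Const c * X v ^ n) (LO (facts P) k T)" unfolding null_homotopy_def
  proof (intro conjI exI allI impI)
    show "LO (facts P) k T = lin_ext id (lop (facts P) k T)" by (simp add: LO_def)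
    show "car_map (btensor (facts P)) (btensor (facts P)) True (lop (facts P) k T)" by (rule lop_car_map[OF k(1) T(2)])
    fix f :: graph_module assume f: "keys f \<subseteq> bas (btensor (facts P))"
    show "LO (facts P) k T (bd (btensor (facts P)) f) + bd (btensor (facts P)) (LO (facts P) k T f) = psmul (Const c * X v ^ n) f"
      by (rule btensor_anticommutator[OF k(1) factorization_odd_map[OF fact_factorization] car_map_odd_map[OF T(2)] T(3) f])
  qed
  thus "\<exists>H c. c \<noteq> 0 \<and> null_homotopy (btensor (facts P)) (Const c * X v ^ n) H" using T(1) by blast
qed

end

section \<open>Removals and additions of marks as maps of tensor products\<close>

definition pos :: "'i list => 'i => nat" where
  "pos xs i = (THE k. k < length xs \<and> xs ! k = i)"

lemma pos_nth: "distinct xs ==> k < length xs ==> pos xs (xs ! k) = k" unfolding pos_def by (rule the_equality) (auto simp: nth_eq_iff_index_eq)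

lemma nth_pos: "distinct xs ==> i \<in> set xs ==> pos xs i < length xs \<and> xs ! pos xs i = i" by (metis in_set_conv_nth pos_nth)

lemma pos_inj: "distinct xs ==> i \<in> set xs ==> j \<in> set xs ==> pos xs i = pos xs j \<longleftrightarrow> i = j" by (metis nth_pos)

lemma pos_update:
  assumes "distinct xs" "distinct (xs[k := z])" "k < length xs"
  shows "pos (xs[k := z]) z = k" "i \<in> set xs ==> i \<noteq> xs ! k ==> pos (xs[k := z]) i = pos xs i"
proof -
  show "pos (xs[k := z]) z = k" using pos_nth[OF assms(2), of k] assms(3) by simp
  assume i: "i \<in> set xs" "i \<noteq> xs ! k"
  hence "pos xs i \<noteq> k" using nth_pos[OF assms(1) i(1)] by auto
  hence "xs[k := z] ! pos xs i = i" using nth_pos[OF assms(1) i(1)] by simp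
  thus "pos (xs[k := z]) i = pos xs i" using pos_nth[OF assms(2), of "pos xs i"] nth_pos[OF assms(1) i(1)] by simp
qed

lemma precedes_pos: "distinct xs ==> i \<in> set xs ==> j \<in> set xs ==> precedes xs i j \<longleftrightarrow> pos xs i < pos xs j"
proof -
  assume d: "distinct xs" and i: "i \<in> set xs" and j: "j \<in> set xs"
  have *: "k = pos xs i" if "k < length xs" "xs ! k = i" for k i using pos_nth[OF d that(1)] that(2) by simp
  show ?thesis
  proof
    assume "precedes xs i j"
    then obtain k l where "k < l" "l < length xs" "xs ! k = i" "xs ! l = j" unfolding precedes_def by blast
    thus "pos xs i < pos xs j" using *[of k i] *[of l j] by simp
  next
    assume "pos xs i < pos xs j"
    thus "precedes xs i j" unfolding precedes_def using nth_pos[OF d i] nth_pos[OF d j] by blast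
  qed
qed

text \<open>\<open>remove_mark\<close> and its description as a reindexing agree on elements of the
  module, so invertibility has to be transported between maps that coincide there.\<close>

lemma hmf_inverse_cong:
  assumes "hinverse n V K L f g" "\<And>i m. m \<in> car K i ==> f' i m = f i m" "bd_closed K" "bd_closed L"
    and V: "V \<subseteq> bvars K"
  shows "hinverse n V K L f' g"
proof -
  have p: "p \<in> polys V ==> p \<in> polys (bvars K)" for p using V polys_mono by blast
  have fm: "mor V K L f" and gm: "mor V L K g" using assms(1) by (auto simp: hmf_inverse_def)
  have f'm: "mor V K L f'"
  proof (rule gmorI)
    fix i k m assume m: "m \<in> hom K i k"
    hence "m \<in> car K i" by (auto simp: hom_iff car_iff)
    thus "f' i m \<in> hom L i k" using gmor_hom[OF fm m] assms(2) by simp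
  qed (use assms(2,3) gmor_car[OF fm] gmor_add[OF fm] gmor_psmul[OF fm] gmor_bd[OF fm] in \<open>auto simp: bd_closed_def car_add car_psmul p\<close>)
  have "htpy n V K L f' f" by (rule homotopic_eqI) (rule assms(2))
  hence "htpy n V K K (\<lambda>i. g i \<circ> f' i) (\<lambda>i. g i \<circ> f i)"
    "htpy n V L L (\<lambda>i. f' i \<circ> g i) (\<lambda>i. f i \<circ> g i)"
    using fm gm f'm assms(3,4) by (auto intro!: homotopic_comp_left homotopic_comp_right simp: gmor_car bd_closed_def)
  thus ?thesis using assms(1) fm gm f'm unfolding hmf_inverse_def by (meson homotopic_trans)
qed

text \<open>Inverts two parallel sides of a square commuting up to homotopy. It turns relations for
  the maps that mark a circle into relations for their inverses.\<close>

lemma square_inverse: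
  assumes u: "hinverse n V K L u u'" and t: "hinverse n V K' L' t t'"
    and v: "mor V L L' v" "mor V K K' v'"
    and sq: "htpy n V K L' (\<lambda>i. v i \<circ> u i) (\<lambda>i. t i \<circ> v' i)"
    and c: "bd_closed K" "bd_closed L" "bd_closed K'" "bd_closed L'"
  shows "htpy n V L K' (\<lambda>i. t' i \<circ> v i) (\<lambda>i. v' i \<circ> u' i)"
proof -
  have m: "mor V K L u" "mor V L K u'" "mor V K' L' t"
      "mor V L' K' t'" using u t by (auto simp: hmf_inverse_def)
  have m2: "mor V K L' (\<lambda>i. v i \<circ> u i)" using m v by (intro gmor_comp)
  have "htpy n V L L' v (\<lambda>i. (\<lambda>i. t i \<circ> v' i) i \<circ> u' i)"
  proof (rule hmf_inverse_cancel_right[OF u _ v(1)])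
    have "htpy n V K K (\<lambda>i m. m) (\<lambda>i. u' i \<circ> u i)" using u by (auto simp: hmf_inverse_def intro: homotopic_sym)
    hence "htpy n V K L' (\<lambda>i. (t i \<circ> v' i) \<circ> (\<lambda>m. m)) (\<lambda>i. (t i \<circ> v' i) \<circ> (u' i \<circ> u i))"
      by (rule homotopic_comp_left) (use m v c in \<open>auto intro!: gmor_comp simp: gmor_car bd_closed_def\<close>)
    thus "htpy n V K L' (\<lambda>i. v i \<circ> u i) (\<lambda>i. (\<lambda>i. (\<lambda>i. t i \<circ> v' i) i \<circ> u' i) i \<circ> u i)"
      using sq by (auto simp: comp_def elim: homotopic_trans)
  qed (use m v c in \<open>auto intro!: gmor_comp\<close>)
  hence "htpy n V L L' (\<lambda>i. t i \<circ> (v' i \<circ> u' i)) v" by (simp add: comp_def homotopic_sym)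
  hence "htpy n V L K' (\<lambda>i. v' i \<circ> u' i) (\<lambda>i. t' i \<circ> v i)"
    by (intro hmf_inverse_cancel_left[OF t]) (use m v c in \<open>auto intro!: gmor_comp\<close>)
  thus ?thesis by (rule homotopic_sym)
qed

definition merge :: "complex => complex => complex => complex" where
  "merge p q = id(p := q)"

text \<open>If an arc connects the two marks on a loop, then removing one of them after re-inserting the
  other one amounts to moving a mark.\<close>

lemma swap_two_marks:
  assumes Amr: "mark_removal Ms Ns A \<tau> \<rho> y x n a w x y V" and Bmr: "mark_removal Ms Ns' A \<tau>' \<rho>' x y n a w x y V"
    and \<tau>\<tau>': "\<And>k. k \<in> A ==> \<tau> k = \<tau>' k" and cs: "cs \<in> bas (btensor Ns)"
  shows "reindexing.E Ms Ns' A \<tau>' \<rho>' ((mark_removal.proj Ms y x a x \<circ> mark_removal.iota Ms A \<tau> a) (single cs r))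
      = single cs (psubst (\<lambda>v. X (\<rho>' v)) r)"
proof -
  interpret A: mark_removal Ms Ns A \<tau> \<rho> y x n a w x y V by (rule Amr)
  interpret B: mark_removal Ms Ns' A \<tau>' \<rho>' x y n a w x y V by (rule Bmr)
  \<comment> \<open>Both removals contract the same arc, so their operators \<open>up\<close> differ
    at most by a sign.\<close>
  have B_up: "B.E (A.up f) = 0" if f: "keys f \<subseteq> bas A.K" for f
  proof -
    have "A.up f = psmul (A.sg * B.sg) (B.up f)" using B.sg(2) by (simp add: A.up_def B.up_def mult.assoc)
    thus ?thesis using B.E_up[OF f] by (simp add: B.E_psmul)
  qed
  have B_h: "B.E (A.h f) = 0" if f: "keys f \<subseteq> bas A.K" for f using B_up[of "A.dd f"] A.dd_keys[of f] f by (simp add: A.h_def B.E_uminus)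
  have B_proj: "B.E (A.proj f) = B.E f" if f: "keys f \<subseteq> bas A.K" for f
    using B_h[OF f] B_h[OF A.bd_keys[OF f]] B.E_bd[OF A.h_keys[OF f]] by (simp add: A.proj_def B.E_diff)
  have len: "length Ns' = length Ns" using bij_betw_same_card[OF A.\<tau>] bij_betw_same_card[OF B.\<tau>] by simp
  have rl: "reidx_list A \<tau>' (length Ns') (A.lift_list cs) = cs"
    by (rule B.reidx_eqI) (use cs len in \<open>auto simp: bas_btensor A.nth_lift_list simp flip: \<tau>\<tau>'\<close>)
  have sg: "inv_sgn (oddset Ms A (A.lift_list cs)) \<tau> = (inv_sgn (oddset Ms A (A.lift_list cs)) \<tau>' :: complex mpoly)"
    by (rule inv_sgn_cong) (auto simp: oddset_def \<tau>\<tau>')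
  have "keys (A.iota (single cs r)) \<subseteq> bas A.K" by (rule A.iota_keys) (use cs in auto)
  hence "B.E (A.proj (A.iota (single cs r))) = B.E (A.iota (single cs r))" by (rule B_proj)
  also have "\<dots> = single cs (B.\<psi> r)"
    by (simp add: A.iota_def B.E_psmul B.E_single B.reindex_even A.nth_lift_list rl sg psubst_mult inv_sgn_sq mult.assoc)
  finally show ?thesis by simp
qed

context planar
begin

abbreviation KK where "KK P \<equiv> btensor (facts P)"
abbreviation C where "C P \<equiv> gfact_of (KK P)"
abbreviation B where "B \<equiv> boundary_points G"
abbreviation hty where "hty P Q \<equiv> homotopic n B (C P) (C Q)"
abbreviation hinv where "hinv P Q \<equiv> hmf_inverse n B (C P) (C Q)"

lemma C_graph_eq: "C_graph n G P = C P" by (simp add: C_graph_def)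

lemma KK_bd_closed: "mk P ==> bd_closed (KK P)" using K_factorization factorization_bd_closed by blast

lemma B_bvars: "mk P ==> B \<subseteq> bvars (KK P)" using mkD(4) bvars_facts by simp

lemma mk_between: "mk P ==> mk Q ==> P \<subseteq> R ==> R \<subseteq> Q ==> mk R"
proof -
  assume P: "mk P" and Q: "mk Q" and R: "P \<subseteq> R" "R \<subseteq> Q"
  have "path_image g \<inter> R \<noteq> {}" if "g \<in> set (oedges G)" "ends g \<inter> sphere 0 1 = {}" for g using mkD(5)[OF P that] R(1) by blast
  moreover have "R \<subseteq> (\<Union>g\<in>curves. path_image g) - (\<Union>w\<in>set (wedges G). path_image w)"
    using Q R(2) unfolding marking_def by (meson order_trans)
  ultimately show ?thesis unfolding marking_def using mkD(4)[OF P] R finite_subset[OF R(2) mkD(1)[OF Q]] by (metis order_trans)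
qed

lemma mk_union: "mk P ==> mk Q ==> mk (P \<union> Q)"
proof -
  assume P: "mk P" and Q: "mk Q"
  have "path_image g \<inter> (P \<union> Q) \<noteq> {}" if "g \<in> set (oedges G)" "ends g \<inter> sphere 0 1 = {}" for g
    using mkD(5)[OF P that] by blast
  moreover have "P \<union> Q \<subseteq> (\<Union>g\<in>curves. path_image g) - (\<Union>w\<in>set (wedges G). path_image w)"
    using P Q unfolding marking_def by (meson Un_least)
  ultimately show ?thesis unfolding marking_def using mkD(4)[OF P] mkD(1)[OF P] mkD(1)[OF Q] by (metis finite_UnI le_supI1)
qed

lemma length_KK: "bs \<in> bas (KK P) ==> length bs = length (names P)" by (simp add: bas_btensor)

section \<open>Mark removals as reindexings of the list of factors\<close>

definition rset :: "complex set => factor_name => nat set" where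
  "rset P \<alpha> = {..<length (names P)} - {pos (names P) \<alpha>}"

definition rmove :: "complex set => complex => complex => nat => nat" where
  "rmove P p q k = pos (names (P - {p})) (rename_factor (merge p q) (names P ! k))"

definition rm :: "complex set => complex => complex => factor_name => graph_module => graph_module" where
  "rm P p q \<alpha> = reindexing.E (facts P) (facts (P - {p})) (rset P \<alpha>) (rmove P p q) (merge p q)"

context
  fixes P p q \<alpha>
  assumes P: "mk P" "mk (P - {p})" and a: "adjacent P p q \<alpha>"
begin

lemma a_set: "\<alpha> \<in> set (names P)" and pq: "p \<noteq> q" and \<alpha>: "\<alpha> = Arc_factor p q \<or> \<alpha> = Arc_factor q p"
  using a by (auto simp: adjacent_def)

lemma rset_iff: "k \<in> rset P \<alpha> \<longleftrightarrow> k < length (names P) \<and> names P ! k \<noteq> \<alpha>"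
  using pos_nth[OF distinct_names[OF P(1)], of k] nth_pos[OF distinct_names[OF P(1)] a_set] by (auto simp: rset_def)

lemma names_bij: "bij_betw (\<lambda>k. names P ! k) (rset P \<alpha>) (set (names P) - {\<alpha>})" unfolding bij_betw_def
proof
  show "inj_on (\<lambda>k. names P ! k) (rset P \<alpha>)" using distinct_names[OF P(1)] by (auto simp: inj_on_def rset_def nth_eq_iff_index_eq)
  show "(\<lambda>k. names P ! k) ` rset P \<alpha> = set (names P) - {\<alpha>}" unfolding set_conv_nth using rset_iff by blast
qed

lemma rename_bij: "bij_betw (rename_factor (merge p q)) (set (names P) - {\<alpha>}) (set (names (P - {p})))"
  unfolding bij_betw_def merge_def using rename_inj[OF P(1) a] rename_names[OF P(1) a] by simp

lemma pos_bij: "mk Q ==> bij_betw (pos (names Q)) (set (names Q)) {..<length (names Q)}" unfolding bij_betw_def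
proof
  assume Q: "mk Q"
  show "inj_on (pos (names Q)) (set (names Q))" using pos_inj[OF distinct_names[OF Q]] by (auto simp: inj_on_def)
  show "pos (names Q) ` set (names Q) = {..<length (names Q)}"
  proof (intro equalityI subsetI)
    fix k assume "k \<in> {..<length (names Q)}"
    hence "k = pos (names Q) (names Q ! k)" "names Q ! k \<in> set (names Q)" using pos_nth[OF distinct_names[OF Q]] by auto
    thus "k \<in> pos (names Q) ` set (names Q)" by (rule image_eqI)
  qed (use nth_pos[OF distinct_names[OF Q]] in auto)
qed

lemma rmove_bij: "bij_betw (rmove P p q) (rset P \<alpha>) {..<length (names (P - {p}))}"
  using bij_betw_trans[OF bij_betw_trans[OF names_bij rename_bij] pos_bij[OF P(2)]] by (simp add: rmove_def[abs_def] comp_def)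

lemma names_rmove: "k \<in> rset P \<alpha> ==> rmove P p q k < length (names (P - {p})) \<and> names (P - {p}) ! rmove P p q k = rename_factor (merge p q) (names P ! k)"
proof -
  assume k: "k \<in> rset P \<alpha>"
  hence "rename_factor (merge p q) (names P ! k) \<in> set (names (P - {p}))" using bij_betwE[OF rename_bij] bij_betwE[OF names_bij] by blast
  thus ?thesis unfolding rmove_def using nth_pos[OF distinct_names[OF P(2)]] by blast
qed

lemma removal_reindexing: "reindexing (facts P) (facts (P - {p})) (rset P \<alpha>) (rmove P p q) (merge p q)"
proof
  show "rset P \<alpha> \<subseteq> {..<length (facts P)}" by (auto simp: rset_def)
  show "bij_betw (rmove P p q) (rset P \<alpha>) {..<length (facts (P - {p}))}" using rmove_bij by simp
  fix k assume k: "k \<in> rset P \<alpha>"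
  hence kl: "k < length (names P)" by (simp add: rset_iff)
  have "facts (P - {p}) ! rmove P p q k = factor n G (P - {p}) (rename_factor (merge p q) (names P ! k))" using names_rmove[OF k] by simp
  also have "\<dots> = brename (merge p q) (facts P ! k)" using factor_rename[OF P(1) a, of "names P ! k"] kl by (simp add: merge_def)
  finally show "facts (P - {p}) ! rmove P p q k = brename (merge p q) (facts P ! k)" .
qed

lemma removal:
  assumes "\<alpha> = Arc_factor y x"
  shows "mark_removal (facts P) (facts (P - {p})) (rset P \<alpha>) (rmove P p q) (merge p q) p q n (pos (names P) \<alpha>) (wp P) x y B"
proof (rule mark_removal.intro[OF removal_reindexing], unfold_locales)
  note nth = nth_pos[OF distinct_names[OF P(1)] a_set]
  show "merge p q = id(p := q)" by (rule merge_def)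
  show "pos (names P) \<alpha> < length (facts P)" using nth by simp
  show "rset P \<alpha> = {..<length (facts P)} - {pos (names P) \<alpha>}" by (simp add: rset_def)
  show "facts P ! pos (names P) \<alpha> = arc_fact n x y" using nth assms by simp
  show "x = p \<and> y = q \<or> x = q \<and> y = p" using \<alpha> assms by auto
  show "p \<noteq> q" by (rule pq)
  show "\<And>k. k < length (facts P) ==> factorization n (wp P k) (facts P ! k)" by (rule fact_factorization)
  show "(\<Sum>k<length (facts P). wp P k) \<in> polys B" using sum_wp[OF P(1)] potential_polys by simp
  show "B \<subseteq> bvars (btensor (facts P))" using mkD(4)[OF P(1)] bvars_facts[OF P(1)] by simp
  show "p \<notin> B" using mkD(4)[OF P(2)] by auto
  show "q \<in> bvars (btensor (facts (P - {p})))" using bvars_facts[OF P(2)] adjacent_marks[OF P(1) a] pq by simp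
qed

lemma rm_hinv: "\<exists>g. hinv P (P - {p}) (\<lambda>i. rm P p q \<alpha>) g"
proof -
  obtain y x where "\<alpha> = Arc_factor y x" using \<alpha> by blast
  thus ?thesis unfolding rm_def using mark_removal.removal_inverse[OF removal] by blast
qed

lemma rm_gmor: "gmor B (C P) (C (P - {p})) (\<lambda>i. rm P p q \<alpha>)" using rm_hinv by (auto simp: hmf_inverse_def)

text \<open>The reordering sign counts inversions among the surviving odd factors, so it does not matter
  whether positions are counted before or after the entry of \<open>\<alpha>\<close> is dropped.\<close>

lemma remove_mark_eq:
  assumes f: "f \<in> car (KK P) i"
  shows "remove_mark n G P \<alpha> p q f = rm P p q \<alpha> f"
proof -
  interpret R: reindexing "facts P" "facts (P - {p})" "rset P \<alpha>" "rmove P p q" "merge p q" by (rule removal_reindexing)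
  let ?Is = "names P" and ?Js = "names (P - {p})" and ?r = "rename_factor (merge p q)" and ?L = "length (names P)" and ?a = "pos (names P) \<alpha>"
  note dI = distinct_names[OF P(1)] and dJ = distinct_names[OF P(2)]
  have a_pos: "?a < ?L" "?Is ! ?a = \<alpha>" using nth_pos[OF dI a_set] by auto
  have basis: "(if bpar (factor n G P \<alpha>) (the (map_of (zip ?Is bs) \<alpha>)) then 0
              else let rest = filter (\<lambda>(i, b). i \<noteq> \<alpha>) (zip ?Is bs) in
                reorder (\<lambda>i. bpar (factor n G (P - {p}) i)) (map (?r \<circ> fst) rest) ?Js (map snd rest))
      = (reindex (facts P) (rset P \<alpha>) (rmove P p q) (length (facts (P - {p}))) bs :: graph_module)"
    if len: "length bs = ?L" for bs
  proof -
    have alpha: "the (map_of (zip ?Is bs) \<alpha>) = bs ! ?a" using map_of_zip_nth[of ?Is bs ?a] len dI a_pos by simp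
    show ?thesis
    proof (cases "bpar (factor n G P \<alpha>) (bs ! ?a)")
      case True
      have "reindex (facts P) (rset P \<alpha>) (rmove P p q) (length (facts (P - {p}))) bs = (0 :: graph_module)"
        by (rule reindex_killed[of ?a]) (use a_pos True in \<open>auto simp: rset_def\<close>)
      thus ?thesis using True alpha by simp
    next
      case False
      \<comment> \<open>The position in the full list of the j-th factor that remains when the arc
        is dropped.\<close>
      define up where "up j = (if j < ?a then j else Suc j)" for j
      define Z where "Z = zip ?Is bs"
      define R where "R = filter (\<lambda>(i, b). i \<noteq> \<alpha>) Z"
      have Z: "length Z = ?L" "\<And>k. k < ?L ==> Z ! k = (?Is ! k, bs ! k)" using len by (auto simp: Z_def)
      have "R = take ?a Z @ drop (Suc ?a) Z"
      proof -
        have "Z = take ?a Z @ Z ! ?a # drop (Suc ?a) Z" using a_pos Z by (intro id_take_nth_drop) simp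
        moreover have "filter (\<lambda>(i, b). i \<noteq> \<alpha>) (take ?a Z) = take ?a Z" "filter (\<lambda>(i, b). i \<noteq> \<alpha>) (drop (Suc ?a) Z) = drop (Suc ?a) Z"
        proof -
          have ne: "False" if "k \<noteq> ?a" "k < ?L" "fst (Z ! k) = \<alpha>" for k using that Z pos_nth[OF dI that(2)] by simp
          have "fst z \<noteq> \<alpha>" if z: "z \<in> set (take ?a Z)" for z
          proof -
            obtain k where "k < ?a" "k < ?L" "z = Z ! k" using z Z(1) by (auto simp: in_set_conv_nth)
            thus ?thesis using ne[of k] by auto
          qed
          thus "filter (\<lambda>(i, b). i \<noteq> \<alpha>) (take ?a Z) = take ?a Z" by (intro filter_True ballI) (simp add: case_prod_beta)
          have "fst z \<noteq> \<alpha>" if z: "z \<in> set (drop (Suc ?a) Z)" for z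
          proof -
            obtain k where k: "k < ?L - Suc ?a" "z = Z ! (Suc ?a + k)" using z Z(1) by (auto simp: in_set_conv_nth)
            hence "Suc ?a + k < ?L" by linarith
            thus ?thesis using ne[of "Suc ?a + k"] k by auto
          qed
          thus "filter (\<lambda>(i, b). i \<noteq> \<alpha>) (drop (Suc ?a) Z) = drop (Suc ?a) Z" by (intro filter_True ballI) (simp add: case_prod_beta)
        qed
        moreover have "filter (\<lambda>(i, b). i \<noteq> \<alpha>) [Z ! ?a] = []" using Z a_pos by simp
        ultimately show ?thesis unfolding R_def by (metis append_Cons append_Nil filter_append)
      qed
      hence lenR: "length R = ?L - 1" and Rn: "\<And>j. j < ?L - 1 ==> R ! j = Z ! up j" using a_pos Z(1) by (auto simp: nth_append up_def min_def)
      have up: "up j < ?L" "up j \<in> rset P \<alpha>" if "j < ?L - 1" for j using that a_pos by (auto simp: up_def rset_def)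
      have up_mono: "up j < up k \<longleftrightarrow> j < k" for j k by (auto simp: up_def)
      have up_inj: "inj up" by (auto simp: inj_def up_def split: if_splits)
      have up_onto: "\<exists>j<?L - 1. k = up j" if "k \<in> rset P \<alpha>" for k
        using that a_pos by (intro exI[of _ "if k < ?a then k else k - 1"]) (auto simp: up_def rset_def)
      define Is' where "Is' = map (?r \<circ> fst) R"
      define bs' where "bs' = map snd R"
      have Is': "length Is' = ?L - 1" "\<And>j. j < ?L - 1 ==> Is' ! j = ?r (?Is ! up j)" "length bs' = ?L - 1" "\<And>j. j < ?L - 1 ==> bs' ! j = bs ! up j"
        using lenR Rn Z(2)[OF up(1)] by (auto simp: Is'_def bs'_def)
      have pos_Is': "pos ?Js (Is' ! j) = rmove P p q (up j)" "Is' ! j \<in> set ?Js" if "j < ?L - 1" for j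
        using Is'(2)[OF that] names_rmove[OF up(2)[OF that]] nth_mem[of "rmove P p q (up j)" ?Js] by (auto simp: rmove_def)
      have dIs': "distinct Is'" unfolding distinct_conv_nth
      proof (intro allI impI notI)
        fix j k assume *: "j < length Is'" "k < length Is'" "j \<noteq> k" "Is' ! j = Is' ! k"
        hence "rmove P p q (up j) = rmove P p q (up k)" using pos_Is'(1)[of j] pos_Is'(1)[of k] Is'(1) by simp
        hence "up j = up k" using R.inj_\<tau> up(2) * Is'(1) by (auto simp: inj_on_def)
        thus False using up_inj * by (simp add: inj_eq)
      qed
      have par: "bpar (factor n G (P - {p}) (Is' ! j)) (bs' ! j) = bpar (facts P ! up j) (bs ! up j)" if "j < ?L - 1" for j
        using factor_rename[OF P(1) a, of "?Is ! up j"] up(1)[OF that] Is'(2,4)[OF that] by (simp add: merge_def)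
      have list: "map (\<lambda>j. the (map_of (zip Is' bs') j)) ?Js = reidx_list (rset P \<alpha>) (rmove P p q) (length (facts (P - {p}))) bs"
      proof (rule R.reidx_eqI[symmetric])
        fix k assume "k \<in> rset P \<alpha>"
        then obtain j where j: "j < ?L - 1" "k = up j" using up_onto by blast
        have "map_of (zip Is' bs') (Is' ! j) = Some (bs' ! j)" using j Is' dIs' by (intro map_of_zip_nth) auto
        moreover have "?Js ! rmove P p q k = Is' ! j" using j pos_Is'[OF j(1)] nth_pos[OF dJ] by metis
        moreover have "rmove P p q k < length ?Js" using names_rmove \<open>k \<in> rset P \<alpha>\<close> by blast
        ultimately show "map (\<lambda>j. the (map_of (zip Is' bs') j)) ?Js ! rmove P p q k = bs ! k" using j Is'(4) by simp
      qed simp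
      let ?S = "oddset (facts P) (rset P \<alpha>) bs"
      let ?U = "{(k, l). k < l \<and> l < length Is' \<and> bpar (factor n G (P - {p}) (Is' ! k)) (bs' ! k) \<and> bpar (factor n G (P - {p}) (Is' ! l)) (bs' ! l) \<and> precedes ?Js (Is' ! l) (Is' ! k)}"
      let ?W = "{(k, l). k \<in> ?S \<and> l \<in> ?S \<and> k < l \<and> rmove P p q l < rmove P p q k}"
      have "card ?W = card ?U"
      proof -
        have "?W = map_prod up up ` ?U"
        proof (intro equalityI subsetI)
          fix z assume "z \<in> ?W"
          then obtain k l where z: "z = (k, l)" "k \<in> ?S" "l \<in> ?S" "k < l" "rmove P p q l < rmove P p q k" by auto
          then obtain j m where jm: "j < ?L - 1" "k = up j" "m < ?L - 1" "l = up m" using up_onto by (metis (no_types, lifting) mem_Collect_eq oddset_def)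
          have "(j, m) \<in> ?U"
            using z jm par[OF jm(1)] par[OF jm(3)] precedes_pos[OF dJ pos_Is'(2)[OF jm(3)] pos_Is'(2)[OF jm(1)]] pos_Is'(1)[OF jm(1)] pos_Is'(1)[OF jm(3)] up_mono Is'(1)
            by (auto simp: oddset_def)
          thus "z \<in> map_prod up up ` ?U" using z jm by force
        next
          fix z assume "z \<in> map_prod up up ` ?U"
          then obtain j m where z: "z = (up j, up m)" "(j, m) \<in> ?U" by auto
          hence jm: "j < ?L - 1" "m < ?L - 1" using Is'(1) by auto
          show "z \<in> ?W"
            using z jm par[OF jm(1)] par[OF jm(2)] precedes_pos[OF dJ pos_Is'(2)[OF jm(2)] pos_Is'(2)[OF jm(1)]] pos_Is'(1)[OF jm(1)] pos_Is'(1)[OF jm(2)] up_mono up(2)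
            by (auto simp: oddset_def)
        qed
        moreover have "inj_on (map_prod up up) ?U" by (rule inj_on_subset[OF map_prod_inj_on[OF up_inj up_inj]]) simp
        ultimately show ?thesis by (simp only: card_image)
      qed
      hence "reorder (\<lambda>i. bpar (factor n G (P - {p}) i)) Is' ?Js bs' = (single (reidx_list (rset P \<alpha>) (rmove P p q) (length (facts (P - {p}))) bs) (inv_sgn ?S (rmove P p q)) :: graph_module)"
        unfolding reorder_def list inv_sgn_def by simp
      also have "\<dots> = reindex (facts P) (rset P \<alpha>) (rmove P p q) (length (facts (P - {p}))) bs"
        by (rule reindex_alive[symmetric]) (use False a_pos in \<open>auto simp: rset_def\<close>)
      finally show ?thesis using False alpha by (simp add: Is'_def bs'_def R_def Z_def Let_def)
    qed
  qed
  have len: "length bs = ?L" if "bs \<in> keys f" for bs using car_keys[OF f] that length_KK by blast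
  show ?thesis unfolding remove_mark_def rm_def R.E_def lin_ext_def Let_def merge_def[symmetric]
    by (intro sum.cong refl arg_cong2[where f=psmul]) (rule basis[unfolded Let_def, OF len])
qed

end

lemma remove_mark_hinv:
  assumes "mk P" "mk (P - {p})" "adjacent P p q \<alpha>"
  shows "\<exists>g. hinv P (P - {p}) (\<lambda>i. remove_mark n G P \<alpha> p q) g"
proof -
  obtain g where "hinv P (P - {p}) (\<lambda>i. rm P p q \<alpha>) g" using rm_hinv[OF assms] by blast
  hence "hinv P (P - {p}) (\<lambda>i. remove_mark n G P \<alpha> p q) g"
    by (rule hmf_inverse_cong) (use assms in \<open>auto intro: remove_mark_eq KK_bd_closed B_bvars[THEN subsetD]\<close>)
  thus ?thesis by blast
qed

subsection \<open>The first mark on a loop\<close>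

definition cpos :: "complex set => (real => complex) => nat" where
  "cpos P c = pos (names P) (Circle_factor c)"

context
  fixes P c x
  assumes P: "mk P" and c: "c \<in> set (oloops G)" "path_image c \<inter> P = {}" "x \<in> path_image c"
begin

lemma x_new: "x \<notin> P" using c by auto

lemma mk_insert: "mk (insert x P)"
proof -
  have "path_image c \<inter> path_image w = {}" if "w \<in> set (wedges G)" for w using planar that c(1) unfolding planar_graph_def by blast
  thus ?thesis using P c unfolding marking_def by (auto; blast)
qed

lemma x_curve: "g \<in> curves ==> x \<in> path_image g ==> g = c" using curves_disjoint[OF mk_insert, of g c x] c by auto

lemma circle_name: "Circle_factor c \<in> set (names P)"
proof -
  have "lm P c = []" using lm(1)[OF P c(1)] c(2) by simp
  thus ?thesis using c(1) by (auto simp: set_names loop_names_def)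
qed

lemma em_insert: "g \<in> set (oedges G) ==> em (insert x P) g = em P g"
proof -
  assume g: "g \<in> set (oedges G)"
  have "g \<noteq> c" using g c(1) edges_loops_distinct by blast
  hence "x \<notin> set (em (insert x P) g)" using x_curve[of g] g em(1)[OF mk_insert g] by auto
  hence "em (insert x P - {x}) g = em (insert x P) g" unfolding em(3)[OF mk_insert g] by (intro filter_True) auto
  thus ?thesis using x_new by simp
qed

lemma lm_insert: "d \<in> set (oloops G) ==> lm (insert x P) d = (if d = c then [x] else lm P d)"
proof -
  assume d: "d \<in> set (oloops G)"
  show ?thesis
  proof (cases "d = c")
    case True
    have s: "set (lm (insert x P) c) = {x}" using lm(1)[OF mk_insert c(1)] c by auto
    hence "length (lm (insert x P) c) = 1" using distinct_card[OF lm(2)[OF mk_insert c(1)]] by simp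
    then obtain u where "lm (insert x P) c = [u]" by (auto simp: length_Suc_conv One_nat_def)
    thus ?thesis using s True by simp
  next
    case False
    hence "x \<notin> set (lm (insert x P) d)" using x_curve[of d] d lm(1)[OF mk_insert d] by auto
    hence "lm (insert x P - {x}) d = lm (insert x P) d" unfolding lm(3)[OF mk_insert d] by (intro filter_True) auto
    thus ?thesis using x_new False by simp
  qed
qed

lemma cpos: "cpos P c < length (names P)" "names P ! cpos P c = Circle_factor c"
  using nth_pos[OF distinct_names[OF P] circle_name] by (auto simp: cpos_def)

lemma names_insert: "names (insert x P) = (names P)[cpos P c := Arc_factor x x]"
proof -
  let ?h = "\<lambda>i. if i = Circle_factor c then Arc_factor x x else i"
  have lcP: "lm P c = []" using lm(1)[OF P c(1)] c(2) by simp
  have e: "edge_arcs (em (insert x P) g) = map ?h (edge_arcs (em P g))" if "g \<in> set (oedges G)" for g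
    unfolding em_insert[OF that] by (rule map_idI[symmetric]) (use edge_arcs_ArcE in fastforce)
  have l: "loop_names (insert x P) d = map ?h (loop_names P d)" if "d \<in> set (oloops G)" for d
  proof (cases "d = c")
    case True
    thus ?thesis using lm_insert[OF that] lcP by (simp add: loop_names_def loop_arcs_def)
  next
    case False
    hence "loop_names (insert x P) d = loop_names P d" using lm_insert[OF that] by (simp add: loop_names_def)
    moreover have "map ?h (loop_names P d) = loop_names P d" by (rule map_idI) (use False loop_arc_mark[OF P that] in auto)
    ultimately show ?thesis by simp
  qed
  have "names (insert x P) = map ?h (names P)" unfolding names_eq map_append map_concat map_map
    by (intro arg_cong2[where f=append] arg_cong[where f=concat] map_cong refl) (auto simp: e l)
  also have "\<dots> = (names P)[cpos P c := Arc_factor x x]"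
  proof (rule nth_equalityI)
    fix k assume "k < length (map ?h (names P))"
    thus "map ?h (names P) ! k = (names P)[cpos P c := Arc_factor x x] ! k"
      using cpos pos_nth[OF distinct_names[OF P], of k] by (auto simp: cpos_def nth_list_update)
  qed simp
  finally show ?thesis .
qed

lemma factor_insert: "i \<noteq> Circle_factor c ==> i \<in> set (names P) ==> factor n G (insert x P) i = factor n G P i"
proof (cases i)
  case (Wide_factor w)
  assume "i \<in> set (names P)"
  hence w: "w \<in> set (wedges G)" using Wide_factor wide_name by simp
  have "out_edges G w ! 0 \<in> set (oedges G)" "out_edges G w ! 1 \<in> set (oedges G)"
      "in_edges G w ! 0 \<in> set (oedges G)" "in_edges G w ! 1 \<in> set (oedges G)" using out_edge[OF w] in_edge[OF w] by auto
  thus ?thesis by (simp only: Wide_factor factor.simps wide_fact_def em_insert)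
qed auto

lemma facts_insert: "facts (insert x P) = (facts P)[cpos P c := arc_fact n x x]"
proof (rule nth_equalityI)
  fix k assume "k < length (facts (insert x P))"
  hence k: "k < length (names P)" by (simp add: names_insert)
  show "facts (insert x P) ! k = (facts P)[cpos P c := arc_fact n x x] ! k"
  proof (cases "k = cpos P c")
    case True
    thus ?thesis using k by (simp add: names_insert)
  next
    case False
    hence "names P ! k \<noteq> Circle_factor c" using pos_nth[OF distinct_names[OF P] k] by (auto simp: cpos_def)
    thus ?thesis using False k factor_insert by (simp add: names_insert)
  qed
qed (simp add: names_insert)

lemma circle_marking: "circle_marking (facts P) (cpos P c) n x (wp P) B"
proof
  show "cpos P c < length (facts P)" using cpos by simp
  show "facts P ! cpos P c = bflip (circle_algebra n)" using cpos by simp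
  show "x \<notin> bvars (btensor (facts P))" using bvars_facts[OF P] x_new by simp
  show "\<And>l. l < length (facts P) ==> factorization n (wp P l) (facts P ! l)" by (rule fact_factorization)
  show "wp P (cpos P c) = 0" using cpos by (simp add: wp_def wpot_def)
  show "(\<Sum>l<length (facts P). wp P l) \<in> polys B" using sum_wp[OF P] potential_polys by simp
  show "B \<subseteq> bvars (btensor (facts P))" using mkD(4)[OF P] bvars_facts[OF P] by simp
  show "1 \<le> n" by (rule n)
qed

lemma circle_hinv: "\<exists>g. hinv P (insert x P) (\<lambda>i. circle_map (cpos P c) x) g"
  using circle_marking.circle_inverse[OF circle_marking] unfolding facts_insert by blast

lemma add_first_mark_eq:
  assumes f: "f \<in> car (KK P) i"
  shows "add_first_mark G P c x f = circle_map (cpos P c) x f"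
proof -
  note d = distinct_names[OF P]
  have basis: "single (map (\<lambda>(i, b). if i = Circle_factor c then [1] else b) (zip (names P) bs)) (X x ^ hd (the (map_of (zip (names P) bs) (Circle_factor c))))
     = (single (bs[cpos P c := [1]]) (X x ^ hd (bs ! cpos P c)) :: graph_module)" if len: "length bs = length (names P)" for bs
  proof -
    have "the (map_of (zip (names P) bs) (Circle_factor c)) = bs ! cpos P c" using map_of_zip_nth[of "names P" bs "cpos P c"] len d cpos by simp
    moreover have "map (\<lambda>(i, b). if i = Circle_factor c then [1] else b) (zip (names P) bs) = bs[cpos P c := [1]]"
    proof (rule nth_equalityI)
      fix k assume "k < length (map (\<lambda>(i, b). if i = Circle_factor c then [1] else b) (zip (names P) bs))"
      thus "map (\<lambda>(i, b). if i = Circle_factor c then [1] else b) (zip (names P) bs) ! k = bs[cpos P c := [1]] ! k"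
        using len cpos pos_nth[OF d, of k] by (auto simp: nth_list_update cpos_def)
    qed (use len in simp)
    ultimately show ?thesis by simp
  qed
  have "length bs = length (names P)" if "bs \<in> keys f" for bs using car_keys[OF f] that length_KK by blast
  thus ?thesis unfolding add_first_mark_def circle_map_def lin_ext_def Let_def
    by (intro sum.cong refl arg_cong2[where f=psmul]) (use basis in simp_all)
qed

lemma add_first_hinv: "\<exists>g. hinv P (insert x P) (\<lambda>i. add_first_mark G P c x) g"
proof -
  obtain g where "hinv P (insert x P) (\<lambda>i. circle_map (cpos P c) x) g" using circle_hinv by blast
  hence "hinv P (insert x P) (\<lambda>i. add_first_mark G P c x) g"
    by (rule hmf_inverse_cong) (use P mk_insert in \<open>auto intro: add_first_mark_eq KK_bd_closed B_bvars[THEN subsetD]\<close>)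
  thus ?thesis by blast
qed

end

end

section \<open>Comparing removals\<close>

lemma merge_simps [simp]: "merge p q p = q" "v \<noteq> p ==> merge p q v = v" by (auto simp: merge_def)

lemma rename_factor_comp: "rename_factor \<rho> (rename_factor \<sigma> i) = rename_factor (\<rho> \<circ> \<sigma>) i" by (cases i) auto

context planar
begin

text \<open>With arcs on both sides, y is neither the first nor the last mark of an edge, so no wide
  edge involves it; and no third arc ends at y.\<close>

lemma mark_avoid:
  assumes P: "mk P" and a: "adjacent P y x (Arc_factor y x)" "adjacent P y z (Arc_factor z y)"
    and i: "i \<in> set (names P)" "i \<noteq> Arc_factor y x" "i \<noteq> Arc_factor z y"
  shows "y \<notin> bvars (factor n G P i)" "rename_factor (merge y q) i = i"
proof -
  have m: "Arc_factor y x \<in> set (names P)" "Arc_factor z y \<in> set (names P)" "y \<noteq> x" "y \<noteq> z" using a by (auto simp: adjacent_def)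
  have arc: "y \<noteq> u \<and> y \<noteq> v" if "i = Arc_factor u v" for u v using that i m arc_unique[OF P] by metis
  show "rename_factor (merge y q) i = i" using arc by (cases i) auto
  show "y \<notin> bvars (factor n G P i)"
  proof (cases i)
    case (Wide_factor w)
    hence w: "w \<in> set (wedges G)" using i wide_name by simp
    show ?thesis
    proof
      assume "y \<in> bvars (factor n G P i)"
      then obtain g where g: "g \<in> set (oedges G)" "y = hd (em P g) \<or> y = last (em P g)" unfolding Wide_factor bvars_wide_cases[OF w] by blast
      hence "y \<in> set (em P g)" using em_nonempty[OF P g(1)] by auto
      hence "y \<in> path_image g" using em(1)[OF P g(1)] by simp
      hence "Arc_factor y x \<in> set (edge_arcs (em P g))" "Arc_factor z y \<in> set (edge_arcs (em P g))"
        using adjacent_same_curve(2)[OF P a(1)] adjacent_same_curve(2)[OF P a(2)] g(1) by auto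
      then obtain as bs cs ds where s: "em P g = as @ y # x # bs" "em P g = cs @ z # y # ds" using edge_arcs_split by meson
      have d: "distinct (em P g)" by (rule em(2)[OF P g(1)])
      have "last (em P g) \<noteq> y" using d m(3) unfolding s(1) by (cases bs rule: rev_cases) auto
      moreover have "hd (em P g) \<noteq> y" using d m(4) unfolding s(2) by (cases cs) auto
      ultimately show False using g(2) by auto
    qed
  next
    case (Arc_factor u v)
    thus ?thesis using arc by (simp add: arc_fact_simps)
  qed (simp add: circle_simps)
qed

lemma two_removals:
  assumes P: "mk P" "mk (P - {y})" and a: "adjacent P y x (Arc_factor y x)" "adjacent P y z (Arc_factor z y)"
  shows "hty P (P - {y}) (\<lambda>i. rm P y x (Arc_factor y x)) (\<lambda>i. rm P y z (Arc_factor z y))" unfolding rm_def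
proof (rule removals_homotopic[OF removal[OF P a(1) refl] removal[OF P a(2) refl]])
  let ?\<alpha> = "Arc_factor y x" and ?\<beta> = "Arc_factor z y"
  note d = distinct_names[OF P(1)]
  have m: "?\<alpha> \<in> set (names P)" "?\<beta> \<in> set (names P)" "y \<noteq> x" "y \<noteq> z" using a by (auto simp: adjacent_def)
  thus "pos (names P) ?\<alpha> \<noteq> pos (names P) ?\<beta>" using pos_inj[OF d] by auto
  have av: "y \<notin> bvars (facts P ! k) \<and> rename_factor (merge y q) (names P ! k) = names P ! k"
    if "k < length (facts P)" "k \<noteq> pos (names P) ?\<alpha>" "k \<noteq> pos (names P) ?\<beta>" for k q
  proof -
    have "names P ! k \<noteq> ?\<alpha>" "names P ! k \<noteq> ?\<beta>" using that pos_nth[OF d, of k] by auto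
    thus ?thesis using mark_avoid(1)[OF P(1) a, of "names P ! k"] mark_avoid(2)[OF P(1) a, of "names P ! k" q] that(1) by simp
  qed
  fix k assume k: "k < length (facts P)" "k \<noteq> pos (names P) ?\<alpha>" "k \<noteq> pos (names P) ?\<beta>"
  show "y \<notin> bvars (facts P ! k)" using av[OF k] by blast
  show "rmove P y x k = rmove P y z k" using av[OF k] by (simp add: rmove_def)
next
  have "names P ! pos (names P) (Arc_factor z y) = Arc_factor z y" "names P ! pos (names P) (Arc_factor y x) = Arc_factor y x"
    using nth_pos[OF distinct_names[OF P(1)]] a by (auto simp: adjacent_def)
  moreover have "z \<noteq> y" "x \<noteq> y" using a by (auto simp: adjacent_def)
  ultimately show "rmove P y x (pos (names P) (Arc_factor z y)) = rmove P y z (pos (names P) (Arc_factor y x))" by (simp add: rmove_def)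
qed

text \<open>Two different arcs at y must be the incoming and the outgoing one, which is the
  situation of \<open>two_removals\<close> up to symmetry.\<close>

lemma removals_agree:
  assumes P: "mk P" "mk (P - {y})" and a: "adjacent P y q \<alpha>" "adjacent P y q' \<alpha>'"
  shows "hty P (P - {y}) (\<lambda>i. rm P y q \<alpha>) (\<lambda>i. rm P y q' \<alpha>')"
proof (cases "\<alpha> = \<alpha>'")
  case True
  hence "q = q'" using a by (auto simp: adjacent_def)
  thus ?thesis using True homotopic_refl by blast
next
  case False
  have m: "\<alpha> \<in> set (names P)" "\<alpha>' \<in> set (names P)" using a by (auto simp: adjacent_def)
  hence "\<alpha> = Arc_factor y q \<and> \<alpha>' = Arc_factor q' y \<or> \<alpha> = Arc_factor q y \<and> \<alpha>' = Arc_factor y q'"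
    using a False arc_unique[OF P(1)] unfolding adjacent_def by metis
  thus ?thesis
  proof
    assume "\<alpha> = Arc_factor y q \<and> \<alpha>' = Arc_factor q' y"
    thus ?thesis using two_removals[OF P, of q q'] a by simp
  next
    assume "\<alpha> = Arc_factor q y \<and> \<alpha>' = Arc_factor y q'"
    thus ?thesis using homotopic_sym[OF two_removals[OF P, of q' q]] a by simp
  qed
qed

text \<open>If q' is the removed mark y, the new neighbour of x is q; the excluded case is the one
  where x would be its own neighbour.\<close>

lemma adjacent_after:
  assumes P: "mk P" and xy: "x \<noteq> y" and a: "adjacent P y q \<alpha>" "adjacent P x q' \<alpha>'" and nc: "\<not> (q = x \<and> q' = y)"
  shows "\<alpha> \<noteq> \<alpha>'" "adjacent (P - {y}) x (merge y q q') (rename_factor (merge y q) \<alpha>')"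
proof -
  show ne: "\<alpha> \<noteq> \<alpha>'" using a xy nc by (auto simp: adjacent_def)
  hence "\<alpha>' \<in> set (names P) - {\<alpha>}" using a by (auto simp: adjacent_def)
  hence "rename_factor (merge y q) \<alpha>' \<in> set (names (P - {y}))" using rename_names[OF P a(1)] unfolding merge_def by blast
  moreover have "x \<noteq> merge y q q'" using a nc by (cases "q' = y") (auto simp: adjacent_def)
  ultimately show "adjacent (P - {y}) x (merge y q q') (rename_factor (merge y q) \<alpha>')" using a(2) xy by (auto simp: adjacent_def)
qed

lemma survivors:
  assumes P: "mk P" "mk (P - {y})" "mk (P - {y} - {x})" and xy: "x \<noteq> y" and a: "adjacent P y q \<alpha>" "adjacent P x q' \<alpha>'" and nc: "\<not> (q = x \<and> q' = y)"
  shows "{k \<in> rset P \<alpha>. rmove P y q k \<in> rset (P - {y}) (rename_factor (merge y q) \<alpha>')} = {k. k < length (names P) \<and> names P ! k \<noteq> \<alpha> \<and> names P ! k \<noteq> \<alpha>'}"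
    and "k \<in> rset P \<alpha> ==> rmove (P - {y}) x (merge y q q') (rmove P y q k)
      = pos (names (P - {y} - {x})) (rename_factor (merge x (merge y q q') \<circ> merge y q) (names P ! k))"
proof -
  note a2 = adjacent_after[OF P(1) xy a nc]
  have "rmove P y q k \<in> rset (P - {y}) (rename_factor (merge y q) \<alpha>') \<longleftrightarrow> names P ! k \<noteq> \<alpha>'" if k: "k \<in> rset P \<alpha>" for k
  proof -
    have "names P ! k \<in> set (names P) - {\<alpha>}" using k rset_iff[OF P(1,2) a(1)] by simp
    moreover have "\<alpha>' \<in> set (names P) - {\<alpha>}" using a a2(1) by (auto simp: adjacent_def)
    ultimately have "rename_factor (merge y q) (names P ! k) = rename_factor (merge y q) \<alpha>' \<longleftrightarrow> names P ! k = \<alpha>'"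
      using inj_onD[OF rename_inj[OF P(1) a(1)]] unfolding merge_def by blast
    thus ?thesis unfolding rset_iff[OF P(2,3) a2(2)] using names_rmove[OF P(1,2) a(1) k] by simp
  qed
  thus "{k \<in> rset P \<alpha>. rmove P y q k \<in> rset (P - {y}) (rename_factor (merge y q) \<alpha>')} = {k. k < length (names P) \<and> names P ! k \<noteq> \<alpha> \<and> names P ! k \<noteq> \<alpha>'}"
    using rset_iff[OF P(1,2) a(1)] by auto
  assume "k \<in> rset P \<alpha>"
  thus "rmove (P - {y}) x (merge y q q') (rmove P y q k)
      = pos (names (P - {y} - {x})) (rename_factor (merge x (merge y q q') \<circ> merge y q) (names P ! k))"
    unfolding rmove_def[of "P - {y}"] using names_rmove[OF P(1,2) a(1)] by (simp add: rename_factor_comp)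
qed

text \<open>Both composites drop the same two arcs, move the survivors to the same places and rename
  marks alike, so they are equal and not merely homotopic.\<close>

lemma commute_removals:
  assumes P: "mk P" "mk (P - {y})" "mk (P - {x})" "mk (P - {y} - {x})" and xy: "x \<noteq> y"
    and a: "adjacent P y q \<alpha>" "adjacent P x q' \<alpha>'" and nc: "\<not> (q = x \<and> q' = y)" and f: "f \<in> car (KK P) i"
  shows "rm (P - {y}) x (merge y q q') (rename_factor (merge y q) \<alpha>') (rm P y q \<alpha> f)
    = rm (P - {x}) y (merge x q' q) (rename_factor (merge x q') \<alpha>) (rm P x q' \<alpha>' f)"
proof -
  have S: "P - {x} - {y} = P - {y} - {x}" by auto
  have P': "mk (P - {x} - {y})" and yx: "y \<noteq> x" and nc': "\<not> (q' = y \<and> q = x)" using P(4) S xy nc by auto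
  note a1 = adjacent_after(2)[OF P(1) xy a nc] and a2 = adjacent_after(2)[OF P(1) yx a(2,1) nc']
  have neq: "y \<noteq> q" "x \<noteq> q'" using a by (auto simp: adjacent_def)
  \<comment> \<open>If q = x, then y is redirected to q' in both orders; the case q' = y is
    symmetric.\<close>
  have \<rho>: "merge x (merge y q q') \<circ> merge y q = merge y (merge x q' q) \<circ> merge x q'"
    by (rule ext) (use xy neq nc in \<open>auto simp: merge_def\<close>)
  note s1 = survivors[OF P(1,2,4) xy a nc] and s2 = survivors[OF P(1,3) P' yx a(2,1) nc']
  show ?thesis unfolding rm_def S
  proof (rule reindexing_commute[OF removal_reindexing[OF P(1,2) a(1)] removal_reindexing[OF P(2,4) a1]
        removal_reindexing[OF P(1,3) a(2)] removal_reindexing[OF P(3) P' a2, unfolded S] _ _ _ f])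
    show "{k \<in> rset P \<alpha>. rmove P y q k \<in> rset (P - {y}) (rename_factor (merge y q) \<alpha>')} =
      {k \<in> rset P \<alpha>'. rmove P x q' k \<in> rset (P - {x}) (rename_factor (merge x q') \<alpha>)}" unfolding s1(1) s2(1) by auto
    fix k assume k: "k \<in> rset P \<alpha>" "rmove P y q k \<in> rset (P - {y}) (rename_factor (merge y q) \<alpha>')"
    hence "k \<in> rset P \<alpha>'" using s1(1) s2(1) by blast
    thus "rmove (P - {y}) x (merge y q q') (rmove P y q k) = rmove (P - {x}) y (merge x q' q) (rmove P x q' k)"
      using s1(2)[OF k(1)] s2(2) \<rho> S by simp
  next
    fix v show "merge x (merge y q q') (merge y q v) = merge y (merge x q' q) (merge x q' v)" using fun_cong[OF \<rho>, of v] by simp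
  qed
qed

subsection \<open>Removals and circles\<close>

lemma set_names_insert:
  assumes "mk Q" "c \<in> set (oloops G)" "path_image c \<inter> Q = {}" "y \<in> path_image c"
  shows "set (names (insert y Q)) = insert (Arc_factor y y) (set (names Q) - {Circle_factor c})"
  unfolding names_insert[OF assms] using set_update_distinct[OF distinct_names[OF assms(1)] cpos(1)[OF assms]] cpos(2)[OF assms] by simp

lemma pos_insert:
  assumes Q: "mk Q" "c \<in> set (oloops G)" "path_image c \<inter> Q = {}" "y \<in> path_image c"
  shows "pos (names (insert y Q)) (Arc_factor y y) = cpos Q c"
    "i \<in> set (names Q) ==> i \<noteq> Circle_factor c ==> pos (names (insert y Q)) i = pos (names Q) i" unfolding names_insert[OF Q]
  using pos_update[OF distinct_names[OF Q(1)], of "cpos Q c" "Arc_factor y y"] distinct_names[OF mk_insert[OF Q]] cpos[OF Q]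
  unfolding names_insert[OF Q] by simp_all

lemma adjacent_insert:
  assumes "mk Q" "c \<in> set (oloops G)" "path_image c \<inter> Q = {}" "y \<in> path_image c"
  shows "adjacent (insert y Q) x q \<alpha> \<longleftrightarrow> adjacent Q x q \<alpha>" unfolding adjacent_def set_names_insert[OF assms] by auto

text \<open>The removed mark and the circle lie on different curves: removing x acts on other
  factors, and renaming x does not affect powers of y.\<close>

lemma remove_circle:
  assumes Q: "mk Q" "c \<in> set (oloops G)" "path_image c \<inter> Q = {}" "y \<in> path_image c" and Qx: "mk (Q - {x})"
    and a: "adjacent Q x q \<alpha>" and f: "f \<in> car (KK Q) i"
  shows "rm (insert y Q) x q \<alpha> (circle_map (cpos Q c) y f) = circle_map (cpos (Q - {x}) c) y (rm Q x q \<alpha> f)"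
proof -
  let ?P = "insert y Q" and ?k = "cpos Q c"
  have x: "x \<in> Q" "q \<in> Q" "x \<noteq> q" using adjacent_marks[OF Q(1) a] a by (auto simp: adjacent_def)
  have xy: "x \<noteq> y" using x_new[OF Q] x by auto
  have S: "?P - {x} = insert y (Q - {x})" using xy by auto
  have Q': "mk (Q - {x})" "c \<in> set (oloops G)" "path_image c \<inter> (Q - {x}) = {}" "y \<in> path_image c" using Q Qx by auto
  have P: "mk ?P" "mk (?P - {x})" using mk_insert[OF Q] mk_insert[OF Q'] S by auto
  have aP: "adjacent ?P x q \<alpha>" using adjacent_insert[OF Q] a by simp
  interpret R0: reindexing "facts Q" "facts (Q - {x})" "rset Q \<alpha>" "rmove Q x q" "merge x q" by (rule removal_reindexing[OF Q(1) Qx a])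
  interpret R: reindexing "facts ?P" "facts (?P - {x})" "rset ?P \<alpha>" "rmove ?P x q" "merge x q" by (rule removal_reindexing[OF P aP])
  have \<alpha>: "\<alpha> \<in> set (names Q)" "\<alpha> \<noteq> Circle_factor c" using a by (auto simp: adjacent_def)
  have len: "length (names ?P) = length (names Q)" "length (names (?P - {x})) = length (names (Q - {x}))"
    unfolding S by (simp_all add: names_insert[OF Q] names_insert[OF Q'])
  have rset: "rset ?P \<alpha> = rset Q \<alpha>" unfolding rset_def len pos_insert(2)[OF Q \<alpha>] ..
  have k: "?k \<in> rset Q \<alpha>" using rset_iff[OF Q(1) Qx a] cpos[OF Q] \<alpha>(2) by auto
  have rk: "rmove Q x q ?k = cpos (Q - {x}) c" 
  proof -
    have "rmove Q x q ?k = pos (names (Q - {x})) (Circle_factor c)" by (simp add: rmove_def cpos(2)[OF Q])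
    thus ?thesis by (simp add: cpos_def)
  qed
  have rmove: "rmove ?P x q j = rmove Q x q j" if j: "j \<in> rset Q \<alpha>" for j
  proof (cases "j = ?k")
    case True
    have "names ?P ! ?k = Arc_factor y y" using cpos[OF Q] by (simp add: names_insert[OF Q])
    hence "rmove ?P x q ?k = pos (names (insert y (Q - {x}))) (Arc_factor y y)" using xy by (simp add: rmove_def S)
    thus ?thesis using True rk pos_insert(1)[OF Q'] by simp
  next
    case False
    have jl: "j < length (names Q)" using j rset_iff[OF Q(1) Qx a] by simp
    have nc: "names Q ! j \<noteq> Circle_factor c" using False pos_nth[OF distinct_names[OF Q(1)] jl] by (auto simp: cpos_def)
    have "rename_factor (merge x q) (names Q ! j) \<in> set (names (Q - {x}))" using names_rmove[OF Q(1) Qx a j] nth_mem by metis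
    moreover have "rename_factor (merge x q) (names Q ! j) \<noteq> Circle_factor c" using nc by (cases "names Q ! j") auto
    moreover have "names ?P ! j = names Q ! j" using False by (simp add: names_insert[OF Q])
    ultimately show ?thesis using pos_insert(2)[OF Q'] by (simp add: rmove_def S)
  qed
  show ?thesis unfolding rm_def using f
  proof (induction f rule: car_induct)
    case zero
    show ?case by simp
  next
    case (single bs r)
    let ?cs = "bs[?k := [1]]" and ?L = "length (facts (Q - {x}))"
    have bl: "length bs = length (facts Q)" using single(1) length_KK by simp
    \<comment> \<open>The shifted circle algebra is odd throughout and \<open>[1]\<close> is the odd
      generator of the arc, so all reordering signs stay the same.\<close>
    have par: "bpar (facts ?P ! j) (?cs ! j) = bpar (facts Q ! j) (bs ! j)" if "j < length (facts Q)" for j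
    proof (cases "j = ?k")
      case True
      have "facts Q ! ?k = bflip (circle_algebra n)" using cpos[OF Q] by simp
      thus ?thesis using True that bl by (simp add: facts_insert[OF Q] arc_fact_simps circle_simps)
    qed (simp add: facts_insert[OF Q])
    have L: "length (facts (?P - {x})) = ?L" using len by simp
    have reindex: "reindex (facts ?P) (rset ?P \<alpha>) (rmove ?P x q) (length (facts (?P - {x}))) ?cs
        = (if \<exists>j<length (facts Q). j \<notin> rset Q \<alpha> \<and> bpar (facts Q ! j) (bs ! j) then 0
           else single ((reidx_list (rset Q \<alpha>) (rmove Q x q) ?L bs)[cpos (Q - {x}) c := [1]]) (inv_sgn (oddset (facts Q) (rset Q \<alpha>) bs) (rmove Q x q)) :: graph_module)"
    proof -
      have "reindex (facts ?P) (rset ?P \<alpha>) (rmove ?P x q) (length (facts (?P - {x}))) ?cs = (reindex (facts ?P) (rset Q \<alpha>) (rmove Q x q) ?L ?cs :: graph_module)"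
        unfolding rset L by (rule fun_cong[OF reindex_cong]) (rule rmove)
      moreover have "oddset (facts ?P) (rset Q \<alpha>) ?cs = oddset (facts Q) (rset Q \<alpha>) bs" using par R0.A by (auto simp: oddset_def)
      moreover have "(\<exists>j<length (facts ?P). j \<notin> rset Q \<alpha> \<and> bpar (facts ?P ! j) (?cs ! j)) \<longleftrightarrow> (\<exists>j<length (facts Q). j \<notin> rset Q \<alpha> \<and> bpar (facts Q ! j) (bs ! j))"
        using par len by auto
      ultimately show ?thesis by (simp only: reindex_def R0.reidx_update[OF k bl] rk)
    qed
    have "psubst (\<lambda>v. X (merge x q v)) (r * X y ^ hd (bs ! ?k)) = psubst (\<lambda>v. X (merge x q v)) r * X y ^ hd (bs ! ?k)"
      using xy by (simp add: psubst_mult psubst_power)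
    moreover have "reidx_list (rset Q \<alpha>) (rmove Q x q) ?L bs ! cpos (Q - {x}) c = bs ! ?k" using R0.nth_reidx[OF k, of bs] rk by simp
    ultimately show ?case unfolding circle_map_single R.E_single R0.E_single reindex unfolding reindex_def circle_map_psmul
      by (auto simp: circle_map_single ac_simps simp del: nth_map)
  next
    case (add f g)
    thus ?case by (simp add: circle_map_add R.E_add R0.E_add)
  qed
qed

lemma two_circles:
  assumes Q: "mk Q" and c: "c \<in> set (oloops G)" "path_image c \<inter> Q = {}" "x \<in> path_image c"
    and d: "d \<in> set (oloops G)" "path_image d \<inter> Q = {}" "y \<in> path_image d" and cd: "c \<noteq> d"
  shows "circle_map (cpos (insert x Q) d) y (circle_map (cpos Q c) x f) = circle_map (cpos (insert y Q) c) x (circle_map (cpos Q d) y f)"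
proof -
  have "cpos (insert x Q) d = cpos Q d" "cpos (insert y Q) c = cpos Q c"
    unfolding cpos_def using pos_insert(2)[OF Q c] pos_insert(2)[OF Q d] circle_name[OF Q c] circle_name[OF Q d] cd by auto
  moreover have "cpos Q c \<noteq> cpos Q d"
    unfolding cpos_def using pos_inj[OF distinct_names[OF Q] circle_name[OF Q c] circle_name[OF Q d]] cd by simp
  moreover have "circle_map l y (circle_map k x f) = circle_map k x (circle_map l y f)" if "k \<noteq> l" for k l by (induction f rule: pm_induct)
       (use that in \<open>auto simp: circle_map_single circle_map_add list_update_swap ac_simps\<close>)
  ultimately show ?thesis by simp
qed

text \<open>Marking the loop at x, re-inserting y and removing x along the same arc gives the loop
  marked directly at y. This is the comparison behind \<open>diamond_two_marks\<close>.\<close>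

lemma two_mark_loop:
  assumes Q: "mk Q" and c: "c \<in> set (oloops G)" "path_image c \<inter> Q = {}" "x \<in> path_image c" "y \<in> path_image c" and xy: "x \<noteq> y"
    and P: "P = insert x (insert y Q)" "mk P"
  shows "\<exists>\<alpha> S. adjacent P y x \<alpha> \<and> adjacent P x y \<alpha> \<and> hinv P (insert x Q) (\<lambda>i. rm P y x \<alpha>) S \<and>
    (\<forall>i. \<forall>f\<in>car (KK Q) i. rm P x y \<alpha> (S i (circle_map (cpos Q c) x f)) = circle_map (cpos Q c) y f)"
proof -
  note Qx = Q c(1,2,3) and Qy = Q c(1,2,4)
  let ?\<alpha> = "Arc_factor y x" and ?\<beta> = "Arc_factor x y" and ?k = "cpos Q c"
  have nQ: "x \<notin> Q" "y \<notin> Q" using c by auto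
  have Py: "P - {y} = insert x Q" and Px: "P - {x} = insert y Q" using P xy nQ by auto
  have mP: "mk P" "mk (P - {y})" "mk (P - {x})" using P mk_insert[OF Qx] mk_insert[OF Qy] Py Px by auto
  have "set (lm P c) = {x, y}" using lm(1)[OF P(2) c(1)] c P by auto
  moreover from this have "length (lm P c) = 2" using distinct_card[OF lm(2)[OF P(2) c(1)]] xy by simp
  ultimately have "lm P c = [x, y] \<or> lm P c = [y, x]" by (auto simp: numeral_2_eq_2 length_Suc_conv doubleton_eq_iff)
  hence "set (loop_names P c) = {?\<alpha>, ?\<beta>}" by (auto simp: loop_names_def loop_arcs_def)
  hence names: "?\<alpha> \<in> set (names P)" "?\<beta> \<in> set (names P)" using c(1) unfolding set_names by blast+
  hence a: "adjacent P y x ?\<alpha>" "adjacent P x y ?\<alpha>" "adjacent P y x ?\<beta>" "adjacent P x y ?\<beta>" using xy by (auto simp: adjacent_def)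
  note Amr = removal[OF mP(1,2) a(1) refl] and Bmr = removal[OF mP(1,3) a(2) refl]
  \<comment> \<open>The other arc closes up to a loop at x or at y, and either one sits where the
    circle factor of the markless loop was.\<close>
  have rmove: "rmove P y x k = rmove P x y k" if k: "k \<in> rset P ?\<alpha>" for k
  proof (cases "names P ! k = ?\<beta>")
    case True
    thus ?thesis using pos_insert(1)[OF Qx] pos_insert(1)[OF Qy] xy by (simp add: rmove_def Py Px)
  next
    case False
    let ?i = "names P ! k"
    have i: "?i \<in> set (names P)" "?i \<noteq> ?\<alpha>" using k rset_iff[OF mP(1,2) a(1)] by auto
    have r: "rename_factor (merge y x) ?i = ?i" "rename_factor (merge x y) ?i = ?i"
      using mark_avoid(2)[OF P(2) a(1,3)] mark_avoid(2)[OF P(2) a(4,2)] i False by auto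
    have "?i \<in> set (names (P - {y}))" using names_rmove[OF mP(1,2) a(1) k] r nth_mem by metis
    moreover have "?i \<noteq> Arc_factor x x" using i(1) names(2) arc_unique(1)[OF P(2)] xy by metis
    ultimately have "?i \<in> set (names Q)" "?i \<noteq> Circle_factor c" unfolding Py set_names_insert[OF Qx] by auto
    thus ?thesis using r pos_insert(2)[OF Qx] pos_insert(2)[OF Qy] by (simp add: rmove_def Py Px)
  qed
  define S where "S = mark_removal.proj (facts P) y x (pos (names P) ?\<alpha>) x \<circ> mark_removal.iota (facts P) (rset P ?\<alpha>) (rmove P y x) (pos (names P) ?\<alpha>)"
  have inv: "hinv P (insert x Q) (\<lambda>i. rm P y x ?\<alpha>) (\<lambda>i. S)"
    using mark_removal.removal_inverse[OF Amr] unfolding S_def rm_def Py .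
  have S_add: "S (f + g) = S f + S g" and S_0: "S 0 = 0" for f g
    using mark_removal.proj_add[OF Amr] mark_removal.iota_add[OF Amr] mark_removal.proj_0[OF Amr]
    by (simp_all add: S_def mark_removal.iota_def[OF Amr] lin_ext_def)
  have "rm P x y ?\<alpha> (S (circle_map ?k x f)) = circle_map ?k y f" if "f \<in> car (KK Q) i" for f i using that
  proof (induction f rule: car_induct)
    case zero
    show ?case using reindexing.E_0[OF removal_reindexing[OF mP(1,3) a(2)]] by (simp add: S_0 rm_def)
  next
    case (single bs r)
    have b: "bs[?k := [1]] \<in> bas (btensor (facts (P - {y})))"
      using circle_marking.update_bas[OF circle_marking[OF Qx] single(1)] by (simp add: Py facts_insert[OF Qx])
    \<comment> \<open>Coefficients over the markless loop involve neither x nor y, so renaming x to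
      y only changes the power of x.\<close>
    have "r \<in> polys Q" using single(3) bvars_facts[OF Q] by simp
    moreover have "merge x y v = v" if "v \<in> Q" for v using that nQ by (intro merge_simps(2)) auto
    ultimately have "psubst (\<lambda>v. X (merge x y v)) r = psubst X r" by (intro psubst_cong) auto
    hence "psubst (\<lambda>v. X (merge x y v)) (r * X x ^ hd (bs ! ?k)) = r * X y ^ hd (bs ! ?k)" by (simp add: psubst_mult psubst_power)
    thus ?case using swap_two_marks[OF Amr Bmr rmove b, of "r * X x ^ hd (bs ! ?k)"] by (simp add: circle_map_single S_def rm_def)
  next
    case (add f g)
    thus ?case using reindexing.E_add[OF removal_reindexing[OF mP(1,3) a(2)]] by (simp add: circle_map_add S_add rm_def)
  qed
  thus ?thesis using a inv by blast
qed

end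

declare One_nat_def [simp]

section \<open>Coherence\<close>

context planar
begin

text \<open>The maps \<open>P \<rightarrow> P - {y}\<close> induced by the elementary maps.\<close>

definition red :: "complex set => complex => (bool => graph_module => graph_module) => bool" where
  "red P y e \<longleftrightarrow> (\<exists>q \<alpha>. adjacent P y q \<alpha> \<and> e = (\<lambda>i. remove_mark n G P \<alpha> y q)) \<or>
     (\<exists>c\<in>set (oloops G). path_image c \<inter> P = {y} \<and> hinv (P - {y}) P (\<lambda>i. add_first_mark G (P - {y}) c y) e)"

lemma sole: "path_image c \<inter> P = {y} ==> path_image c \<inter> (P - {y}) = {} \<and> y \<in> path_image c \<and> y \<in> P \<and> insert y (P - {y}) = P"
  by auto

lemma sole_not_adjacent:
  assumes P: "mk P" and c: "c \<in> set (oloops G)" "path_image c \<inter> P = {y}"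
  shows "\<not> adjacent P y q \<alpha>"
proof
  assume a: "adjacent P y q \<alpha>"
  have "q \<in> path_image c" using adjacent_same_curve(1)[OF P a] c sole by blast
  hence "q = y" using adjacent_marks[OF P a] c(2) by auto
  thus False using a by (auto simp: adjacent_def)
qed

lemma rm_car: "mk P ==> mk (P - {y}) ==> adjacent P y q \<alpha> ==> f \<in> car (KK P) i ==> rm P y q \<alpha> f \<in> car (KK (P - {y})) i"
  using gmor_car[OF rm_gmor] .

lemma remove_mark_rm:
  "mk P ==> mk (P - {y}) ==> adjacent P y q \<alpha> ==> hty P (P - {y}) (\<lambda>i. remove_mark n G P \<alpha> y q) (\<lambda>i. rm P y q \<alpha>)"
  by (rule homotopic_eqI) (rule remove_mark_eq)

lemma red_hinv:
  assumes "mk P" "mk (P - {y})" "red P y e"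
  shows "\<exists>g. hinv P (P - {y}) e g" using assms(3) remove_mark_hinv[OF assms(1,2)] hmf_inverse_sym unfolding red_def by blast

lemma red_gmor: "mk P ==> mk (P - {y}) ==> red P y e ==> gmor B (C P) (C (P - {y})) e" using red_hinv unfolding hmf_inverse_def by blast

text \<open>A lone mark on an edge cannot be removed, since every edge keeps a mark; a removable
  mark without neighbours is therefore the only mark of a loop.\<close>

lemma mark_cases:
  assumes P: "mk P" "mk (P - {y})" and y: "y \<in> P"
  shows "(\<exists>q \<alpha>. adjacent P y q \<alpha>) \<or> (\<exists>c\<in>set (oloops G). path_image c \<inter> P = {y})"
proof -
  obtain g where g: "g \<in> curves" "y \<in> path_image g" using mkD(2)[OF P(1) y] by blast
  note oc = on_curve[OF P(1) g(1)]
  have ym: "y \<in> set (on_curve P g)" using oc(1) g y by simp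
  show ?thesis
  proof (cases "\<exists>t\<in>set (on_curve P g). t \<noteq> y")
    case True
    then obtain q where "neighbours (on_curve P g) y q" using neighbour_exists ym by metis
    thus ?thesis using neighbours_adjacent[OF P(1) g(1)] by blast
  next
    case False
    hence s: "path_image g \<inter> P = {y}" using oc(1) ym by blast
    have "g \<notin> set (oedges G)"
    proof
      assume e: "g \<in> set (oedges G)"
      have "set (em (P - {y}) g) = {}" using em(1)[OF P(2) e] s by auto
      thus False using em_nonempty[OF P(2) e] by simp
    qed
    thus ?thesis using g(1) s by blast
  qed
qed

lemma red_exists:
  assumes P: "mk P" "mk (P - {y})" and y: "y \<in> P"
  shows "\<exists>e. red P y e" using mark_cases[OF assms]
proof
  assume "\<exists>q \<alpha>. adjacent P y q \<alpha>"
  thus ?thesis unfolding red_def by blast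
next
  assume "\<exists>c\<in>set (oloops G). path_image c \<inter> P = {y}"
  then obtain c where c: "c \<in> set (oloops G)" "path_image c \<inter> P = {y}" by blast
  thus ?thesis using add_first_hinv[OF P(2) c(1), of y] sole[OF c(2)] unfolding red_def by auto
qed

text \<open>If y is alone on a loop, both maps are inverses of the same marking of a circle.
  Otherwise both are removals along arcs at y. \<open>sole_not_adjacent\<close> keeps the two cases
  apart.\<close>

lemma red_unique:
  assumes P: "mk P" "mk (P - {y})" and e: "red P y e" "red P y e'"
  shows "hty P (P - {y}) e e'"
proof (cases "\<exists>c\<in>set (oloops G). path_image c \<inter> P = {y}")
  case True
  then obtain c where c: "c \<in> set (oloops G)" "path_image c \<inter> P = {y}" by blast
  have d: "d = c" if "d \<in> set (oloops G)" "path_image d \<inter> P = {y}" for d using curves_disjoint[OF P(1), of d c y] that c by auto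
  have "hinv (P - {y}) P (\<lambda>i. add_first_mark G (P - {y}) c y) e''" if "red P y e''" for e''
    using that sole_not_adjacent[OF P(1) c] d unfolding red_def by blast
  thus ?thesis using hmf_inverse_unique[OF _ _ homotopic_refl KK_bd_closed[OF P(2)] KK_bd_closed[OF P(1)]] e by blast
next
  case False
  then obtain q \<alpha> q' \<alpha>' where a: "adjacent P y q \<alpha>" "e = (\<lambda>i. remove_mark n G P \<alpha> y q)" "adjacent P y q' \<alpha>'" "e' = (\<lambda>i. remove_mark n G P \<alpha>' y q')"
    using e unfolding red_def by blast
  show ?thesis unfolding a(2,4)
    using homotopic_trans[OF homotopic_trans[OF remove_mark_rm[OF P a(1)] removals_agree[OF P a(1,3)]] homotopic_sym[OF remove_mark_rm[OF P a(3)]]] .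
qed

text \<open>Local confluence for one choice of the four reductions; \<open>red_unique\<close>
  extends it to all choices.\<close>

definition diamond :: "complex set => complex => complex => bool" where
  "diamond P y x \<longleftrightarrow> (\<exists>e1 e2 e1' e2'. red P y e1 \<and> red (P - {y}) x e2 \<and> red P x e1' \<and> red (P - {x}) y e2' \<and>
     hty P (P - {y} - {x}) (\<lambda>i. e2 i \<circ> e1 i) (\<lambda>i. e2' i \<circ> e1' i))"

lemma diamond_sym: "diamond P y x ==> diamond P x y"
proof -
  have S: "P - {y} - {x} = P - {x} - {y}" by auto
  assume "diamond P y x"
  then obtain e1 e2 e1' e2' where "red P y e1" "red (P - {y}) x e2" "red P x e1'" "red (P - {x}) y e2'"
    "hty P (P - {x} - {y}) (\<lambda>i. e2 i \<circ> e1 i) (\<lambda>i. e2' i \<circ> e1' i)" unfolding diamond_def S by blast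
  thus "diamond P x y" unfolding diamond_def using homotopic_sym by blast
qed

context
  fixes P x y
  assumes P: "mk P" "mk (P - {y})" "mk (P - {x})" "mk (P - {y} - {x})" and xy: "x \<noteq> y" "x \<in> P" "y \<in> P"
begin

lemma swap_diff: "P - {x} - {y} = P - {y} - {x}" by auto

lemma P': "mk (P - {x} - {y})" using P(4) swap_diff by simp

lemma diamond_noncrossing:
  assumes a: "adjacent P y q \<alpha>" "adjacent P x q' \<alpha>'" and nc: "\<not> (q = x \<and> q' = y)"
  shows "diamond P y x"
proof -
  have nc': "\<not> (q' = y \<and> q = x)" using nc by auto
  note b = adjacent_after(2)[OF P(1) xy(1) a nc] adjacent_after(2)[OF P(1) xy(1)[symmetric] a(2,1) nc']
  let ?e1 = "\<lambda>i::bool. remove_mark n G P \<alpha> y q" and ?e2 = "\<lambda>i::bool. remove_mark n G (P - {y}) (rename_factor (merge y q) \<alpha>') x (merge y q q')"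
  let ?f1 = "\<lambda>i::bool. remove_mark n G P \<alpha>' x q'" and ?f2 = "\<lambda>i::bool. remove_mark n G (P - {x}) (rename_factor (merge x q') \<alpha>) y (merge x q' q)"
  have "hty P (P - {y} - {x}) (\<lambda>i. ?e2 i \<circ> ?e1 i) (\<lambda>i. ?f2 i \<circ> ?f1 i)"
  proof (rule homotopic_eqI)
    fix i m assume m: "m \<in> car (KK P) i"
    show "(?e2 i \<circ> ?e1 i) m = (?f2 i \<circ> ?f1 i) m"
      using commute_removals[OF P xy(1) a nc m] remove_mark_eq[OF P(1,2) a(1) m] remove_mark_eq[OF P(1,3) a(2) m]
        remove_mark_eq[OF P(2,4) b(1) rm_car[OF P(1,2) a(1) m]] remove_mark_eq[OF P(3) P' b(2) rm_car[OF P(1,3) a(2) m]] by simp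
  qed
  moreover have "red P y ?e1" "red (P - {y}) x ?e2" "red P x ?f1" "red (P - {x}) y ?f2" using a b unfolding red_def by blast+
  ultimately show ?thesis unfolding diamond_def by blast
qed

text \<open>The square that commutes strictly contains the maps adding y, which point the other way;
  \<open>square_inverse\<close> passes to their inverses.\<close>

lemma diamond_circle_removal:
  assumes c: "c \<in> set (oloops G)" "path_image c \<inter> P = {y}" and a: "adjacent P x q \<alpha>"
  shows "diamond P y x"
proof -
  let ?Q = "P - {y}"
  have iQ: "insert y ?Q = P" "insert y (P - {x} - {y}) = P - {x}" using xy by auto
  have Q: "mk ?Q" "c \<in> set (oloops G)" "path_image c \<inter> ?Q = {}" "y \<in> path_image c" using P(2) c sole by auto
  have Qx: "mk (P - {x} - {y})" "c \<in> set (oloops G)" "path_image c \<inter> (P - {x} - {y}) = {}" "y \<in> path_image c" using P' Q by auto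
  have aQ: "adjacent ?Q x q \<alpha>" using adjacent_insert[OF Q] a iQ by simp
  obtain g where g: "hinv ?Q P (\<lambda>i. add_first_mark G ?Q c y) g" using add_first_hinv[OF Q] iQ by auto
  obtain g' where g': "hinv (P - {x} - {y}) (P - {x}) (\<lambda>i. add_first_mark G (P - {x} - {y}) c y) g'" using add_first_hinv[OF Qx] iQ by auto
  let ?v = "\<lambda>i::bool. remove_mark n G P \<alpha> x q" and ?v' = "\<lambda>i::bool. remove_mark n G ?Q \<alpha> x q"
  have v: "gmor B (C P) (C (P - {x})) ?v" "gmor B (C ?Q) (C (P - {x} - {y})) ?v'"
    using remove_mark_hinv[OF P(1,3) a] remove_mark_hinv[OF P(2,4) aQ] unfolding hmf_inverse_def swap_diff by blast+
  have "hty ?Q (P - {x}) (\<lambda>i. ?v i \<circ> add_first_mark G ?Q c y) (\<lambda>i. add_first_mark G (P - {x} - {y}) c y \<circ> ?v' i)"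
  proof (rule homotopic_eqI)
    fix i m assume m: "m \<in> car (KK ?Q) i"
    have "add_first_mark G ?Q c y m \<in> car (KK P) i"
      using gmor_car[OF _ m, of B _ "\<lambda>i. add_first_mark G ?Q c y"] g by (auto simp: hmf_inverse_def)
    hence "remove_mark n G P \<alpha> x q (add_first_mark G ?Q c y m) = rm P x q \<alpha> (circle_map (cpos ?Q c) y m)"
      using remove_mark_eq[OF P(1,3) a] add_first_mark_eq[OF Q m] by simp
    moreover have "remove_mark n G ?Q \<alpha> x q m = rm ?Q x q \<alpha> m" by (rule remove_mark_eq[OF P(2,4) aQ m])
    moreover have "add_first_mark G (P - {x} - {y}) c y (rm ?Q x q \<alpha> m) = circle_map (cpos (P - {x} - {y}) c) y (rm ?Q x q \<alpha> m)"
      by (rule add_first_mark_eq[OF Qx]) (use rm_car[OF P(2,4) aQ m] swap_diff in simp)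
    ultimately show "(?v i \<circ> add_first_mark G ?Q c y) m = (add_first_mark G (P - {x} - {y}) c y \<circ> ?v' i) m"
      using remove_circle[OF Q P(4) aQ m] iQ swap_diff by simp
  qed
  from square_inverse[OF g g' v this KK_bd_closed[OF P(2)] KK_bd_closed[OF P(1)] KK_bd_closed[OF P'] KK_bd_closed[OF P(3)]]
  have "hty P (P - {y} - {x}) (\<lambda>i. ?v' i \<circ> g i) (\<lambda>i. g' i \<circ> ?v i)" unfolding swap_diff by (rule homotopic_sym)
  moreover have "red P y g" "red ?Q x ?v'" "red P x ?v" using c g a aQ unfolding red_def by blast+
  moreover have "path_image c \<inter> (P - {x}) = {y}" using c(2) xy by auto
  hence "red (P - {x}) y g'" using c(1) g' unfolding red_def by blast
  ultimately show ?thesis unfolding diamond_def by blast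
qed

lemma diamond_two_circles:
  assumes c: "c \<in> set (oloops G)" "path_image c \<inter> P = {x}" and d: "d \<in> set (oloops G)" "path_image d \<inter> P = {y}"
  shows "diamond P y x"
proof -
  let ?Q = "P - {y} - {x}"
  have cd: "c \<noteq> d" using c d xy by auto
  have i: "insert x ?Q = P - {y}" "insert y ?Q = P - {x}" "insert y (P - {y}) = P" "insert x (P - {x}) = P" using xy by auto
  have Qx: "mk ?Q" "c \<in> set (oloops G)" "path_image c \<inter> ?Q = {}" "x \<in> path_image c" using P(4) c sole by auto
  have Qy: "mk ?Q" "d \<in> set (oloops G)" "path_image d \<inter> ?Q = {}" "y \<in> path_image d" using P(4) d sole by auto
  have Py: "mk (P - {y})" "d \<in> set (oloops G)" "path_image d \<inter> (P - {y}) = {}" "y \<in> path_image d" using P d by auto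
  have Px: "mk (P - {x})" "c \<in> set (oloops G)" "path_image c \<inter> (P - {x}) = {}" "x \<in> path_image c" using P c by auto
  let ?ax = "\<lambda>i::bool. add_first_mark G ?Q c x" and ?ay = "\<lambda>i::bool. add_first_mark G ?Q d y"
    and ?cx = "\<lambda>i::bool. add_first_mark G (P - {x}) c x" and ?cy = "\<lambda>i::bool. add_first_mark G (P - {y}) d y"
  obtain gx where gx: "hinv ?Q (P - {y}) ?ax gx" using add_first_hinv[OF Qx] i by auto
  obtain gy where gy: "hinv ?Q (P - {x}) ?ay gy" using add_first_hinv[OF Qy] i by auto
  obtain hy where hy: "hinv (P - {y}) P ?cy hy" using add_first_hinv[OF Py] i by auto
  obtain hx where hx: "hinv (P - {x}) P ?cx hx" using add_first_hinv[OF Px] i by auto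
  note bd = KK_bd_closed[OF P(1)] KK_bd_closed[OF P(2)] KK_bd_closed[OF P(3)] KK_bd_closed[OF P(4)]
  have car: "?ax i m \<in> car (KK (P - {y})) i" "?ay i m \<in> car (KK (P - {x})) i" if "m \<in> car (KK ?Q) i" for i m
    using that gmor_car[of B "KK ?Q" "KK (P - {y})" ?ax] gmor_car[of B "KK ?Q" "KK (P - {x})" ?ay] gx gy by (auto simp: hmf_inverse_def)
  have "hty ?Q P (\<lambda>i. ?cy i \<circ> ?ax i) (\<lambda>i. ?cx i \<circ> ?ay i)"
  proof (rule homotopic_eqI)
    fix i m assume m: "m \<in> car (KK ?Q) i"
    show "(?cy i \<circ> ?ax i) m = (?cx i \<circ> ?ay i) m"
      using two_circles[OF Qx Qy(2-4) cd, of m] add_first_mark_eq[OF Qx m] add_first_mark_eq[OF Qy m]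
        add_first_mark_eq[OF Py car(1)[OF m]] add_first_mark_eq[OF Px car(2)[OF m]] i by simp
  qed
  from hmf_inverse_unique[OF hmf_inverse_comp[OF gx hy bd(4,2,1)] hmf_inverse_comp[OF gy hx bd(4,3,1)] this bd(4,1)]
  have "hty P ?Q (\<lambda>i. gx i \<circ> hy i) (\<lambda>i. gy i \<circ> hx i)" .
  moreover have "red P y hy" "red P x hx" using c d hy hx unfolding red_def by blast+
  moreover have "path_image c \<inter> (P - {y}) = {x}" "path_image d \<inter> (P - {x}) = {y}" using c d xy by auto
  hence "red (P - {y}) x gx" "red (P - {x}) y gy" using c(1) d(1) gx gy unfolding red_def swap_diff by blast+
  ultimately show ?thesis unfolding diamond_def by blast
qed

text \<open>Adding x and re-inserting y is inverse to removing y and then x. Followed by the removal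
  of x it is the map adding y, so the two orders of reduction are homotopic.\<close>

lemma diamond_two_marks:
  assumes c: "c \<in> set (oloops G)" "path_image c \<inter> P = {x, y}"
  shows "diamond P y x"
proof -
  let ?Q = "P - {y} - {x}"
  have i: "insert x ?Q = P - {y}" "insert y ?Q = P - {x}" "insert x (insert y ?Q) = P" using xy by auto
  have pc: "x \<in> path_image c" "y \<in> path_image c" "path_image c \<inter> ?Q = {}" using c(2) by auto
  have Qx: "mk ?Q" "c \<in> set (oloops G)" "path_image c \<inter> ?Q = {}" "x \<in> path_image c"
    and Qy: "mk ?Q" "c \<in> set (oloops G)" "path_image c \<inter> ?Q = {}" "y \<in> path_image c" using P(4) c pc by auto
  let ?ax = "\<lambda>i::bool. add_first_mark G ?Q c x" and ?ay = "\<lambda>i::bool. add_first_mark G ?Q c y"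
  obtain gx where gx: "hinv ?Q (P - {y}) ?ax gx" using add_first_hinv[OF Qx] i by auto
  obtain gy where gy: "hinv ?Q (P - {x}) ?ay gy" using add_first_hinv[OF Qy] i by auto
  obtain \<alpha> S where a: "adjacent P y x \<alpha>" "adjacent P x y \<alpha>" and S: "hinv P (P - {y}) (\<lambda>i. rm P y x \<alpha>) S"
    and e: "\<And>i f. f \<in> car (KK ?Q) i ==> rm P x y \<alpha> (S i (circle_map (cpos ?Q c) x f)) = circle_map (cpos ?Q c) y f"
    using two_mark_loop[OF P(4) c(1) pc(3,1,2) xy(1) i(3)[symmetric] P(1)] unfolding i(1) by blast
  note bd = KK_bd_closed[OF P(1)] KK_bd_closed[OF P(2)] KK_bd_closed[OF P(3)] KK_bd_closed[OF P(4)]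
  let ?ry = "\<lambda>i::bool. remove_mark n G P \<alpha> y x" and ?rx = "\<lambda>i::bool. remove_mark n G P \<alpha> x y"
  have S': "hinv P (P - {y}) ?ry S" by (rule hmf_inverse_cong[OF S _ bd(1,2) B_bvars[OF P(1)]]) (rule remove_mark_eq[OF P(1,2) a(1)])
  have u: "hinv ?Q P (\<lambda>i. S i \<circ> ?ax i) (\<lambda>i. gx i \<circ> ?ry i)"
    by (rule hmf_inverse_comp[OF gx hmf_inverse_sym[OF S'] bd(4,2,1)])
  have rx: "gmor B (C P) (C (P - {x})) ?rx" using remove_mark_hinv[OF P(1,3) a(2)] unfolding hmf_inverse_def by blast
  have "hty ?Q (P - {x}) (\<lambda>i. ?rx i \<circ> (S i \<circ> ?ax i)) (\<lambda>i. ?ay i \<circ> (\<lambda>m. m))"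
  proof (rule homotopic_eqI)
    fix i m assume m: "m \<in> car (KK ?Q) i"
    have "(S i \<circ> ?ax i) m \<in> car (KK P) i"
      using gmor_car[of B "KK ?Q" "KK P" "\<lambda>i. S i \<circ> ?ax i", OF _ m] u by (auto simp: hmf_inverse_def)
    thus "(?rx i \<circ> (S i \<circ> ?ax i)) m = (?ay i \<circ> (\<lambda>m. m)) m"
      using e[OF m] remove_mark_eq[OF P(1,3) a(2)] add_first_mark_eq[OF Qx m] add_first_mark_eq[OF Qy m] by simp
  qed
  from square_inverse[OF u gy rx gmor_id this bd(4,1,4,3)]
  have "hty P ?Q (\<lambda>i. gx i \<circ> ?ry i) (\<lambda>i. gy i \<circ> ?rx i)" using homotopic_sym by (simp add: comp_def)
  moreover have "red P y ?ry" "red P x ?rx" using a unfolding red_def by blast+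
  moreover have "path_image c \<inter> (P - {y}) = {x}" "path_image c \<inter> (P - {x}) = {y}" using c xy by auto
  hence "red (P - {y}) x gx" "red (P - {x}) y gy" using c(1) gx gy unfolding red_def swap_diff by blast+
  ultimately show ?thesis unfolding diamond_def by blast
qed

lemma diamond: "diamond P y x"
proof -
  have P2: "mk P" "mk (P - {x})" "mk (P - {y})" "mk (P - {x} - {y})" "y \<noteq> x" "y \<in> P" "x \<in> P" using P P' xy by auto
  from mark_cases[OF P(1,2) xy(3)] mark_cases[OF P(1,3) xy(2)] show ?thesis
  proof (elim disjE exE bexE)
    fix c d assume "c \<in> set (oloops G)" "path_image c \<inter> P = {y}" "d \<in> set (oloops G)" "path_image d \<inter> P = {x}"
    thus ?thesis using diamond_two_circles by blast
  next
    fix c q \<alpha> assume "c \<in> set (oloops G)" "path_image c \<inter> P = {y}" "adjacent P x q \<alpha>"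
    thus ?thesis using diamond_circle_removal by blast
  next
    fix c q \<alpha> assume "adjacent P y q \<alpha>" "c \<in> set (oloops G)" "path_image c \<inter> P = {x}"
    thus ?thesis using planar.diamond_circle_removal[OF planar_axioms P2] diamond_sym by blast
  next
    fix q \<alpha> q' \<alpha>' assume a: "adjacent P y q \<alpha>" "adjacent P x q' \<alpha>'"
    show ?thesis
    proof (cases "q = x \<and> q' = y")
      case False
      thus ?thesis using diamond_noncrossing a by blast
    next
      \<comment> \<open>Here each mark would be merged into the other. A third mark on the curve
        allows different neighbours; without one the curve carries exactly x and y.\<close>
      case True
      obtain g where g: "g \<in> curves" "y \<in> path_image g" using mkD(2)[OF P(1) xy(3)] by blast
      have "x \<in> path_image g" using adjacent_same_curve(1)[OF P(1) a(1) g] True by simp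
      note oc = on_curve[OF P(1) g(1)]
      hence xm: "x \<in> set (on_curve P g)" "y \<in> set (on_curve P g)" using g xy \<open>x \<in> path_image g\<close> by auto
      show ?thesis
      proof (cases "\<exists>t\<in>set (on_curve P g). t \<noteq> x \<and> t \<noteq> y")
        case True
        then obtain q q' where q: "neighbours (on_curve P g) y q" "neighbours (on_curve P g) x q'" "\<not> (q = x \<and> q' = y)"
          using neighbours_noncrossing[OF oc(2) xm xy(1)] by blast
        obtain \<beta> \<beta>' where "adjacent P y q \<beta>" "adjacent P x q' \<beta>'"
          using neighbours_adjacent[OF P(1) g(1) q(1)] neighbours_adjacent[OF P(1) g(1) q(2)] by blast
        thus ?thesis using q(3) by (rule diamond_noncrossing)
      next
        case False
        hence s: "path_image g \<inter> P = {x, y}" using oc(1) xm by blast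
        \<comment> \<open>Removing both marks would leave an edge empty, so the curve is a
          loop.\<close>
        have "g \<notin> set (oedges G)"
        proof
          assume e: "g \<in> set (oedges G)"
          have "set (em (P - {y} - {x}) g) = {}" using em(1)[OF P(4) e] s by auto
          thus False using em_nonempty[OF P(4) e] by simp
        qed
        thus ?thesis using g(1) s diamond_two_marks by blast
      qed
    qed
  qed
qed

end

section \<open>Uniqueness of reductions between nested markings\<close>

inductive reduces :: "complex set => complex set => (bool => graph_module => graph_module) => bool" for Q where
  refl: "mk Q ==> reduces Q Q (\<lambda>i m. m)"
| step: "reduces Q R f ==> y \<in> R ==> mk (R - {y}) ==> red R y e ==> reduces Q (R - {y}) (\<lambda>i. e i \<circ> f i)"

lemma reduces_mk: "reduces Q P f ==> mk Q \<and> mk P \<and> P \<subseteq> Q" by (induction rule: reduces.induct) auto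

lemma reduces_hinv: "reduces Q P f ==> \<exists>g. hinv Q P f g"
proof (induction rule: reduces.induct)
  case refl
  show ?case using hmf_inverse_id by blast
next
  case (step R f y e)
  hence mk: "mk Q" "mk R" using reduces_mk by blast+
  thus ?case using step.IH red_hinv[OF mk(2) step(3,4)] hmf_inverse_comp KK_bd_closed step(3) by blast
qed

lemma reduces_exists:
  assumes Q: "mk Q"
  shows "mk P ==> P \<subseteq> Q ==> \<exists>f. reduces Q P f"
proof (induction "card (Q - P)" arbitrary: P)
  case 0
  hence "P = Q" using mkD(1)[OF Q] by auto
  thus ?case using reduces.refl Q by blast
next
  case (Suc k)
  then obtain y where y: "y \<in> Q" "y \<notin> P" by (metis Diff_eq_empty_iff card.empty nat.distinct(1) subsetI)
  let ?R = "insert y P"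
  have R: "mk ?R" by (rule mk_between[OF Suc(3) Q]) (use Suc y in auto)
  have "Q - ?R = (Q - P) - {y}" by auto
  hence "k = card (Q - ?R)" using Suc(2) y by (simp add: card_Diff_singleton)
  moreover have "?R \<subseteq> Q" using Suc(4) y by simp
  ultimately obtain f where f: "reduces Q ?R f" using Suc.hyps(1)[of ?R] R by blast
  have P: "?R - {y} = P" using y by auto
  then obtain e where "red ?R y e" using red_exists[OF R, of y] Suc(3) by auto
  from reduces.step[OF f _ _ this] show ?case using P Suc(3) by auto
qed

text \<open>Confluence read from the end, by induction on the number of removed marks. If the last
  steps remove different marks, both are put back: \<open>diamond\<close> compares the two ways down
  from there, and the induction hypothesis compares the ways of reaching R and R'.\<close>

lemma reduces_unique:
  "reduces Q P f ==> reduces Q P f' ==> hty Q P f f'"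
proof (induction "card (Q - P)" arbitrary: P f f' rule: less_induct)
  case less
  have Q: "mk Q" "finite Q" using less(2) reduces_mk mkD(1) by blast+
  have inv: "P = Q \<and> g = (\<lambda>i m. m) \<or> (\<exists>R h y e. reduces Q R h \<and> y \<in> R \<and> mk (R - {y}) \<and> red R y e \<and> P = R - {y} \<and> g = (\<lambda>i. e i \<circ> h i))"
    if "reduces Q P g" for g using that by (cases rule: reduces.cases) auto
  have nosteps: "P \<noteq> Q" if "reduces Q R h" "y \<in> R" "P = R - {y}" for R h y using reduces_mk[OF that(1)] that by auto
  show ?case
  proof (cases "P = Q")
    case True
    hence "f = (\<lambda>i m. m)" "f' = (\<lambda>i m. m)" using inv[OF less(2)] inv[OF less(3)] nosteps by blast+
    thus ?thesis using homotopic_refl by blast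
  next
    case False
    obtain R h y e where 1: "reduces Q R h" "y \<in> R" "mk (R - {y})" "red R y e" "P = R - {y}" "f = (\<lambda>i. e i \<circ> h i)"
      using inv[OF less(2)] False by blast
    obtain R' h' y' e' where 2: "reduces Q R' h'" "y' \<in> R'" "mk (R' - {y'})" "red R' y' e'" "P = R' - {y'}" "f' = (\<lambda>i. e' i \<circ> h' i)"
      using inv[OF less(3)] False by blast
    have mk: "mk R" "mk R'" "R \<subseteq> Q" "R' \<subseteq> Q" "mk P" using reduces_mk 1 2 by blast+
    note bd = KK_bd_closed[OF Q(1)] KK_bd_closed[OF mk(1)] KK_bd_closed[OF mk(2)] KK_bd_closed[OF mk(5)]
    have gm: "gmor B (C Q) (C S) g" if "reduces Q S g" for S g using reduces_hinv[OF that] unfolding hmf_inverse_def by blast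
    have cardR: "card (Q - R) < card (Q - P)" if "y \<in> R" "R \<subseteq> Q" "P = R - {y}" for R y
    proof (rule psubset_card_mono)
      show "finite (Q - P)" using Q(2) by simp
      show "Q - R \<subset> Q - P" using that by blast
    qed
    show ?thesis
    proof (cases "y = y'")
      case True
      hence RR: "R' = R" using 1(2,5) 2(2,5) by blast
      have h': "reduces Q R h'" using 2(1) RR by simp
      have hh: "hty Q R h h'" by (rule less(1)[OF cardR[OF 1(2) mk(3) 1(5)] 1(1) h'])
      have e': "red R y e'" using 2(4) RR True by simp
      have ee: "hty R P e e'" using red_unique[OF mk(1) 1(3,4) e'] 1(5) by simp
      have "gmor B (C R) (C P) e'" using red_gmor[OF mk(1) 1(3) e'] 1(5) by simp
      from homotopic_comp[OF hh ee gm[OF 1(1)] gm[OF h'] this bd(1,2)] show ?thesis unfolding 1(6) 2(6) .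
    next
      case False
      \<comment> \<open>R is P with y, so S is P with both marks, and it still lies in Q.\<close>
      define S where "S = insert y' R"
      have S: "S = insert y R'" "S - {y'} = R" "S - {y} = R'" "S - {y'} - {y} = P" "S - {y} - {y'} = P"
        unfolding S_def using False 1(2,5) 2(2,5) by auto
      have yy: "y \<in> S" "y' \<in> S" unfolding S_def using 1(2) by auto
      have "S \<subseteq> Q" unfolding S_def using mk(3,4) 2(2) by auto
      hence mS: "mk S" using mk_between[OF mk(1) Q(1), of S] by (auto simp: S_def)
      obtain g where g: "reduces Q S g" using reduces_exists[OF Q(1) mS \<open>S \<subseteq> Q\<close>] by blast
      have "diamond S y' y" by (rule diamond) (use mS mk S yy False in auto)
      then obtain d1 d2 d1' d2' where d: "red S y' d1" "red R y d2" "red S y d1'" "red R' y' d2'"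
        and h: "hty S P (\<lambda>i. d2 i \<circ> d1 i) (\<lambda>i. d2' i \<circ> d1' i)" unfolding diamond_def S(2,3) 1(5)[symmetric] by blast
      have r1: "reduces Q R (\<lambda>i. d1 i \<circ> g i)" using reduces.step[OF g yy(2) _ d(1)] mk S by simp
      have r2: "reduces Q R' (\<lambda>i. d1' i \<circ> g i)" using reduces.step[OF g yy(1) _ d(3)] mk S by simp
      have "hty Q R h (\<lambda>i. d1 i \<circ> g i)" by (rule less(1)[OF cardR[OF 1(2) mk(3) 1(5)] 1(1) r1])
      moreover have "hty R P e d2" using red_unique[OF mk(1) 1(3,4) d(2)] 1(5) by simp
      ultimately have A: "hty Q P f (\<lambda>i. d2 i \<circ> (d1 i \<circ> g i))" unfolding 1(6)
        using homotopic_comp[OF _ _ gm[OF 1(1)] gm[OF r1]] red_gmor[OF mk(1) 1(3) d(2)] bd(1,2) 1(5) by blast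
      have "hty Q R' h' (\<lambda>i. d1' i \<circ> g i)" by (rule less(1)[OF cardR[OF 2(2) mk(4) 2(5)] 2(1) r2])
      moreover have "hty R' P e' d2'" using red_unique[OF mk(2) 2(3,4) d(4)] 2(5) by simp
      ultimately have B: "hty Q P f' (\<lambda>i. d2' i \<circ> (d1' i \<circ> g i))" unfolding 2(6)
        using homotopic_comp[OF _ _ gm[OF 2(1)] gm[OF r2]] red_gmor[OF mk(2) 2(3) d(4)] bd(1,3) 2(5) by blast
      have "hty Q P (\<lambda>i. (d2 i \<circ> d1 i) \<circ> g i) (\<lambda>i. (d2' i \<circ> d1' i) \<circ> g i)"
        by (rule homotopic_comp_right[OF h gm[OF g]])
      thus ?thesis using homotopic_trans[OF homotopic_trans[OF A] homotopic_sym[OF B]] by (simp add: comp_assoc)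
    qed
  qed
qed

subsection \<open>Mark changes\<close>

text \<open>Marking a circle is not itself a reduction, but \<open>red\<close> is defined so that
  every inverse of it is one.\<close>

lemma elementary_map_cases:
  assumes "elementary_map n G P Q e"
  shows "(\<exists>y. y \<in> P \<and> mk P \<and> mk (P - {y}) \<and> Q = P - {y} \<and> red P y e) \<or>
    (\<exists>y. y \<in> Q \<and> mk Q \<and> mk (Q - {y}) \<and> P = Q - {y} \<and> (\<exists>g. hinv P Q e g) \<and> (\<forall>g. hinv P Q e g \<longrightarrow> red Q y g))"
  using assms
proof (cases rule: elementary_map.cases)
  case (remove_start y x)
  hence "adjacent P y x (Arc_factor y x)" by (auto simp: adjacent_def)
  thus ?thesis using remove_start adjacent_marks unfolding red_def by blast
next
  case (remove_end y z)
  hence "adjacent P y z (Arc_factor z y)" by (auto simp: adjacent_def)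
  thus ?thesis using remove_end adjacent_marks unfolding red_def by blast
next
  case (add_first c x)
  note c = add_first(3-6)
  have Q: "mk Q" "Q - {x} = P" "path_image c \<inter> Q = {x}" using mk_insert[OF c] c add_first(1) by auto
  moreover have "\<exists>g. hinv P Q e g" using add_first_hinv[OF c] add_first(1,2) by simp
  moreover have "red Q x g" if "hinv P Q e g" for g using that c(2) Q add_first(2) unfolding red_def by blast
  ultimately show ?thesis using add_first(1) c(1) by blast
qed

lemma elementary_map_mk: "elementary_map n G P Q e ==> mk P \<and> mk Q" using elementary_map_cases by blast

lemma elementary_map_hinv: "elementary_map n G P Q e ==> \<exists>g. hinv P Q e g" using elementary_map_cases red_hinv by blast

lemma mark_change_mk: "mark_change n G P Q f ==> mk P \<and> mk Q" by (induction rule: mark_change.induct) (auto dest: elementary_map_mk)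

lemma mark_change_hinv: "mark_change n G P Q f ==> \<exists>g. hinv P Q f g"
proof (induction rule: mark_change.induct)
  case (none P)
  show ?case using hmf_inverse_id by blast
next
  case (forward P Q f Q' e)
  have m: "mk P" "mk Q" "mk Q'" using mark_change_mk[OF forward(1)] elementary_map_mk[OF forward(2)] by auto
  obtain g h where "hinv P Q f g" "hinv Q Q' e h" using forward(3) elementary_map_hinv[OF forward(2)] by blast
  from hmf_inverse_comp[OF this KK_bd_closed[OF m(1)] KK_bd_closed[OF m(2)] KK_bd_closed[OF m(3)]] show ?case by blast
next
  case (backward P Q f Q' e g)
  have m: "mk P" "mk Q" "mk Q'" using mark_change_mk[OF backward(1)] elementary_map_mk[OF backward(2)] by auto
  have g: "hinv Q Q' g e" using hmf_inverse_sym[OF backward(3)] unfolding C_graph_eq .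
  obtain h where "hinv P Q f h" using backward(4) by blast
  from hmf_inverse_comp[OF this g KK_bd_closed[OF m(1)] KK_bd_closed[OF m(2)] KK_bd_closed[OF m(3)]] show ?case by blast
qed

text \<open>An elementary map is compatible with the reductions from any larger marking \<open>Q\<close>, hence so is
  every composite of elementary maps and their inverses.\<close>

lemma reduces_elementary:
  assumes e: "elementary_map n G P P' e" and Q: "P \<union> P' \<subseteq> Q" "mk Q" and r: "reduces Q P r" "reduces Q P' r'"
  shows "hty Q P' (\<lambda>i. e i \<circ> r i) r'" using elementary_map_cases[OF e]
proof (elim disjE exE conjE)
  fix y assume y: "y \<in> P" "mk P" "mk (P - {y})" "P' = P - {y}" "red P y e"
  thus ?thesis using reduces_unique[OF reduces.step[OF r(1) y(1,3,5)]] r(2) by simp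
next
  fix y g assume y: "y \<in> P'" "mk P'" "mk (P' - {y})" "P = P' - {y}" "hinv P P' e g" "\<forall>g. hinv P P' e g \<longrightarrow> red P' y g"
  hence "hty Q P (\<lambda>i. g i \<circ> r' i) r" using reduces_unique[OF reduces.step[OF r(2) y(1,3)]] r(1) by blast
  moreover have "gmor B (C Q) (C P') r'" "gmor B (C Q) (C P) r" using reduces_hinv[OF r(1)] reduces_hinv[OF r(2)] unfolding hmf_inverse_def by blast+
  ultimately have "hty Q P' r' (\<lambda>i. e i \<circ> r i)"
    using hmf_inverse_cancel_left[OF hmf_inverse_sym[OF y(5)]] KK_bd_closed Q(2) y(2,3,4) by blast
  thus ?thesis by (rule homotopic_sym)
qed

text \<open>\<open>Q0\<close> grows by each marking passed through, so that a marking above it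
  dominates all intermediate ones. Allowing every Q above \<open>Q0\<close> lets two mark changes be
  compared over a common Q.\<close>

lemma mark_change_reduces:
  assumes "mark_change n G P P' f"
  shows "\<exists>Q0. mk Q0 \<and> (\<forall>Q r r'. mk Q \<and> Q0 \<subseteq> Q \<and> reduces Q P r \<and> reduces Q P' r' \<longrightarrow> P \<union> P' \<subseteq> Q \<and> hty Q P' (\<lambda>i. f i \<circ> r i) r')"
  using assms
proof (induction rule: mark_change.induct)
  case (none P)
  thus ?case using reduces_unique reduces_mk by (intro exI[of _ P]) (auto simp: comp_def)
next
  case (forward P R f R' e)
  then obtain Q0 where Q0: "mk Q0" "\<And>Q r r'. mk Q ==> Q0 \<subseteq> Q ==> reduces Q P r ==> reduces Q R r' ==> hty Q R (\<lambda>i. f i \<circ> r i) r'" by blast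
  have m: "mk P" "mk R" "mk R'" using mark_change_mk[OF forward(1)] elementary_map_mk[OF forward(2)] by auto
  show ?case
  proof (intro exI[of _ "Q0 \<union> R"] conjI allI impI)
    show "mk (Q0 \<union> R)" by (rule mk_union[OF Q0(1) m(2)])
    fix Q r r' assume a: "mk Q \<and> Q0 \<union> R \<subseteq> Q \<and> reduces Q P r \<and> reduces Q R' r'"
    thus "P \<union> R' \<subseteq> Q" using reduces_mk by blast
    obtain s where s: "reduces Q R s" using reduces_exists[of Q R] a m by blast
    have "hty Q R (\<lambda>i. f i \<circ> r i) s" using Q0(2)[of Q r s] a s by blast
    moreover have g: "gmor B (C Q) (C P) r" "gmor B (C Q) (C R) s" "gmor B (C P) (C R) f" "gmor B (C R) (C R') e"
      using a s reduces_hinv mark_change_hinv[OF forward(1)] elementary_map_hinv[OF forward(2)] unfolding hmf_inverse_def by blast+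
    ultimately have "hty Q R' (\<lambda>i. e i \<circ> (f i \<circ> r i)) (\<lambda>i. e i \<circ> s i)"
      using homotopic_comp[OF _ homotopic_refl gmor_comp[OF g(1,3)] g(2,4)] KK_bd_closed a m by blast
    moreover have "hty Q R' (\<lambda>i. e i \<circ> s i) r'" using reduces_elementary[OF forward(2)] a s reduces_mk by blast
    ultimately show "hty Q R' (\<lambda>i. (e i \<circ> f i) \<circ> r i) r'" using homotopic_trans by (simp add: comp_assoc) blast
  qed
next
  case (backward P R f R' e g)
  then obtain Q0 where Q0: "mk Q0" "\<And>Q r r'. mk Q ==> Q0 \<subseteq> Q ==> reduces Q P r ==> reduces Q R r' ==> hty Q R (\<lambda>i. f i \<circ> r i) r'" by blast
  have m: "mk P" "mk R" "mk R'" using mark_change_mk[OF backward(1)] elementary_map_mk[OF backward(2)] by auto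
  have h: "hinv R' R e g" using backward(3) unfolding C_graph_eq .
  show ?case
  proof (intro exI[of _ "Q0 \<union> R"] conjI allI impI)
    show "mk (Q0 \<union> R)" by (rule mk_union[OF Q0(1) m(2)])
    fix Q r r' assume a: "mk Q \<and> Q0 \<union> R \<subseteq> Q \<and> reduces Q P r \<and> reduces Q R' r'"
    thus "P \<union> R' \<subseteq> Q" using reduces_mk by blast
    obtain s where s: "reduces Q R s" using reduces_exists[of Q R] a m by blast
    have g: "gmor B (C Q) (C P) r" "gmor B (C Q) (C R') r'" "gmor B (C P) (C R) f"
      using a reduces_hinv mark_change_hinv[OF backward(1)] unfolding hmf_inverse_def by blast+
    have "hty Q R (\<lambda>i. f i \<circ> r i) s" using Q0(2)[of Q r s] a s by blast
    moreover have "hty Q R (\<lambda>i. e i \<circ> r' i) s" using reduces_elementary[OF backward(2)] a s reduces_mk by blast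
    ultimately have "hty Q R (\<lambda>i. e i \<circ> r' i) (\<lambda>i. f i \<circ> r i)" using homotopic_trans homotopic_sym by blast
    from hmf_inverse_cancel_left[OF h this g(2) gmor_comp[OF g(1,3)]]
    have "hty Q R' r' (\<lambda>i. g i \<circ> (f i \<circ> r i))" using KK_bd_closed a m by blast
    thus "hty Q R' (\<lambda>i. (g i \<circ> f i) \<circ> r i) r'" using homotopic_sym by (simp add: comp_assoc)
  qed
qed

lemma mark_change_unique:
  assumes f: "mark_change n G P P' f" "mark_change n G P P' f'"
  shows "hty P P' f f'"
proof -
  obtain Q0 where Q0: "mk Q0" "\<And>Q r r'. mk Q ==> Q0 \<subseteq> Q ==> reduces Q P r ==> reduces Q P' r' ==> hty Q P' (\<lambda>i. f i \<circ> r i) r'"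
    using mark_change_reduces[OF f(1)] by blast
  obtain Q1 where Q1: "mk Q1" "\<And>Q r r'. mk Q ==> Q1 \<subseteq> Q ==> reduces Q P r ==> reduces Q P' r' ==> hty Q P' (\<lambda>i. f' i \<circ> r i) r'"
    using mark_change_reduces[OF f(2)] by blast
  have P: "mk P" "mk P'" using mark_change_mk[OF f(1)] by auto
  define Q where "Q = Q0 \<union> Q1 \<union> (P \<union> P')"
  have Q: "mk Q" unfolding Q_def by (intro mk_union Q0 Q1 P)
  obtain r r' where r: "reduces Q P r" "reduces Q P' r'" using reduces_exists[OF Q] P unfolding Q_def by blast
  have "hty Q P' (\<lambda>i. f i \<circ> r i) r'" "hty Q P' (\<lambda>i. f' i \<circ> r i) r'" using Q0(2)[OF Q _ r] Q1(2)[OF Q _ r] by (auto simp: Q_def)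
  hence "hty Q P' (\<lambda>i. f i \<circ> r i) (\<lambda>i. f' i \<circ> r i)" using homotopic_trans homotopic_sym by blast
  moreover obtain r0 where "hinv Q P r r0" using reduces_hinv[OF r(1)] by blast
  moreover have "gmor B (C P) (C P') f" "gmor B (C P) (C P') f'"
    using mark_change_hinv[OF f(1)] mark_change_hinv[OF f(2)] unfolding hmf_inverse_def by blast+
  ultimately show ?thesis using hmf_inverse_cancel_right KK_bd_closed Q P by blast
qed

text \<open>The elementary map between the two markings points down for a removal and up for a first
  mark; its inverse provides the opposite direction.\<close>

lemma mark_change_step:
  assumes R: "mk R" "mk (R - {y})" "y \<in> R"
  shows "mark_change n G P R f ==> \<exists>f. mark_change n G P (R - {y}) f" and "mark_change n G P (R - {y}) f ==> \<exists>f. mark_change n G P R f"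
proof -
  have "(\<exists>e. elementary_map n G R (R - {y}) e) \<or> (\<exists>e. elementary_map n G (R - {y}) R e)" using mark_cases[OF R]
  proof
    assume "\<exists>q \<alpha>. adjacent R y q \<alpha>"
    then obtain q \<alpha> where "adjacent R y q \<alpha>" by blast
    thus ?thesis unfolding adjacent_def using R elementary_map.remove_start[of G R y q n] elementary_map.remove_end[of G R y q n] by blast
  next
    assume "\<exists>c\<in>set (oloops G). path_image c \<inter> R = {y}"
    then obtain c where c: "c \<in> set (oloops G)" "path_image c \<inter> R = {y}" by blast
    thus ?thesis using elementary_map.add_first[OF R(2) c(1), of y n] sole[OF c(2)] by auto
  qed
  then obtain e where e: "elementary_map n G R (R - {y}) e \<or> elementary_map n G (R - {y}) R e" by blast
  have h: "\<exists>g. hmf_inverse n B (C_graph n G Q) (C_graph n G Q') e g" if "elementary_map n G Q Q' e" for Q Q'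
    using elementary_map_hinv[OF that] unfolding C_graph_eq .
  show "mark_change n G P R f ==> \<exists>f. mark_change n G P (R - {y}) f" "mark_change n G P (R - {y}) f ==> \<exists>f. mark_change n G P R f"
    using e h mark_change.forward mark_change.backward by blast+
qed

text \<open>Climb from P to the union and descend to P'; the reductions from the union only serve to
  list the steps.\<close>

lemma mark_change_exists:
  assumes P: "mk P" "mk P'"
  shows "\<exists>f. mark_change n G P P' f"
proof -
  have down: "\<exists>f. mark_change n G S R f" if "reduces Q R g" "\<exists>f. mark_change n G S Q f" for Q R S g using that
  proof (induction rule: reduces.induct)
    case (step R g y e)
    thus ?case using mark_change_step(1)[OF _ step(3,2)] reduces_mk[OF step(1)] by blast
  qed
  have up: "\<exists>f. mark_change n G S Q f" if "reduces Q R g" "\<exists>f. mark_change n G S R f" for Q R S g using that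
  proof (induction rule: reduces.induct)
    case (step R g y e)
    thus ?case using mark_change_step(2)[OF _ step(3,2)] reduces_mk[OF step(1)] by blast
  qed
  have "mk (P \<union> P')" by (rule mk_union[OF P])
  then obtain g g' where "reduces (P \<union> P') P g" "reduces (P \<union> P') P' g'" using reduces_exists P by (meson Un_upper1 Un_upper2)
  thus ?thesis using up[of "P \<union> P'" P g P] down[of "P \<union> P'" P' g' P] mark_change.none[OF P(1)] by blast
qed

lemma canonical_exists:
  assumes "mk P" "mk P'"
  shows "\<exists>f. hmf_iso n B (C_graph n G P') (C_graph n G P) f \<and> canonical n G P' P f"
proof -
  obtain f where f: "mark_change n G P' P f" using mark_change_exists assms by blast
  hence "hmf_iso n B (C_graph n G P') (C_graph n G P) f" using mark_change_hinv unfolding hmf_iso_def C_graph_eq by blast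
  moreover have "canonical n G P' P f" unfolding canonical_def C_graph_eq using f mark_change_unique by blast
  ultimately show ?thesis by blast
qed

end

theorem proposition27:
  fixes n :: nat and G :: wide_graph and P P' :: "complex set"
  assumes "n \<ge> 1" and "planar_graph G" and "marking G P" and "marking G P'"
  shows "hmf_object n (boundary_points G) (potential n G) (C_graph n G P) \<and>
         hmf_object n (boundary_points G) (potential n G) (C_graph n G P') \<and>
         (\<exists>f. hmf_iso n (boundary_points G) (C_graph n G P') (C_graph n G P) f \<and>
              canonical n G P' P f)"
proof -
  interpret planar G n using assms by unfold_locales
  show ?thesis using C_graph_hmf_object canonical_exists assms by blast
qed

end
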